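(* Let $d\ge 1$ be an integer, $a,b>0$, $s\in(0,1)$, $1<p<\infty$, $u_0\in L^1_{\mathrm{loc}}(\mathbb{R}^d)$, and put $p_F=1+\frac{2s}{d}$. Consider the Cauchy problem (with zero forcing term) $$u_t+\mathcal{L}_{a,b}u=|u|^p\ \text{ in }\mathbb{R}^d\times(0,+\infty),\qquad u(x,0)=u_0(x)\ \text{ in }\mathbb{R}^d. \tag{P}$$ Then the following hold. (i) If $1<p\le p_F$ and $\int_{\mathbb{R}^d}u_0(x)\,dx>0$, then (P) admits no global weak solution. (ii) If $1<p\le p_F$, $\int_{\mathbb{R}^d}u_0(x)\,dx=0$ and $u_0\not\equiv 0$, then (P) admits no global weak solution. (iii) Let $a=b=1$ and $p>p_F$, and set $p_c^s=\frac{d(p-1)}{2s}$. There exists $\delta>0$ such that for every $u_0\in C_0(\mathbb{R}^d)\cap L^{p_c^s}(\mathbb{R}^d)$ with $\|u_0\|_{L^{p_c^s}(\mathbb{R}^d)}\le\delta$, the solution $u$ of (P) exists globally.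
   Context: All functions are real-valued. $\mathcal{L}_{a,b}=-a\Delta+b(-\Delta)^s$, where for $s\in(0,1)$ $$(-\Delta)^s v(x)=C_{d,s}\,\mathrm{P.V.}\int_{\mathbb{R}^d}\frac{v(x)-v(y)}{|x-y|^{d+2s}}\,dy,\qquad C_{d,s}=\frac{2^{2s-1}\,2s\,\Gamma(\frac{d+2s}{2})}{\pi^{d/2}\Gamma(1-s)},$$ i.e. $(-\Delta)^s$ is the Fourier multiplier with symbol $|\xi|^{2s}$. $e^{-t\mathcal{L}_{a,b}}$ is the associated heat semigroup (Fourier multiplier $e^{-t(a|\xi|^2+b|\xi|^{2s})}$, i.e. convolution with the heat kernel $\mathcal{P}_t$). $C_0(\mathbb{R}^d)$ is the space of continuous functions vanishing at infinity, with the sup norm; $C_0^\infty$ denotes smooth compactly supported functions. Global weak solution of (P): a function $u\in L^p_{\mathrm{loc}}([0,+\infty)\times\mathbb{R}^d)$ such that for every $\varphi\in C_0^\infty([0,\infty)\times\mathbb{R}^d)$ the integrals below converge and $$\int_0^\infty\!\!\int_{\mathbb{R}^d}|u|^p\varphi\,dx\,dt+\int_{\mathbb{R}^d}u_0(x)\varphi(x,0)\,dx=\int_0^\infty\!\!\int_{\mathbb{R}^d}u\,(-\varphi_t+\mathcal{L}_{a,b}\varphi)\,dx\,dt.$$ In (iii), "solution" means mild solution, and "exists globally" means that there is $u\in C([0,\infty);C_0(\mathbb{R}^d))$ with $$u(t)=e^{-t\mathcal{L}_{a,b}}u_0+\int_0^t e^{-(t-\tau)\mathcal{L}_{a,b}}|u(\tau)|^p\,d\tau\quad\text{for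 all }t\ge 0.$$ *)

theory Defs
  imports "HOL-Analysis.Analysis"
begin

section \<open>Test functions and local integrability\<close>

definition partial_deriv :: "'b::euclidean_space \<Rightarrow> ('b \<Rightarrow> real) \<Rightarrow> 'b \<Rightarrow> real" where
  "partial_deriv i f x = frechet_derivative f (at x) i"

fun C_k :: "nat \<Rightarrow> ('b::euclidean_space \<Rightarrow> real) \<Rightarrow> bool" where
  "C_k 0 f \<longleftrightarrow> continuous_on UNIV f"
| "C_k (Suc k) f \<longleftrightarrow> f differentiable_on UNIV \<and> (\<forall>i\<in>Basis. C_k k (partial_deriv i f))"

definition test_function :: "('b::euclidean_space \<Rightarrow> real) \<Rightarrow> bool" where
  "test_function \<phi> \<longleftrightarrow> (\<forall>k. C_k k \<phi>) \<and> compact (closure {z. \<phi> z \<noteq> 0})"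

definition Lp_loc_on :: "real \<Rightarrow> 'b::euclidean_space set \<Rightarrow> ('b \<Rightarrow> real) \<Rightarrow> bool" where
  "Lp_loc_on q S f \<longleftrightarrow> f \<in> borel_measurable (lebesgue_on S) \<and>
     (\<forall>K. compact K \<and> K \<subseteq> S \<longrightarrow> set_integrable lebesgue K (\<lambda>z. \<bar>f z\<bar> powr q))"

text \<open>A function in \<open>L\<^sup>1\<^sub>l\<^sub>o\<^sub>c\<close> need not be integrable. Its integral over the whole space is
  understood as \<open>\<integral>f\<^sup>+ - \<integral>f\<^sup>-\<close> in \<open>[-\<infinity>, \<infinity>]\<close>, which is defined as soon as one of the two
  terms is finite. A finite value means that \<open>f\<close> is Lebesgue integrable.\<close>

definition has_ext_integral :: "('b::euclidean_space \<Rightarrow> real) \<Rightarrow> ereal \<Rightarrow> bool" where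
  "has_ext_integral f I \<longleftrightarrow> f \<in> borel_measurable lebesgue \<and>
     ((\<integral>\<^sup>+x. ennreal (f x) \<partial>lebesgue) \<noteq> \<infinity> \<or> (\<integral>\<^sup>+x. ennreal (- f x) \<partial>lebesgue) \<noteq> \<infinity>) \<and>
     I = enn2ereal (\<integral>\<^sup>+x. ennreal (f x) \<partial>lebesgue)
         - enn2ereal (\<integral>\<^sup>+x. ennreal (- f x) \<partial>lebesgue)"


section \<open>The operator\<close>

definition laplacian :: "('a::euclidean_space \<Rightarrow> real) \<Rightarrow> 'a \<Rightarrow> real" where
  "laplacian v x = (\<Sum>i\<in>Basis. partial_deriv i (partial_deriv i v) x)"

definition frac_laplacian_const :: "nat \<Rightarrow> real \<Rightarrow> real" where
  "frac_laplacian_const d s =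
     2 powr (2 * s - 1) * (2 * s) * Gamma ((real d + 2 * s) / 2)
       / (pi powr (real d / 2) * Gamma (1 - s))"

text \<open>This is \<open>(-\<Delta>)\<^sup>s\<close>; the principal value is the limit of the integrals over
  \<open>\<bar>x - y\<bar> \<ge> \<epsilon>\<close> as \<open>\<epsilon> \<down> 0\<close>.\<close>

definition frac_laplacian :: "real \<Rightarrow> ('a::euclidean_space \<Rightarrow> real) \<Rightarrow> 'a \<Rightarrow> real" where
  "frac_laplacian s v x = frac_laplacian_const DIM('a) s *
     Lim (at_right 0) (\<lambda>\<epsilon>. LINT y:- ball x \<epsilon>|lborel.
       (v x - v y) / norm (x - y) powr (real DIM('a) + 2 * s))"

definition mixed_op :: "real \<Rightarrow> real \<Rightarrow> real \<Rightarrow> ('a::euclidean_space \<Rightarrow> real) \<Rightarrow> 'a \<Rightarrow> real" where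
  "mixed_op a b s v x = - a * laplacian v x + b * frac_laplacian s v x"


section \<open>Heat kernel and heat semigroup\<close>

text \<open>The kernel is the inverse Fourier transform of the symbol
  \<open>exp (-t (a \<bar>\<xi>\<bar>\<^sup>2 + b \<bar>\<xi>\<bar>\<^sup>2\<^sup>s))\<close>. That transform is real because the symbol is even, so taking
  the real part only fixes the type.\<close>

definition heat_kernel ::
  "real \<Rightarrow> real \<Rightarrow> real \<Rightarrow> real \<Rightarrow> 'a::euclidean_space \<Rightarrow> real" where
  "heat_kernel a b s t x =
     Re (LINT \<xi>|lborel. cis (x \<bullet> \<xi>) *
           of_real (exp (- t * (a * norm \<xi> ^ 2 + b * norm \<xi> powr (2 * s)))))
       / (2 * pi) ^ DIM('a)"

definition heat_semigroup ::
  "real \<Rightarrow> real \<Rightarrow> real \<Rightarrow> real \<Rightarrow> ('a::euclidean_space \<Rightarrow> real) \<Rightarrow> 'a \<Rightarrow> real" where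
  "heat_semigroup a b s t f x =
     (if t = 0 then f x else (LINT y|lborel. heat_kernel a b s t (x - y) * f y))"


section \<open>Solutions\<close>

definition fujita_exponent :: "nat \<Rightarrow> real \<Rightarrow> real" where
  "fujita_exponent d s = 1 + 2 * s / real d"

text \<open>Space-time points are pairs \<open>(t, x)\<close>. The test functions in
  \<open>C\<^sub>0\<^sup>\<infinity>([0,\<infinity>) \<times> \<real>\<^sup>d)\<close> are, as usual, the restrictions to \<open>t \<ge> 0\<close> of smooth compactly
  supported functions on \<open>\<real> \<times> \<real>\<^sup>d\<close>: they need not vanish at \<open>t = 0\<close>, and only their values
  for \<open>t \<ge> 0\<close> matter below.\<close>

definition global_weak_solution ::
  "real \<Rightarrow> real \<Rightarrow> real \<Rightarrow> real \<Rightarrow> ('a::euclidean_space \<Rightarrow> real) \<Rightarrow> (real \<times> 'a \<Rightarrow> real) \<Rightarrow> bool" where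
  "global_weak_solution a b s p u0 u \<longleftrightarrow>
     Lp_loc_on p ({0..} \<times> UNIV) u \<and>
     (\<forall>\<phi>. test_function \<phi> \<longrightarrow>
        set_integrable lebesgue ({0..} \<times> UNIV) (\<lambda>(t, x). \<bar>u (t, x)\<bar> powr p * \<phi> (t, x)) \<and>
        integrable lebesgue (\<lambda>x. u0 x * \<phi> (0, x)) \<and>
        set_integrable lebesgue ({0..} \<times> UNIV)
          (\<lambda>(t, x). u (t, x) * (- deriv (\<lambda>\<tau>. \<phi> (\<tau>, x)) t + mixed_op a b s (\<lambda>y. \<phi> (t, y)) x)) \<and>
        (LINT (t, x):{0..} \<times> UNIV|lebesgue. \<bar>u (t, x)\<bar> powr p * \<phi> (t, x))
          + (LINT x|lebesgue. u0 x * \<phi> (0, x))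
        = (LINT (t, x):{0..} \<times> UNIV|lebesgue.
             u (t, x) * (- deriv (\<lambda>\<tau>. \<phi> (\<tau>, x)) t + mixed_op a b s (\<lambda>y. \<phi> (t, y)) x)))"

definition C0 :: "('a::euclidean_space \<Rightarrow>\<^sub>C real) set" where
  "C0 = {f. (apply_bcontfun f \<longlongrightarrow> 0) at_infinity}"

definition in_Lp :: "real \<Rightarrow> ('a::euclidean_space \<Rightarrow> real) \<Rightarrow> bool" where
  "in_Lp q f \<longleftrightarrow> f \<in> borel_measurable lebesgue \<and> integrable lebesgue (\<lambda>x. \<bar>f x\<bar> powr q)"

definition Lp_norm :: "real \<Rightarrow> ('a::euclidean_space \<Rightarrow> real) \<Rightarrow> real" where
  "Lp_norm q f = (LINT x|lebesgue. \<bar>f x\<bar> powr q) powr (1 / q)"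

text \<open>Continuity of \<open>u\<close> is with respect to the sup norm, which is the norm of \<^typ>\<open>'a \<Rightarrow>\<^sub>C real\<close>.
  The \<open>C\<^sub>0\<close>-valued Duhamel integral is evaluated pointwise; point evaluations are continuous
  functionals that separate points.\<close>

definition global_mild_solution ::
  "real \<Rightarrow> real \<Rightarrow> real \<Rightarrow> real \<Rightarrow> ('a::euclidean_space \<Rightarrow>\<^sub>C real) \<Rightarrow> (real \<Rightarrow> 'a \<Rightarrow>\<^sub>C real) \<Rightarrow> bool" where
  "global_mild_solution a b s p u0 u \<longleftrightarrow>
     continuous_on {0..} u \<and> (\<forall>t\<ge>0. u t \<in> C0) \<and>
     (\<forall>t\<ge>0. \<forall>x.
        set_integrable lborel {0..t}
          (\<lambda>\<tau>. heat_semigroup a b s (t - \<tau>) (\<lambda>y. \<bar>apply_bcontfun (u \<tau>) y\<bar> powr p) x) \<and>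
        apply_bcontfun (u t) x =
          heat_semigroup a b s t (apply_bcontfun u0) x +
          (LINT \<tau>:{0..t}|lborel.
             heat_semigroup a b s (t - \<tau>) (\<lambda>y. \<bar>apply_bcontfun (u \<tau>) y\<bar> powr p) x))"

end

theory Submission
  imports Defs "HOL-Probability.Probability"
begin

text \<open>Parts (i) and (ii). The test functions are \<open>\<eta>(t / T)\<close> times a dilation by \<open>\<rho>\<close> of the profile
  \<open>(1 + \<bar>x\<bar>\<^sup>2) powr - ((d + 2 s) / 2)\<close>. This profile decays exactly as fast as \<open>(-\<Delta>)\<^sup>s\<close> of a bump,
  so \<open>\<L>\<close> of it is bounded by a multiple of itself, and Young's inequality applies without dividing
  by a vanishing cutoff in \<open>x\<close>. With \<open>T = R powr (2 s)\<close> and \<open>\<rho> = B R\<close>, the limit \<open>R \<rightarrow> \<infinity>\<close>, followed by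
  limits in \<open>B\<close> and in the parameters of Young's inequality, gives \<open>\<integral>\<integral> \<bar>u\<bar>\<^sup>p + \<integral> u\<^sub>0 \<le> 0\<close>. If the
  mean of \<open>u\<^sub>0\<close> is not negative, then \<open>u = 0\<close>, and the weak formulation forces \<open>u\<^sub>0 = 0\<close>.

  Part (iii). The heat kernel is nonnegative because \<open>exp (- t \<bar>\<xi>\<bar>\<^sup>2\<^sup>s)\<close> is a limit of mixtures of
  Gaussians; its mass and the semigroup property come from Fourier inversion. For
  \<open>m = min p (d (p - 1) / (2 s))\<close> the function \<open>2 (S\<^sub>t \<bar>u\<^sub>0\<bar>\<^sup>m)\<^sup>1\<^sup>/\<^sup>m\<close> is a supersolution when the data
  are small, and the Duhamel map is a contraction in the sup norm on the functions below it.\<close>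

section \<open>Smooth functions and cutoffs\<close>

text \<open>The nonlocal operator gives every compactly supported function a tail of order
  |x|^(-d-2s), so a bound of the operator by a power of the test function itself fails outside the
  support. The profile cures this but is not admissible: it is truncated at |x|^2 = M with bounds
  uniform in M, and u has to be shown integrable against it before M can be sent to infinity. In the
  critical case the remainders are scale invariant, so R alone gains nothing. Two separate Young
  parameters are used. The time derivative carries a factor t/T, which makes its share of the energy
  vanish as R tends to infinity, so its parameter may be sent to infinity at fixed B; then B is made
  large, and the other parameter small. The order matters because the time remainder grows with B.
  In part (iii) powers of a linear evolution are used because Jensen's inequality makes them
  compatible with the semigroup. The exponent m must exceed 1 for the time integrals to converge,
  and p > p_F is what leaves room for that.\<close>

definition smooth :: "('b::euclidean_space \<Rightarrow> real) \<Rightarrow> bool" where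
  "smooth f \<longleftrightarrow> (\<forall>k. C_k k f)"

lemma partial_derivI: "(f has_derivative f') (at x) \<Longrightarrow> partial_deriv i f x = f' i"
  unfolding partial_deriv_def by (metis frechet_derivative_at)

lemma C_k_mono: "C_k (Suc k) f \<Longrightarrow> C_k k f"
proof (induction k arbitrary: f)
  case 0
  then show ?case by (auto intro: differentiable_imp_continuous_on)
next
  case (Suc k)
  then show ?case by (metis C_k.simps(2))
qed

lemma smooth_Suc:
  "smooth f \<longleftrightarrow> f differentiable_on UNIV \<and> (\<forall>i\<in>Basis. smooth (partial_deriv i f))"
proof
  assume "smooth f"
  then show "f differentiable_on UNIV \<and> (\<forall>i\<in>Basis. smooth (partial_deriv i f))"
    unfolding smooth_def by (metis C_k.simps(2))
next
  assume A: "f differentiable_on UNIV \<and> (\<forall>i\<in>Basis. smooth (partial_deriv i f))"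
  have "C_k k f" for k
    using A unfolding smooth_def by (cases k) (auto intro: differentiable_imp_continuous_on)
  then show "smooth f" by (simp add: smooth_def)
qed

lemma smooth_differentiable: "smooth f \<Longrightarrow> f differentiable (at x)"
  unfolding smooth_Suc[of f] by (simp add: differentiable_on_def)

lemma smooth_continuous_on: "smooth f \<Longrightarrow> continuous_on A f"
  by (metis C_k.simps(1) continuous_on_subset smooth_def subset_UNIV)

lemma C_k_const: "C_k k (\<lambda>x. c)"
proof (induction k arbitrary: c)
  case (Suc k)
  have "partial_deriv i (\<lambda>x::'a. c) = (\<lambda>x. 0)" for i
    by (rule ext, rule partial_derivI[of _ "\<lambda>x. 0"]) simp
  then show ?case using Suc by simp
qed simp

lemma smooth_const: "smooth (\<lambda>x. c)"
  by (simp add: smooth_def C_k_const)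

lemma smooth_bounded_linear: "bounded_linear f \<Longrightarrow> smooth f"
proof -
  assume f: "bounded_linear f"
  have "partial_deriv i f = (\<lambda>x. f i)" for i
    by (rule ext, rule partial_derivI) (rule bounded_linear_imp_has_derivative[OF f])
  then show "smooth f"
    unfolding smooth_Suc[of f]
    by (auto simp: smooth_const intro: bounded_linear_imp_differentiable_on f)
qed

lemma C_k_add: "C_k k f \<Longrightarrow> C_k k g \<Longrightarrow> C_k k (\<lambda>x. f x + g x)"
proof (induction k arbitrary: f g)
  case (Suc k)
  have "(f has_derivative frechet_derivative f (at x)) (at x)"
       "(g has_derivative frechet_derivative g (at x)) (at x)" for x
    using Suc.prems by (auto simp: differentiable_on_def frechet_derivative_works)
  then have "partial_deriv i (\<lambda>x. f x + g x) = (\<lambda>x. partial_deriv i f x + partial_deriv i g x)" for i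
    by (intro ext partial_derivI[THEN trans])
       (auto intro!: derivative_eq_intros simp: partial_deriv_def)
  with Suc show ?case by (auto intro: differentiable_on_add)
qed (auto intro: continuous_intros)

text \<open>The product rule involves the factors themselves besides their partial derivatives, so
  \<open>C_k_mono\<close> has to lower their order before the induction hypothesis applies.\<close>

lemma C_k_mult: "C_k k f \<Longrightarrow> C_k k g \<Longrightarrow> C_k k (\<lambda>x. f x * g x)"
proof (induction k arbitrary: f g)
  case (Suc k)
  have *: "(f has_derivative frechet_derivative f (at x)) (at x)"
       "(g has_derivative frechet_derivative g (at x)) (at x)" for x
    using Suc.prems by (auto simp: differentiable_on_def frechet_derivative_works)
  have "partial_deriv i (\<lambda>x. f x * g x) =
      (\<lambda>x. f x * partial_deriv i g x + partial_deriv i f x * g x)" for i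
    by (intro ext partial_derivI[THEN trans, OF has_derivative_mult[OF *]])
       (auto simp: partial_deriv_def)
  moreover have "C_k k f" "C_k k g" using Suc.prems C_k_mono by blast+
  ultimately show ?case using Suc
    by (auto intro!: C_k_add simp: differentiable_on_def intro: differentiable_mult)
qed (auto intro: continuous_intros)

lemma smooth_add: "smooth f \<Longrightarrow> smooth g \<Longrightarrow> smooth (\<lambda>x. f x + g x)"
  by (simp add: smooth_def C_k_add)

lemma smooth_mult: "smooth f \<Longrightarrow> smooth g \<Longrightarrow> smooth (\<lambda>x. f x * g x)"
  by (simp add: smooth_def C_k_mult)

lemma smooth_diff: "smooth f \<Longrightarrow> smooth g \<Longrightarrow> smooth (\<lambda>x. f x - g x)"
  using smooth_add[OF _ smooth_mult[OF smooth_const[of "-1"]], of f g] by simp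

lemma smooth_sum: "(\<And>i. i \<in> I \<Longrightarrow> smooth (f i)) \<Longrightarrow> smooth (\<lambda>x. \<Sum>i\<in>I. f i x)"
  by (induction I rule: infinite_finite_induct) (auto intro: smooth_const smooth_add)

lemma smooth_prod: "(\<And>i. i \<in> I \<Longrightarrow> smooth (f i)) \<Longrightarrow> smooth (\<lambda>x. \<Prod>i\<in>I. f i x)"
  by (induction I rule: infinite_finite_induct) (auto intro: smooth_const smooth_mult)

section \<open>Composition with smooth functions of one variable\<close>

definition smooth1_on :: "real set \<Rightarrow> (real \<Rightarrow> real) \<Rightarrow> bool" where
  "smooth1_on S h \<longleftrightarrow> (\<exists>D. D 0 = h \<and>
     (\<forall>n. \<forall>x\<in>S. (D n has_real_derivative D (Suc n) x) (at x)))"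

text \<open>Differentiating \<open>D n (f x)\<close> produces \<open>D (Suc n) (f x)\<close> times a
  partial derivative of \<open>f\<close>, so the induction on the order treats all members of the
  sequence at once. This is why \<open>smooth1_on\<close> provides a whole sequence of
  derivatives.\<close>

lemma smooth_compose:
  assumes h: "smooth1_on S h" and f: "smooth f" "\<And>x. f x \<in> S"
  shows "smooth (\<lambda>x. h (f x))"
proof -
  from h obtain D where D0: "D 0 = h"
    and D: "\<And>n x. x \<in> S \<Longrightarrow> (D n has_real_derivative D (Suc n) x) (at x)"
    unfolding smooth1_on_def by blast
  have fd: "(f has_derivative frechet_derivative f (at x)) (at x)" for x
    using smooth_differentiable[OF f(1)] by (simp add: frechet_derivative_works)
  have der: "((\<lambda>x. D n (f x)) has_derivative (\<lambda>v. D (Suc n) (f x) * frechet_derivative f (at x) v)) (at x)"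
    for n x
    using has_derivative_compose[OF fd, of "D n" _ x] D[OF f(2), of n x]
    by (auto simp: has_field_derivative_def)
  then have dif: "(\<lambda>x. D n (f x)) differentiable (at x)" for n x
    unfolding differentiable_def by blast
  have "C_k k (\<lambda>x. D n (f x))" for k n
  proof (induction k arbitrary: n)
    case 0
    show ?case
      using dif by (auto intro!: differentiable_imp_continuous_on simp: differentiable_on_def)
  next
    case (Suc k)
    have "partial_deriv i (\<lambda>x. D n (f x)) = (\<lambda>x. D (Suc n) (f x) * partial_deriv i f x)" for i
      by (intro ext partial_derivI[THEN trans, OF der]) (simp add: partial_deriv_def)
    moreover have "C_k k (partial_deriv i f)" if "i \<in> Basis" for i
      using f(1) that unfolding smooth_Suc[of f] by (auto simp: smooth_def)
    ultimately show ?case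
      using dif Suc by (auto intro!: C_k_mult simp: differentiable_on_def)
  qed
  from this[of _ 0] show ?thesis by (simp add: smooth_def D0)
qed

section \<open>The flat function exp (- 1 / t)\<close>

lemma poly_exp_bound:
  assumes "c > 0"
  shows "\<exists>C\<ge>0. \<forall>y\<ge>0. \<bar>poly q y\<bar> \<le> C * exp (c * y :: real)"
  using assms
proof (induction q arbitrary: c)
  case 0
  then show ?case by (intro exI[of _ 0]) simp
next
  case (pCons a q)
  \<comment> \<open>The rate is halved: one half of the exponential bounds the old polynomial, the
    other half absorbs the new factor y.\<close>
  obtain C where C: "C \<ge> 0" "\<And>y. y \<ge> 0 \<Longrightarrow> \<bar>poly q y\<bar> \<le> C * exp (c / 2 * y)"
    using pCons.IH[of "c / 2"] pCons.prems by auto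
  have "\<bar>poly (pCons a q) y\<bar> \<le> (\<bar>a\<bar> + 2 / c * C) * exp (c * y)" if y: "y \<ge> 0" for y
  proof -
    have "c / 2 * y \<le> exp (c / 2 * y)"
      using exp_ge_add_one_self[of "c / 2 * y"] by linarith
    then have "y \<le> 2 / c * exp (c / 2 * y)"
      using pCons.prems by (simp add: field_simps)
    then have "y * \<bar>poly q y\<bar> \<le> (2 / c * exp (c / 2 * y)) * (C * exp (c / 2 * y))"
      using C y by (intro mult_mono) auto
    also have "\<dots> = 2 / c * C * exp (c * y)"
      by (simp flip: exp_add)
    finally have 1: "y * \<bar>poly q y\<bar> \<le> 2 / c * C * exp (c * y)" .
    have "\<bar>a\<bar> * 1 \<le> \<bar>a\<bar> * exp (c * y)"
      using pCons.prems y by (intro mult_left_mono) auto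
    moreover have "\<bar>poly (pCons a q) y\<bar> \<le> \<bar>a\<bar> + y * \<bar>poly q y\<bar>"
      using abs_triangle_ineq[of a "y * poly q y"] y by (simp add: abs_mult)
    ultimately show ?thesis using 1 by (simp add: algebra_simps)
  qed
  then show ?case using C pCons.prems by (intro exI[of _ "\<bar>a\<bar> + 2 / c * C"]) auto
qed

text \<open>With y = 1/t, the derivative of P(y) exp (- y) with respect to t is y^2 (P(y) - P'(y))
  exp (- y). The recursion records this, \<open>[:0, 0, 1:]\<close> being y^2.\<close>

fun expinv_poly :: "nat \<Rightarrow> real poly" where
  "expinv_poly 0 = 1"
| "expinv_poly (Suc n) = [:0, 0, 1:] * (expinv_poly n - pderiv (expinv_poly n))"

definition expinvD :: "nat \<Rightarrow> real \<Rightarrow> real" where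
  "expinvD n t = (if t \<le> 0 then 0 else poly (expinv_poly n) (1 / t) * exp (- 1 / t))"

abbreviation expinv :: "real \<Rightarrow> real" where
  "expinv \<equiv> expinvD 0"

lemma expinv_eq: "expinv t = (if t \<le> 0 then 0 else exp (- 1 / t))"
  by (simp add: expinvD_def)

lemma expinv_tendsto: "((\<lambda>t. poly q (1 / t) * exp (- 1 / t)) \<longlongrightarrow> 0) (at_right (0::real))"
proof -
  obtain C where C: "\<And>y. y \<ge> 0 \<Longrightarrow> \<bar>poly q y\<bar> \<le> C * exp (1 / 2 * y :: real)"
    using poly_exp_bound[of "1/2" q] by auto
  have "((\<lambda>y. poly q y * exp (- y)) \<longlongrightarrow> (0::real)) at_top"
  proof (rule Lim_null_comparison)
    have "norm (poly q y * exp (- y)) \<le> C * exp (- (1 / 2 * y))" if "y \<ge> 0" for y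
    proof -
      have "norm (poly q y * exp (- y)) \<le> (C * exp (1 / 2 * y)) * exp (- y)"
        using C[OF that] by (simp add: abs_mult)
      also have "\<dots> = C * exp (- (1 / 2 * y))" by (simp flip: exp_add)
      finally show ?thesis .
    qed
    then show "\<forall>\<^sub>F y in at_top. norm (poly q y * exp (- y)) \<le> C * exp (- (1 / 2 * y))"
      by (auto intro: eventually_mono[OF eventually_ge_at_top[of 0]])
    show "((\<lambda>y. C * exp (- (1 / 2 * y :: real))) \<longlongrightarrow> 0) at_top"
      by (rule tendsto_mult_right_zero, rule filterlim_compose[OF exp_at_bot])
         (use filterlim_tendsto_pos_mult_at_top[OF tendsto_const[of "1/2::real"] _ filterlim_ident]
          in \<open>simp add: filterlim_uminus_at_bot\<close>)
  qed
  then have "((\<lambda>t. poly q (inverse t) * exp (- inverse t)) \<longlongrightarrow> (0::real)) (at_right 0)"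
    by (rule filterlim_compose) (rule filterlim_inverse_at_top_right)
  then show ?thesis by (simp add: divide_inverse)
qed

lemma has_derivative_expinvD: "(expinvD n has_real_derivative expinvD (Suc n) t) (at t)"
proof -
  consider "t < 0" | "t > 0" | "t = 0" by linarith
  then show ?thesis
  proof cases
    case 1
    have "((\<lambda>_. 0) has_real_derivative 0) (at t)" by simp
    then have "(expinvD n has_real_derivative 0) (at t)"
      by (rule has_field_derivative_transform_within_open[of _ _ _ "{..<0}"])
         (use 1 in \<open>auto simp: expinvD_def\<close>)
    then show ?thesis using 1 by (simp add: expinvD_def)
  next
    case 2
    have "((\<lambda>t. poly (expinv_poly n) (1/t) * exp (- 1 / t)) has_real_derivative
        poly (expinv_poly (Suc n)) (1/t) * exp (- 1 / t)) (at t)"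
      using 2 by (auto intro!: derivative_eq_intros DERIV_chain2[OF poly_DERIV]
          simp: field_simps power2_eq_square)
    then have "(expinvD n has_real_derivative poly (expinv_poly (Suc n)) (1/t) * exp (- 1 / t)) (at t)"
      by (rule has_field_derivative_transform_within_open[of _ _ _ "{0<..}"])
         (use 2 in \<open>auto simp: expinvD_def\<close>)
    then show ?thesis using 2 by (simp add: expinvD_def)
  next
    case 3
    \<comment> \<open>Division by h multiplies the polynomial in 1/h by its variable
      \<open>[:0,1:]\<close>, so the difference quotient at 0 is again of the form treated in
      \<open>expinv_tendsto\<close>.\<close>
    have R: "((\<lambda>h. expinvD n h / h) \<longlongrightarrow> 0) (at_right 0)"
    proof (rule Lim_transform_eventually)
      show "((\<lambda>t. poly ([:0,1:] * expinv_poly n) (1 / t) * exp (- 1 / t)) \<longlongrightarrow> 0) (at_right 0)"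
        by (rule expinv_tendsto)
      show "\<forall>\<^sub>F t in at_right 0. poly ([:0,1:] * expinv_poly n) (1 / t) * exp (- 1 / t) = expinvD n t / t"
        by (auto simp: eventually_at_filter expinvD_def)
    qed
    have L: "((\<lambda>h. expinvD n h / h) \<longlongrightarrow> 0) (at_left 0)"
      by (rule Lim_transform_eventually[OF tendsto_const])
         (auto simp: eventually_at_filter expinvD_def)
    have "((\<lambda>h. (expinvD n (0 + h) - expinvD n 0) / h) \<longlongrightarrow> 0) (at 0)"
      using filterlim_split_at[OF L R] by (simp add: expinvD_def)
    then show ?thesis using 3 by (simp add: DERIV_def expinvD_def)
  qed
qed

lemma smooth1_expinv: "smooth1_on UNIV expinv"
  unfolding smooth1_on_def using has_derivative_expinvD by blast

lemma expinv_nonneg: "0 \<le> expinv t" and expinv_le_1: "expinv t \<le> 1"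
  by (auto simp: expinv_eq)

lemma expinv_pos: "t > 0 \<Longrightarrow> 0 < expinv t"
  by (simp add: expinv_eq)

lemma expinv_mono: "t \<le> t' \<Longrightarrow> expinv t \<le> expinv t'"
  by (auto simp: expinv_eq divide_simps)

text \<open>Polynomial growth in 1/t costs only a factor exp ((1 - \<theta>) / t), and what is left
  of exp (- 1 / t) is its power \<theta>. For \<theta> = 1/p the derivative of the time cutoff is
  thereby dominated by the power 1/p of the cutoff, the quantity that Young's inequality pairs with
  |u|.\<close>

lemma expinvD_powr_bound:
  assumes "0 < \<theta>" "\<theta> < 1"
  shows "\<exists>C\<ge>0. \<forall>t. \<bar>expinvD n t\<bar> \<le> C * expinv t powr \<theta>"
proof -
  obtain C where C: "C \<ge> 0" "\<And>y. y \<ge> 0 \<Longrightarrow> \<bar>poly (expinv_poly n) y\<bar> \<le> C * exp ((1 - \<theta>) * y)"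
    using poly_exp_bound[of "1 - \<theta>" "expinv_poly n"] assms by auto
  have "\<bar>expinvD n t\<bar> \<le> C * expinv t powr \<theta>" for t
  proof (cases "t \<le> 0")
    case False
    have "\<bar>expinvD n t\<bar> = \<bar>poly (expinv_poly n) (1/t)\<bar> * exp (- (1 / t))"
      using False by (simp add: expinvD_def abs_mult)
    also have "\<dots> \<le> (C * exp ((1 - \<theta>) * (1 / t))) * exp (- (1 / t))"
      using False C(2)[of "1/t"] by (intro mult_right_mono) auto
    also have "\<dots> = C * exp (- \<theta> * (1 / t))"
      using False by (simp add: field_simps flip: exp_add)
    also have "exp (- \<theta> * (1 / t)) = expinv t powr \<theta>"
      using False by (simp add: expinv_eq powr_def)
    finally show ?thesis .
  qed (simp add: expinvD_def)
  with C show ?thesis by blast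
qed

lemma expinvD_bounded: "\<exists>C\<ge>0. \<forall>t. \<bar>expinvD n t\<bar> \<le> C"
proof -
  obtain C where C: "C \<ge> 0" "\<And>t. \<bar>expinvD n t\<bar> \<le> C * expinv t powr (1/2)"
    using expinvD_powr_bound[of "1/2" n] by auto
  have "expinv t powr (1/2) \<le> 1" for t
    using powr_mono2[of "1/2" "expinv t" 1] expinv_nonneg expinv_le_1 by auto
  then have "\<bar>expinvD n t\<bar> \<le> C" for t
    using C(2)[of t] mult_left_mono[OF _ C(1), of "expinv t powr (1/2)" 1] by (metis order_trans mult.right_neutral)
  then show ?thesis using C by blast
qed

section \<open>Cutoffs and the truncated profile\<close>

definition cutoff :: "real \<Rightarrow> real" where
  "cutoff r = exp 1 * expinv (1 - r)"

lemma cutoff_0: "cutoff 0 = 1"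
  by (simp add: cutoff_def expinv_eq flip: exp_add)

lemma cutoff_nonneg: "0 \<le> cutoff r"
  by (simp add: cutoff_def expinv_nonneg)

lemma cutoff_mono: "r \<le> r' \<Longrightarrow> cutoff r' \<le> cutoff r"
  by (simp add: cutoff_def expinv_mono)

lemma cutoff_le_1: "0 \<le> r \<Longrightarrow> cutoff r \<le> 1"
  using cutoff_mono[of 0 r] cutoff_0 by simp

lemma cutoff_eq_0: "1 \<le> r \<Longrightarrow> cutoff r = 0"
  by (simp add: cutoff_def expinv_eq)

lemma cutoff_pos: "r < 1 \<Longrightarrow> 0 < cutoff r"
  by (simp add: cutoff_def expinv_pos)

lemma smooth_cutoff: "smooth f \<Longrightarrow> smooth (\<lambda>x. cutoff (f x))"
  unfolding cutoff_def
  by (intro smooth_mult smooth_const smooth_compose[OF smooth1_expinv] smooth_diff) auto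

lemma cutoff_has_derivative:
  "(cutoff has_real_derivative - exp 1 * expinvD 1 (1 - r)) (at r)"
  unfolding cutoff_def
  by (auto intro!: derivative_eq_intros DERIV_chain2[OF has_derivative_expinvD])

lemma smooth1_powr: "smooth1_on {-1<..} (\<lambda>r. (1 + r) powr a)"
proof -
  define D where "D n r = (\<Prod>i<n. a - real i) * (1 + r) powr (a - real n)" for n r
  have "(D n has_real_derivative D (Suc n) r) (at r)" if "r > -1" for n r
    unfolding D_def using that
    by (auto intro!: derivative_eq_intros simp: algebra_simps)
  moreover have "D 0 = (\<lambda>r. (1 + r) powr a)" by (simp add: D_def fun_eq_iff)
  ultimately show ?thesis unfolding smooth1_on_def by auto
qed

text \<open>For \<open>\<sigma> = (d + 2 s) / 2\<close> and \<open>r = \<bar>x\<bar>\<^sup>2\<close> the weight \<open>(1 + r) powr - \<sigma>\<close> has the decay of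
  \<open>(-\<Delta>)\<^sup>s\<close> of a bump.\<close>

definition radial_bound :: "real \<Rightarrow> real \<Rightarrow> (real \<Rightarrow> real) \<Rightarrow> (real \<Rightarrow> real) \<Rightarrow> (real \<Rightarrow> real) \<Rightarrow> bool" where
  "radial_bound \<sigma> A F F1 F2 \<longleftrightarrow> (\<forall>r\<ge>0.
     (F has_real_derivative F1 r) (at r) \<and> (F1 has_real_derivative F2 r) (at r) \<and>
     \<bar>F r\<bar> \<le> A * (1 + r) powr - \<sigma> \<and> \<bar>F1 r\<bar> \<le> A * (1 + r) powr - \<sigma> \<and>
     (1 + r) * \<bar>F2 r\<bar> \<le> A * (1 + r) powr - \<sigma>)"

text \<open>The variable r stands for the square of the norm, which keeps radial functions smooth at
  the origin. The truncation at r = M only makes the support compact; M is sent to infinity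
  later.\<close>

definition profile :: "real \<Rightarrow> real \<Rightarrow> real \<Rightarrow> real" where
  "profile \<sigma> M r = (1 + r) powr - \<sigma> * cutoff (r / M)"

text \<open>The derivatives of the truncation are of size 1/M and 1/M^2 but live on r < M, where (1
  + r)/M \<le> 2 because M \<ge> 1. Multiplied by the matching power of 1 + r they are bounded
  independently of M.\<close>

lemma radial_bound_profile:
  assumes \<sigma>: "\<sigma> > 0"
  shows "\<exists>A\<ge>0. \<forall>M\<ge>1. \<exists>F1 F2. radial_bound \<sigma> A (profile \<sigma> M) F1 F2"
proof -
  obtain C1 where C1: "C1 \<ge> 0" "\<And>t. \<bar>expinvD 1 t\<bar> \<le> C1" using expinvD_bounded by blast
  obtain C2 where C2: "C2 \<ge> 0" "\<And>t. \<bar>expinvD 2 t\<bar> \<le> C2" using expinvD_bounded by blast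
  define e where "e = exp (1::real)"
  have e: "e > 0" by (simp add: e_def)
  \<comment> \<open>The summands serve the three estimates in turn: 1 for the profile, the next two
    for its first derivative, the rest for its second.\<close>
  define A where "A = 1 + \<sigma> + 2 * e * C1 + \<sigma> * (\<sigma> + 1) + 4 * \<sigma> * e * C1 + 4 * e * C2"
  have A0: "A \<ge> 0" unfolding A_def using \<sigma> e C1 C2 by (intro add_nonneg_nonneg mult_nonneg_nonneg) auto
  have "\<exists>F1 F2. radial_bound \<sigma> A (profile \<sigma> M) F1 F2" if M: "M \<ge> 1" for M
  proof -
    define K where "K r = cutoff (r / M)" for r
    define K1 where "K1 r = - (e / M) * expinvD 1 (1 - r / M)" for r
    define K2 where "K2 r = (e / M\<^sup>2) * expinvD 2 (1 - r / M)" for r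
    define h where "h r = (1 + r) powr - \<sigma>" for r :: real
    define h1 where "h1 r = - \<sigma> * (1 + r) powr (- \<sigma> - 1)" for r :: real
    define h2 where "h2 r = \<sigma> * (\<sigma> + 1) * (1 + r) powr (- \<sigma> - 2)" for r :: real
    have K: "(K has_real_derivative K1 r) (at r)" for r
      unfolding K_def K1_def e_def using M
      by (intro DERIV_chain2[OF cutoff_has_derivative, THEN DERIV_cong]) (auto intro!: derivative_eq_intros)
    have K1: "(K1 has_real_derivative K2 r) (at r)" for r
      unfolding K1_def K2_def
      using M by (auto intro!: derivative_eq_intros DERIV_chain2[OF has_derivative_expinvD]
            simp: power2_eq_square numeral_2_eq_2)
    have h: "(h has_real_derivative h1 r) (at r)" "(h1 has_real_derivative h2 r) (at r)" if "r \<ge> 0" for r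
      unfolding h_def h1_def h2_def using that
      by (auto intro!: derivative_eq_intros simp: algebra_simps)
    define F1 where "F1 r = h r * K1 r + h1 r * K r" for r
    define F2 where "F2 r = h r * K2 r + 2 * (h1 r * K1 r) + h2 r * K r" for r
    have "radial_bound \<sigma> A (profile \<sigma> M) F1 F2"
      unfolding radial_bound_def
    proof (intro allI impI conjI)
      fix r :: real assume r: "r \<ge> 0"
      have prof: "profile \<sigma> M = (\<lambda>r. h r * K r)"
        by (simp add: profile_def h_def K_def fun_eq_iff)
      show "(profile \<sigma> M has_real_derivative F1 r) (at r)"
        unfolding prof F1_def using DERIV_mult[OF h(1)[OF r] K[of r]] by (simp add: algebra_simps)
      show "(F1 has_real_derivative F2 r) (at r)"
        unfolding F1_def F2_def
        using DERIV_add[OF DERIV_mult[OF h(1)[OF r] K1[of r]] DERIV_mult[OF h(2)[OF r] K[of r]]]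
        by (simp add: algebra_simps)
      have Kb: "\<bar>K r\<bar> \<le> 1"
        unfolding K_def using cutoff_le_1[of "r / M"] cutoff_nonneg[of "r / M"] r M by simp
      have K1b: "(1 + r) * \<bar>K1 r\<bar> \<le> 2 * e * C1" 
      proof (cases "r < M")
        case True
        have "(1 + r) * \<bar>K1 r\<bar> = e * ((1 + r) / M) * \<bar>expinvD 1 (1 - r / M)\<bar>"
          unfolding K1_def using M e by (simp add: abs_mult)
        also have "\<dots> \<le> e * 2 * C1"
          using e r True M C1 by (intro mult_mono) (auto simp: divide_simps)
        finally show ?thesis by (simp add: mult_ac)
      next
        case False
        then have "K1 r = 0" using M unfolding K1_def expinvD_def by (simp add: divide_simps)
        then show ?thesis using e C1 by simp
      qed
      have K2b: "(1 + r) * ((1 + r) * \<bar>K2 r\<bar>) \<le> 4 * e * C2" 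
      proof (cases "r < M")
        case True
        have "(1 + r) * ((1 + r) * \<bar>K2 r\<bar>) = e * (((1 + r) / M) * ((1 + r) / M)) * \<bar>expinvD 2 (1 - r / M)\<bar>"
          unfolding K2_def using M e by (simp add: abs_mult power2_eq_square)
        also have "\<dots> \<le> e * (2 * 2) * C2"
          using e r True M C2 by (intro mult_mono) (auto simp: divide_simps)
        finally show ?thesis by (simp add: mult_ac)
      next
        case False
        then have "K2 r = 0" using M unfolding K2_def expinvD_def by (simp add: divide_simps)
        then show ?thesis using e C2 by simp
      qed
      have h0: "h r > 0" using r by (simp add: h_def)
      have h1e: "(1 + r) * h1 r = - \<sigma> * h r" 
        using r powr_add[of "1 + r" "- \<sigma> - 1" 1] by (simp add: h1_def h_def)
      have h2e: "(1 + r) * ((1 + r) * h2 r) = \<sigma> * (\<sigma> + 1) * h r"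
        using r powr_add[of "1 + r" "- \<sigma> - 2" 2] powr_numeral[of "1 + r" "num.Bit0 num.One"] by (simp add: h2_def h_def power2_eq_square)
      have le1: "x \<le> (1 + r) * x" if "x \<ge> 0" for x
        using r that by (simp add: algebra_simps)
      have h1b: "\<bar>h1 r\<bar> \<le> \<sigma> * h r" 
        using le1[of "\<bar>h1 r\<bar>"] arg_cong[OF h1e, of abs] r \<sigma> h0 by (simp add: abs_mult)
      have K1b': "\<bar>K1 r\<bar> \<le> 2 * e * C1" 
        using le1[of "\<bar>K1 r\<bar>"] K1b by linarith
      show "\<bar>profile \<sigma> M r\<bar> \<le> A * (1 + r) powr - \<sigma>"
      proof -
        have "\<bar>profile \<sigma> M r\<bar> = h r * \<bar>K r\<bar>" unfolding prof using h0 by (simp add: abs_mult)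
        also have "\<dots> \<le> h r * A" using Kb h0 \<sigma> e C1 C2 unfolding A_def 
          by (intro mult_left_mono) (auto intro!: order_trans[OF Kb] simp: add.assoc)
        finally show ?thesis by (simp add: h_def mult.commute)
      qed
      show "\<bar>F1 r\<bar> \<le> A * (1 + r) powr - \<sigma>"
      proof -
        have "\<bar>F1 r\<bar> \<le> h r * \<bar>K1 r\<bar> + \<bar>h1 r\<bar> * \<bar>K r\<bar>"
          unfolding F1_def using h0 by (intro abs_triangle_ineq[THEN order_trans]) (simp add: abs_mult)
        also have "\<dots> \<le> h r * (2 * e * C1) + (\<sigma> * h r) * 1"
          using h0 \<sigma> K1b' h1b Kb by (intro add_mono mult_mono) auto
        also have "\<dots> = h r * (\<sigma> + 2 * e * C1)" by (simp add: algebra_simps)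
        also have "\<dots> \<le> h r * A" using h0 \<sigma> e C1 C2 unfolding A_def 
          by (intro mult_left_mono) (auto simp: add.assoc)
        finally show ?thesis by (simp add: h_def mult.commute)
      qed
      show "(1 + r) * \<bar>F2 r\<bar> \<le> A * (1 + r) powr - \<sigma>"
      proof -
        \<comment> \<open>Two factors 1 + r are distributed over the two derivatives in each Leibniz
          term; the bound asked for keeps one of them.\<close>
        have "(1 + r) * ((1 + r) * \<bar>F2 r\<bar>) = \<bar>h r * ((1 + r) * ((1 + r) * K2 r)) + 2 * (((1 + r) * h1 r) * ((1 + r) * K1 r)) + ((1 + r) * ((1 + r) * h2 r)) * K r\<bar>"
        proof -
          have "(1 + r) * ((1 + r) * \<bar>F2 r\<bar>) = \<bar>(1 + r) * ((1 + r) * F2 r)\<bar>"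
            using r by (simp add: abs_mult)
          then show ?thesis by (simp add: F2_def algebra_simps)
        qed
        also have "\<dots> \<le> \<bar>h r * ((1 + r) * ((1 + r) * K2 r))\<bar> + \<bar>2 * (((1 + r) * h1 r) * ((1 + r) * K1 r))\<bar> + \<bar>((1 + r) * ((1 + r) * h2 r)) * K r\<bar>"
          by linarith
        also have "\<dots> = h r * ((1 + r) * ((1 + r) * \<bar>K2 r\<bar>)) + 2 * ((\<sigma> * h r) * ((1 + r) * \<bar>K1 r\<bar>)) + (\<sigma> * (\<sigma> + 1) * h r) * \<bar>K r\<bar>"
          unfolding h1e h2e using r h0 \<sigma> by (simp add: abs_mult)
        also have "\<dots> \<le> h r * (4 * e * C2) + 2 * ((\<sigma> * h r) * (2 * e * C1)) + (\<sigma> * (\<sigma> + 1) * h r) * 1"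
          using h0 \<sigma> K1b K2b Kb by (intro add_mono mult_left_mono) auto
        also have "\<dots> = h r * (\<sigma> * (\<sigma> + 1) + 4 * \<sigma> * e * C1 + 4 * e * C2)" by (simp add: algebra_simps)
        also have "\<dots> \<le> h r * A" using h0 \<sigma> e C1 C2 unfolding A_def 
          by (intro mult_left_mono) (auto simp: add.assoc)
        finally have "(1 + r) * ((1 + r) * \<bar>F2 r\<bar>) \<le> A * h r" by (simp add: mult.commute)
        moreover have "(1 + r) * \<bar>F2 r\<bar> \<le> (1 + r) * ((1 + r) * \<bar>F2 r\<bar>)"
          using r by (intro le1) simp
        ultimately show ?thesis unfolding h_def by (rule order_trans[rotated])
      qed
    qed
    then show ?thesis by blast
  qed
  with A0 show ?thesis by blast
qed

section \<open>Admissible test functions\<close>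

lemma test_functionI:
  assumes "smooth \<phi>" "bounded S" "\<And>z. z \<notin> S \<Longrightarrow> \<phi> z = 0"
  shows "test_function \<phi>"
proof -
  have "{z. \<phi> z \<noteq> 0} \<subseteq> S" using assms(3) by blast
  then have "bounded {z. \<phi> z \<noteq> 0}" using assms(2) bounded_subset by blast
  then show ?thesis using assms(1) by (simp add: test_function_def smooth_def)
qed

definition bump :: "real \<Rightarrow> real \<Rightarrow> 'a::euclidean_space \<Rightarrow> real" where
  "bump \<sigma> M x = profile \<sigma> M ((norm x)\<^sup>2)"

lemma bump_eq_0: "M > 0 \<Longrightarrow> (norm x)\<^sup>2 \<ge> M \<Longrightarrow> bump \<sigma> M x = 0"
  by (simp add: bump_def profile_def cutoff_eq_0 divide_simps)

lemma test_function_bump: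
  fixes T \<rho> :: real
  assumes "T > 0" "\<rho> > 0" "M > 0"
  shows "test_function (\<lambda>z::real \<times> 'a::euclidean_space.
    cutoff ((fst z / T)\<^sup>2) * bump \<sigma> M (snd z /\<^sub>R \<rho>))"
proof (rule test_functionI)
  have n: "(norm x)\<^sup>2 = (\<Sum>b\<in>Basis. (x \<bullet> b) * (x \<bullet> b))" for x :: 'a
    by (simp add: power2_norm_eq_inner euclidean_inner[of x x])
  have s1: "smooth (\<lambda>z::real \<times> 'a. (norm (snd z /\<^sub>R \<rho>))\<^sup>2)"
    unfolding n
    by (intro smooth_sum smooth_mult smooth_bounded_linear bounded_linear_intros)
  have s2: "smooth (\<lambda>z::real \<times> 'a. (1 + (norm (snd z /\<^sub>R \<rho>))\<^sup>2) powr - \<sigma>)"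
    by (intro smooth_compose[OF smooth1_powr s1]) (auto intro: less_le_trans[OF _ zero_le_power2])
  have s3: "smooth (\<lambda>z::real \<times> 'a. (fst z / T)\<^sup>2)"
    unfolding power2_eq_square divide_inverse
    by (intro smooth_mult smooth_const smooth_bounded_linear[OF bounded_linear_fst])
  show "smooth (\<lambda>z::real \<times> 'a. cutoff ((fst z / T)\<^sup>2) * bump \<sigma> M (snd z /\<^sub>R \<rho>))"
    unfolding bump_def profile_def
    unfolding divide_inverse
    by (intro smooth_mult s2 s3[unfolded divide_inverse] smooth_cutoff s1 smooth_const)
  show "bounded ({-T..T} \<times> cball (0::'a) (\<rho> * sqrt M))"
    by (intro bounded_Times) auto
  fix z :: "real \<times> 'a" assume z: "z \<notin> {-T..T} \<times> cball 0 (\<rho> * sqrt M)"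
  obtain t x where [simp]: "z = (t, x)" by (cases z)
  show "cutoff ((fst z / T)\<^sup>2) * bump \<sigma> M (snd z /\<^sub>R \<rho>) = 0"
  proof (cases "t \<in> {-T..T}")
    case True
    with z have "norm x > \<rho> * sqrt M" by auto
    then have "norm (x /\<^sub>R \<rho>) \<ge> sqrt M" using assms by (simp add: field_simps)
    then have "(norm (x /\<^sub>R \<rho>))\<^sup>2 \<ge> M" using assms power_mono[of "sqrt M" "norm (x /\<^sub>R \<rho>)" 2] by simp
    then show ?thesis using bump_eq_0[OF assms(3), of "x /\<^sub>R \<rho>"] by (simp del: norm_scaleR)
  next
    case False
    then have "\<bar>t\<bar> \<ge> T" by auto
    then have "(t / T)\<^sup>2 \<ge> 1" using assms 
      using power_mono[of T "\<bar>t\<bar>" 2] by (simp add: power_divide divide_simps)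
    then show ?thesis by (simp add: cutoff_eq_0)
  qed
qed

text \<open>As n grows, these functions tend at time 0 to the indicator of the open box between c
  and e. They serve to recover the initial value once the solution is known to vanish.\<close>

lemma test_function_box:
  fixes c e :: "'a::euclidean_space" and n :: real
  assumes n: "n > 0"
  shows "test_function (\<lambda>z::real \<times> 'a. cutoff ((fst z)\<^sup>2) *
    (\<Prod>b\<in>Basis. expinv (n * (snd z \<bullet> b - c \<bullet> b)) * expinv (n * (e \<bullet> b - snd z \<bullet> b))))"
proof (rule test_functionI)
  show "smooth (\<lambda>z::real \<times> 'a. cutoff ((fst z)\<^sup>2) *
    (\<Prod>b\<in>Basis. expinv (n * (snd z \<bullet> b - c \<bullet> b)) * expinv (n * (e \<bullet> b - snd z \<bullet> b))))"
    unfolding power2_eq_square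
    by (intro smooth_mult smooth_prod smooth_cutoff smooth_compose[OF smooth1_expinv] smooth_diff
          smooth_const UNIV_I smooth_bounded_linear bounded_linear_intros)
  show "bounded ({-1..1::real} \<times> cbox c e)"
    by (intro bounded_Times) auto
  fix z :: "real \<times> 'a" assume z: "z \<notin> {-1..1::real} \<times> cbox c e"
  obtain t x where [simp]: "z = (t, x)" by (cases z)
  show "cutoff ((fst z)\<^sup>2) *
    (\<Prod>b\<in>Basis. expinv (n * (snd z \<bullet> b - c \<bullet> b)) * expinv (n * (e \<bullet> b - snd z \<bullet> b))) = 0"
  proof (cases "t \<in> {-1..1::real}")
    case True
    with z obtain b where b: "b \<in> Basis" "x \<bullet> b < c \<bullet> b \<or> x \<bullet> b > e \<bullet> b" 
      by (force simp: mem_box)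
    have "expinv (n * (x \<bullet> b - c \<bullet> b)) = 0 \<or> expinv (n * (e \<bullet> b - x \<bullet> b)) = 0"
      using b(2) n by (auto simp: expinv_eq mult_le_0_iff)
    then have "(\<Prod>b\<in>Basis. expinv (n * (x \<bullet> b - c \<bullet> b)) * expinv (n * (e \<bullet> b - x \<bullet> b))) = 0"
      using b(1) by (intro prod_zero) auto
    then show ?thesis by simp
  next
    case False
    then have "\<bar>t\<bar> \<ge> 1" by auto
    then have "t\<^sup>2 \<ge> 1" using power_mono[of 1 "\<bar>t\<bar>" 2] by simp
    then show ?thesis by (simp add: cutoff_eq_0)
  qed
qed

section \<open>The fractional Laplacian of radial profiles\<close>

lemma lborel_integral_affine:
  fixes f :: "'a::euclidean_space \<Rightarrow> 'b::{banach, second_countable_topology}"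
  assumes c: "c \<noteq> 0" and f[measurable]: "f \<in> borel_measurable borel"
  shows "(LINT x|lborel. f x) = \<bar>c\<bar> ^ DIM('a) *\<^sub>R (LINT x|lborel. f (t + c *\<^sub>R x))"
  by (subst lborel_affine[OF c, of t]) (simp add: integral_density integral_distr)

lemma lborel_integrable_affine_iff:
  fixes f :: "'a::euclidean_space \<Rightarrow> 'b::{banach, second_countable_topology}"
  assumes c: "c \<noteq> 0" and f[measurable]: "f \<in> borel_measurable borel"
  shows "integrable lborel (\<lambda>x. f (t + c *\<^sub>R x)) \<longleftrightarrow> integrable lborel f"
proof -
  have "integrable lborel f \<longleftrightarrow>
      integrable (density (distr lborel borel (\<lambda>x. t + c *\<^sub>R x)) (\<lambda>_. ennreal (\<bar>c\<bar> ^ DIM('a)))) f"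
    by (subst lborel_affine[OF c, of t]) simp
  also have "\<dots> \<longleftrightarrow> integrable lborel (\<lambda>x. \<bar>c\<bar> ^ DIM('a) *\<^sub>R f (t + c *\<^sub>R x))"
    using c by (simp add: integrable_density integrable_distr_eq)
  also have "\<dots> \<longleftrightarrow> integrable lborel (\<lambda>x. f (t + c *\<^sub>R x))"
    using c integrable_scaleR_right[of "inverse (\<bar>c\<bar> ^ DIM('a))" lborel "\<lambda>x. \<bar>c\<bar> ^ DIM('a) *\<^sub>R f (t + c *\<^sub>R x)"]
    by (auto intro!: integrable_scaleR_right)
  finally show ?thesis by simp
qed

lemma nn_integral_powr_two_sided:
  fixes a c :: real
  assumes "a > -1" "c < -1"
  shows "(\<integral>\<^sup>+\<tau>. ennreal (if \<tau> \<le> 0 then 0 else if \<tau> \<le> 1 then \<tau> powr a else \<tau> powr c) \<partial>lborel) < \<infinity>"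
proof -
  have 1: "((\<lambda>\<tau>. \<tau> powr a) has_integral (1 powr (a + 1) / (a + 1))) {0..1}"
    using assms by (intro has_integral_powr_from_0) auto
  have 2: "((\<lambda>\<tau>. \<tau> powr c) has_integral -(1 powr (c + 1)) / (c + 1)) {1..}"
    using assms by (intro has_integral_powr_to_inf) auto
  have "(\<integral>\<^sup>+\<tau>. ennreal (if \<tau> \<le> 0 then 0 else if \<tau> \<le> 1 then \<tau> powr a else \<tau> powr c) \<partial>lborel)
     \<le> (\<integral>\<^sup>+\<tau>. ennreal (\<tau> powr a) * indicator {0..1} \<tau> + ennreal (\<tau> powr c) * indicator {1..} \<tau> \<partial>lborel)"
    by (intro nn_integral_mono) (auto split: split_indicator)
  also have "\<dots> = (\<integral>\<^sup>+\<tau>. ennreal (\<tau> powr a) * indicator {0..1} \<tau> \<partial>lborel)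
      + (\<integral>\<^sup>+\<tau>. ennreal (\<tau> powr c) * indicator {1..} \<tau> \<partial>lborel)"
    by (intro nn_integral_add) auto
  also have "\<dots> < \<infinity>"
    using nn_integral_has_integral_lebesgue'[OF _ 1] nn_integral_has_integral_lebesgue'[OF _ 2] by auto
  finally show ?thesis .
qed

text \<open>|y|^(-d-2s) is, up to a constant, the Levy density of the isotropic 2s-stable process;
  the factor min (|y|^2) 1 is, up to a constant, the size of a second difference of a bounded
  function with bounded second derivatives.\<close>

definition frac_kernel :: "real \<Rightarrow> 'a::euclidean_space \<Rightarrow> real" where
  "frac_kernel s y = min ((norm y)\<^sup>2) 1 * norm y powr - (real DIM('a) + 2 * s)"

lemma frac_kernel_nonneg: "0 \<le> frac_kernel s y"
  by (simp add: frac_kernel_def)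

lemma borel_measurable_frac_kernel[measurable]: "frac_kernel s \<in> borel_measurable borel"
  unfolding frac_kernel_def[abs_def] by measurable

lemma integrable_frac_kernel:
  assumes s: "0 < s" "s < 1"
  shows "integrable lborel (frac_kernel s :: 'a::euclidean_space \<Rightarrow> real)"
proof (rule integrableI_nonneg)
  define \<gamma> where "\<gamma> = real DIM('a) + 2 * s"
  have \<gamma>: "\<gamma> > 0" using s by (simp add: \<gamma>_def add_nonneg_pos)
  \<comment> \<open>The additional -1 in the exponent makes up for the length |y| of the interval
    over which the profile is averaged, and \<open>C\<close> makes up for evaluating the decreasing
    power at its right end 2 |y|.\<close>
  define g where "g \<tau> = (if \<tau> \<le> 0 then 0 else min (\<tau>\<^sup>2) 1 * \<tau> powr (- \<gamma> - 1))" for \<tau> :: real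
  have gm[measurable]: "g \<in> borel_measurable borel" unfolding g_def[abs_def] by measurable
  define C where "C = 2 powr (\<gamma> + 1)"
  text \<open>Averaging the radial profile over \<open>[\<bar>y\<bar>, 2 \<bar>y\<bar>]\<close> reduces the claim, by Tonelli, to the
    volume of balls.\<close>
  have le: "ennreal (frac_kernel s y) \<le> (\<integral>\<^sup>+\<tau>. ennreal (C * g \<tau>) * (if norm y \<le> \<tau> then 1 else 0) \<partial>lborel)"
    if y: "y \<noteq> 0" for y :: 'a
  proof -
    let ?r = "norm y"
    have r: "?r > 0" using y by simp
    have low: "min (?r\<^sup>2) 1 * (2 * ?r) powr (- \<gamma> - 1) \<le> g \<tau>" if "\<tau> \<in> {?r..2 * ?r}" for \<tau>
    proof -
      have "min (?r\<^sup>2) 1 \<le> min (\<tau>\<^sup>2) 1" using that r by (intro min.mono power_mono) auto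
      moreover have "(2 * ?r) powr (- \<gamma> - 1) \<le> \<tau> powr (- \<gamma> - 1)"
        using that r \<gamma> less_le_trans[of 0 ?r \<tau>] by (intro powr_mono2') auto
      moreover have "\<tau> > 0" using that r less_le_trans[of 0 ?r \<tau>] by auto
      ultimately show ?thesis unfolding g_def by (auto intro!: mult_mono)
    qed
    have fk: "frac_kernel s y = C * (min (?r\<^sup>2) 1 * (2 * ?r) powr (- \<gamma> - 1)) * ?r"
    proof -
      have "(2 * ?r) powr (- \<gamma> - 1) = 2 powr (-(\<gamma> + 1)) * (?r powr (- \<gamma>) / ?r)"
        using r powr_diff[of ?r "- \<gamma>" 1] by (simp add: powr_mult)
      then show ?thesis using r
        by (simp add: frac_kernel_def C_def flip: \<gamma>_def powr_add)
    qed
    have "ennreal (frac_kernel s y) = (\<integral>\<^sup>+\<tau>. ennreal (C * (min (?r\<^sup>2) 1 * (2 * ?r) powr (- \<gamma> - 1))) * indicator {?r..2 * ?r} \<tau> \<partial>lborel)"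
    proof -
      have "ennreal (c * ?r) = (\<integral>\<^sup>+\<tau>. ennreal c * indicator {?r..2 * ?r} \<tau> \<partial>lborel)" for c
        using r by (subst nn_integral_cmult_indicator) (simp_all add: ennreal_mult'')
      then show ?thesis unfolding fk .
    qed
    also have "\<dots> \<le> (\<integral>\<^sup>+\<tau>. ennreal (C * g \<tau>) * (if norm y \<le> \<tau> then 1 else 0) \<partial>lborel)"
      using low by (intro nn_integral_mono) (auto split: split_indicator intro!: ennreal_leI mult_left_mono simp: C_def)
    finally show ?thesis .
  qed
  have "(\<integral>\<^sup>+(y::'a). ennreal (frac_kernel s y) \<partial>lborel)
      \<le> (\<integral>\<^sup>+(y::'a). (\<integral>\<^sup>+\<tau>. ennreal (C * g \<tau>) * (if norm y \<le> \<tau> then 1 else 0) \<partial>lborel) \<partial>lborel)"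
  proof (rule nn_integral_mono_AE)
    have "AE y::'a in lborel. y \<noteq> 0" by (rule AE_lborel_singleton)
    then show "AE y::'a in lborel. ennreal (frac_kernel s y) \<le> (\<integral>\<^sup>+\<tau>. ennreal (C * g \<tau>) * (if norm y \<le> \<tau> then 1 else 0) \<partial>lborel)"
      using le by auto
  qed
  also have "\<dots> = (\<integral>\<^sup>+\<tau>. (\<integral>\<^sup>+(y::'a). ennreal (C * g \<tau>) * (if norm y \<le> \<tau> then 1 else 0) \<partial>lborel) \<partial>lborel)"
    by (rule lborel_pair.Fubini') measurable
  also have "\<dots> = (\<integral>\<^sup>+\<tau>. ennreal (C * g \<tau>) * emeasure lborel (cball (0::'a) \<tau>) \<partial>lborel)"
  proof (intro nn_integral_cong)
    fix \<tau> :: real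
    have "(\<integral>\<^sup>+(y::'a). ennreal (C * g \<tau>) * (if norm y \<le> \<tau> then 1 else 0) \<partial>lborel)
        = (\<integral>\<^sup>+(y::'a). ennreal (C * g \<tau>) * indicator (cball 0 \<tau>) y \<partial>lborel)"
      by (intro nn_integral_cong) (auto split: split_indicator)
    then show "(\<integral>\<^sup>+(y::'a). ennreal (C * g \<tau>) * (if norm y \<le> \<tau> then 1 else 0) \<partial>lborel)
        = ennreal (C * g \<tau>) * emeasure lborel (cball (0::'a) \<tau>)"
      by (simp add: nn_integral_cmult_indicator)
  qed
  also have "\<dots> = (\<integral>\<^sup>+\<tau>. ennreal (C * unit_ball_vol DIM('a)) *
      ennreal (if \<tau> \<le> 0 then 0 else if \<tau> \<le> 1 then \<tau> powr (1 - 2 * s) else \<tau> powr (-1 - 2 * s)) \<partial>lborel)"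
  proof (intro nn_integral_cong)
    fix \<tau> :: real
    show "ennreal (C * g \<tau>) * emeasure lborel (cball (0::'a) \<tau>) = ennreal (C * unit_ball_vol DIM('a)) *
      ennreal (if \<tau> \<le> 0 then 0 else if \<tau> \<le> 1 then \<tau> powr (1 - 2 * s) else \<tau> powr (-1 - 2 * s))"
    proof (cases "\<tau> \<le> 0")
      case False
      \<comment> \<open>The volume of the ball turns the exponents into 1 - 2s near 0 and -1 - 2s at
        infinity; these are integrable because s < 1 and s > 0 respectively.\<close>
      have e: "g \<tau> * \<tau> ^ DIM('a) = (if \<tau> \<le> 1 then \<tau> powr (1 - 2 * s) else \<tau> powr (-1 - 2 * s))"
      proof -
        have "\<tau> powr (- \<gamma> - 1) * \<tau> ^ DIM('a) = \<tau> powr (-1 - 2 * s)"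
        proof -
          have "\<tau> powr (- \<gamma> - 1) * \<tau> ^ DIM('a) = \<tau> powr ((- \<gamma> - 1) + real DIM('a))"
            using False by (simp add: powr_realpow[of \<tau>, symmetric] flip: powr_add)
          also have "(- \<gamma> - 1) + real DIM('a) = -1 - 2 * s" by (simp add: \<gamma>_def)
          finally show ?thesis .
        qed
        moreover have "\<tau>\<^sup>2 * \<tau> powr (-1 - 2 * s) = \<tau> powr (1 - 2 * s)"
          using False powr_add[of \<tau> 2 "-1 - 2 * s"] by simp
        moreover have "min (\<tau>\<^sup>2) 1 = (if \<tau> \<le> 1 then \<tau>\<^sup>2 else 1)"
          using False power_mono[of \<tau> 1 2] power_mono[of 1 \<tau> 2] by auto
        ultimately show ?thesis using False by (simp add: g_def mult.assoc)
      qed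
      have g0: "g \<tau> \<ge> 0" by (simp add: g_def)
      have "ennreal (C * g \<tau>) * emeasure lborel (cball (0::'a) \<tau>) = ennreal (C * unit_ball_vol DIM('a)) * ennreal (g \<tau> * \<tau> ^ DIM('a))"
        using False g0 by (simp add: emeasure_cball C_def mult_ac flip: ennreal_mult')
      then show ?thesis using e False by simp
    qed (simp add: g_def)
  qed
  also have "\<dots> = ennreal (C * unit_ball_vol DIM('a)) * (\<integral>\<^sup>+\<tau>. 
      ennreal (if \<tau> \<le> 0 then 0 else if \<tau> \<le> 1 then \<tau> powr (1 - 2 * s) else \<tau> powr (-1 - 2 * s)) \<partial>lborel)"
    by (intro nn_integral_cmult) measurable
  also have "\<dots> < \<infinity>"
    using nn_integral_powr_two_sided[of "1 - 2 * s" "-1 - 2 * s"] s by (simp add: ennreal_mult_less_top)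
  finally show "(\<integral>\<^sup>+(y::'a). ennreal (frac_kernel s y) \<partial>lborel) < \<infinity>" .
qed (auto simp: frac_kernel_nonneg)

section \<open>The weight and its behaviour under translation\<close>

lemma norm_powr_eq: "norm y powr - \<gamma> = ((norm y)\<^sup>2) powr - (\<gamma> / 2)"
  for y :: "'a::real_normed_vector"
  by (cases "y = 0") (simp_all add: powr_powr flip: powr_numeral)

definition weight :: "real \<Rightarrow> 'a::euclidean_space \<Rightarrow> real" where
  "weight s x = (1 + (norm x)\<^sup>2) powr - ((real DIM('a) + 2 * s) / 2)"

lemma one_plus_norm_sq_pos: "0 < 1 + (norm x)\<^sup>2"
  by (rule add_pos_nonneg) auto

lemma weight_pos: "0 < weight s x"
  using one_plus_norm_sq_pos[of x] by (simp add: weight_def)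

lemma weight_le_1: "0 < s \<Longrightarrow> weight s x \<le> 1"
  unfolding weight_def using powr_mono2'[of "- ((real DIM('a) + 2 * s) / 2)" 1 "1 + (norm x)\<^sup>2"] by simp

lemma continuous_on_weight: "continuous_on A f \<Longrightarrow> continuous_on A (\<lambda>x. weight s (f x))"
  unfolding weight_def
  by (intro continuous_intros ballI less_imp_neq[OF one_plus_norm_sq_pos, THEN not_sym])

lemma borel_measurable_weight[measurable]: "weight s \<in> borel_measurable borel"
  by (intro borel_measurable_continuous_onI continuous_on_weight continuous_on_id)

lemma weight_compare:
  fixes x y :: "'a::euclidean_space"
  assumes "0 < s" "1 + (norm x)\<^sup>2 \<le> 4 * (1 + (norm y)\<^sup>2)"
  shows "weight s y \<le> 4 powr ((real DIM('a) + 2 * s) / 2) * weight s x"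
proof -
  have g: "real DIM('a) + 2 * s > 0" using assms by (simp add: add_nonneg_pos)
  have "weight s y = 4 powr ((real DIM('a) + 2 * s) / 2) * (4 * (1 + (norm y)\<^sup>2)) powr - ((real DIM('a) + 2 * s) / 2)"
    unfolding weight_def by (subst powr_mult) (simp_all add: powr_minus)
  also have "\<dots> \<le> 4 powr ((real DIM('a) + 2 * s) / 2) * weight s x"
    unfolding weight_def using assms g
    by (intro mult_left_mono powr_mono2') (auto simp: add_pos_nonneg)
  finally show ?thesis .
qed

lemma norm_sq_triangle: "(norm x)\<^sup>2 \<le> 2 * (norm (x + y))\<^sup>2 + 2 * (norm y)\<^sup>2"
  for x y :: "'a::real_normed_vector"
proof -
  have "norm x \<le> norm (x + y) + norm y" using norm_triangle_ineq4[of "x + y" y] by simp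
  then have "(norm x)\<^sup>2 \<le> (norm (x + y) + norm y)\<^sup>2" by (intro power_mono) auto
  also have "\<dots> \<le> 2 * (norm (x + y))\<^sup>2 + 2 * (norm y)\<^sup>2"
    using zero_le_power2[of "norm (x + y) - norm y"] by (simp add: power2_eq_square algebra_simps)
  finally show ?thesis .
qed

lemma weight_nearby:
  fixes x y :: "'a::euclidean_space"
  assumes "0 < s" "norm y \<le> 1"
  shows "weight s (x + y) \<le> 4 powr ((real DIM('a) + 2 * s) / 2) * weight s x"
proof (rule weight_compare[OF assms(1)])
  have "(norm y)\<^sup>2 \<le> 1" using assms by (simp add: power_le_one)
  then show "1 + (norm x)\<^sup>2 \<le> 4 * (1 + (norm (x + y))\<^sup>2)"
    using norm_sq_triangle[of x y] by (smt (verit) zero_le_power2)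
qed

text \<open>Since x = (x + y) - y, one of |x + y| and |y| is at least |x|/2, and the weight there is
  at most a constant times the weight at x. This makes the convolution of the weight with itself
  decay like the weight, so that the tail of the nonlocal operator reproduces the profile.\<close>

lemma weight_mult_le:
  fixes x y :: "'a::euclidean_space"
  assumes "0 < s"
  shows "weight s (x + y) * weight s y \<le>
    4 powr ((real DIM('a) + 2 * s) / 2) * weight s x * (weight s y + weight s (x + y))"
proof -
  let ?c = "4 powr ((real DIM('a) + 2 * s) / 2)"
  have "weight s (x + y) \<le> ?c * weight s x \<or> weight s y \<le> ?c * weight s x"
  proof (cases "(norm y)\<^sup>2 \<le> (norm (x + y))\<^sup>2")
    case True
    then have "1 + (norm x)\<^sup>2 \<le> 4 * (1 + (norm (x + y))\<^sup>2)"
      using norm_sq_triangle[of x y] by (smt (verit) zero_le_power2)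
    then show ?thesis using weight_compare[OF assms] by blast
  next
    case False
    then have "1 + (norm x)\<^sup>2 \<le> 4 * (1 + (norm y)\<^sup>2)"
      using norm_sq_triangle[of x y] by (smt (verit) zero_le_power2)
    then show ?thesis using weight_compare[OF assms] by blast
  qed
  then show ?thesis
  proof
    assume "weight s (x + y) \<le> ?c * weight s x"
    then have "weight s (x + y) * weight s y \<le> ?c * weight s x * weight s y"
      using weight_pos[of s y] by (intro mult_right_mono) auto
    also have "\<dots> \<le> ?c * weight s x * (weight s y + weight s (x + y))"
      using weight_pos[of s x] weight_pos[of s "x + y"] by (intro mult_left_mono) auto
    finally show ?thesis .
  next
    assume "weight s y \<le> ?c * weight s x"
    then have "weight s (x + y) * weight s y \<le> weight s (x + y) * (?c * weight s x)"
      using weight_pos[of s "x + y"] by (intro mult_left_mono) auto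
    also have "\<dots> = ?c * weight s x * weight s (x + y)" by simp
    also have "\<dots> \<le> ?c * weight s x * (weight s y + weight s (x + y))"
      using weight_pos[of s x] weight_pos[of s "y"] by (intro mult_left_mono) auto
    finally show ?thesis .
  qed
qed

lemma norm_powr_le_weight:
  fixes y :: "'a::euclidean_space"
  assumes "0 < s" "1 \<le> norm y"
  shows "norm y powr - (real DIM('a) + 2 * s) \<le> 4 powr ((real DIM('a) + 2 * s) / 2) * weight s y"
proof -
  have g: "real DIM('a) + 2 * s > 0" using assms by (simp add: add_nonneg_pos)
  have n: "norm y powr - (real DIM('a) + 2 * s) = ((norm y)\<^sup>2) powr - ((real DIM('a) + 2 * s) / 2)"
    by (rule norm_powr_eq)
  have le: "1 + (norm y)\<^sup>2 \<le> 4 * (norm y)\<^sup>2"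
    using one_le_power[OF assms(2), of 2] by linarith
  have A: "4 powr ((real DIM('a) + 2 * s) / 2) * weight s y \<ge> 4 powr ((real DIM('a) + 2 * s) / 2) * (4 * (norm y)\<^sup>2) powr - ((real DIM('a) + 2 * s) / 2)"
    unfolding weight_def using g le
    by (intro mult_left_mono powr_mono2') (auto simp: add_pos_nonneg)
  have B: "4 powr ((real DIM('a) + 2 * s) / 2) * (4 * (norm y)\<^sup>2) powr - ((real DIM('a) + 2 * s) / 2)
      = ((norm y)\<^sup>2) powr - ((real DIM('a) + 2 * s) / 2)"
    by (subst powr_mult) (simp_all add: powr_minus)
  show ?thesis unfolding n B[symmetric] by (rule A)
qed

lemma weight_le_frac_kernel:
  fixes y :: "'a::euclidean_space"
  assumes "0 < s"
  shows "weight s y \<le> indicator (cball 0 1) y + frac_kernel s y"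
proof (cases "norm y \<le> 1")
  case True
  then show ?thesis using weight_le_1[OF assms, of y] frac_kernel_nonneg[of s y] by simp
next
  case False
  have g: "real DIM('a) + 2 * s > 0" using assms by (simp add: add_nonneg_pos)
  have n: "norm y powr - (real DIM('a) + 2 * s) = ((norm y)\<^sup>2) powr - ((real DIM('a) + 2 * s) / 2)"
    by (rule norm_powr_eq)
  have "min ((norm y)\<^sup>2) 1 = 1" using False power_mono[of 1 "norm y" 2] by simp
  moreover have "weight s y \<le> ((norm y)\<^sup>2) powr - ((real DIM('a) + 2 * s) / 2)"
    unfolding weight_def using g False by (intro powr_mono2') auto
  ultimately show ?thesis using False unfolding frac_kernel_def n by simp
qed

lemma integrable_weight:
  assumes s: "0 < s" "s < 1"
  shows "integrable lborel (weight s :: 'a::euclidean_space \<Rightarrow> real)"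
proof (rule Bochner_Integration.integrable_bound)
  show "integrable lborel (\<lambda>y::'a. indicator (cball 0 1) y + frac_kernel s y :: real)"
    by (intro Bochner_Integration.integrable_add integrable_frac_kernel s integrable_real_indicator)
       (auto simp: emeasure_cball)
  show "AE y::'a in lborel. norm (weight s y) \<le> norm (indicator (cball 0 1) y + frac_kernel s y :: real)"
    by (intro AE_I2)
       (metis abs_ge_self less_imp_le order_trans real_norm_def abs_of_nonneg weight_pos
          weight_le_frac_kernel[OF s(1)])
qed measurable

section \<open>Second differences and the Laplacian of radial functions\<close>

lemma second_difference_bound:
  fixes g g1 g2 :: "real \<Rightarrow> real"
  assumes "\<And>t. t \<in> {-1..1} \<Longrightarrow> (g has_real_derivative g1 t) (at t)"
    and "\<And>t. t \<in> {-1..1} \<Longrightarrow> (g1 has_real_derivative g2 t) (at t)"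
    and "\<And>t. t \<in> {-1..1} \<Longrightarrow> \<bar>g2 t\<bar> \<le> M"
  shows "\<bar>2 * g 0 - g 1 - g (-1)\<bar> \<le> 2 * M"
proof -
  obtain a where a: "0 < a" "a < 1" "g 1 - g 0 = g1 a"
    using MVT2[of 0 1 g g1] assms(1) by auto
  obtain b where b: "-1 < b" "b < 0" "g 0 - g (-1) = g1 b"
    using MVT2[of "-1" 0 g g1] assms(1) by auto
  \<comment> \<open>The two first differences are values of \<open>g1\<close> at points of
    \<open>{-1..1}\<close>, which are at most 2 apart; this is the factor 2 in the bound.\<close>
  obtain c where c: "b < c" "c < a" "g1 a - g1 b = (a - b) * g2 c"
    using MVT2[of b a g1 g2] assms(2) a b by auto
  have "\<bar>2 * g 0 - g 1 - g (-1)\<bar> = (a - b) * \<bar>g2 c\<bar>"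
  proof -
    have "2 * g 0 - g 1 - g (-1) = - ((a - b) * g2 c)" using a b c by linarith
    then show ?thesis using a b by (simp add: abs_mult)
  qed
  also have "\<dots> \<le> 2 * M"
    using a b c assms(3)[of c] by (intro mult_mono) auto
  finally show ?thesis .
qed

lemma has_derivative_radial:
  fixes x :: "'a::euclidean_space"
  assumes "(F has_real_derivative D) (at ((norm x)\<^sup>2))"
  shows "((\<lambda>x. F ((norm x)\<^sup>2)) has_derivative (\<lambda>h. D * (2 * (x \<bullet> h)))) (at x)"
proof -
  have "((\<lambda>x. (norm x)\<^sup>2) has_derivative (\<lambda>h. 2 * (x \<bullet> h))) (at x)"
    unfolding power2_norm_eq_inner
    by (auto intro!: derivative_eq_intros simp: inner_commute)
  from has_derivative_compose[OF this assms[unfolded has_field_derivative_def]]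
  show ?thesis by simp
qed

text \<open>The symmetric difference cancels the first-order term and leaves the factor |y|^2 that
  the singular kernel needs. The second derivative of F(|z|^2) along y is 4 (z . y)^2
  \<open>F2\<close> + 2 |y|^2 \<open>F1\<close>, whence 6 A, doubled by
  \<open>second_difference_bound\<close>; the power of 4 moves the weight from the segment back to
  x.\<close>

lemma radial_second_difference:
  fixes x y :: "'a::euclidean_space"
  assumes F: "radial_bound ((real DIM('a) + 2 * s) / 2) A F F1 F2" and A: "A \<ge> 0"
    and s: "0 < s" and y: "norm y \<le> 1"
  shows "\<bar>2 * F ((norm x)\<^sup>2) - F ((norm (x + y))\<^sup>2) - F ((norm (x - y))\<^sup>2)\<bar>
    \<le> 12 * A * 4 powr ((real DIM('a) + 2 * s) / 2) * (norm y)\<^sup>2 * weight s x"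
proof -
  define z where "z t = x + t *\<^sub>R y" for t :: real
  define g where "g t = F ((norm (z t))\<^sup>2)" for t
  define g1 where "g1 t = F1 ((norm (z t))\<^sup>2) * (2 * (z t \<bullet> y))" for t
  define g2 where "g2 t = F2 ((norm (z t))\<^sup>2) * (2 * (z t \<bullet> y)) * (2 * (z t \<bullet> y)) + F1 ((norm (z t))\<^sup>2) * (2 * (y \<bullet> y))" for t
  have F': "(F has_real_derivative F1 r) (at r)" "(F1 has_real_derivative F2 r) (at r)"
     "\<bar>F1 r\<bar> \<le> A * (1 + r) powr - ((real DIM('a) + 2 * s) / 2)"
     "(1 + r) * \<bar>F2 r\<bar> \<le> A * (1 + r) powr - ((real DIM('a) + 2 * s) / 2)" if "r \<ge> 0" for r
    using F that unfolding radial_bound_def by auto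
  have nz: "((\<lambda>t. (norm (z t))\<^sup>2) has_real_derivative 2 * (z t \<bullet> y)) (at t)" for t
    unfolding z_def power2_norm_eq_inner has_field_derivative_def
    by (auto intro!: derivative_eq_intros simp: inner_commute algebra_simps)
  have zy: "((\<lambda>t. z t \<bullet> y) has_real_derivative (y \<bullet> y)) (at t)" for t
    unfolding z_def has_field_derivative_def
    by (auto intro!: derivative_eq_intros simp: inner_commute algebra_simps)
  have "\<bar>2 * g 0 - g 1 - g (-1)\<bar> \<le> 2 * (6 * A * (norm y)\<^sup>2 * (4 powr ((real DIM('a) + 2 * s) / 2) * weight s x))"
  proof (rule second_difference_bound)
    fix t :: real assume t: "t \<in> {-1..1}"
    show "(g has_real_derivative g1 t) (at t)"
      unfolding g_def g1_def by (rule DERIV_chain2[OF F'(1) nz]) simp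
    show "(g1 has_real_derivative g2 t) (at t)"
      unfolding g1_def g2_def
      by (rule derivative_eq_intros DERIV_chain2[OF F'(2) nz] zy refl | simp add: algebra_simps)+
    have n: "norm (t *\<^sub>R y) \<le> 1" using t y by (simp add: mult_le_one abs_le_iff)
    have ws: "weight s (z t) \<le> 4 powr ((real DIM('a) + 2 * s) / 2) * weight s x"
      using weight_nearby[OF s n, of x] by (simp add: z_def)
    have cs: "\<bar>z t \<bullet> y\<bar> * \<bar>z t \<bullet> y\<bar> \<le> (1 + (norm (z t))\<^sup>2) * (norm y)\<^sup>2"
    proof -
      have "\<bar>z t \<bullet> y\<bar> * \<bar>z t \<bullet> y\<bar> \<le> (norm (z t) * norm y) * (norm (z t) * norm y)"
        by (intro mult_mono Cauchy_Schwarz_ineq2) auto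
      also have "\<dots> \<le> (1 + (norm (z t))\<^sup>2) * (norm y)\<^sup>2"
        by (simp add: power2_eq_square algebra_simps)
      finally show ?thesis .
    qed
    have "\<bar>g2 t\<bar> \<le> 4 * (\<bar>F2 ((norm (z t))\<^sup>2)\<bar> * (\<bar>z t \<bullet> y\<bar> * \<bar>z t \<bullet> y\<bar>)) + 2 * (norm y)\<^sup>2 * \<bar>F1 ((norm (z t))\<^sup>2)\<bar>"
      unfolding g2_def by (rule abs_triangle_ineq[THEN order_trans]) (simp add: abs_mult power2_norm_eq_inner mult_ac)
    also have "\<dots> \<le> 4 * (\<bar>F2 ((norm (z t))\<^sup>2)\<bar> * ((1 + (norm (z t))\<^sup>2) * (norm y)\<^sup>2)) + 2 * (norm y)\<^sup>2 * \<bar>F1 ((norm (z t))\<^sup>2)\<bar>"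
      using cs by (intro add_mono mult_left_mono) auto
    also have "\<dots> = 4 * (norm y)\<^sup>2 * ((1 + (norm (z t))\<^sup>2) * \<bar>F2 ((norm (z t))\<^sup>2)\<bar>) + 2 * (norm y)\<^sup>2 * \<bar>F1 ((norm (z t))\<^sup>2)\<bar>"
      by (simp add: mult_ac)
    also have "\<dots> \<le> 4 * (norm y)\<^sup>2 * (A * weight s (z t)) + 2 * (norm y)\<^sup>2 * (A * weight s (z t))"
      using F'(3,4)[of "(norm (z t))\<^sup>2"] unfolding weight_def by (intro add_mono mult_left_mono) auto
    also have "\<dots> = 6 * A * (norm y)\<^sup>2 * weight s (z t)" by simp
    also have "\<dots> \<le> 6 * A * (norm y)\<^sup>2 * (4 powr ((real DIM('a) + 2 * s) / 2) * weight s x)"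
      using ws A by (intro mult_left_mono) auto
    finally show "\<bar>g2 t\<bar> \<le> 6 * A * (norm y)\<^sup>2 * (4 powr ((real DIM('a) + 2 * s) / 2) * weight s x)" .
  qed
  then show ?thesis by (simp add: g_def z_def mult_ac)
qed

lemma laplacian_radial:
  fixes x :: "'a::euclidean_space"
  assumes F: "\<And>r. r \<ge> 0 \<Longrightarrow> (F has_real_derivative F1 r) (at r)"
    "\<And>r. r \<ge> 0 \<Longrightarrow> (F1 has_real_derivative F2 r) (at r)"
  shows "laplacian (\<lambda>x. F ((norm x)\<^sup>2)) x =
    4 * (norm x)\<^sup>2 * F2 ((norm x)\<^sup>2) + 2 * real DIM('a) * F1 ((norm x)\<^sup>2)"
proof -
  have 1: "partial_deriv i (\<lambda>x::'a. F ((norm x)\<^sup>2)) = (\<lambda>x. F1 ((norm x)\<^sup>2) * (2 * (x \<bullet> i)))" for i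
    by (rule ext, rule partial_derivI[OF has_derivative_radial]) (simp add: F)
  have 2: "partial_deriv i (\<lambda>x::'a. F1 ((norm x)\<^sup>2) * (2 * (x \<bullet> i))) x
      = F2 ((norm x)\<^sup>2) * (4 * (x \<bullet> i)\<^sup>2) + 2 * F1 ((norm x)\<^sup>2)" if "i \<in> Basis" for i
  proof -
    have "((\<lambda>x::'a. F1 ((norm x)\<^sup>2) * (2 * (x \<bullet> i))) has_derivative
        (\<lambda>h. F1 ((norm x)\<^sup>2) * (2 * (h \<bullet> i)) + (F2 ((norm x)\<^sup>2) * (2 * (x \<bullet> h))) * (2 * (x \<bullet> i)))) (at x)"
      by (rule has_derivative_mult has_derivative_radial F | auto intro!: derivative_eq_intros)+
    from partial_derivI[OF this, of i] that show ?thesis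
      by (simp add: power2_eq_square algebra_simps inner_Basis)
  qed
  have n: "(norm x)\<^sup>2 = (\<Sum>i\<in>Basis. (x \<bullet> i)\<^sup>2)"
    unfolding power2_norm_eq_inner by (subst euclidean_inner) (simp add: power2_eq_square)
  have "laplacian (\<lambda>x. F ((norm x)\<^sup>2)) x =
      (\<Sum>i\<in>Basis. F2 ((norm x)\<^sup>2) * (4 * (x \<bullet> i)\<^sup>2) + 2 * F1 ((norm x)\<^sup>2))"
    unfolding laplacian_def 1 by (rule sum.cong[OF refl 2])
  also have "\<dots> = 4 * (\<Sum>i\<in>Basis. (x \<bullet> i)\<^sup>2) * F2 ((norm x)\<^sup>2) + 2 * real DIM('a) * F1 ((norm x)\<^sup>2)"
    by (simp add: sum.distrib sum_distrib_left sum_distrib_right mult_ac)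
  finally show ?thesis unfolding n[symmetric] .
qed

section \<open>The principal value as an absolutely convergent integral\<close>

definition second_quotient :: "real \<Rightarrow> ('a::euclidean_space \<Rightarrow> real) \<Rightarrow> 'a \<Rightarrow> 'a \<Rightarrow> real" where
  "second_quotient s v x y =
     (2 * v x - v (x + y) - v (x - y)) * norm y powr - (real DIM('a) + 2 * s)"

text \<open>The substitutions y = x + z and y = x - z give the same truncated integral, and their
  mean has half the second quotient as integrand. The latter is integrable by hypothesis, so
  dominated convergence removes the truncation.\<close>

lemma frac_laplacian_eq:
  fixes v :: "'a::euclidean_space \<Rightarrow> real"
  assumes s: "0 < s" "s < 1" and v[measurable]: "v \<in> borel_measurable borel"
    and B: "\<And>y. \<bar>v y\<bar> \<le> B" and q: "integrable lborel (second_quotient s v x)"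
  shows "frac_laplacian s v x =
    frac_laplacian_const DIM('a) s * ((LINT y|lborel. second_quotient s v x y) / 2)"
proof -
  define \<gamma> where "\<gamma> = real DIM('a) + 2 * s"
  have q_def: "second_quotient s v x y = (2 * v x - v (x + y) - v (x - y)) * norm y powr - \<gamma>" for y
    by (simp add: second_quotient_def \<gamma>_def)
  define T where "T \<epsilon> = (LINT y:- ball x \<epsilon>|lborel. (v x - v y) / norm (x - y) powr \<gamma>)" for \<epsilon>
  define h where "h \<epsilon> c z = indicator (- ball 0 \<epsilon>) z * (v x - v (x + c *\<^sub>R z)) * norm z powr - \<gamma>"
    for \<epsilon> c and z :: 'a
  have [measurable]: "h \<epsilon> c \<in> borel_measurable borel" for \<epsilon> c
    unfolding h_def[abs_def] by measurable
  have hint: "integrable lborel (h \<epsilon> c)" if "\<epsilon> > 0" for \<epsilon> c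
  proof (rule Bochner_Integration.integrable_bound)
    show "integrable lborel (\<lambda>z::'a. 2 * B / min (\<epsilon>\<^sup>2) 1 * frac_kernel s z)"
      by (intro integrable_mult_right integrable_frac_kernel s)
    have "norm (h \<epsilon> c z) \<le> norm (2 * B / min (\<epsilon>\<^sup>2) 1 * frac_kernel s z)" for z
    proof (cases "norm z < \<epsilon>")
      case False
      have B0: "B \<ge> 0" using B[of x] by simp
      have "norm (h \<epsilon> c z) = \<bar>v x - v (x + c *\<^sub>R z)\<bar> * norm z powr - \<gamma>"
        using False by (simp add: h_def abs_mult)
      also have "\<dots> \<le> (2 * B) * norm z powr - \<gamma>"
        using B[of x] B[of "x + c *\<^sub>R z"] by (intro mult_right_mono) auto
      also have "\<dots> \<le> (2 * B / min (\<epsilon>\<^sup>2) 1 * min ((norm z)\<^sup>2) 1) * norm z powr - \<gamma>"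
      proof (intro mult_right_mono)
        have "min (\<epsilon>\<^sup>2) 1 \<le> min ((norm z)\<^sup>2) 1"
          using False that by (intro min.mono power_mono) auto
        then show "2 * B \<le> 2 * B / min (\<epsilon>\<^sup>2) 1 * min ((norm z)\<^sup>2) 1"
          using B0 that mult_left_mono[of "min (\<epsilon>\<^sup>2) 1" "min ((norm z)\<^sup>2) 1" "2 * B"]
          by (simp add: pos_le_divide_eq)
      qed simp
      finally show ?thesis using B0 by (simp add: frac_kernel_def \<gamma>_def mult_ac)
    qed (simp add: h_def)
    then show "AE z in lborel. norm (h \<epsilon> c z) \<le> norm (2 * B / min (\<epsilon>\<^sup>2) 1 * frac_kernel s z)"
      by blast
  qed measurable
  have Th: "T \<epsilon> = (LINT z|lborel. h \<epsilon> c z)" if "\<epsilon> > 0" "\<bar>c\<bar> = 1" for \<epsilon> c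
  proof -
    have c0: "c \<noteq> 0" using that by auto
    show ?thesis
      unfolding T_def set_lebesgue_integral_def
      by (subst lborel_integral_affine[OF c0, of _ x], measurable)
         (use that in \<open>auto intro!: Bochner_Integration.integral_cong
            simp: h_def indicator_def dist_norm powr_minus divide_inverse\<close>)
  qed
  have T: "T \<epsilon> = (LINT z|lborel. indicator (- ball 0 \<epsilon>) z * second_quotient s v x z) / 2" if "\<epsilon> > 0" for \<epsilon>
  proof -
    have "T \<epsilon> + T \<epsilon> = (LINT z|lborel. h \<epsilon> 1 z + h \<epsilon> (-1) z)"
      using Th[OF that, of 1] Th[OF that, of "-1"] hint[OF that] by simp
    also have "(\<lambda>z. h \<epsilon> 1 z + h \<epsilon> (-1) z) = (\<lambda>z. indicator (- ball 0 \<epsilon>) z * second_quotient s v x z)"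
      by (auto simp: fun_eq_iff h_def q_def algebra_simps)
    finally show ?thesis by simp
  qed
  have "((\<lambda>\<epsilon>. LINT z|lborel. indicator (- ball 0 \<epsilon>) z * second_quotient s v x z)
     \<longlongrightarrow> (LINT z|lborel. second_quotient s v x z)) (at_right 0)"
    unfolding tendsto_at_iff_sequentially comp_def
  proof (intro allI impI)
    fix X :: "nat \<Rightarrow> real" assume X: "\<forall>i. X i \<in> {0<..} - {0}" "X \<longlonglongrightarrow> 0"
    show "(\<lambda>i. LINT z|lborel. indicator (- ball 0 (X i)) z * second_quotient s v x z)
        \<longlonglongrightarrow> (LINT z|lborel. second_quotient s v x z)"
    proof (rule integral_dominated_convergence[where w="\<lambda>z. norm (second_quotient s v x z)"])
      show "AE z in lborel. (\<lambda>i. indicator (- ball 0 (X i)) z * second_quotient s v x z) \<longlonglongrightarrow> second_quotient s v x z"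
      proof (rule AE_mp[OF AE_lborel_singleton[of 0]], intro AE_I2 impI)
        fix z :: 'a assume "z \<noteq> 0"
        then have "\<forall>\<^sub>F i in sequentially. X i < norm z"
          using X(2) by (intro order_tendstoD) auto
        then have "\<forall>\<^sub>F i in sequentially. indicator (- ball 0 (X i)) z * second_quotient s v x z = second_quotient s v x z"
          by eventually_elim auto
        then show "(\<lambda>i. indicator (- ball 0 (X i)) z * second_quotient s v x z) \<longlonglongrightarrow> second_quotient s v x z"
          by (rule tendsto_eventually)
      qed
    qed (use q in \<open>auto simp: indicator_def intro!: integrable_norm\<close>)
  qed
  then have "((\<lambda>\<epsilon>. (LINT z|lborel. indicator (- ball 0 \<epsilon>) z * second_quotient s v x z) / 2)
     \<longlongrightarrow> (LINT z|lborel. second_quotient s v x z) / 2) (at_right 0)"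
    by (intro tendsto_divide) auto
  then have "(T \<longlongrightarrow> (LINT z|lborel. second_quotient s v x z) / 2) (at_right 0)"
    by (rule Lim_transform_eventually) (auto simp: eventually_at_filter T)
  then have "Lim (at_right 0) T = (LINT z|lborel. second_quotient s v x z) / 2"
    by (intro tendsto_Lim) auto
  then show ?thesis
    unfolding frac_laplacian_def T_def \<gamma>_def by simp
qed

lemma frac_laplacian_const_pos:
  assumes "0 < s" "s < 1"
  shows "0 < frac_laplacian_const d s"
proof -
  have "(real d + 2 * s) / 2 > 0" using assms by (simp add: add_nonneg_pos)
  then show ?thesis
    unfolding frac_laplacian_const_def using assms
    by (intro divide_pos_pos mult_pos_pos Gamma_real_pos) auto
qed

text \<open>For |y| \<le> 1 the estimate of second differences is used. For |y| > 1 the kernel is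
  itself at most a multiple of \<open>weight s y\<close>, and \<open>weight_mult_le\<close> extracts
  \<open>weight s x\<close> from the products. What remains is integrable in y, with an integral
  that does not depend on x.\<close>

lemma second_quotient_radial_bound:
  fixes x y :: "'a::euclidean_space"
  assumes F: "radial_bound ((real DIM('a) + 2 * s) / 2) A F F1 F2" and A: "A \<ge> 0" and s: "0 < s"
  defines "K \<equiv> 4 powr ((real DIM('a) + 2 * s) / 2)"
  shows "\<bar>second_quotient s (\<lambda>z. F ((norm z)\<^sup>2)) x y\<bar> \<le> A * weight s x *
    ((12 * K + 2) * frac_kernel s y + K\<^sup>2 * (2 * weight s y + weight s (x + y) + weight s (x - y)))"
proof -
  have K: "K > 0" by (simp add: K_def)
  have Fb: "\<bar>F ((norm z)\<^sup>2)\<bar> \<le> A * weight s z" for z :: 'a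
    using F unfolding radial_bound_def weight_def by simp
  have nn: "0 \<le> A * weight s x * (K\<^sup>2 * (2 * weight s y + weight s (x + y) + weight s (x - y)))"
      "0 \<le> A * weight s x * (2 * frac_kernel s y)" "0 \<le> A * weight s x * (12 * K * frac_kernel s y)"
    using A K weight_pos[of s x] weight_pos[of s y] weight_pos[of s "x+y"] weight_pos[of s "x-y"]
      frac_kernel_nonneg[of s y]
    by (intro mult_nonneg_nonneg; simp)+
  show ?thesis
  proof (cases "norm y \<le> 1")
    case True
    have k: "(norm y)\<^sup>2 * norm y powr - (real DIM('a) + 2 * s) = frac_kernel s y"
      using True by (simp add: frac_kernel_def power_le_one min_def)
    have "\<bar>second_quotient s (\<lambda>z. F ((norm z)\<^sup>2)) x y\<bar>
        \<le> (12 * A * K * (norm y)\<^sup>2 * weight s x) * norm y powr - (real DIM('a) + 2 * s)"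
      unfolding second_quotient_def abs_mult
      using radial_second_difference[OF F A s True, of x] by (simp add: K_def mult_right_mono)
    also have "\<dots> = A * weight s x * (12 * K * ((norm y)\<^sup>2 * norm y powr - (real DIM('a) + 2 * s)))"
      by (simp only: mult_ac)
    also have "\<dots> = A * weight s x * (12 * K * frac_kernel s y)" unfolding k ..
    finally show ?thesis using nn by (simp add: algebra_simps)
  next
    case False
    let ?N = "norm y powr - (real DIM('a) + 2 * s)"
    have N: "?N \<le> K * weight s y"
      using norm_powr_le_weight[OF s, of y] False by (simp add: K_def)
    have k: "?N = frac_kernel s y"
    proof -
      have "1 \<le> (norm y)\<^sup>2" using False by (intro one_le_power) simp
      then show ?thesis by (simp add: frac_kernel_def min_absorb2)
    qed
    have w: "weight s (x + y) * weight s y \<le> K * weight s x * (weight s y + weight s (x + y))"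
      "weight s (x - y) * weight s y \<le> K * weight s x * (weight s y + weight s (x - y))"
      using weight_mult_le[OF s, of x y] weight_mult_le[OF s, of x "-y"]
      by (simp_all add: K_def weight_def)
    have "\<bar>second_quotient s (\<lambda>z. F ((norm z)\<^sup>2)) x y\<bar>
        \<le> (2 * (A * weight s x) + A * weight s (x + y) + A * weight s (x - y)) * ?N"
      unfolding second_quotient_def abs_mult
      using Fb[of x] Fb[of "x + y"] Fb[of "x - y"] by (simp add: mult_right_mono)
    also have "\<dots> = A * weight s x * (2 * ?N) + A * (weight s (x + y) + weight s (x - y)) * ?N"
      by (simp add: algebra_simps)
    also have "\<dots> \<le> A * weight s x * (2 * ?N) + A * (weight s (x + y) + weight s (x - y)) * (K * weight s y)"
      using N A weight_pos[of s "x+y"] weight_pos[of s "x-y"]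
      by (intro add_left_mono mult_left_mono mult_nonneg_nonneg) auto
    also have "\<dots> = A * weight s x * (2 * ?N) + A * K * (weight s (x + y) * weight s y + weight s (x - y) * weight s y)"
      by (simp add: algebra_simps)
    also have "\<dots> \<le> A * weight s x * (2 * ?N) + A * K * (K * weight s x * (weight s y + weight s (x + y)) + K * weight s x * (weight s y + weight s (x - y)))"
      using w A K by (intro add_left_mono mult_left_mono add_mono) auto
    also have "\<dots> = A * weight s x * (2 * frac_kernel s y) + A * weight s x * (K\<^sup>2 * (2 * weight s y + weight s (x + y) + weight s (x - y)))"
      unfolding k by (simp add: algebra_simps power2_eq_square)
    finally show ?thesis using nn by (simp add: algebra_simps)
  qed
qed

lemma continuous_on_radial:
  assumes F: "\<And>r. r \<ge> 0 \<Longrightarrow> (F has_real_derivative F1 r) (at r)"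
  shows "continuous_on A (\<lambda>z::'a::euclidean_space. F ((norm z)\<^sup>2))"
  using has_derivative_radial[OF F]
  by (intro has_derivative_continuous_on[where f'="\<lambda>z h. F1 ((norm z)\<^sup>2) * (2 * (z \<bullet> h))"])
     (auto intro: has_derivative_at_withinI)

lemma second_quotient_radial:
  assumes s: "0 < s" "s < 1"
  shows "\<exists>C\<ge>0. \<forall>A F F1 F2. \<forall>x::'a::euclidean_space. A \<ge> 0 \<longrightarrow>
    radial_bound ((real DIM('a) + 2 * s) / 2) A F F1 F2 \<longrightarrow>
    integrable lborel (second_quotient s (\<lambda>z. F ((norm z)\<^sup>2)) x) \<and>
    (LINT y|lborel. \<bar>second_quotient s (\<lambda>z. F ((norm z)\<^sup>2)) x y\<bar>) \<le> C * A * weight s x"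
proof -
  define K where "K = 4 powr ((real DIM('a) + 2 * s) / 2)"
  \<comment> \<open>The integral of the bound above: translated and reflected weights have the same
    integral, so the coefficients 2, 1 and 1 add up to 4.\<close>
  define C where "C = (12 * K + 2) * (LINT y::'a|lborel. frac_kernel s y)
      + K\<^sup>2 * (4 * (LINT y::'a|lborel. weight s y))"
  have C: "C \<ge> 0" unfolding C_def
    by (intro add_nonneg_nonneg mult_nonneg_nonneg Bochner_Integration.integral_nonneg)
       (auto simp: K_def frac_kernel_nonneg less_imp_le[OF weight_pos])
  have "integrable lborel (second_quotient s (\<lambda>z. F ((norm z)\<^sup>2)) x) \<and>
    (LINT y|lborel. \<bar>second_quotient s (\<lambda>z. F ((norm z)\<^sup>2)) x y\<bar>) \<le> C * A * weight s x"
    if A: "A \<ge> 0" and F: "radial_bound ((real DIM('a) + 2 * s) / 2) A F F1 F2"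
    for A F F1 F2 and x :: 'a
  proof -
    define Q where "Q y = A * weight s x * ((12 * K + 2) * frac_kernel s y
        + K\<^sup>2 * (2 * weight s y + weight s (x + y) + weight s (x - y)))" for y
    have w: "integrable lborel (weight s :: 'a \<Rightarrow> real)" by (rule integrable_weight[OF s])
    have wi: "integrable lborel (\<lambda>y. weight s (x + y))" "integrable lborel (\<lambda>y. weight s (x - y))"
      using lborel_integrable_affine_iff[of 1 "weight s" x] lborel_integrable_affine_iff[of "-1" "weight s" x] w
      by simp_all
    have we: "(LINT y|lborel. weight s (x + y)) = (LINT y::'a|lborel. weight s y)"
       "(LINT y|lborel. weight s (x - y)) = (LINT y::'a|lborel. weight s y)"
      using lborel_integral_affine[of 1 "weight s" x] lborel_integral_affine[of "-1" "weight s" x]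
      by simp_all
    have Qi: "integrable lborel Q"
      unfolding Q_def[abs_def]
      by (intro Bochner_Integration.integrable_add integrable_mult_right wi w integrable_frac_kernel s)
    have QI: "(LINT y|lborel. Q y) = C * A * weight s x"
      using wi w integrable_frac_kernel[OF s, where 'a='a]
      by (simp add: Q_def C_def we)
    have [measurable]: "(\<lambda>z::'a. F ((norm z)\<^sup>2)) \<in> borel_measurable borel"
      using F unfolding radial_bound_def
      by (intro borel_measurable_continuous_onI continuous_on_radial[of F F1]) auto
    have m: "second_quotient s (\<lambda>z. F ((norm z)\<^sup>2)) x \<in> borel_measurable borel"
      unfolding second_quotient_def[abs_def] by measurable
    have le: "\<bar>second_quotient s (\<lambda>z. F ((norm z)\<^sup>2)) x y\<bar> \<le> Q y" for y
      unfolding Q_def K_def by (rule second_quotient_radial_bound[OF F A s(1)])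
    have i: "integrable lborel (second_quotient s (\<lambda>z. F ((norm z)\<^sup>2)) x)"
      by (rule Bochner_Integration.integrable_bound[OF Qi])
         (use m le in \<open>auto intro: order_trans[OF _ abs_ge_self]\<close>)
    have "(LINT y|lborel. \<bar>second_quotient s (\<lambda>z. F ((norm z)\<^sup>2)) x y\<bar>) \<le> (LINT y|lborel. Q y)"
      using i Qi le by (intro integral_mono integrable_abs) auto
    with i QI show ?thesis by simp
  qed
  with C show ?thesis by blast
qed

section \<open>Scaling and sign of the operator\<close>

lemma second_quotient_scale:
  fixes x :: "'a::euclidean_space"
  assumes "\<rho> > 0"
  shows "second_quotient s (\<lambda>z. c * v (z /\<^sub>R \<rho>)) x y =
    c * \<rho> powr - (real DIM('a) + 2 * s) * second_quotient s v (x /\<^sub>R \<rho>) (y /\<^sub>R \<rho>)"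
proof -
  have "norm y powr - (real DIM('a) + 2 * s) = \<rho> powr - (real DIM('a) + 2 * s) * norm (y /\<^sub>R \<rho>) powr - (real DIM('a) + 2 * s)"
  proof -
    have "norm y = \<rho> * norm (y /\<^sub>R \<rho>)" using assms by simp
    then have "norm y powr - (real DIM('a) + 2 * s) = (\<rho> * norm (y /\<^sub>R \<rho>)) powr - (real DIM('a) + 2 * s)"
      by (rule arg_cong)
    then show ?thesis using assms by (simp only: powr_mult)
  qed
  then show ?thesis
    unfolding second_quotient_def by (simp add: scaleR_add_right scaleR_diff_right algebra_simps del: norm_scaleR)
qed

text \<open>Dilation by \<rho> scales the nonlocal part by \<rho>^(-2s) and the Laplacian by
  \<rho>^(-2), which is smaller for \<rho> \<ge> 1. At large scales the fractional part dominates,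
  which is why the critical exponent is the one of the fractional operator.\<close>

lemma mixed_op_radial_bound:
  assumes s: "0 < s" "s < 1" and ab: "a \<ge> 0" "b \<ge> 0"
  shows "\<exists>C\<ge>0. \<forall>A F F1 F2 c \<rho>. \<forall>x::'a::euclidean_space. A \<ge> 0 \<longrightarrow> \<rho> \<ge> 1 \<longrightarrow>
    radial_bound ((real DIM('a) + 2 * s) / 2) A F F1 F2 \<longrightarrow>
    \<bar>mixed_op a b s (\<lambda>y. c * F ((norm (y /\<^sub>R \<rho>))\<^sup>2)) x\<bar>
      \<le> C * A * \<bar>c\<bar> * \<rho> powr (- 2 * s) * weight s (x /\<^sub>R \<rho>)"
proof -
  obtain C where C: "C \<ge> 0" "\<And>A F F1 F2 x::'a. A \<ge> 0 \<Longrightarrow>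
    radial_bound ((real DIM('a) + 2 * s) / 2) A F F1 F2 \<Longrightarrow>
    integrable lborel (second_quotient s (\<lambda>z. F ((norm z)\<^sup>2)) x) \<and>
    (LINT y|lborel. \<bar>second_quotient s (\<lambda>z. F ((norm z)\<^sup>2)) x y\<bar>) \<le> C * A * weight s x"
    using second_quotient_radial[OF s, where 'a='a] by blast
  define k where "k = frac_laplacian_const DIM('a) s"
  have k: "k > 0" unfolding k_def by (rule frac_laplacian_const_pos[OF s])
  define C' where "C' = a * (4 + 2 * real DIM('a)) + b * (k * C)"
  have C': "C' \<ge> 0" unfolding C'_def using ab k C(1) by auto
  have "\<bar>mixed_op a b s (\<lambda>y. c * F ((norm (y /\<^sub>R \<rho>))\<^sup>2)) x\<bar>
      \<le> C' * A * \<bar>c\<bar> * \<rho> powr (- 2 * s) * weight s (x /\<^sub>R \<rho>)"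
    if A: "A \<ge> 0" and \<rho>: "\<rho> \<ge> 1" and F: "radial_bound ((real DIM('a) + 2 * s) / 2) A F F1 F2"
    for A F F1 F2 c \<rho> and x :: 'a
  proof -
    let ?v = "\<lambda>z::'a. F ((norm z)\<^sup>2)"
    let ?u = "\<lambda>y::'a. c * ?v (y /\<^sub>R \<rho>)"
    let ?w = "weight s (x /\<^sub>R \<rho>)"
    have F': "(F has_real_derivative F1 r) (at r)" "(F1 has_real_derivative F2 r) (at r)"
       "\<bar>F r\<bar> \<le> A * (1 + r) powr - ((real DIM('a) + 2 * s) / 2)"
       "\<bar>F1 r\<bar> \<le> A * (1 + r) powr - ((real DIM('a) + 2 * s) / 2)"
       "(1 + r) * \<bar>F2 r\<bar> \<le> A * (1 + r) powr - ((real DIM('a) + 2 * s) / 2)" if "r \<ge> 0" for r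
      using F that unfolding radial_bound_def by auto
    have cont: "continuous_on UNIV ?v" by (rule continuous_on_radial[OF F'(1)])
    have [measurable]: "?v \<in> borel_measurable borel"
      using cont by (rule borel_measurable_continuous_onI)
    have um[measurable]: "?u \<in> borel_measurable borel" by measurable
    have ub: "\<bar>?u y\<bar> \<le> \<bar>c\<bar> * A" for y
    proof -
      have "\<bar>?v (y /\<^sub>R \<rho>)\<bar> \<le> A * weight s (y /\<^sub>R \<rho>)" using F'(3) by (simp add: weight_def)
      also have "\<dots> \<le> A" using weight_le_1[OF s(1)] A by (rule mult_left_le)
      finally show ?thesis by (simp add: abs_mult mult_left_mono)
    qed
    let ?q = "second_quotient s ?v (x /\<^sub>R \<rho>)"
    have [measurable]: "?q \<in> borel_measurable borel"
      unfolding second_quotient_def[abs_def] by measurable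
    have q: "integrable lborel ?q" "(LINT y|lborel. \<bar>?q y\<bar>) \<le> C * A * ?w"
      using C(2)[OF A F] by auto
    have qs: "second_quotient s ?u x = (\<lambda>y. c * \<rho> powr - (real DIM('a) + 2 * s) * ?q (y /\<^sub>R \<rho>))"
      by (intro ext second_quotient_scale) (use \<rho> in simp)
    have i: "integrable lborel (\<lambda>y. ?q (y /\<^sub>R \<rho>))"
      using lborel_integrable_affine_iff[of "inverse \<rho>" ?q 0] \<rho> q by simp
    have "(LINT y|lborel. ?q y) = inverse \<rho> ^ DIM('a) * (LINT y|lborel. ?q (y /\<^sub>R \<rho>))"
      using lborel_integral_affine[of "inverse \<rho>" ?q 0] \<rho> by simp
    then have e: "(LINT y|lborel. ?q (y /\<^sub>R \<rho>)) = \<rho> powr real DIM('a) * (LINT y|lborel. ?q y)"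
      using \<rho> by (simp add: powr_realpow field_simps)
    have "frac_laplacian s ?u x = k * ((LINT y|lborel. second_quotient s ?u x y) / 2)"
      unfolding k_def
      by (rule frac_laplacian_eq[OF s um ub]) (use i qs in auto)
    also have "(LINT y|lborel. second_quotient s ?u x y) = c * (\<rho> powr - (real DIM('a) + 2 * s) * \<rho> powr real DIM('a)) * (LINT y|lborel. ?q y)"
      unfolding qs by (simp add: e)
    also have "\<rho> powr - (real DIM('a) + 2 * s) * \<rho> powr real DIM('a) = \<rho> powr (- 2 * s)"
      by (simp flip: powr_add)
    finally have fe: "frac_laplacian s ?u x = k / 2 * c * \<rho> powr (- 2 * s) * (LINT y|lborel. ?q y)" by simp
    have fb: "\<bar>frac_laplacian s ?u x\<bar> \<le> k * C * A * \<bar>c\<bar> * \<rho> powr (- 2 * s) * ?w"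
    proof -
      have "\<bar>LINT y|lborel. ?q y\<bar> \<le> C * A * ?w"
        using integral_abs_bound[of lborel ?q] q(2) by linarith
      then have "\<bar>frac_laplacian s ?u x\<bar> \<le> k / 2 * \<bar>c\<bar> * \<rho> powr (- 2 * s) * (C * A * ?w)"
        unfolding fe using k by (simp add: abs_mult mult_left_mono)
      also have "\<dots> = (k * C * A * \<bar>c\<bar> * \<rho> powr (- 2 * s) * ?w) / 2" by simp
      also have "\<dots> \<le> k * C * A * \<bar>c\<bar> * \<rho> powr (- 2 * s) * ?w"
        using k C(1) A weight_pos[of s "x /\<^sub>R \<rho>"] by simp
      finally show ?thesis .
    qed
    have lb: "\<bar>laplacian ?u x\<bar> \<le> (4 + 2 * real DIM('a)) * A * \<bar>c\<bar> * \<rho> powr (- 2 * s) * ?w"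
    proof -
      let ?r = "(norm (x /\<^sub>R \<rho>))\<^sup>2"
      let ?G = "\<lambda>r. c * F (r / \<rho>\<^sup>2)" let ?G1 = "\<lambda>r. c * F1 (r / \<rho>\<^sup>2) / \<rho>\<^sup>2"
      let ?G2 = "\<lambda>r. c * F2 (r / \<rho>\<^sup>2) / \<rho>\<^sup>2 / \<rho>\<^sup>2"
      have nr: "(norm (z /\<^sub>R \<rho>))\<^sup>2 = (norm z)\<^sup>2 / \<rho>\<^sup>2" for z :: 'a
        using \<rho> by (simp add: power_mult_distrib field_simps)
      have d: "((\<lambda>r. r / \<rho>\<^sup>2) has_real_derivative 1 / \<rho>\<^sup>2) (at r)" for r
        by (rule DERIV_cdivide[OF DERIV_ident])
      have G1: "(?G has_real_derivative ?G1 r) (at r)" if "r \<ge> 0" for r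
        using DERIV_cmult[OF DERIV_chain2[OF F'(1) d], of r c] that by simp
      have G2: "(?G1 has_real_derivative ?G2 r) (at r)" if "r \<ge> 0" for r
        using DERIV_cmult[OF DERIV_chain2[OF F'(2) d], of r "c / \<rho>\<^sup>2"] that by (simp add: mult_ac)
      have "?u = (\<lambda>z. ?G ((norm z)\<^sup>2))" unfolding nr ..
      then have "laplacian ?u x = laplacian (\<lambda>z. ?G ((norm z)\<^sup>2)) x" by (rule arg_cong)
      also have "\<dots> = 4 * (norm x)\<^sup>2 * ?G2 ((norm x)\<^sup>2) + 2 * real DIM('a) * ?G1 ((norm x)\<^sup>2)"
        by (rule laplacian_radial[OF G1 G2])
      also have "\<dots> = c / \<rho>\<^sup>2 * (4 * (?r * F2 ?r) + 2 * real DIM('a) * F1 ?r)"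
      proof -
        have "4 * X * (c * p / m / m) + 2 * D * (c * q / m) = c / m * (4 * (X / m * p) + 2 * D * q)"
          for X p q D m :: real
          by (simp add: ring_distribs mult_ac)
        then show ?thesis unfolding nr .
      qed
      finally have L: "laplacian ?u x = c / \<rho>\<^sup>2 * (4 * (?r * F2 ?r) + 2 * real DIM('a) * F1 ?r)" .
      have "\<bar>4 * (?r * F2 ?r) + 2 * real DIM('a) * F1 ?r\<bar> \<le> 4 * (?r * \<bar>F2 ?r\<bar>) + 2 * real DIM('a) * \<bar>F1 ?r\<bar>"
        by (rule abs_triangle_ineq[THEN order_trans]) (simp add: abs_mult)
      also have "\<dots> \<le> 4 * ((1 + ?r) * \<bar>F2 ?r\<bar>) + 2 * real DIM('a) * \<bar>F1 ?r\<bar>"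
        by (intro add_mono mult_left_mono mult_right_mono) auto
      also have "\<dots> \<le> 4 * (A * ?w) + 2 * real DIM('a) * (A * ?w)"
        using F'(4,5)[of ?r] unfolding weight_def by (intro add_mono mult_left_mono) auto
      finally have "\<bar>laplacian ?u x\<bar> \<le> \<bar>c\<bar> / \<rho>\<^sup>2 * (4 * (A * ?w) + 2 * real DIM('a) * (A * ?w))"
        unfolding L by (simp add: abs_mult divide_right_mono mult_left_mono)
      also have "\<dots> = (\<bar>c\<bar> * (4 * (A * ?w) + 2 * real DIM('a) * (A * ?w))) * \<rho> powr (-2)"
        using \<rho> by (simp add: powr_minus powr_numeral field_simps)
      also have "\<dots> \<le> (\<bar>c\<bar> * (4 * (A * ?w) + 2 * real DIM('a) * (A * ?w))) * \<rho> powr (-2 * s)"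
        using A weight_pos[of s "x /\<^sub>R \<rho>"] s \<rho> by (intro mult_left_mono powr_mono) auto
      finally show ?thesis by (simp add: algebra_simps)
    qed
    have "\<bar>mixed_op a b s ?u x\<bar> \<le> a * \<bar>laplacian ?u x\<bar> + b * \<bar>frac_laplacian s ?u x\<bar>"
      unfolding mixed_op_def using ab
      by (intro abs_triangle_ineq[THEN order_trans]) (simp add: abs_mult)
    also have "\<dots> \<le> a * ((4 + 2 * real DIM('a)) * A * \<bar>c\<bar> * \<rho> powr (- 2 * s) * ?w)
        + b * (k * C * A * \<bar>c\<bar> * \<rho> powr (- 2 * s) * ?w)"
      using lb fb ab by (intro add_mono mult_left_mono)
    also have "\<dots> = C' * A * \<bar>c\<bar> * \<rho> powr (- 2 * s) * ?w"
      by (simp add: C'_def algebra_simps)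
    finally show ?thesis .
  qed
  with C' show ?thesis by blast
qed

lemma bump_nonneg: "0 \<le> bump \<sigma> M x"
  by (simp add: bump_def profile_def cutoff_nonneg)

text \<open>Outside the support the Laplacian vanishes and the nonlocal term only averages -V over
  the support, so it is negative. There |y| \<le> |x| + 1 and (|x| + 1)^2 \<le> 2 (1 + |x|^2), which
  bounds the kernel below by a multiple of the weight.\<close>

lemma mixed_op_bump_far:
  assumes s: "0 < s" "s < 1" and ab: "a \<ge> 0" "b > 0"
  defines "\<sigma> \<equiv> (real DIM('a) + 2 * s) / 2"
  shows "\<exists>c0>0. \<forall>c\<ge>0. \<forall>x::'a::euclidean_space. 2 \<le> norm x \<longrightarrow>
    mixed_op a b s (\<lambda>y. c * bump \<sigma> 1 y) x \<le> - (c0 * c * weight s x)"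
proof -
  define V :: "'a \<Rightarrow> real" where "V = bump \<sigma> 1"
  define k where "k = frac_laplacian_const DIM('a) s"
  have k: "k > 0" unfolding k_def by (rule frac_laplacian_const_pos[OF s])
  have \<sigma>: "\<sigma> > 0" using s by (simp add: \<sigma>_def add_nonneg_pos)
  obtain A F1 F2 where A: "A \<ge> 0" and F: "radial_bound \<sigma> A (profile \<sigma> 1) F1 F2"
    using radial_bound_profile[OF \<sigma>] by (metis order_refl)
  have F': "(profile \<sigma> 1 has_real_derivative F1 r) (at r)" if "r \<ge> 0" for r
    using F that unfolding radial_bound_def by auto
  have Ve: "V = (\<lambda>z. profile \<sigma> 1 ((norm z)\<^sup>2))" by (simp add: V_def bump_def fun_eq_iff)
  have cont: "continuous_on UNIV V" unfolding Ve by (rule continuous_on_radial[OF F'])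
  have [measurable]: "V \<in> borel_measurable borel"
    using cont by (rule borel_measurable_continuous_onI)
  have V0: "V z = 0" if "norm z \<ge> 1" for z
    unfolding V_def using that by (intro bump_eq_0) auto
  have Vn: "V z \<ge> 0" for z by (simp add: V_def bump_nonneg)
  have Vb: "V z \<le> A * indicator (cball 0 1) z" for z
  proof (cases "norm z < 1")
    case True
    have "V z \<le> A * weight s z" 
      using F unfolding radial_bound_def weight_def Ve \<sigma>_def by (simp add: abs_le_iff)
    also have "\<dots> \<le> A" using weight_le_1[OF s(1)] A by (rule mult_left_le)
    finally show ?thesis using True by simp
  qed (use V0 A in auto)
  have Vi: "integrable lborel V"
    by (rule Bochner_Integration.integrable_bound[of _ "\<lambda>z. A * indicator (cball 0 1) z"])
       (use Vb Vn A in \<open>auto simp: emeasure_cball intro!: integrable_mult_right integrable_real_indicator\<close>)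
  define J where "J = (LINT z|lborel. V z)"
  have J: "J > 0"
  proof -
    have "J \<noteq> 0"
    proof
      assume "J = 0"
      then have "AE z in lborel. V z = 0"
        using integral_nonneg_eq_0_iff_AE[OF Vi] Vn by (simp add: J_def)
      then have "{z. V z \<noteq> 0} \<in> null_sets lborel" by (simp add: AE_iff_null_sets)
      then have "negligible {z. V z \<noteq> 0}"
        by (simp add: negligible_iff_null_sets null_sets_completionI)
      moreover have "open {z. V z \<noteq> 0}" using cont by (intro open_Collect_neq continuous_on_const)
      ultimately have "V 0 = 0" using open_not_negligible by blast
      then show False by (simp add: V_def bump_def profile_def cutoff_0)
    qed
    moreover have "J \<ge> 0" unfolding J_def by (simp add: Vn)
    ultimately show ?thesis by simp
  qed
  \<comment> \<open>\<open>J\<close> is the mass of the bump. Of the two terms V(x + y) and V(x - y)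
    one is dropped, so the factor 1/2 of the symmetrisation remains.\<close>
  define c0 where "c0 = b * (k / 2 * (2 powr - \<sigma> * J))"
  have c0: "c0 > 0" using ab k J by (simp add: c0_def)
  have "mixed_op a b s (\<lambda>y. c * bump \<sigma> 1 y) x \<le> - (c0 * c * weight s x)"
    if c: "c \<ge> 0" and x: "2 \<le> norm x" for c and x :: 'a
  proof -
    have loc: "((\<lambda>y. g y) has_derivative (\<lambda>_. 0)) (at z)" if "norm z > 1" "\<And>y. norm y > 1 \<Longrightarrow> g y = 0" for z :: 'a and g :: "'a \<Rightarrow> real"
    proof (rule has_derivative_transform_within_open)
      show "((\<lambda>_. 0) has_derivative (\<lambda>_. 0)) (at z)" by simp
      show "open {y::'a. norm y > 1}" by (intro open_Collect_less continuous_intros)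
    qed (use that in auto)
    have p1: "partial_deriv i (\<lambda>y. c * V y) y = 0" if "norm y > 1" for y i
      by (rule partial_derivI[OF loc]) (use that V0 in auto)
    have p2: "partial_deriv i (partial_deriv i (\<lambda>y. c * V y)) x = 0" for i
      by (rule partial_derivI[OF loc]) (use x p1 in auto)
    have lap: "laplacian (\<lambda>y. c * V y) x = 0" by (simp add: laplacian_def p2)
    let ?q = "second_quotient s (\<lambda>y. c * V y) x"
    let ?N = "\<lambda>y::'a. norm y powr - (real DIM('a) + 2 * s)"
    have "integrable lborel (second_quotient s V x)"
      using second_quotient_radial[OF s, where 'a='a] A F unfolding \<sigma>_def[symmetric] Ve by blast
    moreover have qe: "?q = (\<lambda>y. c * second_quotient s V x y)"
      by (simp add: second_quotient_def algebra_simps fun_eq_iff)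
    ultimately have qi: "integrable lborel ?q" unfolding qe by simp
    have qle: "?q y \<le> - (c * V (x + y)) * (2 powr - \<sigma> * weight s x)" for y
    proof -
      have "V (x + y) * (2 powr - \<sigma> * weight s x) \<le> (V (x + y) + V (x - y)) * ?N y"
      proof (cases "norm (x + y) < 1")
        case True
        have y: "1 \<le> norm y" "norm y \<le> norm x + 1"
          using True x norm_triangle_ineq4[of "x + y" x] norm_triangle_ineq4[of "x + y" y] by auto
        have "(norm y)\<^sup>2 \<le> (norm x + 1)\<^sup>2" using y by (intro power_mono) auto
        also have "\<dots> \<le> 2 * (1 + (norm x)\<^sup>2)"
          using zero_le_power2[of "norm x - 1"] by (simp add: power2_eq_square algebra_simps)
        finally have "2 powr - \<sigma> * weight s x \<le> ?N y"
          unfolding norm_powr_eq weight_def \<sigma>_def[symmetric] using \<sigma> y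
          by (subst powr_mult[symmetric]) (auto intro!: powr_mono2')
        then have "V (x + y) * (2 powr - \<sigma> * weight s x) \<le> V (x + y) * ?N y"
          using Vn by (intro mult_left_mono) auto
        also have "\<dots> \<le> (V (x + y) + V (x - y)) * ?N y"
          using Vn by (intro mult_right_mono) auto
        finally show ?thesis .
      qed (use V0 Vn in auto)
      then have "c * (V (x + y) * (2 powr - \<sigma> * weight s x)) \<le> c * ((V (x + y) + V (x - y)) * ?N y)"
        using c by (rule mult_left_mono)
      moreover have "V x = 0" using x V0 by simp
      ultimately show ?thesis by (simp add: second_quotient_def algebra_simps)
    qed
    have Vxi: "integrable lborel (\<lambda>y. V (x + y))"
      using lborel_integrable_affine_iff[of 1 V x] Vi by simp
    have Vxe: "(LINT y|lborel. V (x + y)) = J"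
      using lborel_integral_affine[of 1 V x] by (simp add: J_def)
    have "(LINT y|lborel. ?q y) \<le> (LINT y|lborel. - (c * V (x + y)) * (2 powr - \<sigma> * weight s x))"
      using qi qle Vxi by (intro integral_mono) auto
    also have "\<dots> = - (c * J) * (2 powr - \<sigma> * weight s x)"
      by (simp add: Vxe)
    finally have I: "(LINT y|lborel. ?q y) \<le> - (c * J) * (2 powr - \<sigma> * weight s x)" .
    have "frac_laplacian s (\<lambda>y. c * V y) x = k * ((LINT y|lborel. ?q y) / 2)"
      unfolding k_def
    proof (rule frac_laplacian_eq[OF s _ _ qi])
      fix y
      have "V y \<le> A" using Vb[of y] A by (cases "norm y \<le> 1") auto
      then show "\<bar>c * V y\<bar> \<le> c * A" using c Vn[of y] by (simp add: abs_mult mult_left_mono)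
    qed measurable
    then have "mixed_op a b s (\<lambda>y. c * V y) x = b * (k / 2 * (LINT y|lborel. ?q y))"
      unfolding mixed_op_def lap by simp
    also have "\<dots> \<le> b * (k / 2 * (- (c * J) * (2 powr - \<sigma> * weight s x)))"
      using I ab k by (intro mult_left_mono) auto
    also have "\<dots> = - (c0 * c * weight s x)" by (simp add: c0_def)
    finally show ?thesis by (simp add: V_def)
  qed
  with c0 show ?thesis by blast
qed

section \<open>Positivity of the heat kernel\<close>

lemma lborel_integral_prod:
  fixes f :: "'a::euclidean_space \<Rightarrow> real \<Rightarrow> 'b::{real_normed_field,banach,second_countable_topology}"
  assumes f: "\<And>b. b \<in> Basis \<Longrightarrow> integrable lborel (f b)"
  shows "integrable lborel (\<lambda>x::'a. \<Prod>b\<in>Basis. f b (x \<bullet> b))"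
    and "(LINT x::'a|lborel. (\<Prod>b\<in>Basis. f b (x \<bullet> b))) = (\<Prod>b\<in>Basis. (LINT r|lborel. f b r))"
proof -
  interpret product_sigma_finite "\<lambda>_::'a. lborel :: real measure" by standard
  have [measurable]: "f b \<in> borel_measurable borel" if "b \<in> Basis" for b
    using borel_measurable_integrable[OF f[OF that]] by simp
  have [measurable]: "(\<lambda>x::'a. \<Prod>b\<in>Basis. f b (x \<bullet> b)) \<in> borel_measurable borel"
    by measurable
  have m[measurable]: "(\<lambda>y::'a \<Rightarrow> real. \<Sum>b\<in>Basis. y b *\<^sub>R b) \<in> measurable (\<Pi>\<^sub>M b\<in>Basis. lborel) borel"
    by measurable
  have e: "(\<Sum>b\<in>Basis. y b *\<^sub>R b) \<bullet> b' = y b'" if "b' \<in> Basis" for y :: "'a \<Rightarrow> real" and b'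
    using that by (simp add: inner_sum_left inner_Basis if_distrib sum.delta cong: if_cong)
  have "integrable (\<Pi>\<^sub>M b\<in>Basis. lborel) (\<lambda>y. \<Prod>b\<in>Basis. f b (y b))"
    by (rule product_integrable_prod) (use f in auto)
  then show "integrable lborel (\<lambda>x::'a. \<Prod>b\<in>Basis. f b (x \<bullet> b))"
    by (subst lborel_eq) (simp add: integrable_distr_eq e)
  show "(LINT x::'a|lborel. (\<Prod>b\<in>Basis. f b (x \<bullet> b))) = (\<Prod>b\<in>Basis. (LINT r|lborel. f b r))"
    by (subst lborel_eq) (simp add: integral_distr e product_integral_prod f)
qed

text \<open>Rescaling by sqrt (2 c) turns the integral into the characteristic function of the
  standard normal distribution at k / sqrt (2 c).\<close>

lemma gaussian_char:
  fixes c k :: real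
  assumes c: "c > 0"
  shows "integrable lborel (\<lambda>r. cis (k * r) * of_real (exp (- c * r\<^sup>2)))"
    and "(LINT r|lborel. cis (k * r) * of_real (exp (- c * r\<^sup>2)))
      = of_real (sqrt (pi / c) * exp (- k\<^sup>2 / (4 * c)))"
proof -
  define t where "t = k / sqrt (2 * c)"
  define g where "g r = cis (t * r) * of_real (std_normal_density r)" for r
  have gm[measurable]: "g \<in> borel_measurable borel"
    unfolding g_def[abs_def] cis_conv_exp by measurable
  have "char std_normal_distribution t = of_real (exp (- t\<^sup>2 / 2))"
    by (simp add: char_std_normal_distribution)
  moreover have "char std_normal_distribution t = (LINT r|lborel. g r)"
    unfolding char_def g_def
    by (subst integral_density) (auto simp: cis_conv_exp scaleR_conv_of_real mult_ac)
  ultimately have gI: "(LINT r|lborel. g r) = of_real (exp (- t\<^sup>2 / 2))" by simp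
  have gi: "integrable lborel g"
    by (rule Bochner_Integration.integrable_bound[OF integrable_normal_density[of 1 0]])
       (auto simp: g_def norm_mult)
  have sc: "sqrt (2 * c) \<noteq> 0" using c by simp
  have ge: "g (sqrt (2 * c) * r) = of_real (1 / sqrt (2 * pi)) * (cis (k * r) * of_real (exp (- c * r\<^sup>2)))" for r
    using c by (simp add: g_def t_def std_normal_density_def power_mult_distrib mult_ac)
  have "integrable lborel (\<lambda>r. of_real (1 / sqrt (2 * pi)) * (cis (k * r) * of_real (exp (- c * r\<^sup>2))) :: complex)"
    unfolding ge[symmetric] using lborel_integrable_affine_iff[OF sc gm, of 0] gi by simp
  from integrable_mult_right[OF this, of "of_real (sqrt (2 * pi))"]
  show "integrable lborel (\<lambda>r. cis (k * r) * of_real (exp (- c * r\<^sup>2)))"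
    by (simp flip: mult.assoc of_real_mult)
  have "(LINT r|lborel. g r) = sqrt (2 * c) *\<^sub>R (LINT r|lborel. g (sqrt (2 * c) * r))"
    using lborel_integral_affine[OF sc gm, of 0] c by simp
  also have "\<dots> = of_real (sqrt (2 * c) / sqrt (2 * pi)) * (LINT r|lborel. cis (k * r) * of_real (exp (- c * r\<^sup>2)))"
    unfolding ge by (simp add: scaleR_conv_of_real)
  finally have A: "of_real (sqrt (2 * c) / sqrt (2 * pi)) * (LINT r|lborel. cis (k * r) * of_real (exp (- c * r\<^sup>2))) = (of_real (exp (- t\<^sup>2 / 2)) :: complex)"
    using gI by simp
  have B: "of_real (sqrt (2 * c) / sqrt (2 * pi)) * (of_real (sqrt (pi / c) * exp (- k\<^sup>2 / (4 * c))) :: complex) = of_real (exp (- t\<^sup>2 / 2))"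
  proof -
    have "t\<^sup>2 = k\<^sup>2 / (2 * c)" using c by (simp add: t_def power_divide)
    moreover have "sqrt (2 * c) / sqrt (2 * pi) * sqrt (pi / c) = 1"
      using c by (simp flip: real_sqrt_divide real_sqrt_mult)
    ultimately have "sqrt (2 * c) / sqrt (2 * pi) * (sqrt (pi / c) * exp (- k\<^sup>2 / (4 * c))) = exp (- t\<^sup>2 / 2)"
      by (simp only: mult.assoc[symmetric]) simp
    then show ?thesis by (simp only: of_real_mult[symmetric])
  qed
  have C: "of_real (sqrt (2 * c) / sqrt (2 * pi)) \<noteq> (0::complex)" using c by simp
  show "(LINT r|lborel. cis (k * r) * of_real (exp (- c * r\<^sup>2)))
      = of_real (sqrt (pi / c) * exp (- k\<^sup>2 / (4 * c)))"
    by (rule mult_left_cancel[OF C, THEN iffD1, OF trans[OF A B[symmetric]]])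
qed

lemma norm_sq_Basis: "(norm (x::'a::euclidean_space))\<^sup>2 = (\<Sum>b\<in>Basis. (x \<bullet> b)\<^sup>2)"
  unfolding power2_norm_eq_inner by (subst euclidean_inner) (simp add: power2_eq_square)

lemma cis_sum: "finite I \<Longrightarrow> cis (\<Sum>i\<in>I. f i) = (\<Prod>i\<in>I. cis (f i))"
  by (induction I rule: finite_induct) (auto simp: cis_mult[symmetric])

text \<open>Complex exponentials factorise over the coordinates and cosines do not, so the product
  formula is applied to \<open>cis\<close> and the real part is taken afterwards.\<close>

lemma gaussian_cos:
  fixes x :: "'a::euclidean_space"
  assumes c: "c > 0"
  shows integrable_gaussian: "integrable lborel (\<lambda>\<xi>::'a. exp (- c * (norm \<xi>)\<^sup>2))"
    and "(LINT \<xi>|lborel. cos (x \<bullet> \<xi>) * exp (- c * (norm \<xi>)\<^sup>2))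
      = (pi / c) powr (real DIM('a) / 2) * exp (- (norm x)\<^sup>2 / (4 * c))"
proof -
  have P: "(\<Prod>b\<in>Basis. cis (y \<bullet> b * (\<xi> \<bullet> b)) * of_real (exp (- c * (\<xi> \<bullet> b)\<^sup>2)))
      = cis (y \<bullet> \<xi>) * of_real (exp (- c * (norm \<xi>)\<^sup>2))" for y \<xi> :: 'a
  proof -
    have "cis (y \<bullet> \<xi>) = (\<Prod>b\<in>Basis. cis (y \<bullet> b * (\<xi> \<bullet> b)))"
      by (subst euclidean_inner) (rule cis_sum, simp)
    moreover have "exp (- c * (norm \<xi>)\<^sup>2) = (\<Prod>b\<in>Basis. exp (- c * (\<xi> \<bullet> b)\<^sup>2))"
      unfolding norm_sq_Basis by (simp add: exp_sum sum_distrib_left sum_negf[symmetric] del: sum_negf)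
    ultimately show ?thesis by (simp add: prod.distrib)
  qed
  note lp = lborel_integral_prod[where 'a='a and f="\<lambda>b r. cis (y \<bullet> b * r) * of_real (exp (- c * r\<^sup>2))" for y,
      OF gaussian_char(1)[OF c], unfolded P]
  have i0: "integrable lborel (\<lambda>\<xi>::'a. cis (0 \<bullet> \<xi>) * of_real (exp (- c * (norm \<xi>)\<^sup>2)) :: complex)"
    by (rule lp)
  from integrable_norm[OF i0]
  show "integrable lborel (\<lambda>\<xi>::'a. exp (- c * (norm \<xi>)\<^sup>2))" by (simp add: norm_mult)
  have i: "integrable lborel (\<lambda>\<xi>::'a. cis (x \<bullet> \<xi>) * of_real (exp (- c * (norm \<xi>)\<^sup>2)) :: complex)"
    by (rule lp)
  have "(LINT \<xi>|lborel. cos (x \<bullet> \<xi>) * exp (- c * (norm \<xi>)\<^sup>2)) = 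
      Re (LINT \<xi>|lborel. cis (x \<bullet> \<xi>) * of_real (exp (- c * (norm \<xi>)\<^sup>2)))"
    by (subst integral_Re[OF i, symmetric]) simp
  also have "(LINT \<xi>|lborel. cis (x \<bullet> \<xi>) * of_real (exp (- c * (norm \<xi>)\<^sup>2)) :: complex)
     = (\<Prod>b\<in>Basis. of_real (sqrt (pi / c) * exp (- (x \<bullet> b)\<^sup>2 / (4 * c))))"
    unfolding lp(2) gaussian_char(2)[OF c] ..
  also have "\<dots> = of_real (\<Prod>b\<in>Basis. sqrt (pi / c) * exp (- (x \<bullet> b)\<^sup>2 / (4 * c)))"
    by (simp only: of_real_prod)
  also have "(\<Prod>b\<in>Basis. sqrt (pi / c) * exp (- (x \<bullet> b)\<^sup>2 / (4 * c)))
      = sqrt (pi / c) ^ DIM('a) * exp (\<Sum>b\<in>Basis. - (x \<bullet> b)\<^sup>2 / (4 * c))"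
    by (simp add: prod.distrib exp_sum)
  also have "(\<Sum>b\<in>Basis. - (x \<bullet> b)\<^sup>2 / (4 * c)) = - (norm x)\<^sup>2 / (4 * c)"
    unfolding norm_sq_Basis by (simp add: sum_negf sum_divide_distrib)
  also have "sqrt (pi / c) ^ DIM('a) = (pi / c) powr (real DIM('a) / 2)"
    using c by (simp add: powr_half_sqrt[symmetric] powr_realpow[symmetric] powr_powr)
  finally show "(LINT \<xi>|lborel. cos (x \<bullet> \<xi>) * exp (- c * (norm \<xi>)\<^sup>2))
      = (pi / c) powr (real DIM('a) / 2) * exp (- (norm x)\<^sup>2 / (4 * c))" by simp
qed

lemma integrable_lborel_prod_mult:
  fixes f :: "'a::euclidean_space \<Rightarrow> real" and g :: "'b::euclidean_space \<Rightarrow> real"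
  assumes f: "integrable lborel f" and g: "integrable lborel g"
  shows "integrable (lborel \<Otimes>\<^sub>M lborel) (\<lambda>(x, y). f x * g y)"
proof (rule lborel_pair.Fubini_integrable)
  show "(\<lambda>(x, y). f x * g y) \<in> borel_measurable (lborel \<Otimes>\<^sub>M lborel)"
    using f g by measurable
  show "integrable lborel (\<lambda>x. LINT y|lborel. norm (case (x, y) of (x, y) \<Rightarrow> f x * g y))"
    using f by (simp add: abs_mult integrable_abs)
  show "AE x in lborel. integrable lborel (\<lambda>y. case (x, y) of (x, y) \<Rightarrow> f x * g y)"
    using g by simp
qed

text \<open>The functions of \<open>\<lambda> = \<bar>\<xi>\<bar>\<^sup>2\<close> whose product with every Gaussian has a nonnegative Fourier
  transform. By Bernstein's theorem these include \<open>exp (- t \<lambda>\<^sup>s)\<close>; that case is obtained below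
  from compound Poisson approximations of the \<open>s\<close>-stable subordinator.\<close>

definition pos_multiplier :: "'a::euclidean_space itself \<Rightarrow> (real \<Rightarrow> real) \<Rightarrow> bool" where
  "pos_multiplier _ m \<longleftrightarrow> m \<in> borel_measurable borel \<and> (\<exists>B. \<forall>l\<ge>0. \<bar>m l\<bar> \<le> B) \<and>
     (\<forall>t>0. \<forall>x::'a. 0 \<le> (LINT \<xi>|lborel. cos (x \<bullet> \<xi>) * exp (- t * (norm \<xi>)\<^sup>2) * m ((norm \<xi>)\<^sup>2)))"

section \<open>Closure properties of positive multipliers\<close>

lemma integrable_cos_gaussian:
  fixes x :: "'a::euclidean_space"
  assumes "t > 0" and [measurable]: "m \<in> borel_measurable borel" and B: "\<And>l. l \<ge> 0 \<Longrightarrow> \<bar>m l\<bar> \<le> B"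
  shows "integrable lborel (\<lambda>\<xi>. cos (x \<bullet> \<xi>) * exp (- t * (norm \<xi>)\<^sup>2) * m ((norm \<xi>)\<^sup>2))"
proof (rule Bochner_Integration.integrable_bound)
  show "integrable lborel (\<lambda>\<xi>::'a. B * exp (- t * (norm \<xi>)\<^sup>2))"
    by (intro integrable_mult_right integrable_gaussian assms)
  have "norm (cos (x \<bullet> \<xi>) * exp (- t * (norm \<xi>)\<^sup>2) * m ((norm \<xi>)\<^sup>2)) \<le> 1 * exp (- t * (norm \<xi>)\<^sup>2) * B" for \<xi>
    unfolding norm_mult by (intro mult_mono) (auto simp: B)
  moreover have "B \<ge> 0" using B[of 0] by simp
  ultimately show "AE \<xi> in lborel. norm (cos (x \<bullet> \<xi>) * exp (- t * (norm \<xi>)\<^sup>2) * m ((norm \<xi>)\<^sup>2)) \<le> norm (B * exp (- t * (norm \<xi>)\<^sup>2))"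
    by (simp add: mult_ac)
qed measurable

lemma pos_multiplier_1: "pos_multiplier TYPE('a::euclidean_space) (\<lambda>_. 1)"
proof -
  have "0 \<le> (LINT \<xi>|lborel. cos (x \<bullet> \<xi>) * exp (- t * (norm \<xi>)\<^sup>2) * 1)" if "t > 0" for t and x :: 'a
    unfolding mult_1_right gaussian_cos(2)[OF that] by simp
  then show ?thesis unfolding pos_multiplier_def by auto
qed

lemma pos_multiplier_add:
  assumes "pos_multiplier TYPE('a::euclidean_space) m" "pos_multiplier TYPE('a) m'"
  shows "pos_multiplier TYPE('a) (\<lambda>l. m l + m' l)"
proof -
  obtain B B' where B: "\<And>l. l \<ge> 0 \<Longrightarrow> \<bar>m l\<bar> \<le> B" "\<And>l. l \<ge> 0 \<Longrightarrow> \<bar>m' l\<bar> \<le> B'"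
    and [measurable]: "m \<in> borel_measurable borel" "m' \<in> borel_measurable borel"
    using assms unfolding pos_multiplier_def by auto
  have "\<bar>m l + m' l\<bar> \<le> B + B'" if "l \<ge> 0" for l using B[OF that] by linarith
  moreover have "0 \<le> (LINT \<xi>|lborel. cos (x \<bullet> \<xi>) * exp (- t * (norm \<xi>)\<^sup>2) * (m ((norm \<xi>)\<^sup>2) + m' ((norm \<xi>)\<^sup>2)))"
    if "t > 0" for t and x :: 'a
  proof -
    have "(LINT \<xi>|lborel. cos (x \<bullet> \<xi>) * exp (- t * (norm \<xi>)\<^sup>2) * (m ((norm \<xi>)\<^sup>2) + m' ((norm \<xi>)\<^sup>2))) =
      (LINT \<xi>|lborel. cos (x \<bullet> \<xi>) * exp (- t * (norm \<xi>)\<^sup>2) * m ((norm \<xi>)\<^sup>2)) +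
      (LINT \<xi>|lborel. cos (x \<bullet> \<xi>) * exp (- t * (norm \<xi>)\<^sup>2) * m' ((norm \<xi>)\<^sup>2))"
    proof -
      have "integrable lborel (\<lambda>\<xi>. cos (x \<bullet> \<xi>) * exp (- t * (norm \<xi>)\<^sup>2) * m ((norm \<xi>)\<^sup>2))"
        by (rule integrable_cos_gaussian[OF that _ B(1)]) auto
      moreover have "integrable lborel (\<lambda>\<xi>. cos (x \<bullet> \<xi>) * exp (- t * (norm \<xi>)\<^sup>2) * m' ((norm \<xi>)\<^sup>2))"
        by (rule integrable_cos_gaussian[OF that _ B(2)]) auto
      ultimately show ?thesis by (simp add: distrib_left)
    qed
    then show ?thesis using assms that unfolding pos_multiplier_def by simp
  qed
  ultimately show ?thesis unfolding pos_multiplier_def by auto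
qed

lemma pos_multiplier_cmult:
  assumes "pos_multiplier TYPE('a::euclidean_space) m" "c \<ge> 0"
  shows "pos_multiplier TYPE('a) (\<lambda>l. c * m l)"
proof -
  obtain B where B: "\<And>l. l \<ge> 0 \<Longrightarrow> \<bar>m l\<bar> \<le> B" and [measurable]: "m \<in> borel_measurable borel"
    using assms unfolding pos_multiplier_def by auto
  have "\<bar>c * m l\<bar> \<le> c * B" if "l \<ge> 0" for l using B[OF that] assms by (simp add: abs_mult mult_left_mono)
  moreover have "(LINT \<xi>|lborel. cos (x \<bullet> \<xi>) * exp (- t * (norm \<xi>)\<^sup>2) * (c * m ((norm \<xi>)\<^sup>2)))
     = c * (LINT \<xi>|lborel. cos (x \<bullet> \<xi>) * exp (- t * (norm \<xi>)\<^sup>2) * m ((norm \<xi>)\<^sup>2))" for t and x :: 'a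
    by (subst integral_mult_right_zero[symmetric]) (simp add: mult_ac)
  ultimately show ?thesis using assms unfolding pos_multiplier_def by auto
qed

text \<open>The Gaussian factor is the dominating function, so pointwise convergence with a common
  bound is enough.\<close>

lemma pos_multiplier_limit:
  assumes m: "\<And>n. pos_multiplier TYPE('a::euclidean_space) (m n)"
    and B: "\<And>n l. l \<ge> 0 \<Longrightarrow> \<bar>m n l\<bar> \<le> B"
    and lim: "\<And>l. l \<ge> 0 \<Longrightarrow> (\<lambda>n. m n l) \<longlonglongrightarrow> m' l"
    and [measurable]: "m' \<in> borel_measurable borel"
  shows "pos_multiplier TYPE('a) m'"
proof -
  have [measurable]: "m n \<in> borel_measurable borel" for n
    using m unfolding pos_multiplier_def by auto
  have B': "\<bar>m' l\<bar> \<le> B" if "l \<ge> 0" for l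
    by (rule tendsto_upperbound[OF tendsto_rabs[OF lim[OF that]]]) (auto simp: B that)
  have "0 \<le> (LINT \<xi>|lborel. cos (x \<bullet> \<xi>) * exp (- t * (norm \<xi>)\<^sup>2) * m' ((norm \<xi>)\<^sup>2))"
    if t: "t > 0" for t and x :: 'a
  proof -
    have "(\<lambda>n. LINT \<xi>|lborel. cos (x \<bullet> \<xi>) * exp (- t * (norm \<xi>)\<^sup>2) * m n ((norm \<xi>)\<^sup>2))
       \<longlonglongrightarrow> (LINT \<xi>|lborel. cos (x \<bullet> \<xi>) * exp (- t * (norm \<xi>)\<^sup>2) * m' ((norm \<xi>)\<^sup>2))"
    proof (rule integral_dominated_convergence[where w="\<lambda>\<xi>. B * exp (- t * (norm \<xi>)\<^sup>2)"])
      show "integrable lborel (\<lambda>\<xi>::'a. B * exp (- t * (norm \<xi>)\<^sup>2))"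
        by (intro integrable_mult_right integrable_gaussian t)
      have "norm (cos (x \<bullet> \<xi>) * exp (- t * (norm \<xi>)\<^sup>2) * m n ((norm \<xi>)\<^sup>2)) \<le> 1 * exp (- t * (norm \<xi>)\<^sup>2) * B" for \<xi> n
        unfolding norm_mult by (intro mult_mono) (auto simp: B)
      then show "AE \<xi> in lborel. norm (cos (x \<bullet> \<xi>) * exp (- t * (norm \<xi>)\<^sup>2) * m n ((norm \<xi>)\<^sup>2)) \<le> B * exp (- t * (norm \<xi>)\<^sup>2)" for n
        by (simp add: mult_ac)
    qed (auto intro!: tendsto_mult lim)
    then show ?thesis
      by (rule tendsto_lowerbound) (use m t in \<open>auto simp: pos_multiplier_def\<close>)
  qed
  with B' show ?thesis unfolding pos_multiplier_def by auto
qed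

text \<open>Multiplication by exp (- \<tau> l) only lengthens the Gaussian time from t to t +
  \<tau>. Quantifying over all Gaussians in \<open>pos_multiplier\<close> makes the class stable
  under this, and Fubini adds up the contributions of the times \<tau>.\<close>

lemma pos_multiplier_laplace:
  assumes m: "pos_multiplier TYPE('a::euclidean_space) m"
    and k: "integrable lborel k" "\<And>\<tau>. k \<tau> \<ge> 0" "\<And>\<tau>. \<tau> < 0 \<Longrightarrow> k \<tau> = 0"
  shows "pos_multiplier TYPE('a) (\<lambda>l. m l * (LINT \<tau>|lborel. exp (- \<tau> * l) * k \<tau>))"
proof -
  obtain B where B: "\<And>l. l \<ge> 0 \<Longrightarrow> \<bar>m l\<bar> \<le> B" and [measurable]: "m \<in> borel_measurable borel"
    using m unfolding pos_multiplier_def by auto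
  have [measurable]: "k \<in> borel_measurable borel" using k(1) by simp
  have B0: "B \<ge> 0" using B[of 0] by simp
  have le: "exp (- \<tau> * l) * k \<tau> \<le> k \<tau>" if "l \<ge> 0" for l \<tau>
    using k(2)[of \<tau>] k(3)[of \<tau>] that by (cases "\<tau> < 0") (auto intro!: mult_left_le_one_le simp: mult_nonneg_nonneg)
  have gi: "integrable lborel (\<lambda>\<tau>. exp (- \<tau> * l) * k \<tau>)" if "l \<ge> 0" for l
    by (rule Bochner_Integration.integrable_bound[OF k(1)]) (use le[OF that] k(2) in \<open>auto simp: abs_mult\<close>)
  have gb: "\<bar>LINT \<tau>|lborel. exp (- \<tau> * l) * k \<tau>\<bar> \<le> (LINT \<tau>|lborel. k \<tau>)" if "l \<ge> 0" for l
  proof -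
    have "0 \<le> (LINT \<tau>|lborel. exp (- \<tau> * l) * k \<tau>)" using k(2) by simp
    moreover have "(LINT \<tau>|lborel. exp (- \<tau> * l) * k \<tau>) \<le> (LINT \<tau>|lborel. k \<tau>)"
      using gi[OF that] k(1) le[OF that] by (rule integral_mono)
    ultimately show ?thesis by simp
  qed
  have "\<bar>m l * (LINT \<tau>|lborel. exp (- \<tau> * l) * k \<tau>)\<bar> \<le> B * (LINT \<tau>|lborel. k \<tau>)" if "l \<ge> 0" for l
    unfolding abs_mult using B[OF that] gb[OF that] B0 by (intro mult_mono) auto
  moreover have "0 \<le> (LINT \<xi>|lborel. cos (x \<bullet> \<xi>) * exp (- t * (norm \<xi>)\<^sup>2) *
      (m ((norm \<xi>)\<^sup>2) * (LINT \<tau>|lborel. exp (- \<tau> * (norm \<xi>)\<^sup>2) * k \<tau>)))" if t: "t > 0" for t and x :: 'a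
  proof -
    define F where "F \<xi> \<tau> = cos (x \<bullet> \<xi>) * exp (- t * (norm \<xi>)\<^sup>2) * m ((norm \<xi>)\<^sup>2) * (exp (- \<tau> * (norm \<xi>)\<^sup>2) * k \<tau>)" for \<xi> \<tau>
    have Fm[measurable]: "(\<lambda>(\<xi>, \<tau>). F \<xi> \<tau>) \<in> borel_measurable (lborel \<Otimes>\<^sub>M lborel)"
      unfolding F_def by measurable
    have Fi: "integrable (lborel \<Otimes>\<^sub>M lborel) (\<lambda>(\<xi>, \<tau>). F \<xi> \<tau>)"
    proof (rule Bochner_Integration.integrable_bound)
      show "integrable (lborel \<Otimes>\<^sub>M lborel) (\<lambda>(\<xi>::'a, \<tau>). (B * exp (- t * (norm \<xi>)\<^sup>2)) * k \<tau>)"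
        by (intro integrable_lborel_prod_mult k integrable_mult_right integrable_gaussian t)
      have "\<bar>F \<xi> \<tau>\<bar> \<le> 1 * exp (- t * (norm \<xi>)\<^sup>2) * B * k \<tau>" for \<xi> \<tau>
        unfolding F_def abs_mult using B le[of "(norm \<xi>)\<^sup>2" \<tau>] k(2)[of \<tau>] B0
        by (intro mult_mono) (auto simp: abs_mult)
      then show "AE z in lborel \<Otimes>\<^sub>M lborel. norm (case z of (\<xi>, \<tau>) \<Rightarrow> F \<xi> \<tau>) \<le> norm (case z of (\<xi>::'a, \<tau>) \<Rightarrow> (B * exp (- t * (norm \<xi>)\<^sup>2)) * k \<tau>)"
        using k(2) B0 by (intro AE_I2) (auto simp: abs_mult mult_ac)
    qed measurable
    have e: "(LINT \<xi>|lborel. cos (x \<bullet> \<xi>) * exp (- t * (norm \<xi>)\<^sup>2) *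
      (m ((norm \<xi>)\<^sup>2) * (LINT \<tau>|lborel. exp (- \<tau> * (norm \<xi>)\<^sup>2) * k \<tau>))) = (LINT \<tau>|lborel. (LINT \<xi>|lborel. F \<xi> \<tau>))"
    proof -
      have "(LINT \<xi>|lborel. cos (x \<bullet> \<xi>) * exp (- t * (norm \<xi>)\<^sup>2) *
        (m ((norm \<xi>)\<^sup>2) * (LINT \<tau>|lborel. exp (- \<tau> * (norm \<xi>)\<^sup>2) * k \<tau>))) = (LINT \<xi>|lborel. (LINT \<tau>|lborel. F \<xi> \<tau>))"
        unfolding F_def by (simp add: mult.assoc)
      also have "\<dots> = (LINT \<tau>|lborel. (LINT \<xi>|lborel. F \<xi> \<tau>))"
        using lborel_pair.Fubini_integral[OF Fi] by simp
      finally show ?thesis .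
    qed
    show ?thesis unfolding e
    proof (rule Bochner_Integration.integral_nonneg)
      fix \<tau> :: real
      show "0 \<le> (LINT \<xi>|lborel. F \<xi> \<tau>)"
      proof (cases "\<tau> < 0")
        case False
        have "F \<xi> \<tau> = k \<tau> * (cos (x \<bullet> \<xi>) * exp (- (t + \<tau>) * (norm \<xi>)\<^sup>2) * m ((norm \<xi>)\<^sup>2))" for \<xi>
        proof -
          have "exp (- (t + \<tau>) * (norm \<xi>)\<^sup>2) = exp (- t * (norm \<xi>)\<^sup>2) * exp (- \<tau> * (norm \<xi>)\<^sup>2)"
            by (simp add: algebra_simps flip: exp_add)
          then show ?thesis by (simp only: F_def mult_ac)
        qed
        then have e: "(LINT \<xi>|lborel. F \<xi> \<tau>) = k \<tau> * (LINT \<xi>|lborel. cos (x \<bullet> \<xi>) * exp (- (t + \<tau>) * (norm \<xi>)\<^sup>2) * m ((norm \<xi>)\<^sup>2))"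
          by simp
        show ?thesis
        proof -
          have "t + \<tau> > 0" using False t by simp
          then have "0 \<le> (LINT \<xi>|lborel. cos (x \<bullet> \<xi>) * exp (- (t + \<tau>) * (norm \<xi>)\<^sup>2) * m ((norm \<xi>)\<^sup>2))"
            using m unfolding pos_multiplier_def by blast
          then show ?thesis unfolding e using k(2) by (intro mult_nonneg_nonneg)
        qed
      qed (simp add: F_def k(3))
    qed
  qed
  moreover have "(\<lambda>l. m l * (LINT \<tau>|lborel. exp (- \<tau> * l) * k \<tau>)) \<in> borel_measurable borel" by measurable
  ultimately show ?thesis unfolding pos_multiplier_def by blast
qed

text \<open>This is the Laplace transform of a compound Poisson law with jump density k. In the
  expansion of the exponential each power is a multiplier by repeated use of
  \<open>pos_multiplier_laplace\<close>; the factor exp (- I) keeps the partial sums below 1, so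
  their limit stays in the class.\<close>

lemma pos_multiplier_exp_laplace:
  assumes k: "integrable lborel k" "\<And>\<tau>. k \<tau> \<ge> 0" "\<And>\<tau>. \<tau> < 0 \<Longrightarrow> k \<tau> = 0"
  shows "pos_multiplier TYPE('a::euclidean_space)
    (\<lambda>l. exp ((LINT \<tau>|lborel. exp (- \<tau> * l) * k \<tau>) - (LINT \<tau>|lborel. k \<tau>)))"
proof -
  define g where "g l = (LINT \<tau>|lborel. exp (- \<tau> * l) * k \<tau>)" for l
  define I where "I = (LINT \<tau>|lborel. k \<tau>)"
  have [measurable]: "k \<in> borel_measurable borel" using k(1) by simp
  have gm[measurable]: "g \<in> borel_measurable borel" unfolding g_def[abs_def] by measurable
  have le: "exp (- \<tau> * l) * k \<tau> \<le> k \<tau>" if "l \<ge> 0" for l \<tau>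
    using k(2)[of \<tau>] k(3)[of \<tau>] that by (cases "\<tau> < 0") (auto intro!: mult_left_le_one_le simp: mult_nonneg_nonneg)
  have gi: "integrable lborel (\<lambda>\<tau>. exp (- \<tau> * l) * k \<tau>)" if "l \<ge> 0" for l
    by (rule Bochner_Integration.integrable_bound[OF k(1)]) (use le[OF that] k(2) in \<open>auto simp: abs_mult\<close>)
  have g0: "0 \<le> g l" for l using k(2) by (simp add: g_def)
  have gI: "g l \<le> I" if "l \<ge> 0" for l
    unfolding g_def I_def using gi[OF that] k(1) le[OF that] by (rule integral_mono)
  have power: "pos_multiplier TYPE('a) (\<lambda>l. g l ^ n)" for n
  proof (induction n)
    case (Suc n)
    from pos_multiplier_laplace[OF this k] show ?case by (simp add: g_def mult.commute)
  qed (simp add: pos_multiplier_1)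
  have sum: "pos_multiplier TYPE('a) (\<lambda>l. \<Sum>i<n. exp (- I) * (g l ^ i /\<^sub>R fact i))" for n
  proof (induction n)
    case 0
    show ?case using pos_multiplier_cmult[OF pos_multiplier_1, of 0] by simp
  next
    case (Suc n)
    have "pos_multiplier TYPE('a) (\<lambda>l. (exp (- I) * inverse (fact n)) * g l ^ n)"
      by (intro pos_multiplier_cmult power) simp
    from pos_multiplier_add[OF Suc this] show ?case by (simp add: mult_ac)
  qed
  have "pos_multiplier TYPE('a) (\<lambda>l. exp (g l - I))"
  proof (rule pos_multiplier_limit[OF sum])
    fix l :: real assume l: "l \<ge> 0"
    have "(\<lambda>n. g l ^ n /\<^sub>R fact n) sums exp (g l)" by (rule exp_converges)
    then have S: "(\<lambda>n. exp (- I) * (g l ^ n /\<^sub>R fact n)) sums (exp (- I) * exp (g l))" by (rule sums_mult)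
    then show "(\<lambda>n. \<Sum>i<n. exp (- I) * (g l ^ i /\<^sub>R fact i)) \<longlonglongrightarrow> exp (g l - I)"
      by (simp add: sums_def exp_diff exp_minus divide_inverse mult.commute)
    fix n
    have nn: "0 \<le> exp (- I) * (g l ^ i /\<^sub>R fact i)" for i using g0[of l] by simp
    have "(\<Sum>i<n. exp (- I) * (g l ^ i /\<^sub>R fact i)) \<le> exp (- I) * exp (g l)"
      using sum_le_suminf[OF sums_summable[OF S], of "{..<n}"] nn S by (simp add: sums_iff)
    also have "\<dots> \<le> exp (- I) * exp I" using gI[OF l] by simp
    also have "\<dots> = 1" by (simp flip: exp_add)
    finally show "\<bar>\<Sum>i<n. exp (- I) * (g l ^ i /\<^sub>R fact i)\<bar> \<le> 1"
      using sum_nonneg[of "{..<n}" "\<lambda>i. exp (- I) * (g l ^ i /\<^sub>R fact i)"] nn by simp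
  qed measurable
  then show ?thesis by (simp add: g_def I_def)
qed

text \<open>l^s is a constant times the integral of (1 - exp (- \<tau> l)) \<tau>^(-1-s) over \<tau>
  > 0. The jump density is not integrable at 0, so jumps below 1/(n + 1) are removed, which leaves
  compound Poisson laws, and n is sent to infinity.\<close>

lemma pos_multiplier_stable:
  assumes s: "0 < s" "s < 1" and t: "t > 0"
  shows "pos_multiplier TYPE('a::euclidean_space) (\<lambda>l. exp (- t * l powr s))"
proof -
  \<comment> \<open>An integrable majorant: near 0 one power of \<tau> is gained from 1 - exp (-
    \<tau> l) \<le> \<tau> l, and at infinity this difference is at most 1.\<close>
  define h where "h \<tau> = (if \<tau> \<le> 0 then 0 else if \<tau> \<le> 1 then \<tau> powr - s else \<tau> powr (-1 - s))" for \<tau> :: real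
  have [measurable]: "h \<in> borel_measurable borel" unfolding h_def[abs_def] by measurable
  have h0: "h \<tau> \<ge> 0" for \<tau> by (simp add: h_def)
  have hi: "integrable lborel h"
    using nn_integral_powr_two_sided[of "- s" "-1 - s"] s h0
    by (intro integrableI_nonneg) (auto simp: h_def[abs_def])
  define G where "G l \<tau> = (if \<tau> \<le> 0 then 0 else (1 - exp (- \<tau> * l)) * \<tau> powr (-1 - s))" for l \<tau> :: real
  have [measurable]: "G l \<in> borel_measurable borel" for l unfolding G_def[abs_def] by measurable
  have G0: "0 \<le> G l \<tau>" if "l \<ge> 0" for l \<tau>
    using that by (auto simp: G_def intro!: mult_nonneg_nonneg)
  have Gh: "G l \<tau> \<le> max 1 l * h \<tau>" if l: "l \<ge> 0" for l \<tau>
  proof (cases "\<tau> \<le> 0")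
    case False
    show ?thesis
    proof (cases "\<tau> \<le> 1")
      case True
      have "1 - exp (- \<tau> * l) \<le> \<tau> * l" using exp_ge_add_one_self[of "- \<tau> * l"] by simp
      then have "G l \<tau> \<le> \<tau> * l * \<tau> powr (-1 - s)" using False by (simp add: G_def mult_right_mono)
      also have "\<dots> = l * \<tau> powr - s" using False powr_add[of \<tau> 1 "-1 - s"] by simp
      also have "\<dots> \<le> max 1 l * h \<tau>" using False True by (simp add: h_def mult_right_mono)
      finally show ?thesis .
    next
      case False
      have "G l \<tau> \<le> 1 * \<tau> powr (-1 - s)"
        using False by (auto simp: G_def intro!: mult_right_mono)
      also have "\<dots> \<le> max 1 l * h \<tau>" using False by (simp add: h_def mult_right_mono)
      finally show ?thesis .
    qed
  qed (simp add: G_def h_def)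
  have Gi: "integrable lborel (G l)" if "l \<ge> 0" for l
    by (rule Bochner_Integration.integrable_bound[OF integrable_mult_right[OF hi, of "max 1 l"]])
       (use G0[OF that] Gh[OF that] h0 in \<open>auto simp: abs_mult\<close>)
  \<comment> \<open>Scaling \<tau> gives the dependence on l; \<open>c\<close> enters only through
    its positivity, as the normalisation of the jump density \<open>k\<close>.\<close>
  define c where "c = (LINT \<tau>|lborel. G 1 \<tau>)"
  have c: "c > 0"
  proof -
    have "c \<noteq> 0"
    proof
      assume "c = 0"
      then have "AE \<tau> in lborel. G 1 \<tau> = 0"
        using integral_nonneg_eq_0_iff_AE[OF Gi[of 1]] G0[of 1] by (simp add: c_def)
      then have "AE \<tau> in lborel. \<tau> \<notin> {0<..<1::real}"
        by eventually_elim (auto simp: G_def)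
      then have "{0<..<1::real} \<in> null_sets lborel" by (subst (asm) AE_iff_null_sets[symmetric]) auto
      then have "emeasure lborel {0<..<1::real} = 0" by blast
      then show False by simp
    qed
    then show ?thesis using G0[of 1] by (simp add: c_def less_le)
  qed
  have GI: "(LINT \<tau>|lborel. G l \<tau>) = c * l powr s" if l: "l \<ge> 0" for l
  proof (cases "l = 0")
    case False
    then have l: "l > 0" using l by simp
    have "G 1 (l * \<tau>) = l powr (-1 - s) * G l \<tau>" for \<tau>
      using l by (auto simp: G_def powr_mult mult_le_0_iff zero_less_mult_iff mult_ac)
    then have "c = \<bar>l\<bar> * (l powr (-1 - s) * (LINT \<tau>|lborel. G l \<tau>))"
      unfolding c_def using lborel_integral_affine[of l "G 1" 0] l by simp
    also have "\<dots> = l powr - s * (LINT \<tau>|lborel. G l \<tau>)"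
      using l powr_add[of l 1 "-1 - s"] by simp
    finally show ?thesis using l by (simp add: powr_minus field_simps)
  next
    case True
    have "G 0 = (\<lambda>_. 0)" by (simp add: G_def fun_eq_iff)
    then show ?thesis using True by simp
  qed
  define k where "k n \<tau> = (if \<tau> < 1 / real (Suc n) then 0 else t / c * \<tau> powr (-1 - s))" for n and \<tau> :: real
  have km[measurable]: "k n \<in> borel_measurable borel" for n unfolding k_def[abs_def] by measurable
  have k0: "k n \<tau> \<ge> 0" for n \<tau> using t c by (simp add: k_def)
  have kn: "k n \<tau> = 0" if "\<tau> < 0" for n \<tau> using that
    by (simp add: k_def) (meson le_less_trans linorder_not_le of_nat_0_le_iff zero_le_divide_1_iff add_nonneg_nonneg zero_le_one order_less_le_trans)
  have kh: "k n \<tau> \<le> t / c * real (Suc n) * h \<tau>" for n \<tau>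
  proof (cases "\<tau> < 1 / real (Suc n)")
    case False
    have "1 / real (Suc n) > 0" by simp
    then have "\<tau> > 0" using False by linarith
    moreover have "1 \<le> real (Suc n) * \<tau>"
      using False by (simp add: not_less pos_divide_le_eq mult.commute)
    ultimately have \<tau>: "\<tau> > 0" "1 \<le> real (Suc n) * \<tau>" by blast+
    have "\<tau> powr (-1 - s) \<le> real (Suc n) * h \<tau>"
    proof (cases "\<tau> \<le> 1")
      case True
      have "1 * \<tau> powr (-1 - s) \<le> (real (Suc n) * \<tau>) * \<tau> powr (-1 - s)"
        using \<tau> by (intro mult_right_mono) auto
      also have "\<dots> = real (Suc n) * \<tau> powr - s" using \<tau> powr_add[of \<tau> 1 "-1 - s"] by simp
      finally show ?thesis using \<tau> True by (simp add: h_def)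
    next
      case False
      have "1 * \<tau> powr (-1 - s) \<le> real (Suc n) * \<tau> powr (-1 - s)"
        by (intro mult_right_mono) auto
      then show ?thesis using False by (simp add: h_def)
    qed
    then have "t / c * \<tau> powr (-1 - s) \<le> t / c * (real (Suc n) * h \<tau>)"
      using t c by (intro mult_left_mono) auto
    then show ?thesis using False by (simp add: k_def mult_ac)
  qed (use t c h0 in \<open>simp add: k_def\<close>)
  have ki: "integrable lborel (k n)" for n
    by (rule Bochner_Integration.integrable_bound[OF integrable_mult_right[OF hi, of "t / c * real (Suc n)"]])
       (use k0 kh h0 t c in \<open>auto simp: abs_mult\<close>)
  have le: "exp (- \<tau> * l) * k n \<tau> \<le> k n \<tau>" if "l \<ge> 0" for l \<tau> n
    using k0[of n \<tau>] kn[of \<tau> n] that by (cases "\<tau> < 0") (auto intro!: mult_left_le_one_le simp: mult_nonneg_nonneg)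
  have kli: "integrable lborel (\<lambda>\<tau>. exp (- \<tau> * l) * k n \<tau>)" if "l \<ge> 0" for l n
    by (rule Bochner_Integration.integrable_bound[OF ki[of n]]) (use le[OF that] k0 in \<open>auto simp: abs_mult\<close>)
  define E where "E n l = (LINT \<tau>|lborel. exp (- \<tau> * l) * k n \<tau>) - (LINT \<tau>|lborel. k n \<tau>)" for n l
  show ?thesis
  proof (rule pos_multiplier_limit[where m="\<lambda>n l. exp (E n l)" and B=1])
    show "pos_multiplier TYPE('a) (\<lambda>l. exp (E n l))" for n
      unfolding E_def by (rule pos_multiplier_exp_laplace[OF ki k0 kn])
    show "\<bar>exp (E n l)\<bar> \<le> 1" if "l \<ge> 0" for n l
      using integral_mono[OF kli[OF that] ki le[OF that]] by (simp add: E_def)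
    fix l :: real assume l: "l \<ge> 0"
    have "(\<lambda>n. LINT \<tau>|lborel. exp (- \<tau> * l) * k n \<tau> - k n \<tau>) \<longlonglongrightarrow> (LINT \<tau>|lborel. - (t / c) * G l \<tau>)"
    proof (rule integral_dominated_convergence[where w="\<lambda>\<tau>. t / c * G l \<tau>"])
      show "integrable lborel (\<lambda>\<tau>. t / c * G l \<tau>)" by (intro integrable_mult_right Gi l)
      have e: "exp (- \<tau> * l) * k n \<tau> - k n \<tau> = (if \<tau> < 1 / real (Suc n) then 0 else - (t / c) * G l \<tau>)" for n \<tau>
      proof (cases "\<tau> < 1 / real (Suc n)")
        case False
        then have "\<tau> > 0" by (meson less_le_trans linorder_not_le of_nat_0_less_iff zero_less_Suc zero_less_divide_1_iff)
        then show ?thesis using False by (simp add: k_def G_def algebra_simps)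
      qed (simp add: k_def)
      show "AE \<tau> in lborel. (\<lambda>n. exp (- \<tau> * l) * k n \<tau> - k n \<tau>) \<longlonglongrightarrow> - (t / c) * G l \<tau>"
      proof (intro AE_I2)
        fix \<tau> :: real
        show "(\<lambda>n. exp (- \<tau> * l) * k n \<tau> - k n \<tau>) \<longlonglongrightarrow> - (t / c) * G l \<tau>"
        proof (cases "\<tau> > 0")
          case True
          have "\<forall>\<^sub>F n in sequentially. 1 / real (Suc n) < \<tau>"
            using LIMSEQ_inverse_real_of_nat True by (intro order_tendstoD) (auto simp: inverse_eq_divide)
          then have "\<forall>\<^sub>F n in sequentially. exp (- \<tau> * l) * k n \<tau> - k n \<tau> = - (t / c) * G l \<tau>"
            unfolding e by eventually_elim simp
          then show ?thesis by (rule tendsto_eventually)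
        next
          case False
          then have "G l \<tau> = 0" by (simp add: G_def)
          then show ?thesis unfolding e by (simp cong: if_cong)
        qed
      qed
      show "AE \<tau> in lborel. norm (exp (- \<tau> * l) * k n \<tau> - k n \<tau>) \<le> t / c * G l \<tau>" for n
        unfolding e using t c G0[OF l] by (auto simp: abs_mult)
    qed measurable
    moreover have "(LINT \<tau>|lborel. exp (- \<tau> * l) * k n \<tau> - k n \<tau>) = E n l" for n
      unfolding E_def by (rule Bochner_Integration.integral_diff[OF kli[OF l] ki])
    moreover have "(LINT \<tau>|lborel. - (t / c) * G l \<tau>) = - t * l powr s"
      using GI[OF l] c by simp
    ultimately have "(\<lambda>n. E n l) \<longlonglongrightarrow> - t * l powr s" by simp
    then show "(\<lambda>n. exp (E n l)) \<longlonglongrightarrow> exp (- t * l powr s)" by (rule tendsto_exp)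
  qed measurable
qed

section \<open>The heat kernel as a Fourier integral\<close>

definition heat_symbol :: "real \<Rightarrow> real \<Rightarrow> 'a::euclidean_space \<Rightarrow> real" where
  "heat_symbol s t \<xi> = exp (- t * ((norm \<xi>)\<^sup>2 + norm \<xi> powr (2 * s)))"

lemma heat_symbol_bounds: "0 < heat_symbol s t \<xi>" "t \<ge> 0 \<Longrightarrow> heat_symbol s t \<xi> \<le> 1"
  by (auto simp: heat_symbol_def)

lemma heat_symbol_uminus: "heat_symbol s t (- \<xi>) = heat_symbol s t \<xi>"
  by (simp add: heat_symbol_def)

lemma heat_symbol_add: "heat_symbol s t \<xi> * heat_symbol s r \<xi> = heat_symbol s (t + r) \<xi>"
  by (simp add: heat_symbol_def algebra_simps flip: exp_add)

lemma continuous_on_heat_symbol: "s > 0 \<Longrightarrow> continuous_on A (heat_symbol s t)"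
  unfolding heat_symbol_def[abs_def]
  by (intro continuous_intros continuous_on_powr') auto

lemma borel_measurable_heat_symbol[measurable]: "heat_symbol s t \<in> borel_measurable borel"
  unfolding heat_symbol_def[abs_def] by measurable

lemma integrable_heat_symbol:
  assumes "t > 0"
  shows "integrable lborel (heat_symbol s t :: 'a::euclidean_space \<Rightarrow> real)"
proof (rule Bochner_Integration.integrable_bound[OF integrable_gaussian[OF assms]])
  have "heat_symbol s t \<xi> \<le> exp (- t * (norm \<xi>)\<^sup>2)" for \<xi> :: 'a
    using assms by (simp add: heat_symbol_def)
  then show "AE \<xi>::'a in lborel. norm (heat_symbol s t \<xi>) \<le> norm (exp (- t * (norm \<xi>)\<^sup>2))"
    by (intro AE_I2) (simp add: abs_of_pos[OF heat_symbol_bounds(1)])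
qed measurable

lemma heat_kernel_eq:
  assumes "t > 0"
  shows "heat_kernel 1 1 s t (x::'a::euclidean_space) =
    (LINT \<xi>|lborel. cos (x \<bullet> \<xi>) * heat_symbol s t \<xi>) / (2 * pi) ^ DIM('a)"
proof -
  have "integrable lborel (\<lambda>\<xi>. cis (x \<bullet> \<xi>) * of_real (heat_symbol s t \<xi>))"
    by (rule Bochner_Integration.integrable_bound[OF integrable_heat_symbol[OF assms]])
       (auto simp: norm_mult cis_conv_exp)
  from integral_Re[OF this] show ?thesis
    unfolding heat_kernel_def by (simp add: heat_symbol_def)
qed

lemma integrable_cos_symbol:
  assumes "t > 0"
  shows "integrable lborel (\<lambda>\<xi>::'a::euclidean_space. cos (x \<bullet> \<xi>) * heat_symbol s t \<xi>)"
  by (rule Bochner_Integration.integrable_bound[OF integrable_heat_symbol[OF assms, of s]])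
     (auto simp: abs_mult less_imp_le[OF heat_symbol_bounds(1)] intro!: mult_left_le_one_le)

text \<open>The Laplacian supplies the Gaussian factor exp (- t |\<xi>|^2) that the definition of
  \<open>pos_multiplier\<close> asks for; the fractional part is the multiplier.\<close>

lemma heat_kernel_nonneg:
  assumes s: "0 < s" "s < 1" and t: "t > 0"
  shows "0 \<le> heat_kernel 1 1 s t (x::'a::euclidean_space)"
proof -
  have "heat_symbol s t \<xi> = exp (- t * (norm \<xi>)\<^sup>2) * exp (- t * ((norm \<xi>)\<^sup>2) powr s)" for \<xi> :: 'a
    by (cases "\<xi> = 0") (simp_all add: heat_symbol_def algebra_simps powr_powr flip: exp_add powr_numeral)
  then show ?thesis
    using pos_multiplier_stable[OF s t, where 'a='a] t
    unfolding heat_kernel_eq[OF t] pos_multiplier_def by (simp add: mult.assoc)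
qed

lemma continuous_on_heat_kernel:
  assumes t: "t > 0"
  shows "continuous_on A (heat_kernel 1 1 s t :: 'a::euclidean_space \<Rightarrow> real)"
proof -
  have "isCont (\<lambda>x::'a. LINT \<xi>|lborel. cos (x \<bullet> \<xi>) * heat_symbol s t \<xi>) x" for x
    unfolding continuous_at_sequentially comp_def
  proof (intro allI impI)
    fix X :: "nat \<Rightarrow> 'a" assume X: "X \<longlonglongrightarrow> x"
    show "(\<lambda>n. LINT \<xi>|lborel. cos (X n \<bullet> \<xi>) * heat_symbol s t \<xi>) \<longlonglongrightarrow> (LINT \<xi>|lborel. cos (x \<bullet> \<xi>) * heat_symbol s t \<xi>)"
      by (rule integral_dominated_convergence[where w="heat_symbol s t"])
         (auto intro!: tendsto_intros X integrable_heat_symbol t mult_left_le_one_le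
            simp: abs_mult less_imp_le[OF heat_symbol_bounds(1)])
  qed
  then have "continuous_on A (\<lambda>x::'a. (LINT \<xi>|lborel. cos (x \<bullet> \<xi>) * heat_symbol s t \<xi>) / (2 * pi) ^ DIM('a))"
    by (intro continuous_intros continuous_at_imp_continuous_on ballI) auto
  then show ?thesis by (simp add: heat_kernel_eq[OF t, abs_def])
qed

lemma borel_measurable_heat_kernel:
  "t > 0 \<Longrightarrow> heat_kernel 1 1 s t \<in> borel_measurable borel"
  by (intro borel_measurable_continuous_onI continuous_on_heat_kernel)

text \<open>Discarding the Gaussian factor leaves exp (- t |\<xi>|^(2s)), and rescaling \<xi> by
  t^(1/(2s)) gives the rate, with one constant for small and large times alike.\<close>

lemma heat_kernel_bound:
  assumes s: "0 < s" "s < 1"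
  shows "\<exists>C>0. \<forall>t>0. \<forall>x::'a::euclidean_space. heat_kernel 1 1 s t x \<le> C * t powr - (real DIM('a) / (2 * s))"
proof -
  define m where "m \<xi> = exp (- (norm \<xi> powr (2 * s)))" for \<xi> :: 'a
  have [measurable]: "m \<in> borel_measurable borel" unfolding m_def[abs_def] by measurable
  define \<gamma> where "\<gamma> = real DIM('a) + 2 * s"
  have \<gamma>: "\<gamma> > 0" using s by (simp add: \<gamma>_def add_nonneg_pos)
  \<comment> \<open>exp y dominates y^N / N! for y = |\<xi>|^(2s). This N makes y^N at least
    |\<xi>|^(d+2s) outside the unit ball, so that \<open>frac_kernel\<close> serves as an integrable
    majorant there.\<close>
  obtain N :: nat where N: "\<gamma> / (2 * s) \<le> real N" using real_arch_simple by blast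
  have mle: "m \<xi> \<le> (fact N + 1) * (indicator (cball 0 1) \<xi> + frac_kernel s \<xi>)" for \<xi>
  proof (cases "norm \<xi> \<le> 1")
    case True
    have "m \<xi> \<le> 1" by (simp add: m_def)
    also have "1 \<le> (fact N + 1) * (1 + frac_kernel s \<xi>)"
      using frac_kernel_nonneg[of s \<xi>] by (simp add: algebra_simps add_nonneg_nonneg)
    finally show ?thesis using True by simp
  next
    case False
    let ?y = "norm \<xi> powr (2 * s)"
    have y: "?y \<ge> 1" using False s by (intro ge_one_powr_ge_zero) auto
    have "norm \<xi> powr \<gamma> = ?y powr (\<gamma> / (2 * s))" using s by (simp add: powr_powr)
    also have "\<dots> \<le> ?y powr real N" using y N by (intro powr_mono) auto
    also have "\<dots> = ?y ^ N" by (rule powr_realpow) (use y in linarith)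
    also have "\<dots> \<le> fact N * exp ?y"
    proof -
      have "?y ^ N / fact N \<le> exp ?y"
        using sum_le_suminf[OF summable_exp, of "{N}" ?y] y
        by (simp add: exp_def divide_inverse mult.commute)
      then show ?thesis by (simp add: field_simps)
    qed
    finally have "norm \<xi> powr \<gamma> * m \<xi> \<le> fact N" by (simp add: m_def exp_minus field_simps)
    have "m \<xi> \<le> fact N * norm \<xi> powr - \<gamma>"
    proof -
      have "norm \<xi> powr \<gamma> > 0" using False by auto
      with \<open>norm \<xi> powr \<gamma> * m \<xi> \<le> fact N\<close> show ?thesis
        by (simp add: powr_minus pos_le_divide_eq mult.commute flip: divide_inverse)
    qed
    also have "norm \<xi> powr - \<gamma> = frac_kernel s \<xi>"
    proof -
      have "1 \<le> (norm \<xi>)\<^sup>2" using False by (intro one_le_power) simp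
      then show ?thesis by (simp add: frac_kernel_def min_absorb2 \<gamma>_def)
    qed
    finally show ?thesis using False frac_kernel_nonneg[of s \<xi>] by (simp add: algebra_simps)
  qed
  have m0: "m \<xi> > 0" for \<xi> by (simp add: m_def)
  have mi: "integrable lborel m"
  proof (rule Bochner_Integration.integrable_bound)
    show "integrable lborel (\<lambda>y::'a. (fact N + 1) * (indicator (cball 0 1) y + frac_kernel s y) :: real)"
      by (intro integrable_mult_right Bochner_Integration.integrable_add integrable_frac_kernel s integrable_real_indicator)
         (auto simp: emeasure_cball)
    show "AE y in lborel. norm (m y) \<le> norm ((fact N + 1) * (indicator (cball 0 1) y + frac_kernel s y) :: real)"
      using mle m0 by (intro AE_I2) (metis abs_ge_self less_imp_le order_trans real_norm_def abs_of_nonneg)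
  qed measurable
  \<comment> \<open>The summand 1 makes \<open>C\<close> positive without a lower bound on the
    integral.\<close>
  define C where "C = (LINT \<xi>|lborel. m \<xi>) / (2 * pi) ^ DIM('a) + 1"
  have C: "C > 0" unfolding C_def using m0 by (intro add_nonneg_pos divide_nonneg_pos) (auto simp: less_imp_le)
  have "heat_kernel 1 1 s t x \<le> C * t powr - (real DIM('a) / (2 * s))" if t: "t > 0" for t and x :: 'a
  proof -
    define c where "c = t powr (1 / (2 * s))"
    have c: "c > 0" using t by (simp add: c_def)
    have mc: "m (c *\<^sub>R \<xi>) = exp (- t * norm \<xi> powr (2 * s))" for \<xi> :: 'a
      using s t c by (simp add: m_def powr_mult) (simp add: c_def powr_powr)
    have I: "(LINT \<xi>|lborel. m \<xi>) = c ^ DIM('a) * (LINT \<xi>|lborel. m (c *\<^sub>R \<xi>))"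
      using lborel_integral_affine[of c m 0] c by simp
    have i: "integrable lborel (\<lambda>\<xi>. m (c *\<^sub>R \<xi>))"
      using lborel_integrable_affine_iff[of c m 0] c mi by simp
    have le: "cos (x \<bullet> \<xi>) * heat_symbol s t \<xi> \<le> m (c *\<^sub>R \<xi>)" for \<xi>
    proof -
      have "cos (x \<bullet> \<xi>) * heat_symbol s t \<xi> \<le> 1 * heat_symbol s t \<xi>"
        by (intro mult_right_mono) (auto simp: less_imp_le[OF heat_symbol_bounds(1)])
      also have "\<dots> \<le> m (c *\<^sub>R \<xi>)" unfolding mc using t by (simp add: heat_symbol_def)
      finally show ?thesis .
    qed
    have "(LINT \<xi>|lborel. cos (x \<bullet> \<xi>) * heat_symbol s t \<xi>) \<le> (LINT \<xi>|lborel. m (c *\<^sub>R \<xi>))"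
      by (rule integral_mono[OF integrable_cos_symbol[OF t] i le])
    also have "\<dots> = (LINT \<xi>|lborel. m \<xi>) * t powr - (real DIM('a) / (2 * s))"
    proof -
      have "c ^ DIM('a) = t powr (real DIM('a) / (2 * s))"
        using c by (simp add: powr_realpow[symmetric] c_def powr_powr)
      then show ?thesis unfolding I using t by (simp add: powr_minus field_simps)
    qed
    finally have "heat_kernel 1 1 s t x \<le> (LINT \<xi>|lborel. m \<xi>) * t powr - (real DIM('a) / (2 * s)) / (2 * pi) ^ DIM('a)"
      unfolding heat_kernel_eq[OF t] by (intro divide_right_mono) auto
    also have "\<dots> \<le> C * t powr - (real DIM('a) / (2 * s))"
      by (simp add: C_def algebra_simps)
    finally show ?thesis .
  qed
  with C show ?thesis by blast
qed

abbreviation heat :: "real \<Rightarrow> real \<Rightarrow> ('a::euclidean_space \<Rightarrow> real) \<Rightarrow> 'a \<Rightarrow> real" where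
  "heat s \<equiv> heat_semigroup 1 1 s"

context
  fixes s :: real
  assumes s: "0 < s" "s < 1"
begin

section \<open>The heat semigroup\<close>

lemma heat_kernel_uminus: "t > 0 \<Longrightarrow> heat_kernel 1 1 s t (- x) = heat_kernel 1 1 s t (x::'a::euclidean_space)"
  by (simp add: heat_kernel_eq)

text \<open>Fourier inversion in regularised form. The kernel is not yet known to be integrable, so
  it is damped by a Gaussian, which permits Fubini; the result is the symbol averaged over a
  Gaussian of width of order sqrt c around \<xi>.\<close>

lemma heat_kernel_gaussian:
  fixes \<xi> :: "'a::euclidean_space"
  assumes t: "t > 0" and c: "c > 0"
  shows "integrable lborel (\<lambda>z. heat_kernel 1 1 s t z * (cos (z \<bullet> \<xi>) * exp (- c * (norm z)\<^sup>2)))"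
    and "(LINT z|lborel. heat_kernel 1 1 s t z * (cos (z \<bullet> \<xi>) * exp (- c * (norm z)\<^sup>2))) =
      (LINT y|lborel. heat_symbol s t (\<xi> + (2 * sqrt c) *\<^sub>R y) * exp (- (norm y)\<^sup>2)) / pi powr (real DIM('a) / 2)"
proof -
  define m :: "'a \<Rightarrow> real" where "m = heat_symbol s t"
  define g where "g z = exp (- c * (norm z)\<^sup>2)" for z :: 'a
  define G where "G x = (pi / c) powr (real DIM('a) / 2) * exp (- (norm x)\<^sup>2 / (4 * c))" for x :: 'a
  have [measurable]: "m \<in> borel_measurable borel" "g \<in> borel_measurable borel" "G \<in> borel_measurable borel"
    unfolding m_def g_def[abs_def] G_def[abs_def] by measurable
  have mi: "integrable lborel m" unfolding m_def by (rule integrable_heat_symbol[OF t])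
  have gi: "integrable lborel g" unfolding g_def by (rule integrable_gaussian[OF c])
  have m0: "m \<zeta> > 0" for \<zeta> unfolding m_def by (rule heat_symbol_bounds)
  have g0: "g z > 0" for z by (simp add: g_def)
  define F where "F z \<zeta> = (cos (z \<bullet> \<zeta>) * m \<zeta>) * (cos (z \<bullet> \<xi>) * g z)" for z \<zeta>
  have Fi: "integrable (lborel \<Otimes>\<^sub>M lborel) (\<lambda>(z, \<zeta>). F z \<zeta>)"
  proof (rule Bochner_Integration.integrable_bound[OF integrable_lborel_prod_mult[OF gi mi]])
    have "\<bar>F z \<zeta>\<bar> \<le> (1 * m \<zeta>) * (1 * g z)" for z \<zeta>
      unfolding F_def abs_mult using m0[of \<zeta>] g0[of z]
      by (intro mult_mono) (auto simp: less_imp_le)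
    then show "AE p in lborel \<Otimes>\<^sub>M lborel. norm (case p of (z, \<zeta>) \<Rightarrow> F z \<zeta>) \<le> norm (case p of (z, \<zeta>) \<Rightarrow> g z * m \<zeta>)"
      using m0 g0 by (intro AE_I2) (auto simp: abs_mult abs_of_pos mult.commute)
  qed (unfold F_def, measurable)
  have kF: "heat_kernel 1 1 s t z * (cos (z \<bullet> \<xi>) * g z) = (LINT \<zeta>|lborel. F z \<zeta>) / (2 * pi) ^ DIM('a)" for z
    unfolding heat_kernel_eq[OF t] F_def m_def by simp
  show "integrable lborel (\<lambda>z. heat_kernel 1 1 s t z * (cos (z \<bullet> \<xi>) * exp (- c * (norm z)\<^sup>2)))"
    unfolding g_def[symmetric] kF using lborel_pair.integrable_fst[OF Fi] by simp
  have inner: "(LINT z|lborel. F z \<zeta>) = (m \<zeta> * G (\<zeta> - \<xi>) + m \<zeta> * G (\<zeta> + \<xi>)) / 2" for \<zeta>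
  proof -
    have i: "integrable lborel (\<lambda>z. cos (x \<bullet> z) * g z)" for x
      using integrable_cos_gaussian[OF c, of "\<lambda>_. 1" 1 x] by (simp add: g_def)
    have "F z \<zeta> = m \<zeta> / 2 * (cos ((\<zeta> - \<xi>) \<bullet> z) * g z + cos ((\<zeta> + \<xi>) \<bullet> z) * g z)" for z
    proof -
      have "cos (z \<bullet> \<zeta>) * cos (z \<bullet> \<xi>) = (cos ((\<zeta> - \<xi>) \<bullet> z) + cos ((\<zeta> + \<xi>) \<bullet> z)) / 2"
        by (simp add: cos_times_cos inner_diff_left inner_add_left inner_commute[of z])
      then have "m \<zeta> * g z * (cos (z \<bullet> \<zeta>) * cos (z \<bullet> \<xi>)) = m \<zeta> * g z * ((cos ((\<zeta> - \<xi>) \<bullet> z) + cos ((\<zeta> + \<xi>) \<bullet> z)) / 2)"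
        by simp
      then show ?thesis by (simp add: F_def algebra_simps)
    qed
    then have "(LINT z|lborel. F z \<zeta>) = (LINT z|lborel. m \<zeta> / 2 * (cos ((\<zeta> - \<xi>) \<bullet> z) * g z + cos ((\<zeta> + \<xi>) \<bullet> z) * g z))"
      by (simp only:)
    also have "\<dots> = m \<zeta> / 2 * ((LINT z|lborel. cos ((\<zeta> - \<xi>) \<bullet> z) * g z) + (LINT z|lborel. cos ((\<zeta> + \<xi>) \<bullet> z) * g z))"
      by (simp only: integral_mult_right_zero Bochner_Integration.integral_add[OF i i])
    also have "\<dots> = m \<zeta> / 2 * (G (\<zeta> - \<xi>) + G (\<zeta> + \<xi>))"
      unfolding g_def gaussian_cos(2)[OF c] G_def ..
    finally show ?thesis by (simp add: algebra_simps)
  qed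
  have Gb: "\<bar>G x\<bar> \<le> (pi / c) powr (real DIM('a) / 2)" for x
    using c by (auto simp: G_def abs_mult intro!: mult_right_le_one_le)
  have Gi: "integrable lborel (\<lambda>\<zeta>. m \<zeta> * G (\<zeta> - x))" for x
  proof (rule Bochner_Integration.integrable_bound[OF integrable_mult_left[OF mi, of "(pi / c) powr (real DIM('a) / 2)"]])
    show "AE \<zeta> in lborel. norm (m \<zeta> * G (\<zeta> - x)) \<le> norm (m \<zeta> * (pi / c) powr (real DIM('a) / 2))"
      using Gb m0 by (intro AE_I2) (auto simp: abs_mult intro!: mult_left_mono)
  qed measurable
  \<comment> \<open>The product-to-sum formula produces Gaussians centred at \<xi> and at -\<xi>; as
    the symbol is even, both contribute the same.\<close>
  have sym: "(LINT \<zeta>|lborel. m \<zeta> * G (\<zeta> + \<xi>)) = (LINT \<zeta>|lborel. m \<zeta> * G (\<zeta> - \<xi>))"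
  proof -
    have "m (- \<zeta>) * G (- \<zeta> + \<xi>) = m \<zeta> * G (\<zeta> - \<xi>)" for \<zeta>
      by (simp add: m_def heat_symbol_uminus G_def norm_minus_commute)
    then show ?thesis
      using lborel_integral_affine[of "-1" "\<lambda>\<zeta>. m \<zeta> * G (\<zeta> + \<xi>)" 0] by simp
  qed
  have sc: "2 * sqrt c \<noteq> 0" using c by simp
  have "(LINT z|lborel. heat_kernel 1 1 s t z * (cos (z \<bullet> \<xi>) * g z)) = (LINT z|lborel. (LINT \<zeta>|lborel. F z \<zeta>)) / (2 * pi) ^ DIM('a)"
    unfolding kF by simp
  also have "(LINT z|lborel. (LINT \<zeta>|lborel. F z \<zeta>)) = (LINT \<zeta>|lborel. (LINT z|lborel. F z \<zeta>))"
    using lborel_pair.Fubini_integral[OF Fi] by simp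
  also have "\<dots> = (LINT \<zeta>|lborel. m \<zeta> * G (\<zeta> - \<xi>))"
    unfolding inner using Gi[of \<xi>] Gi[of "- \<xi>"] by (simp add: sym)
  also have "\<dots> = (2 * sqrt c) ^ DIM('a) * (LINT y|lborel. m (\<xi> + (2 * sqrt c) *\<^sub>R y) * G ((2 * sqrt c) *\<^sub>R y))"
    using lborel_integral_affine[OF sc, of "\<lambda>\<zeta>. m \<zeta> * G (\<zeta> - \<xi>)" \<xi>] c by simp
  also have "(LINT y|lborel. m (\<xi> + (2 * sqrt c) *\<^sub>R y) * G ((2 * sqrt c) *\<^sub>R y)) =
      (LINT y|lborel. m (\<xi> + (2 * sqrt c) *\<^sub>R y) * exp (- (norm y)\<^sup>2)) * (pi / c) powr (real DIM('a) / 2)"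
  proof -
    have "m (\<xi> + (2 * sqrt c) *\<^sub>R y) * G ((2 * sqrt c) *\<^sub>R y) =
      (m (\<xi> + (2 * sqrt c) *\<^sub>R y) * exp (- (norm y)\<^sup>2)) * (pi / c) powr (real DIM('a) / 2)" for y
      using c by (simp add: G_def power_mult_distrib)
    then show ?thesis by (simp only: integral_mult_left_zero)
  qed
  finally have R: "(LINT z|lborel. heat_kernel 1 1 s t z * (cos (z \<bullet> \<xi>) * g z)) =
    (LINT y|lborel. m (\<xi> + (2 * sqrt c) *\<^sub>R y) * exp (- (norm y)\<^sup>2)) * 
      ((2 * sqrt c) ^ DIM('a) * (pi / c) powr (real DIM('a) / 2) / (2 * pi) ^ DIM('a))" by simp
  have "(2 * sqrt c) ^ DIM('a) * (pi / c) powr (real DIM('a) / 2) / (2 * pi) ^ DIM('a) = 1 / pi powr (real DIM('a) / 2)"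
  proof -
    let ?h = "real DIM('a) / 2"
    have "sqrt c ^ DIM('a) = c powr ?h" "pi ^ DIM('a) = pi powr ?h * pi powr ?h"
      using c by (simp_all add: powr_half_sqrt[symmetric] powr_realpow[symmetric] powr_powr flip: powr_add)
    then show ?thesis using c by (simp add: power_mult_distrib powr_divide)
  qed
  then show "(LINT z|lborel. heat_kernel 1 1 s t z * (cos (z \<bullet> \<xi>) * exp (- c * (norm z)\<^sup>2))) =
      (LINT y|lborel. heat_symbol s t (\<xi> + (2 * sqrt c) *\<^sub>R y) * exp (- (norm y)\<^sup>2)) / pi powr (real DIM('a) / 2)"
    using R unfolding g_def m_def by simp
qed

lemma gaussian_integral:
  "integrable lborel (\<lambda>y::'a::euclidean_space. exp (- (norm y)\<^sup>2))"
  "(LINT y::'a|lborel. exp (- (norm y)\<^sup>2)) = pi powr (real DIM('a) / 2)"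
  using integrable_gaussian[of 1, where 'a='a] gaussian_cos(2)[of 1 "0::'a"] by simp_all

text \<open>exp (- |y|^2) / pi^(d/2) is a probability density and the symbol is continuous and
  bounded by 1, so the averages converge to the value at \<xi>.\<close>

lemma heat_kernel_gaussian_limit:
  fixes \<xi> :: "'a::euclidean_space"
  assumes t: "t > 0"
  shows "(\<lambda>n. LINT z|lborel. heat_kernel 1 1 s t z * (cos (z \<bullet> \<xi>) * exp (- (1 / real (Suc n)) * (norm z)\<^sup>2)))
    \<longlonglongrightarrow> heat_symbol s t \<xi>"
proof -
  have lim: "(\<lambda>n. LINT y|lborel. heat_symbol s t (\<xi> + (2 * sqrt (1 / real (Suc n))) *\<^sub>R y) * exp (- (norm y)\<^sup>2))
    \<longlonglongrightarrow> (LINT y::'a|lborel. heat_symbol s t \<xi> * exp (- (norm y)\<^sup>2))"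
  proof (rule integral_dominated_convergence[where w="\<lambda>y. exp (- (norm y)\<^sup>2)"])
    show "AE y::'a in lborel. (\<lambda>n. heat_symbol s t (\<xi> + (2 * sqrt (1 / real (Suc n))) *\<^sub>R y) * exp (- (norm y)\<^sup>2))
      \<longlonglongrightarrow> heat_symbol s t \<xi> * exp (- (norm y)\<^sup>2)"
    proof (intro AE_I2 tendsto_mult tendsto_const)
      fix y :: 'a
      have "(\<lambda>n. 1 / real (Suc n)) \<longlonglongrightarrow> 0" using LIMSEQ_inverse_real_of_nat by (simp add: inverse_eq_divide)
      then have "(\<lambda>n. \<xi> + (2 * sqrt (1 / real (Suc n))) *\<^sub>R y) \<longlonglongrightarrow> \<xi> + (2 * sqrt 0) *\<^sub>R y"
        by (intro tendsto_intros)
      then have "(\<lambda>n. \<xi> + (2 * sqrt (1 / real (Suc n))) *\<^sub>R y) \<longlonglongrightarrow> \<xi>" by simp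
      then show "(\<lambda>n. heat_symbol s t (\<xi> + (2 * sqrt (1 / real (Suc n))) *\<^sub>R y)) \<longlonglongrightarrow> heat_symbol s t \<xi>"
        using continuous_on_heat_symbol[OF s(1), of UNIV t]
        by (intro continuous_on_tendsto_compose[of UNIV "heat_symbol s t"]) auto
    qed
    show "AE y::'a in lborel. norm (heat_symbol s t (\<xi> + (2 * sqrt (1 / real (Suc n))) *\<^sub>R y) * exp (- (norm y)\<^sup>2)) \<le> exp (- (norm y)\<^sup>2)" for n
      by (intro AE_I2) (auto simp: abs_mult abs_of_pos[OF heat_symbol_bounds(1)] heat_symbol_bounds(2)[OF less_imp_le[OF t]])
  qed (auto intro: gaussian_integral)
  have "heat_symbol s t \<xi> = (LINT y::'a|lborel. heat_symbol s t \<xi> * exp (- (norm y)\<^sup>2)) / pi powr (real DIM('a) / 2)"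
    by (simp add: gaussian_integral)
  moreover have "1 / real (Suc n) > 0" for n by simp
  ultimately show ?thesis
    unfolding heat_kernel_gaussian(2)[OF t \<open>\<And>n. 1 / real (Suc n) > 0\<close>]
    using tendsto_divide[OF lim tendsto_const[of "pi powr (real DIM('a) / 2)"]] by simp
qed

text \<open>At frequency 0 the damped integrals increase as the damping is removed, because the
  kernel is nonnegative. Monotone convergence yields integrability and mass together: positivity
  replaces a pointwise decay estimate for the kernel.\<close>

lemma integrable_heat_kernel:
  assumes t: "t > 0"
  shows "integrable lborel (heat_kernel 1 1 s t :: 'a::euclidean_space \<Rightarrow> real)"
    and "(LINT z::'a|lborel. heat_kernel 1 1 s t z) = 1"
proof -
  let ?f = "\<lambda>n (z::'a). heat_kernel 1 1 s t z * (cos (z \<bullet> 0) * exp (- (1 / real (Suc n)) * (norm z)\<^sup>2))"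
  have pos: "1 / real (Suc n) > 0" for n by simp
  have i: "integrable lborel (?f n)" for n by (rule heat_kernel_gaussian(1)[OF t pos])
  have mono: "AE z in lborel. mono (\<lambda>n. ?f n z)"
  proof (intro AE_I2 monoI)
    fix z :: 'a and n n' :: nat assume "n \<le> n'"
    then have "1 / real (Suc n') * (norm z)\<^sup>2 \<le> 1 / real (Suc n) * (norm z)\<^sup>2"
      by (intro mult_right_mono) (auto simp: field_simps)
    then show "?f n z \<le> ?f n' z"
      using heat_kernel_nonneg[OF s t, of z] by (intro mult_left_mono) auto
  qed
  have lim: "AE z in lborel. (\<lambda>n. ?f n z) \<longlonglongrightarrow> heat_kernel 1 1 s t z"
  proof (intro AE_I2)
    fix z :: 'a
    have "(\<lambda>n. 1 / real (Suc n)) \<longlonglongrightarrow> 0" using LIMSEQ_inverse_real_of_nat by (simp add: inverse_eq_divide)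
    then have "(\<lambda>n. ?f n z) \<longlonglongrightarrow> heat_kernel 1 1 s t z * (cos (z \<bullet> 0) * exp (- 0 * (norm z)\<^sup>2))"
      by (intro tendsto_intros)
    then show "(\<lambda>n. ?f n z) \<longlonglongrightarrow> heat_kernel 1 1 s t z" by simp
  qed
  have I: "(\<lambda>n. integral\<^sup>L lborel (?f n)) \<longlonglongrightarrow> 1"
    using heat_kernel_gaussian_limit[OF t, of "0::'a"] s by (simp add: heat_symbol_def)
  have m: "heat_kernel 1 1 s t \<in> borel_measurable (lborel :: 'a measure)"
    using borel_measurable_heat_kernel[OF t] by simp
  show "integrable lborel (heat_kernel 1 1 s t :: 'a \<Rightarrow> real)"
    by (rule integrable_monotone_convergence[OF i mono lim I m])
  show "(LINT z::'a|lborel. heat_kernel 1 1 s t z) = 1"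
    by (rule integral_monotone_convergence[OF i mono lim I m])
qed

text \<open>With integrability available, dominated convergence removes the damping at every
  frequency.\<close>

lemma heat_kernel_cos:
  fixes \<xi> :: "'a::euclidean_space"
  assumes t: "t > 0"
  shows "integrable lborel (\<lambda>z. heat_kernel 1 1 s t z * cos (z \<bullet> \<xi>))"
    and "(LINT z|lborel. heat_kernel 1 1 s t z * cos (z \<bullet> \<xi>)) = heat_symbol s t \<xi>"
proof -
  have [measurable]: "heat_kernel 1 1 s t \<in> borel_measurable (borel :: 'a measure)"
    by (rule borel_measurable_heat_kernel[OF t])
  show "integrable lborel (\<lambda>z. heat_kernel 1 1 s t z * cos (z \<bullet> \<xi>))"
    by (rule Bochner_Integration.integrable_bound[OF integrable_heat_kernel(1)[OF t]])
       (auto simp: abs_mult heat_kernel_nonneg[OF s t] intro!: mult_right_le_one_le)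
  have "(\<lambda>n. LINT z|lborel. heat_kernel 1 1 s t z * (cos (z \<bullet> \<xi>) * exp (- (1 / real (Suc n)) * (norm z)\<^sup>2)))
    \<longlonglongrightarrow> (LINT z|lborel. heat_kernel 1 1 s t z * (cos (z \<bullet> \<xi>) * exp (- 0 * (norm z)\<^sup>2)))"
  proof (rule integral_dominated_convergence[where w="heat_kernel 1 1 s t"])
    show "AE z in lborel. (\<lambda>n. heat_kernel 1 1 s t z * (cos (z \<bullet> \<xi>) * exp (- (1 / real (Suc n)) * (norm z)\<^sup>2)))
      \<longlonglongrightarrow> heat_kernel 1 1 s t z * (cos (z \<bullet> \<xi>) * exp (- 0 * (norm z)\<^sup>2))"
    proof (intro AE_I2)
      fix z :: 'a
      have "(\<lambda>n. 1 / real (Suc n)) \<longlonglongrightarrow> 0" using LIMSEQ_inverse_real_of_nat by (simp add: inverse_eq_divide)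
      then show "(\<lambda>n. heat_kernel 1 1 s t z * (cos (z \<bullet> \<xi>) * exp (- (1 / real (Suc n)) * (norm z)\<^sup>2)))
        \<longlonglongrightarrow> heat_kernel 1 1 s t z * (cos (z \<bullet> \<xi>) * exp (- 0 * (norm z)\<^sup>2))"
        by (intro tendsto_intros)
    qed
    show "AE z in lborel. norm (heat_kernel 1 1 s t z * (cos (z \<bullet> \<xi>) * exp (- (1 / real (Suc n)) * (norm z)\<^sup>2))) \<le> heat_kernel 1 1 s t z" for n
    proof (intro AE_I2)
      fix z :: 'a
      have "\<bar>cos (z \<bullet> \<xi>)\<bar> * exp (- (1 / real (Suc n)) * (norm z)\<^sup>2) \<le> 1 * 1"
        by (intro mult_mono) auto
      then show "norm (heat_kernel 1 1 s t z * (cos (z \<bullet> \<xi>) * exp (- (1 / real (Suc n)) * (norm z)\<^sup>2))) \<le> heat_kernel 1 1 s t z"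
        using heat_kernel_nonneg[OF s t, of z] by (simp add: abs_mult mult_left_le)
    qed
  qed (auto intro: integrable_heat_kernel(1)[OF t])
  from LIMSEQ_unique[OF this heat_kernel_gaussian_limit[OF t]]
  show "(LINT z|lborel. heat_kernel 1 1 s t z * cos (z \<bullet> \<xi>)) = heat_symbol s t \<xi>" by simp
qed

lemma heat_kernel_sin:
  fixes \<xi> :: "'a::euclidean_space"
  assumes t: "t > 0"
  shows "integrable lborel (\<lambda>z. heat_kernel 1 1 s t z * sin (z \<bullet> \<xi>))"
    and "(LINT z|lborel. heat_kernel 1 1 s t z * sin (z \<bullet> \<xi>)) = 0"
proof -
  have [measurable]: "heat_kernel 1 1 s t \<in> borel_measurable (borel :: 'a measure)"
    by (rule borel_measurable_heat_kernel[OF t])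
  show "integrable lborel (\<lambda>z. heat_kernel 1 1 s t z * sin (z \<bullet> \<xi>))"
    by (rule Bochner_Integration.integrable_bound[OF integrable_heat_kernel(1)[OF t]])
       (auto simp: abs_mult heat_kernel_nonneg[OF s t] intro!: mult_right_le_one_le)
  show "(LINT z|lborel. heat_kernel 1 1 s t z * sin (z \<bullet> \<xi>)) = 0"
    using lborel_integral_affine[of "-1" "\<lambda>z. heat_kernel 1 1 s t z * sin (z \<bullet> \<xi>)" 0]
    by (simp add: heat_kernel_uminus[OF t])
qed

lemma heat_kernel_shift:
  fixes x :: "'a::euclidean_space"
  assumes t: "t > 0"
  shows "integrable lborel (\<lambda>y. heat_kernel 1 1 s t (x - y))" "(LINT y|lborel. heat_kernel 1 1 s t (x - y)) = 1"
  using lborel_integrable_affine_iff[of "-1" "heat_kernel 1 1 s t" x] integrable_heat_kernel[OF t, where 'a='a]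
    lborel_integral_affine[of "-1" "heat_kernel 1 1 s t" x] borel_measurable_heat_kernel[OF t]
  by simp_all

text \<open>The second kernel is written as a Fourier integral and Fubini moves the convolution
  inside, where it becomes the transform of the first kernel; the symbols then multiply. The sine
  terms vanish because the kernel is even.\<close>

lemma heat_kernel_convolution:
  fixes x :: "'a::euclidean_space"
  assumes t: "t > 0" and r: "r > 0"
  shows "(LINT y|lborel. heat_kernel 1 1 s t (x - y) * heat_kernel 1 1 s r y) = heat_kernel 1 1 s (t + r) x"
proof -
  have m[measurable]: "heat_kernel 1 1 s t \<in> borel_measurable (borel :: 'a measure)"
    by (rule borel_measurable_heat_kernel[OF t])
  define F where "F y \<xi> = heat_kernel 1 1 s t (x - y) * (cos (y \<bullet> \<xi>) * heat_symbol s r \<xi>)" for y \<xi> :: 'a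
  have Fi: "integrable (lborel \<Otimes>\<^sub>M lborel) (\<lambda>(y, \<xi>). F y \<xi>)"
  proof (rule Bochner_Integration.integrable_bound[OF integrable_lborel_prod_mult[OF heat_kernel_shift(1)[OF t] integrable_heat_symbol[OF r]]])
    show "AE p in lborel \<Otimes>\<^sub>M lborel. norm (case p of (y, \<xi>) \<Rightarrow> F y \<xi>) \<le> norm (case p of (y, \<xi>) \<Rightarrow> heat_kernel 1 1 s t (x - y) * heat_symbol s r (\<xi>::'a))"
      using heat_kernel_nonneg[OF s t] heat_symbol_bounds(1)
      by (intro AE_I2) (auto simp: F_def abs_mult less_imp_le intro!: mult_left_mono mult_left_le_one_le)
  qed (unfold F_def, measurable)
  have inner: "(LINT y|lborel. F y \<xi>) = cos (x \<bullet> \<xi>) * heat_symbol s (t + r) \<xi>" for \<xi>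
  proof -
    have "(LINT y|lborel. F y \<xi>) = (LINT z|lborel. F (x - z) \<xi>)"
      using lborel_integral_affine[of "-1" "\<lambda>y. F y \<xi>" x] by (simp add: F_def)
    also have "\<dots> = (LINT z|lborel. heat_symbol s r \<xi> * (cos (x \<bullet> \<xi>) * (heat_kernel 1 1 s t z * cos (z \<bullet> \<xi>)) + sin (x \<bullet> \<xi>) * (heat_kernel 1 1 s t z * sin (z \<bullet> \<xi>))))"
      by (intro Bochner_Integration.integral_cong refl)
         (simp add: F_def inner_diff_left cos_diff algebra_simps)
    also have "\<dots> = heat_symbol s r \<xi> * (cos (x \<bullet> \<xi>) * heat_symbol s t \<xi>)"
      using heat_kernel_cos[OF t, of \<xi>] heat_kernel_sin[OF t, of \<xi>] by simp
    finally show ?thesis by (simp add: heat_symbol_add[symmetric])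
  qed
  have "(LINT y|lborel. heat_kernel 1 1 s t (x - y) * heat_kernel 1 1 s r y) = (LINT y|lborel. (LINT \<xi>|lborel. F y \<xi>)) / (2 * pi) ^ DIM('a)"
    unfolding heat_kernel_eq[OF r] F_def by simp
  also have "(LINT y|lborel. (LINT \<xi>|lborel. F y \<xi>)) = (LINT \<xi>|lborel. (LINT y|lborel. F y \<xi>))"
    using lborel_pair.Fubini_integral[OF Fi] by simp
  also have "\<dots> / (2 * pi) ^ DIM('a) = heat_kernel 1 1 s (t + r) x"
    unfolding inner using t r by (simp add: heat_kernel_eq)
  finally show ?thesis .
qed

section \<open>The semigroup on bounded functions\<close>

lemma integrable_heat_kernel_mult:
  fixes f :: "'a::euclidean_space \<Rightarrow> real"
  assumes t: "t > 0" and [measurable]: "f \<in> borel_measurable borel" and B: "\<And>y. \<bar>f y\<bar> \<le> B"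
  shows "integrable lborel (\<lambda>y. heat_kernel 1 1 s t (x - y) * f y)"
proof -
  have [measurable]: "heat_kernel 1 1 s t \<in> borel_measurable (borel :: 'a measure)"
    by (rule borel_measurable_heat_kernel[OF t])
  have B0: "B \<ge> 0" using B[of 0] by simp
  show ?thesis
    by (rule Bochner_Integration.integrable_bound[OF integrable_mult_left[OF heat_kernel_shift(1)[OF t, of x], of B]])
       (use B B0 in \<open>auto simp: abs_mult intro!: mult_left_mono\<close>)
qed

lemma heat_semigroup_pos: "t > 0 \<Longrightarrow> heat s t f x = (LINT y|lborel. heat_kernel 1 1 s t (x - y) * f y)"
  by (simp add: heat_semigroup_def)

lemma heat_semigroup_0: "heat s 0 f x = f x"
  by (simp add: heat_semigroup_def)

lemma heat_semigroup_pos':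
  fixes f :: "'a::euclidean_space \<Rightarrow> real"
  assumes t: "t > 0" and [measurable]: "f \<in> borel_measurable borel"
  shows "heat s t f x = (LINT y|lborel. heat_kernel 1 1 s t y * f (x - y))"
proof -
  have [measurable]: "heat_kernel 1 1 s t \<in> borel_measurable (borel :: 'a measure)"
    by (rule borel_measurable_heat_kernel[OF t])
  show ?thesis
    using lborel_integral_affine[of "-1" "\<lambda>y. heat_kernel 1 1 s t (x - y) * f y" x] t
    by (simp add: heat_semigroup_pos)
qed

lemma heat_semigroup_mono:
  fixes f g :: "'a::euclidean_space \<Rightarrow> real"
  assumes t: "t \<ge> 0" and m: "f \<in> borel_measurable borel" "g \<in> borel_measurable borel"
    and B: "\<And>y. \<bar>f y\<bar> \<le> B" "\<And>y. \<bar>g y\<bar> \<le> B'" and le: "\<And>y. f y \<le> g y"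
  shows "heat s t f x \<le> heat s t g x"
proof (cases "t = 0")
  case False
  then have t: "t > 0" using t by simp
  show ?thesis
    unfolding heat_semigroup_pos[OF t]
    by (rule integral_mono[OF integrable_heat_kernel_mult[OF t m(1) B(1)] integrable_heat_kernel_mult[OF t m(2) B(2)]])
       (intro mult_left_mono le heat_kernel_nonneg s t)
qed (simp add: heat_semigroup_0 le)

lemma heat_semigroup_const: "t \<ge> 0 \<Longrightarrow> heat s t (\<lambda>_. c) (x::'a::euclidean_space) = c"
  by (cases "t = 0") (simp_all add: heat_semigroup_0 heat_semigroup_pos heat_kernel_shift)

lemma heat_semigroup_diff:
  fixes f g :: "'a::euclidean_space \<Rightarrow> real"
  assumes t: "t \<ge> 0" and m: "f \<in> borel_measurable borel" "g \<in> borel_measurable borel"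
    and B: "\<And>y. \<bar>f y\<bar> \<le> B" "\<And>y. \<bar>g y\<bar> \<le> B'"
  shows "heat s t (\<lambda>y. f y - g y) x = heat s t f x - heat s t g x"
proof (cases "t = 0")
  case False
  then have t: "t > 0" using t by simp
  show ?thesis
    using integrable_heat_kernel_mult[OF t m(1) B(1)] integrable_heat_kernel_mult[OF t m(2) B(2)]
    by (simp add: heat_semigroup_pos[OF t] right_diff_distrib)
qed (simp add: heat_semigroup_0)

lemma heat_semigroup_cmult: "heat s t (\<lambda>y. c * f y) x = c * heat s t f x" for x :: "'a::euclidean_space"
proof (cases "t = 0")
  case False
  then have "heat s t (\<lambda>y. c * f y) x = (LINT y|lborel. c * (heat_kernel 1 1 s t (x - y) * f y))"
    by (simp add: heat_semigroup_def mult_ac)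
  then show ?thesis using False by (simp add: heat_semigroup_def)
qed (simp add: heat_semigroup_0)

lemma heat_semigroup_bound:
  fixes f :: "'a::euclidean_space \<Rightarrow> real"
  assumes t: "t \<ge> 0" and m: "f \<in> borel_measurable borel" and B: "\<And>y. \<bar>f y\<bar> \<le> B"
  shows "\<bar>heat s t f x\<bar> \<le> B"
proof -
  have B0: "B \<ge> 0" using B[of 0] by simp
  have B': "f y \<le> B" "- B \<le> f y" for y using B[of y] by (auto simp: abs_le_iff)
  have c: "\<bar>B\<bar> \<le> B" "\<bar>- B\<bar> \<le> B" using B0 by auto
  have "heat s t f x \<le> heat s t (\<lambda>_. B) x" by (rule heat_semigroup_mono[OF t m _ B c(1) B'(1)]) simp
  moreover have "heat s t (\<lambda>_. - B) x \<le> heat s t f x" by (rule heat_semigroup_mono[OF t _ m c(2) B B'(2)]) simp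
  ultimately show ?thesis by (simp add: heat_semigroup_const[OF t] abs_le_iff)
qed

lemma borel_measurable_heat_semigroup:
  fixes f :: "'a::euclidean_space \<Rightarrow> real"
  assumes t: "t \<ge> 0" and [measurable]: "f \<in> borel_measurable borel"
  shows "heat s t f \<in> borel_measurable borel"
proof (cases "t = 0")
  case False
  then have t: "t > 0" using t by simp
  have [measurable]: "heat_kernel 1 1 s t \<in> borel_measurable (borel :: 'a measure)"
    by (rule borel_measurable_heat_kernel[OF t])
  show ?thesis unfolding heat_semigroup_pos[OF t, abs_def] by measurable
next
  case True
  then have "heat s t f = f" by (simp add: heat_semigroup_0 fun_eq_iff)
  then show ?thesis by simp
qed

lemma heat_semigroup_add:
  fixes f :: "'a::euclidean_space \<Rightarrow> real"
  assumes t: "t \<ge> 0" "r \<ge> 0" and f[measurable]: "f \<in> borel_measurable borel" and B: "\<And>y. \<bar>f y\<bar> \<le> B"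
  shows "heat s t (heat s r f) x = heat s (t + r) f x"
proof (cases "t = 0 \<or> r = 0")
  case False
  then have t: "t > 0" and r: "r > 0" using t by auto
  have [measurable]: "heat_kernel 1 1 s t \<in> borel_measurable (borel :: 'a measure)"
      "heat_kernel 1 1 s r \<in> borel_measurable (borel :: 'a measure)"
    using borel_measurable_heat_kernel t r by auto
  define F where "F y z = heat_kernel 1 1 s t (x - y) * (heat_kernel 1 1 s r (y - z) * f z)" for y z
  have Fm: "(\<lambda>(y, z). F y z) \<in> borel_measurable (lborel \<Otimes>\<^sub>M lborel)"
    unfolding F_def by measurable
  have Fi: "integrable (lborel \<Otimes>\<^sub>M lborel) (\<lambda>(y, z). F y z)"
  proof (rule lborel_pair.Fubini_integrable[OF Fm])
    have "integrable lborel (\<lambda>z. F y z)" for y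
      unfolding F_def by (intro integrable_mult_right integrable_heat_kernel_mult[OF r f B])
    then show "AE y in lborel. integrable lborel (\<lambda>z. case (y, z) of (y, z) \<Rightarrow> F y z)" by simp
    have e: "norm (F y z) = heat_kernel 1 1 s t (x - y) * (heat_kernel 1 1 s r (y - z) * \<bar>f z\<bar>)" for y z
      by (simp add: F_def abs_mult abs_of_nonneg[OF heat_kernel_nonneg[OF s t]] abs_of_nonneg[OF heat_kernel_nonneg[OF s r]])
    have fa: "\<bar>\<bar>f y\<bar>\<bar> \<le> B" for y using B by simp
    have "(\<lambda>y. LINT z|lborel. norm (F y z)) = (\<lambda>y. heat_kernel 1 1 s t (x - y) * heat s r (\<lambda>z. \<bar>f z\<bar>) y)"
      unfolding e heat_semigroup_pos[OF r] by simp
    moreover have "integrable lborel (\<lambda>y. heat_kernel 1 1 s t (x - y) * heat s r (\<lambda>z. \<bar>f z\<bar>) y)"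
      by (rule integrable_heat_kernel_mult[OF t borel_measurable_heat_semigroup heat_semigroup_bound[OF _ _ fa]])
         (use r in auto)
    ultimately show "integrable lborel (\<lambda>y. LINT z|lborel. norm (case (y, z) of (y, z) \<Rightarrow> F y z))" by simp
  qed
  have inner: "(LINT y|lborel. F y z) = heat_kernel 1 1 s (t + r) (x - z) * f z" for z
  proof -
    have "(LINT y|lborel. F y z) = f z * (LINT y|lborel. heat_kernel 1 1 s t (x - y) * heat_kernel 1 1 s r (y - z))"
      by (simp add: F_def mult_ac flip: integral_mult_right_zero)
    also have "(LINT y|lborel. heat_kernel 1 1 s t (x - y) * heat_kernel 1 1 s r (y - z)) =
        (LINT y|lborel. heat_kernel 1 1 s t (x - z - y) * heat_kernel 1 1 s r y)"
      using lborel_integral_affine[of 1 "\<lambda>y. heat_kernel 1 1 s t (x - y) * heat_kernel 1 1 s r (y - z)" z]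
      by (simp add: algebra_simps)
    finally show ?thesis by (simp add: heat_kernel_convolution[OF t r])
  qed
  have "heat s t (heat s r f) x = (LINT y|lborel. (LINT z|lborel. F y z))"
    unfolding heat_semigroup_pos[OF t] heat_semigroup_pos[OF r] F_def by simp
  also have "\<dots> = (LINT z|lborel. (LINT y|lborel. F y z))"
    using lborel_pair.Fubini_integral[OF Fi] by simp
  also have "\<dots> = heat s (t + r) f x"
    using t r unfolding inner by (simp add: heat_semigroup_pos)
  finally show ?thesis .
next
  case True
  have [simp]: "heat s 0 g = g" for g :: "'a \<Rightarrow> real" by (simp add: heat_semigroup_0 fun_eq_iff)
  show ?thesis using True by auto
qed

lemma heat_semigroup_Jensen:
  fixes f :: "'a::euclidean_space \<Rightarrow> real"
  assumes t: "t \<ge> 0" and f[measurable]: "f \<in> borel_measurable borel" and B: "\<And>y. f y \<le> B"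
    and f0: "\<And>y. 0 \<le> f y" and \<theta>: "0 < \<theta>" "\<theta> \<le> 1"
  shows "heat s t (\<lambda>y. f y powr \<theta>) x \<le> heat s t f x powr \<theta>"
proof -
  have fB: "\<bar>f y\<bar> \<le> B" for y using B f0 by simp
  have fp: "\<bar>f y powr \<theta>\<bar> \<le> B powr \<theta>" for y using B f0 \<theta> by (simp add: powr_mono2)
  have E0: "0 \<le> heat s t f x"
  proof -
    have "heat s t (\<lambda>_. 0) x \<le> heat s t f x" by (rule heat_semigroup_mono[OF t _ f _ fB f0]) auto
    then show ?thesis by (simp add: heat_semigroup_const[OF t])
  qed
  have affine: "heat s t (\<lambda>y. k - c * f y) x = k - c * heat s t f x" for k c
  proof -
    have "\<bar>c * f y\<bar> \<le> \<bar>c\<bar> * B" for y using fB by (simp add: abs_mult mult_left_mono)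
    from heat_semigroup_diff[where f="\<lambda>_. k" and g="\<lambda>y. c * f y" and B="\<bar>k\<bar>", OF t _ _ _ this] show ?thesis
      by (simp add: heat_semigroup_const[OF t] heat_semigroup_cmult)
  qed
  text \<open>Concavity enters through the tangent line of \<open>r \<mapsto> r powr \<theta>\<close> at \<open>A\<close>.\<close>
  have key: "heat s t (\<lambda>y. f y powr \<theta>) x \<le> A powr \<theta>" if A: "A > heat s t f x" for A
  proof -
    have A0: "A > 0" using A E0 by simp
    have tan: "r powr \<theta> \<le> A powr \<theta> - \<theta> * A powr (\<theta> - 1) * (A - r)" if "r \<ge> 0" for r
    proof -
      have "(r / A) powr \<theta> * 1 powr (1 - \<theta>) \<le> \<theta> * (r / A) + (1 - \<theta>) * 1"
        using Youngs_inequality_0[of \<theta> "1 - \<theta>" "r / A" 1] that A0 \<theta> by (cases "r = 0") auto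
      then have "(r / A) powr \<theta> \<le> 1 - \<theta> * ((A - r) / A)" using A0 by (simp add: field_simps)
      then have "A powr \<theta> * (r / A) powr \<theta> \<le> A powr \<theta> * (1 - \<theta> * ((A - r) / A))"
        by (intro mult_left_mono) auto
      moreover have "A powr \<theta> * (r / A) powr \<theta> = r powr \<theta>"
        using A0 that by (simp add: powr_mult[symmetric])
      moreover have "A powr (\<theta> - 1) = A powr \<theta> / A" using A0 by (simp add: powr_diff)
      moreover have "A powr \<theta> * (1 - \<theta> * ((A - r) / A)) = A powr \<theta> - \<theta> * (A powr \<theta> / A) * (A - r)"
      proof -
        have "X * (1 - q * (Y / A)) = X - q * (X / A) * Y" for X q Y :: real
          by (simp add: right_diff_distrib)
        then show ?thesis .
      qed
      ultimately show ?thesis by simp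
    qed
    have "heat s t (\<lambda>y. f y powr \<theta>) x \<le> heat s t (\<lambda>y. (A powr \<theta> - \<theta> * A powr (\<theta> - 1) * A) - (- (\<theta> * A powr (\<theta> - 1))) * f y) x"
    proof (rule heat_semigroup_mono[OF t])
      show "\<bar>(A powr \<theta> - \<theta> * A powr (\<theta> - 1) * A) - (- (\<theta> * A powr (\<theta> - 1))) * f y\<bar>
         \<le> \<bar>A powr \<theta> - \<theta> * A powr (\<theta> - 1) * A\<bar> + \<theta> * A powr (\<theta> - 1) * B" for y
        using \<theta> f0 B by (intro abs_triangle_ineq4[THEN order_trans] add_left_mono) (auto simp: abs_mult intro!: mult_left_mono)
      show "f y powr \<theta> \<le> (A powr \<theta> - \<theta> * A powr (\<theta> - 1) * A) - (- (\<theta> * A powr (\<theta> - 1))) * f y" for y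
        using tan[OF f0[of y]] by (simp add: algebra_simps)
    qed (use fp in auto)
    also have "\<dots> = (A powr \<theta> - \<theta> * A powr (\<theta> - 1) * A) - (- (\<theta> * A powr (\<theta> - 1))) * heat s t f x"
      by (rule affine)
    also have "\<dots> = A powr \<theta> - \<theta> * A powr (\<theta> - 1) * (A - heat s t f x)" by (simp add: algebra_simps)
    also have "\<dots> \<le> A powr \<theta>" using A \<theta> by simp
    finally show ?thesis .
  qed
  \<comment> \<open>The heat value may be 0, where the power need not have a tangent line; this is
    why \<open>A\<close> lies strictly above it and tends to it only now.\<close>
  have "((\<lambda>A. A powr \<theta>) \<longlongrightarrow> heat s t f x powr \<theta>) (at_right (heat s t f x))"
    using \<theta> E0 by (intro tendsto_powr2) (auto simp: eventually_at_filter)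
  then show ?thesis
    by (rule tendsto_lowerbound) (auto simp: eventually_at_filter key)
qed

text \<open>Convolution of an integrable function with a bounded kernel. Applied to |u0|^q this is
  the source of all decay in time in part (iii).\<close>

lemma heat_semigroup_L1_bound:
  shows "\<exists>C>0. \<forall>t>0. \<forall>f. \<forall>x::'a::euclidean_space. integrable lborel f \<longrightarrow> (\<forall>y. 0 \<le> f y) \<longrightarrow>
    heat s t f x \<le> C * t powr - (real DIM('a) / (2 * s)) * (LINT y|lborel. f y)"
proof -
  obtain C where C: "C > 0" "\<And>t x::'a. t > 0 \<Longrightarrow> heat_kernel 1 1 s t x \<le> C * t powr - (real DIM('a) / (2 * s))"
    using heat_kernel_bound[OF s, where 'a='a] by blast
  have "heat s t f x \<le> C * t powr - (real DIM('a) / (2 * s)) * (LINT y|lborel. f y)"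
    if t: "t > 0" and f: "integrable lborel f" "\<And>y. 0 \<le> f y" for t f and x :: 'a
  proof -
    let ?K = "C * t powr - (real DIM('a) / (2 * s))"
    have [measurable]: "heat_kernel 1 1 s t \<in> borel_measurable (borel :: 'a measure)"
      by (rule borel_measurable_heat_kernel[OF t])
    have [measurable]: "f \<in> borel_measurable borel" using f(1) by simp
    have le: "heat_kernel 1 1 s t (x - y) * f y \<le> ?K * f y" for y
      using C(2)[OF t] f(2) by (intro mult_right_mono)
    have "integrable lborel (\<lambda>y. heat_kernel 1 1 s t (x - y) * f y)"
      by (rule Bochner_Integration.integrable_bound[OF integrable_mult_right[OF f(1), of ?K]])
         (use le f(2) C(1) in \<open>auto simp: abs_mult abs_of_nonneg[OF heat_kernel_nonneg[OF s t]]\<close>)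
    then have "heat s t f x \<le> (LINT y|lborel. ?K * f y)"
      unfolding heat_semigroup_pos[OF t] using f le by (intro integral_mono) auto
    then show ?thesis by simp
  qed
  with C(1) show ?thesis by blast
qed

section \<open>Continuity and decay of the evolution\<close>

lemma continuous_on_heat_semigroup:
  fixes f :: "'a::euclidean_space \<Rightarrow> real"
  assumes t: "t \<ge> 0" and f: "continuous_on UNIV f" and B: "\<And>y. \<bar>f y\<bar> \<le> B"
  shows "continuous_on UNIV (heat s t f)"
proof (cases "t = 0")
  case False
  then have t: "t > 0" using t by simp
  have fm[measurable]: "f \<in> borel_measurable borel" using f by (rule borel_measurable_continuous_onI)
  have [measurable]: "heat_kernel 1 1 s t \<in> borel_measurable (borel :: 'a measure)"
    by (rule borel_measurable_heat_kernel[OF t])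
  have "isCont (heat s t f) x" for x
    unfolding continuous_at_sequentially comp_def
  proof (intro allI impI)
    fix X :: "nat \<Rightarrow> 'a" assume X: "X \<longlonglongrightarrow> x"
    show "(\<lambda>n. heat s t f (X n)) \<longlonglongrightarrow> heat s t f x"
      unfolding heat_semigroup_pos'[OF t fm]
    proof (rule integral_dominated_convergence[where w="\<lambda>y. heat_kernel 1 1 s t y * B"])
      show "AE y in lborel. (\<lambda>n. heat_kernel 1 1 s t y * f (X n - y)) \<longlonglongrightarrow> heat_kernel 1 1 s t y * f (x - y)"
        using f X by (intro AE_I2 tendsto_intros continuous_on_tendsto_compose[OF f]) auto
      show "AE y in lborel. norm (heat_kernel 1 1 s t y * f (X n - y)) \<le> heat_kernel 1 1 s t y * B" for n
        using B by (intro AE_I2) (auto simp: abs_mult abs_of_nonneg[OF heat_kernel_nonneg[OF s t]] heat_kernel_nonneg[OF s t] intro!: mult_left_mono)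
    qed (auto intro!: integrable_mult_left integrable_heat_kernel t)
  qed
  then show ?thesis by (simp add: continuous_on_eq_continuous_at)
next
  case True
  then have "heat s t f = f" by (simp add: heat_semigroup_0 fun_eq_iff)
  then show ?thesis using f by simp
qed

lemma heat_semigroup_at_infinity:
  fixes f :: "'a::euclidean_space \<Rightarrow> real"
  assumes t: "t \<ge> 0" and f: "continuous_on UNIV f" and B: "\<And>y. \<bar>f y\<bar> \<le> B"
    and lim: "(f \<longlongrightarrow> 0) at_infinity"
  shows "(heat s t f \<longlongrightarrow> 0) at_infinity"
proof (cases "t = 0")
  case False
  then have t: "t > 0" using t by simp
  have fm[measurable]: "f \<in> borel_measurable borel" using f by (rule borel_measurable_continuous_onI)
  have [measurable]: "heat_kernel 1 1 s t \<in> borel_measurable (borel :: 'a measure)"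
    by (rule borel_measurable_heat_kernel[OF t])
  have seq: "(\<lambda>n. heat s t f (X n)) \<longlonglongrightarrow> 0" if X: "filterlim X at_infinity sequentially" for X :: "nat \<Rightarrow> 'a"
  proof -
    have "(\<lambda>n. heat s t f (X n)) \<longlonglongrightarrow> (LINT y::'a|lborel. heat_kernel 1 1 s t y * 0)"
      unfolding heat_semigroup_pos'[OF t fm]
    proof (rule integral_dominated_convergence[where w="\<lambda>y. heat_kernel 1 1 s t y * B"])
      have "filterlim (\<lambda>n. X n - y) at_infinity sequentially" for y
      proof -
        have "filterlim (\<lambda>n. - y + X n) at_infinity sequentially"
          by (rule tendsto_add_filterlim_at_infinity[OF tendsto_const X])
        then show ?thesis by simp
      qed
      then show "AE y in lborel. (\<lambda>n. heat_kernel 1 1 s t y * f (X n - y)) \<longlonglongrightarrow> heat_kernel 1 1 s t y * 0"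
        by (intro AE_I2 tendsto_mult tendsto_const filterlim_compose[OF lim])
      show "AE y in lborel. norm (heat_kernel 1 1 s t y * f (X n - y)) \<le> heat_kernel 1 1 s t y * B" for n
        using B by (intro AE_I2) (auto simp: abs_mult abs_of_nonneg[OF heat_kernel_nonneg[OF s t]] heat_kernel_nonneg[OF s t] intro!: mult_left_mono)
    qed (auto intro!: integrable_mult_left integrable_heat_kernel t)
    then show ?thesis by simp
  qed
  show ?thesis
  proof (rule ccontr)
    assume "\<not> ?thesis"
    then obtain e where e: "e > 0" "\<not> (\<forall>\<^sub>F x in at_infinity. dist (heat s t f x) 0 < e)"
      unfolding tendsto_iff by blast
    then have "\<exists>x. norm x \<ge> real n \<and> \<not> dist (heat s t f x) 0 < e" for n :: nat
      unfolding eventually_at_infinity by blast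
    then obtain X where X: "\<And>n. norm (X n) \<ge> real n" "\<And>n. \<not> dist (heat s t f (X n)) 0 < e"
      by metis
    have "filterlim (\<lambda>n. norm (X n)) at_top sequentially"
      by (rule filterlim_at_top_mono[OF filterlim_real_sequentially]) (use X in auto)
    then have "filterlim X at_infinity sequentially"
      by (rule filterlim_norm_at_top_imp_at_infinity)
    from seq[OF this] have "\<forall>\<^sub>F n in sequentially. dist (heat s t f (X n)) 0 < e"
      using e(1) by (rule tendstoD)
    then show False using X(2) by (auto simp: eventually_sequentially)
  qed
next
  case True
  then have "heat s t f = f" by (simp add: heat_semigroup_0 fun_eq_iff)
  then show ?thesis using lim by simp
qed

text \<open>1 - exp (- |z|^2) replaces the indicator of the complement of a ball: it is small only
  near 0, and its integral against the kernel is known from \<open>heat_kernel_gaussian\<close> at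
  frequency 0 with c = 1.\<close>

lemma heat_kernel_concentrates:
  "((\<lambda>t. LINT z::'a::euclidean_space|lborel. heat_kernel 1 1 s t z * (1 - exp (- (norm z)\<^sup>2))) \<longlongrightarrow> 0) (at_right 0)"
proof -
  let ?J = "\<lambda>t. (LINT y::'a|lborel. heat_symbol s t (2 *\<^sub>R y) * exp (- (norm y)\<^sup>2)) / pi powr (real DIM('a) / 2)"
  have e: "(LINT z::'a|lborel. heat_kernel 1 1 s t z * (1 - exp (- (norm z)\<^sup>2))) = 1 - ?J t" if t: "t > 0" for t
    using heat_kernel_gaussian[OF t, of 1 "0::'a"] integrable_heat_kernel[OF t, where 'a='a]
    by (simp add: right_diff_distrib)
  have "(?J \<longlongrightarrow> (LINT y::'a|lborel. 1 * exp (- (norm y)\<^sup>2)) / pi powr (real DIM('a) / 2)) (at_right 0)"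
  proof (intro tendsto_divide tendsto_const)
    show "((\<lambda>t. LINT y::'a|lborel. heat_symbol s t (2 *\<^sub>R y) * exp (- (norm y)\<^sup>2)) \<longlongrightarrow>
      (LINT y::'a|lborel. 1 * exp (- (norm y)\<^sup>2))) (at_right 0)"
      unfolding tendsto_at_iff_sequentially comp_def
    proof (intro allI impI)
      fix X :: "nat \<Rightarrow> real" assume X: "\<forall>i. X i \<in> {0<..} - {0}" "X \<longlonglongrightarrow> 0"
      show "(\<lambda>i. LINT y::'a|lborel. heat_symbol s (X i) (2 *\<^sub>R y) * exp (- (norm y)\<^sup>2)) \<longlonglongrightarrow> (LINT y::'a|lborel. 1 * exp (- (norm y)\<^sup>2))"
      proof (rule integral_dominated_convergence[where w="\<lambda>y. exp (- (norm y)\<^sup>2)"])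
        show "AE y::'a in lborel. (\<lambda>i. heat_symbol s (X i) (2 *\<^sub>R y) * exp (- (norm y)\<^sup>2)) \<longlonglongrightarrow> 1 * exp (- (norm y)\<^sup>2)"
        proof (intro AE_I2 tendsto_mult tendsto_const)
          fix y :: 'a
          have "(\<lambda>i. heat_symbol s (X i) (2 *\<^sub>R y)) \<longlonglongrightarrow> exp (- 0 * ((norm (2 *\<^sub>R y))\<^sup>2 + norm (2 *\<^sub>R y) powr (2 * s)))"
            unfolding heat_symbol_def by (intro tendsto_intros X)
          then show "(\<lambda>i. heat_symbol s (X i) (2 *\<^sub>R y)) \<longlonglongrightarrow> 1" by simp
        qed
        have "heat_symbol s (X i) (2 *\<^sub>R y) \<le> 1" for i and y :: 'a
          using heat_symbol_bounds(2)[of "X i" s "2 *\<^sub>R y"] X(1)[rule_format, of i] by (simp add: less_imp_le)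
        then show "AE y::'a in lborel. norm (heat_symbol s (X i) (2 *\<^sub>R y) * exp (- (norm y)\<^sup>2)) \<le> exp (- (norm y)\<^sup>2)" for i
          by (intro AE_I2) (auto simp: abs_mult abs_of_pos[OF heat_symbol_bounds(1)])
      qed (auto intro: gaussian_integral)
    qed
  qed auto
  then have "((\<lambda>t. 1 - ?J t) \<longlongrightarrow> 1 - 1) (at_right 0)"
    by (intro tendsto_diff tendsto_const) (simp add: gaussian_integral)
  then have "((\<lambda>t. 1 - ?J t) \<longlongrightarrow> 0) (at_right 0)" by simp
  then show ?thesis
    by (rule Lim_transform_eventually) (auto simp: eventually_at_filter e)
qed

lemma C0_uniformly_continuous:
  fixes f :: "'a::euclidean_space \<Rightarrow> real"
  assumes f: "continuous_on UNIV f" and lim: "(f \<longlongrightarrow> 0) at_infinity" and e: "e > 0"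
  shows "\<exists>d>0. \<forall>x y. dist x y < d \<longrightarrow> dist (f x) (f y) < e"
proof -
  have "\<forall>\<^sub>F x in at_infinity. dist (f x) 0 < e / 2" using lim e by (intro tendstoD) auto
  then obtain K where K: "\<And>x. norm x \<ge> K \<Longrightarrow> dist (f x) 0 < e / 2"
    unfolding eventually_at_infinity by blast
  have "uniformly_continuous_on (cball 0 (K + 1)) f"
    by (rule compact_uniformly_continuous) (use f in \<open>auto intro: continuous_on_subset\<close>)
  then obtain d where d: "d > 0" "\<And>x y. x \<in> cball 0 (K + 1) \<Longrightarrow> y \<in> cball 0 (K + 1) \<Longrightarrow> dist y x < d \<Longrightarrow> dist (f y) (f x) < e"
    unfolding uniformly_continuous_on_def using e by metis
  have "dist (f x) (f y) < e" if xy: "dist x y < min d 1" for x y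
  proof (cases "norm x \<le> K \<or> norm y \<le> K")
    case True
    have "norm x \<le> norm y + dist x y" "norm y \<le> norm x + dist x y"
      using norm_triangle_sub[of x y] norm_triangle_sub[of y x] by (auto simp: dist_norm norm_minus_commute)
    then have "x \<in> cball 0 (K + 1)" "y \<in> cball 0 (K + 1)" using True xy by auto
    then show ?thesis using d(2)[of y x] xy by auto
  next
    case False
    then have "dist (f x) 0 < e / 2" "dist (f y) 0 < e / 2" using K by auto
    then show ?thesis using dist_triangle2[of "f x" "f y" 0] by linarith
  qed
  then show ?thesis using d(1) by (intro exI[of _ "min d 1"]) auto
qed

lemma heat_semigroup_strongly_continuous:
  fixes f :: "'a::euclidean_space \<Rightarrow> real"
  assumes f: "continuous_on UNIV f" and B: "\<And>y. \<bar>f y\<bar> \<le> B" and lim: "(f \<longlongrightarrow> 0) at_infinity" and e: "e > 0"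
  shows "\<exists>d>0. \<forall>t. 0 \<le> t \<and> t < d \<longrightarrow> (\<forall>x. \<bar>heat s t f x - f x\<bar> \<le> e)"
proof -
  have fm[measurable]: "f \<in> borel_measurable borel" using f by (rule borel_measurable_continuous_onI)
  have B0: "B \<ge> 0" using B[of 0] by simp
  obtain \<delta> where \<delta>: "\<delta> > 0" "\<And>x y. dist x y < \<delta> \<Longrightarrow> dist (f x) (f y) < e / 2"
    using C0_uniformly_continuous[OF f lim, of "e / 2"] e by auto
  \<comment> \<open>A lower bound of 1 - exp (- |y|^2) outside the \<delta>-ball, so that with
    \<open>M\<close> = 2 B / \<kappa> the second term of the estimate covers the trivial bound 2 B
    there.\<close>
  define \<kappa> where "\<kappa> = 1 - exp (- \<delta>\<^sup>2)"
  have \<kappa>: "\<kappa> > 0" using \<delta> by (simp add: \<kappa>_def)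
  define M where "M = 2 * B / \<kappa>"
  have M: "M \<ge> 0" using B0 \<kappa> by (simp add: M_def)
  have pt: "\<bar>f (x - y) - f x\<bar> \<le> e / 2 + M * (1 - exp (- (norm y)\<^sup>2))" for x y
  proof (cases "norm y < \<delta>")
    case True
    then have "\<bar>f (x - y) - f x\<bar> < e / 2" using \<delta>(2)[of "x - y" x] by (simp add: dist_norm)
    moreover have "0 \<le> M * (1 - exp (- (norm y)\<^sup>2))" using M by (intro mult_nonneg_nonneg) auto
    ultimately show ?thesis by linarith
  next
    case False
    have "\<kappa> \<le> 1 - exp (- (norm y)\<^sup>2)"
      unfolding \<kappa>_def using False \<delta> by (simp add: power_mono)
    then have "M * \<kappa> \<le> M * (1 - exp (- (norm y)\<^sup>2))" using M by (rule mult_left_mono)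
    moreover have "M * \<kappa> = 2 * B" using \<kappa> by (simp add: M_def)
    moreover have "\<bar>f (x - y) - f x\<bar> \<le> 2 * B" using B[of "x - y"] B[of x] by linarith
    ultimately show ?thesis using e by linarith
  qed
  have "\<forall>\<^sub>F t in at_right 0. (LINT z::'a|lborel. heat_kernel 1 1 s t z * (1 - exp (- (norm z)\<^sup>2))) < e / 2 / (M + 1)"
    using heat_kernel_concentrates[where 'a='a] e M by (intro order_tendstoD) auto
  then obtain d where d: "d > 0" "\<And>t. 0 < t \<Longrightarrow> t < d \<Longrightarrow> (LINT z::'a|lborel. heat_kernel 1 1 s t z * (1 - exp (- (norm z)\<^sup>2))) < e / 2 / (M + 1)"
    unfolding eventually_at_right_field by auto
  have "\<bar>heat s t f x - f x\<bar> \<le> e" if t: "0 \<le> t" "t < d" for t x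
  proof (cases "t = 0")
    case False
    then have t0: "t > 0" using t by simp
    have [measurable]: "heat_kernel 1 1 s t \<in> borel_measurable (borel :: 'a measure)"
      by (rule borel_measurable_heat_kernel[OF t0])
    note P = integrable_heat_kernel[OF t0, where 'a='a]
    have iP: "integrable lborel (\<lambda>z::'a. heat_kernel 1 1 s t z * (1 - exp (- (norm z)\<^sup>2)))"
      by (rule Bochner_Integration.integrable_bound[OF P(1)])
         (auto simp: abs_mult heat_kernel_nonneg[OF s t0] intro!: mult_right_le_one_le)
    have i: "integrable lborel (\<lambda>y. heat_kernel 1 1 s t y * f (x - y))"
      by (rule Bochner_Integration.integrable_bound[OF integrable_mult_left[OF P(1), of B]])
         (use B B0 in \<open>auto simp: abs_mult intro!: mult_left_mono\<close>)
    have d0: "heat s t f x - f x = (LINT y|lborel. heat_kernel 1 1 s t y * f (x - y) - heat_kernel 1 1 s t y * f x)"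
      unfolding heat_semigroup_pos'[OF t0 fm] using i P by simp
    have "\<bar>heat s t f x - f x\<bar> \<le> (LINT y|lborel. \<bar>heat_kernel 1 1 s t y * f (x - y) - heat_kernel 1 1 s t y * f x\<bar>)"
      unfolding d0 by (rule integral_abs_bound)
    also have "\<dots> \<le> (LINT y|lborel. e / 2 * heat_kernel 1 1 s t y + M * (heat_kernel 1 1 s t y * (1 - exp (- (norm (y::'a))\<^sup>2))))"
    proof (rule integral_mono)
      show "integrable lborel (\<lambda>y. \<bar>heat_kernel 1 1 s t y * f (x - y) - heat_kernel 1 1 s t y * f x\<bar>)"
        using i P by (intro integrable_abs Bochner_Integration.integrable_diff integrable_mult_left) auto
      show "integrable lborel (\<lambda>y::'a. e / 2 * heat_kernel 1 1 s t y + M * (heat_kernel 1 1 s t y * (1 - exp (- (norm y)\<^sup>2))))"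
        using iP P by (intro Bochner_Integration.integrable_add integrable_mult_right) auto
      fix y :: 'a
      have "\<bar>heat_kernel 1 1 s t y * f (x - y) - heat_kernel 1 1 s t y * f x\<bar> = heat_kernel 1 1 s t y * \<bar>f (x - y) - f x\<bar>"
        using heat_kernel_nonneg[OF s t0, of y] by (simp add: abs_mult flip: right_diff_distrib)
      also have "\<dots> \<le> heat_kernel 1 1 s t y * (e / 2 + M * (1 - exp (- (norm y)\<^sup>2)))"
        using pt heat_kernel_nonneg[OF s t0, of y] by (rule mult_left_mono)
      finally show "\<bar>heat_kernel 1 1 s t y * f (x - y) - heat_kernel 1 1 s t y * f x\<bar> \<le> e / 2 * heat_kernel 1 1 s t y + M * (heat_kernel 1 1 s t y * (1 - exp (- (norm y)\<^sup>2)))"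
        by (simp add: algebra_simps)
    qed
    also have "\<dots> = e / 2 + M * (LINT z::'a|lborel. heat_kernel 1 1 s t z * (1 - exp (- (norm z)\<^sup>2)))"
      using iP P by simp
    also have "\<dots> \<le> e / 2 + M * (e / 2 / (M + 1))"
      using d(2)[OF t0 t(2)] M by (intro add_left_mono mult_left_mono) auto
    also have "\<dots> \<le> e"
      using e M by (simp add: field_simps)
    finally show ?thesis .
  qed (use e in \<open>simp add: heat_semigroup_0\<close>)
  with d(1) show ?thesis by blast
qed

end

text \<open>Needed for the Duhamel integral, whose integrand takes values in the bounded continuous
  functions.\<close>

instance bcontfun :: (metric_space, banach) banach ..

section \<open>Global existence for small data\<close>

lemma powr_diff_le:
  fixes a b p :: real
  assumes "0 \<le> a" "a \<le> b" "1 < p"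
  shows "b powr p - a powr p \<le> p * b powr (p - 1) * (b - a)"
proof -
  define p' where "p' = p / (p - 1)"
  have p': "p' > 1" "1 / p + 1 / p' = 1" using assms by (auto simp: p'_def field_simps)
  \<comment> \<open>The tangent-line inequality for the convex power is Young's inequality
    rearranged; in this form the value 0 needs no separate case.\<close>
  have "a * b powr (p - 1) \<le> a powr p / p + (b powr (p - 1)) powr p' / p'"
    by (rule Youngs_inequality) (use assms p' in auto)
  also have "(b powr (p - 1)) powr p' = b powr p" using assms by (simp add: powr_powr p'_def)
  finally have "p * (a * b powr (p - 1)) \<le> p * (a powr p / p + b powr p / p')"
    using assms by (intro mult_left_mono) auto
  also have "\<dots> = a powr p + (p - 1) * b powr p" using assms by (simp add: p'_def field_simps)
  finally have "p * (a * b powr (p - 1)) \<le> a powr p + (p - 1) * b powr p" .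
  moreover have "b * b powr (p - 1) = b powr p"
    using assms powr_mult_base[of b "p - 1"] by simp
  ultimately show ?thesis by (simp add: algebra_simps)
qed

lemma abs_powr_diff_le:
  fixes a b p M :: real
  assumes "\<bar>a\<bar> \<le> M" "\<bar>b\<bar> \<le> M" "1 < p"
  shows "\<bar>\<bar>a\<bar> powr p - \<bar>b\<bar> powr p\<bar> \<le> p * M powr (p - 1) * \<bar>a - b\<bar>"
proof -
  have *: "\<bar>v\<bar> powr p - \<bar>u\<bar> powr p \<le> p * M powr (p - 1) * \<bar>a - b\<bar> \<and> \<bar>u\<bar> powr p \<le> \<bar>v\<bar> powr p"
    if "\<bar>u\<bar> \<le> \<bar>v\<bar>" "\<bar>v\<bar> \<le> M" "\<bar>v\<bar> - \<bar>u\<bar> \<le> \<bar>a - b\<bar>" for u v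
  proof -
    have "\<bar>v\<bar> powr p - \<bar>u\<bar> powr p \<le> p * \<bar>v\<bar> powr (p - 1) * (\<bar>v\<bar> - \<bar>u\<bar>)"
      by (rule powr_diff_le) (use that assms in auto)
    also have "\<dots> \<le> p * M powr (p - 1) * \<bar>a - b\<bar>"
      using that assms by (intro mult_mono powr_mono2) auto
    finally show ?thesis using that assms by (auto intro!: powr_mono2)
  qed
  show ?thesis
    using *[of a b] *[of b a] assms by (cases "\<bar>a\<bar> \<le> \<bar>b\<bar>") auto
qed

definition abs_powr_bcf :: "real \<Rightarrow> ('a::euclidean_space \<Rightarrow>\<^sub>C real) \<Rightarrow> 'a \<Rightarrow>\<^sub>C real" where
  "abs_powr_bcf p f = Bcontfun (\<lambda>x. \<bar>apply_bcontfun f x\<bar> powr p)"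

lemma bcontfun_abs_le: "\<bar>apply_bcontfun f x\<bar> \<le> norm f"
  for f :: "'a::euclidean_space \<Rightarrow>\<^sub>C real"
  using norm_bounded[of f x] by simp

lemma apply_abs_powr_bcf:
  fixes f :: "'a::euclidean_space \<Rightarrow>\<^sub>C real"
  assumes "p > 0"
  shows "apply_bcontfun (abs_powr_bcf p f) x = \<bar>apply_bcontfun f x\<bar> powr p"
proof -
  have "(\<lambda>x. \<bar>apply_bcontfun f x\<bar> powr p) \<in> bcontfun"
  proof (rule bcontfun_normI)
    show "continuous_on UNIV (\<lambda>x. \<bar>apply_bcontfun f x\<bar> powr p)"
      using assms by (intro continuous_on_powr' continuous_intros) auto
    show "norm (\<bar>apply_bcontfun f x\<bar> powr p) \<le> norm f powr p" for x
      using assms bcontfun_abs_le[of f x] by (simp add: powr_mono2)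
  qed
  then show ?thesis by (simp add: abs_powr_bcf_def Bcontfun_inverse)
qed

lemma abs_powr_bcf_C0:
  assumes "f \<in> C0" "p > 0"
  shows "abs_powr_bcf p f \<in> C0"
proof -
  have "((\<lambda>x. \<bar>apply_bcontfun f x\<bar> powr p) \<longlongrightarrow> \<bar>0\<bar> powr p) at_infinity"
    using assms unfolding C0_def by (intro tendsto_powr2 tendsto_intros) auto
  then show ?thesis using assms by (simp add: C0_def apply_abs_powr_bcf[OF assms(2), abs_def])
qed

lemma dist_abs_powr_bcf:
  fixes f g :: "'a::euclidean_space \<Rightarrow>\<^sub>C real"
  assumes "norm f \<le> M" "norm g \<le> M" "1 < p"
  shows "dist (abs_powr_bcf p f) (abs_powr_bcf p g) \<le> p * M powr (p - 1) * dist f g"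
proof (rule dist_bound)
  fix x
  have "\<bar>apply_bcontfun f x\<bar> \<le> M" "\<bar>apply_bcontfun g x\<bar> \<le> M"
    using bcontfun_abs_le[of f x] bcontfun_abs_le[of g x] assms by auto
  then have "dist (apply_bcontfun (abs_powr_bcf p f) x) (apply_bcontfun (abs_powr_bcf p g) x)
      \<le> p * M powr (p - 1) * dist (apply_bcontfun f x) (apply_bcontfun g x)"
    using abs_powr_diff_le[of "apply_bcontfun f x" M "apply_bcontfun g x" p] assms by (simp add: apply_abs_powr_bcf dist_real_def)
  also have "\<dots> \<le> p * M powr (p - 1) * dist f g"
    using assms dist_bounded[of f x g] by (intro mult_left_mono) auto
  finally show "dist (apply_bcontfun (abs_powr_bcf p f) x) (apply_bcontfun (abs_powr_bcf p g) x) \<le> p * M powr (p - 1) * dist f g" .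
qed

lemma continuous_on_abs_powr_bcf:
  fixes u :: "'b::metric_space \<Rightarrow> 'a::euclidean_space \<Rightarrow>\<^sub>C real"
  assumes u: "continuous_on X u" "\<And>x. x \<in> X \<Longrightarrow> norm (u x) \<le> M" and p: "1 < p"
  shows "continuous_on X (\<lambda>x. abs_powr_bcf p (u x))"
  unfolding continuous_on_def
proof
  fix x assume x: "x \<in> X"
  show "((\<lambda>y. abs_powr_bcf p (u y)) \<longlongrightarrow> abs_powr_bcf p (u x)) (at x within X)"
  proof (rule tendsto_dist_iff[THEN iffD2], rule Lim_null_comparison)
    show "\<forall>\<^sub>F y in at x within X. norm (dist (abs_powr_bcf p (u y)) (abs_powr_bcf p (u x))) \<le> p * M powr (p - 1) * dist (u y) (u x)"
      using u(2) x p by (auto simp: eventually_at_filter intro!: always_eventually dist_abs_powr_bcf)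
    have "((\<lambda>y. dist (u y) (u x)) \<longlongrightarrow> 0) (at x within X)"
      using u(1) x by (simp add: continuous_on_def flip: tendsto_dist_iff)
    then show "((\<lambda>y. p * M powr (p - 1) * dist (u y) (u x)) \<longlongrightarrow> 0) (at x within X)"
      by (rule tendsto_mult_right_zero)
  qed
qed

lemma bounded_linear_apply_bcontfun: "bounded_linear (\<lambda>f. apply_bcontfun f x)"
  for x :: "'a::euclidean_space"
  by (rule bounded_linear_intro[where K=1]) (auto simp: norm_bounded)

lemma bcontfun_borel: "apply_bcontfun f \<in> borel_measurable borel"
  for f :: "'a::euclidean_space \<Rightarrow>\<^sub>C real"
  by (intro borel_measurable_continuous_onI continuous_on_apply_bcontfun)

context
  fixes s :: real
  assumes s: "0 < s" "s < 1"
begin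

section \<open>The semigroup and the Duhamel term on \<open>C0\<close>\<close>

definition heat_bcf :: "real \<Rightarrow> ('a::euclidean_space \<Rightarrow>\<^sub>C real) \<Rightarrow> 'a \<Rightarrow>\<^sub>C real" where
  "heat_bcf t f = Bcontfun (heat s t (apply_bcontfun f))"

lemma apply_heat_bcf:
  fixes f :: "'a::euclidean_space \<Rightarrow>\<^sub>C real"
  assumes "t \<ge> 0"
  shows "apply_bcontfun (heat_bcf t f) = heat s t (apply_bcontfun f)"
proof -
  have "heat s t (apply_bcontfun f) \<in> bcontfun"
  proof (rule bcontfun_normI)
    show "continuous_on UNIV (heat s t (apply_bcontfun f))"
      by (rule continuous_on_heat_semigroup[OF s assms _ bcontfun_abs_le]) simp
    show "norm (heat s t (apply_bcontfun f) x) \<le> norm f" for x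
      using heat_semigroup_bound[OF s assms bcontfun_borel bcontfun_abs_le] by simp
  qed
  then show ?thesis by (simp add: heat_bcf_def Bcontfun_inverse)
qed

lemma heat_bcf_0: "heat_bcf 0 f = f"
  by (rule bcontfun_eqI) (simp add: apply_heat_bcf heat_semigroup_0[OF s])

lemma heat_bcf_add: "t \<ge> 0 \<Longrightarrow> r \<ge> 0 \<Longrightarrow> heat_bcf t (heat_bcf r f) = heat_bcf (t + r) f"
  by (rule bcontfun_eqI) (simp add: apply_heat_bcf heat_semigroup_add[OF s _ _ bcontfun_borel bcontfun_abs_le])

lemma dist_heat_bcf: "t \<ge> 0 \<Longrightarrow> dist (heat_bcf t f) (heat_bcf t g) \<le> dist f g"
proof (rule dist_bound)
  fix x :: 'a assume t: "t \<ge> 0"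
  have "dist (apply_bcontfun (heat_bcf t f) x) (apply_bcontfun (heat_bcf t g) x) = \<bar>heat s t (\<lambda>y. apply_bcontfun f y - apply_bcontfun g y) x\<bar>"
    by (simp add: apply_heat_bcf t dist_real_def heat_semigroup_diff[OF s t bcontfun_borel bcontfun_borel bcontfun_abs_le bcontfun_abs_le])
  also have "\<dots> \<le> dist f g"
    by (rule heat_semigroup_bound[OF s t])
       (use dist_bounded[of f _ g] bcontfun_borel[of f] bcontfun_borel[of g] in \<open>auto simp: dist_real_def\<close>)
  finally show "dist (apply_bcontfun (heat_bcf t f) x) (apply_bcontfun (heat_bcf t g) x) \<le> dist f g" .
qed

lemma heat_bcf_C0: "t \<ge> 0 \<Longrightarrow> f \<in> C0 \<Longrightarrow> heat_bcf t f \<in> C0"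
  by (simp add: C0_def apply_heat_bcf heat_semigroup_at_infinity[OF s _ _ bcontfun_abs_le])

lemma heat_bcf_near_0:
  assumes "f \<in> C0" "e > 0"
  shows "\<exists>d>0. \<forall>t. 0 \<le> t \<and> t < d \<longrightarrow> dist (heat_bcf t f) f \<le> e"
proof -
  obtain d where d: "d > 0" "\<And>t x. 0 \<le> t \<Longrightarrow> t < d \<Longrightarrow> \<bar>heat s t (apply_bcontfun f) x - apply_bcontfun f x\<bar> \<le> e"
    using heat_semigroup_strongly_continuous[OF s, of "apply_bcontfun f" "norm f" e] assms bcontfun_abs_le[of f]
    by (auto simp: C0_def)
  then show ?thesis
    by (intro exI[of _ d] conjI allI impI dist_bound) (auto simp: apply_heat_bcf dist_real_def)
qed

text \<open>By the semigroup law and contractivity a time increment can be moved to time 0, where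
  strong continuity applies.\<close>

lemma dist_heat_bcf_time:
  assumes "0 \<le> t" "0 \<le> r"
  shows "dist (heat_bcf t f) (heat_bcf r f) \<le> dist (heat_bcf \<bar>t - r\<bar> f) f"
proof -
  have *: "dist (heat_bcf (r + h) f) (heat_bcf r f) \<le> dist (heat_bcf h f) f" if "h \<ge> 0" "r \<ge> 0" for h r
    using dist_heat_bcf[OF that(2), of "heat_bcf h f" f] that by (simp add: heat_bcf_add)
  show ?thesis
  proof (cases "r \<le> t")
    case True
    then show ?thesis using *[of "t - r" r] assms by simp
  next
    case False
    then show ?thesis using *[of "r - t" t] assms by (simp add: dist_commute)
  qed
qed

text \<open>Contractivity makes the dependence on the function uniform in time, so strong continuity
  is needed only at the single function \<open>f x\<close>.\<close>

lemma continuous_on_heat_bcf: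
  fixes f :: "'b::metric_space \<Rightarrow> 'a::euclidean_space \<Rightarrow>\<^sub>C real"
  assumes f: "continuous_on X f" "\<And>x. x \<in> X \<Longrightarrow> f x \<in> C0"
    and \<tau>: "continuous_on X \<tau>" "\<And>x. x \<in> X \<Longrightarrow> 0 \<le> \<tau> x"
  shows "continuous_on X (\<lambda>x. heat_bcf (\<tau> x) (f x))"
  unfolding continuous_on_def
proof
  fix x assume x: "x \<in> X"
  show "((\<lambda>y. heat_bcf (\<tau> y) (f y)) \<longlongrightarrow> heat_bcf (\<tau> x) (f x)) (at x within X)"
  proof (rule tendstoI)
    fix e :: real assume e: "e > 0"
    obtain d where d: "d > 0" "\<And>t. 0 \<le> t \<Longrightarrow> t < d \<Longrightarrow> dist (heat_bcf t (f x)) (f x) \<le> e / 2"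
      using heat_bcf_near_0[OF f(2)[OF x], of "e / 2"] e by auto
    have "(f \<longlongrightarrow> f x) (at x within X)" "(\<tau> \<longlongrightarrow> \<tau> x) (at x within X)"
      using f(1) \<tau>(1) x by (auto simp: continuous_on_def)
    then have "\<forall>\<^sub>F y in at x within X. dist (f y) (f x) < e / 2" "\<forall>\<^sub>F y in at x within X. dist (\<tau> y) (\<tau> x) < d"
      using e d(1) by (auto intro: tendstoD simp del: less_divide_eq_numeral1)
    moreover have "\<forall>\<^sub>F y in at x within X. y \<in> X" by (auto simp: eventually_at_filter)
    ultimately show "\<forall>\<^sub>F y in at x within X. dist (heat_bcf (\<tau> y) (f y)) (heat_bcf (\<tau> x) (f x)) < e"
    proof eventually_elim
      case (elim y)
      have "dist (heat_bcf (\<tau> y) (f y)) (heat_bcf (\<tau> x) (f x)) \<le> dist (heat_bcf (\<tau> y) (f y)) (heat_bcf (\<tau> y) (f x)) + dist (heat_bcf (\<tau> y) (f x)) (heat_bcf (\<tau> x) (f x))"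
        by (rule dist_triangle)
      also have "\<dots> \<le> dist (f y) (f x) + dist (heat_bcf \<bar>\<tau> y - \<tau> x\<bar> (f x)) (f x)"
        using \<tau>(2) x elim by (intro add_mono dist_heat_bcf dist_heat_bcf_time) auto
      also have "dist (heat_bcf \<bar>\<tau> y - \<tau> x\<bar> (f x)) (f x) \<le> e / 2"
        using elim by (intro d) (auto simp: dist_real_def)
      finally show ?case using elim by linarith
    qed
  qed
qed

definition duhamel :: "(real \<Rightarrow> 'a::euclidean_space \<Rightarrow>\<^sub>C real) \<Rightarrow> real \<Rightarrow> 'a \<Rightarrow>\<^sub>C real" where
  "duhamel w t = integral {0..t} (\<lambda>\<tau>. heat_bcf (t - \<tau>) (w \<tau>))"

context
  fixes w :: "real \<Rightarrow> 'a::euclidean_space \<Rightarrow>\<^sub>C real"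
  assumes w: "continuous_on {0..} w" "\<And>t. t \<ge> 0 \<Longrightarrow> w t \<in> C0"
begin

lemma continuous_on_duhamel_integrand: "continuous_on {0..t} (\<lambda>\<tau>. heat_bcf (t - \<tau>) (w \<tau>))"
  by (rule continuous_on_heat_bcf) (auto intro!: continuous_intros continuous_on_subset[OF w(1)] w(2))

lemma continuous_on_duhamel_point: "continuous_on {0..t} (\<lambda>\<tau>. heat s (t - \<tau>) (apply_bcontfun (w \<tau>)) x)"
proof -
  have "continuous_on {0..t} (\<lambda>\<tau>. apply_bcontfun (heat_bcf (t - \<tau>) (w \<tau>)) x)"
    by (rule bounded_linear.continuous_on[OF bounded_linear_apply_bcontfun continuous_on_duhamel_integrand])
  then show ?thesis by (rule continuous_on_eq) (simp add: apply_heat_bcf)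
qed

lemma apply_duhamel: "apply_bcontfun (duhamel w t) x = integral {0..t} (\<lambda>\<tau>. heat s (t - \<tau>) (apply_bcontfun (w \<tau>)) x)"
proof -
  have "(\<lambda>\<tau>. heat_bcf (t - \<tau>) (w \<tau>)) integrable_on {0..t}"
    by (rule integrable_continuous_real[OF continuous_on_duhamel_integrand])
  from integral_linear[OF this bounded_linear_apply_bcontfun, of x]
  have "apply_bcontfun (duhamel w t) x = integral {0..t} (\<lambda>\<tau>. apply_bcontfun (heat_bcf (t - \<tau>) (w \<tau>)) x)"
    by (simp add: duhamel_def o_def)
  also have "\<dots> = integral {0..t} (\<lambda>\<tau>. heat s (t - \<tau>) (apply_bcontfun (w \<tau>)) x)"
    by (rule integral_cong) (simp add: apply_heat_bcf)
  finally show ?thesis .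
qed

lemma duhamel_lborel:
  "set_integrable lborel {0..t} (\<lambda>\<tau>. heat s (t - \<tau>) (apply_bcontfun (w \<tau>)) x)"
  "(LINT \<tau>:{0..t}|lborel. heat s (t - \<tau>) (apply_bcontfun (w \<tau>)) x) = apply_bcontfun (duhamel w t) x"
proof -
  show *: "set_integrable lborel {0..t} (\<lambda>\<tau>. heat s (t - \<tau>) (apply_bcontfun (w \<tau>)) x)"
    by (rule borel_integrable_atLeastAtMost'[OF continuous_on_duhamel_point])
  show "(LINT \<tau>:{0..t}|lborel. heat s (t - \<tau>) (apply_bcontfun (w \<tau>)) x) = apply_bcontfun (duhamel w t) x"
    unfolding apply_duhamel by (rule set_borel_integral_eq_integral(2)[OF *])
qed

text \<open>Freezing the integrand after time \<open>t\<close> turns \<open>duhamel w t\<close> into an integral over a fixed interval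
  with a jointly continuous integrand.\<close>

lemma continuous_on_duhamel: "continuous_on {0..} (duhamel w)"
proof -
  have *: "continuous_on {0..T} (duhamel w)" if T: "T \<ge> 0" for T
  proof -
    define G where "G t \<tau> = heat_bcf (max (t - \<tau>) 0) (w (min \<tau> t))" for t \<tau>
    have "continuous_on ({0..T} \<times> cbox 0 T) (\<lambda>(t, \<tau>). G t \<tau>)"
      unfolding G_def case_prod_beta
    proof (rule continuous_on_heat_bcf)
      show "continuous_on ({0..T} \<times> cbox 0 T) (\<lambda>x. w (min (snd x) (fst x)))"
        by (rule continuous_on_compose2[OF w(1)]) (auto intro!: continuous_intros)
    qed (auto intro!: continuous_intros w(2))
    from integral_continuous_on_param[OF this]
    have "continuous_on {0..T} (\<lambda>t. integral {0..T} (G t) - (T - t) *\<^sub>R w t)"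
      by (intro continuous_intros continuous_on_subset[OF w(1)]) auto
    moreover have "integral {0..T} (G t) - (T - t) *\<^sub>R w t = duhamel w t" if t: "t \<in> {0..T}" for t
    proof -
      have "continuous_on {0..T} (G t)"
        unfolding G_def
      proof (rule continuous_on_heat_bcf)
        show "continuous_on {0..T} (\<lambda>\<tau>. w (min \<tau> t))"
          by (rule continuous_on_compose2[OF w(1)]) (use t in \<open>auto intro!: continuous_intros\<close>)
      qed (use t in \<open>auto intro!: continuous_intros w(2)\<close>)
      then have "G t integrable_on {0..T}" by (rule integrable_continuous_real)
      then have "integral {0..T} (G t) = integral {0..t} (G t) + integral {t..T} (G t)"
        using t by (intro Henstock_Kurzweil_Integration.integral_combine[symmetric]) auto
      also have "integral {0..t} (G t) = duhamel w t"
        unfolding duhamel_def G_def by (rule integral_cong) (auto simp: max_def min_def)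
      also have "integral {t..T} (G t) = integral {t..T} (\<lambda>_. w t)"
        unfolding G_def by (rule integral_cong) (auto simp: max_def min_def heat_bcf_0)
      finally show ?thesis using t by simp
    qed
    ultimately show ?thesis by (rule continuous_on_eq)
  qed
  show ?thesis
    unfolding continuous_on_def
  proof
    fix t :: real assume t: "t \<in> {0..}"
    have "(duhamel w \<longlongrightarrow> duhamel w t) (at t within {0..t + 1})" using *[of "t + 1"] t by (auto simp: continuous_on_def)
    moreover have "at t within {0..t + 1} = at t within {0..}"
      by (rule at_within_nhd[of _ "{..<t + 1}"]) auto
    ultimately show "(duhamel w \<longlongrightarrow> duhamel w t) (at t within {0..})" by simp
  qed
qed

end

section \<open>Fixed point below the supersolution\<close>

lemma integral_le_powr:
  fixes h :: "real \<Rightarrow> real"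
  assumes h: "continuous_on {0..t} h" and t: "0 < t" and e: "e < 1"
    and le: "\<And>\<tau>. 0 < \<tau> \<Longrightarrow> \<tau> \<le> t \<Longrightarrow> h \<tau> \<le> c * \<tau> powr - e"
  shows "integral {0..t} h \<le> c * (t powr (1 - e) / (1 - e))"
proof -
  have H: "(h has_integral integral {0..t} h) {0..t}"
    using integrable_continuous_real[OF h] by (simp add: has_integral_integral)
  have "((\<lambda>\<tau>. \<tau> powr - e) has_integral (t powr (- e + 1) / (- e + 1))) {0..t}"
    using e t by (intro has_integral_powr_from_0) auto
  then have P: "((\<lambda>\<tau>. c * \<tau> powr - e) has_integral c * (t powr (- e + 1) / (- e + 1))) {0..t}"
    by (rule has_integral_mult_right)
  \<comment> \<open>\<open>0 powr - e\<close> is 0, so the majorant need not dominate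
    \<open>h\<close> at \<tau> = 0; \<open>h\<close> is therefore changed at this single
    point.\<close>
  have "((\<lambda>\<tau>. if \<tau> = 0 then c * 0 powr - e else h \<tau>) has_integral integral {0..t} h) {0..t}"
    by (rule has_integral_spike_finite[OF _ _ H, of "{0}"]) auto
  from has_integral_le[OF this P] le show ?thesis by (simp add: add.commute)
qed

lemma integral_abs_le_powr:
  fixes h :: "real \<Rightarrow> real"
  assumes h: "continuous_on {0..t} h" and t: "0 < t" and e: "e < 1"
    and le: "\<And>\<tau>. 0 < \<tau> \<Longrightarrow> \<tau> \<le> t \<Longrightarrow> \<bar>h \<tau>\<bar> \<le> c * \<tau> powr - e"
  shows "\<bar>integral {0..t} h\<bar> \<le> c * (t powr (1 - e) / (1 - e))"
proof -
  have "integral {0..t} h \<le> c * (t powr (1 - e) / (1 - e))"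
    by (rule integral_le_powr[OF h t e]) (use le abs_le_D1 in blast)
  moreover have "integral {0..t} (\<lambda>\<tau>. - h \<tau>) \<le> c * (t powr (1 - e) / (1 - e))"
    by (rule integral_le_powr[OF _ t e]) (use h le in \<open>auto intro: continuous_intros dest: abs_le_D2\<close>)
  ultimately show ?thesis by simp
qed

text \<open>The supersolution is \<open>2 z\<^sup>1\<^sup>/\<^sup>m\<close>, where \<open>z\<close> is the linear evolution of \<open>\<bar>u\<^sub>0\<bar>\<^sup>m\<close>. By
  Jensen's inequality and the semigroup property, fractional powers of \<open>z\<close> are supersolutions of
  the linear equation, so a factor \<open>z\<^sup>\<kappa>\<close> passes through the Duhamel integral while the remaining
  power of \<open>z\<close> is estimated by its decay in time.\<close>

lemma global_mild_solution_exists: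
  fixes u0 :: "'a::euclidean_space \<Rightarrow>\<^sub>C real"
  assumes u0: "u0 \<in> C0" and p: "1 < p" and m: "1 < m" "m \<le> p" and D: "D > 0"
    and \<kappa>: "\<kappa> = min 1 ((p - 1) / m)"
    and z: "\<And>t x. t > 0 \<Longrightarrow> heat s t (\<lambda>y. \<bar>apply_bcontfun u0 y\<bar> powr m) x \<le> D * t powr - (m / (p - 1))"
    and K1: "2 powr p * D powr ((p - 1) / m) * ((p - 1) / (m - 1)) \<le> 1"
    and K2: "p * 2 powr (p - 1) * D powr ((p - 1) / m) * ((p - 1) / (m * \<kappa>)) \<le> 1 / 2"
  shows "\<exists>u. global_mild_solution 1 1 s p u0 u"
proof -
  define \<mu> where "\<mu> = m / (p - 1)"
  have \<mu>: "\<mu> > 0" using p m by (simp add: \<mu>_def)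
  have \<kappa>01: "0 < \<kappa>" "\<kappa> \<le> 1" "\<kappa> \<le> (p - 1) / m" using p m \<kappa> by auto
  define Z where "Z t = heat_bcf t (abs_powr_bcf m u0)" for t
  have Zx: "apply_bcontfun (Z t) x = heat s t (\<lambda>y. \<bar>apply_bcontfun u0 y\<bar> powr m) x" if "t \<ge> 0" for t x
  proof -
    have "apply_bcontfun (abs_powr_bcf m u0) = (\<lambda>y. \<bar>apply_bcontfun u0 y\<bar> powr m)"
      using m by (intro ext apply_abs_powr_bcf) simp
    then show ?thesis using that by (simp add: Z_def apply_heat_bcf)
  qed
  have pw0: "abs_powr_bcf m u0 \<in> C0" using u0 m by (intro abs_powr_bcf_C0) auto
  have ZC0: "Z t \<in> C0" if "t \<ge> 0" for t unfolding Z_def using pw0 that by (rule heat_bcf_C0[rotated])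
  have Zadd: "heat s r (apply_bcontfun (Z t)) = apply_bcontfun (Z (r + t))" if "r \<ge> 0" "t \<ge> 0" for r t
    using that by (simp add: Z_def apply_heat_bcf[symmetric] heat_bcf_add)
  have Z0: "0 \<le> apply_bcontfun (Z t) x" if "t \<ge> 0" for t x
  proof -
    have "heat s t (\<lambda>_. 0) x \<le> heat s t (apply_bcontfun (abs_powr_bcf m u0)) x"
      using m by (intro heat_semigroup_mono[OF s that _ bcontfun_borel _ bcontfun_abs_le, where B=0]) (auto simp: apply_abs_powr_bcf)
    then show ?thesis using that by (simp add: Z_def apply_heat_bcf heat_semigroup_const[OF s])
  qed
  have Zle: "apply_bcontfun (Z t) x \<le> norm u0 powr m" if "t \<ge> 0" for t x
  proof -
    have "\<bar>apply_bcontfun (abs_powr_bcf m u0) y\<bar> \<le> norm u0 powr m" for y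
      using m bcontfun_abs_le[of u0 y] by (simp add: apply_abs_powr_bcf powr_mono2)
    from heat_semigroup_bound[OF s that bcontfun_borel this, of x] show ?thesis
      using that by (simp add: Z_def apply_heat_bcf)
  qed
  have Zdecay: "apply_bcontfun (Z t) x \<le> D * t powr - \<mu>" if "t > 0" for t x
    using z[OF that] that by (simp add: Zx \<mu>_def)
  have Zb: "\<bar>apply_bcontfun (Z t) y powr \<alpha>\<bar> \<le> norm (Z t) powr \<alpha>" if "\<alpha> \<ge> 0" "t \<ge> 0" for \<alpha> t y
    using that Z0[of t y] bcontfun_abs_le[of "Z t" y] by (simp add: powr_mono2)
  have Zm: "(\<lambda>y. apply_bcontfun (Z t) y powr \<alpha>) \<in> borel_measurable borel" for t \<alpha>
    using bcontfun_borel[of "Z t"] by measurable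
  \<comment> \<open>Jensen's inequality requires 0 < \<beta> \<le> 1, and \<beta> \<le> \<alpha>
    keeps the surplus power monotone. The larger \<beta> is, the weaker is the singularity of the
    bound at \<tau> = 0.\<close>
  have step: "heat s (t - \<tau>) (\<lambda>y. apply_bcontfun (Z \<tau>) y powr \<alpha>) x \<le>
      D powr (\<alpha> - \<beta>) * apply_bcontfun (Z t) x powr \<beta> * \<tau> powr - (\<mu> * (\<alpha> - \<beta>))"
    if \<tau>: "0 < \<tau>" "\<tau> \<le> t" and \<beta>: "0 < \<beta>" "\<beta> \<le> 1" "\<beta> \<le> \<alpha>" for t \<tau> x \<alpha> \<beta>
  proof -
    let ?c = "D powr (\<alpha> - \<beta>) * \<tau> powr - (\<mu> * (\<alpha> - \<beta>))"
    have pt: "apply_bcontfun (Z \<tau>) y powr \<alpha> \<le> ?c * apply_bcontfun (Z \<tau>) y powr \<beta>" for y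
    proof -
      have "apply_bcontfun (Z \<tau>) y powr \<alpha> = apply_bcontfun (Z \<tau>) y powr (\<alpha> - \<beta>) * apply_bcontfun (Z \<tau>) y powr \<beta>"
        by (simp flip: powr_add)
      also have "\<dots> \<le> (D * \<tau> powr - \<mu>) powr (\<alpha> - \<beta>) * apply_bcontfun (Z \<tau>) y powr \<beta>"
        using Zdecay[OF \<tau>(1)] Z0[of \<tau> y] \<tau> \<beta> by (intro mult_right_mono powr_mono2) auto
      also have "(D * \<tau> powr - \<mu>) powr (\<alpha> - \<beta>) = ?c"
        using D by (simp add: powr_mult powr_powr)
      finally show ?thesis .
    qed
    have "heat s (t - \<tau>) (\<lambda>y. apply_bcontfun (Z \<tau>) y powr \<alpha>) x \<le> heat s (t - \<tau>) (\<lambda>y. ?c * apply_bcontfun (Z \<tau>) y powr \<beta>) x"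
    proof (rule heat_semigroup_mono[OF s])
      show "\<bar>apply_bcontfun (Z \<tau>) y powr \<alpha>\<bar> \<le> norm (Z \<tau>) powr \<alpha>" for y by (rule Zb) (use \<tau> \<beta> in auto)
      have "\<bar>apply_bcontfun (Z \<tau>) y powr \<beta>\<bar> \<le> norm (Z \<tau>) powr \<beta>" for y by (rule Zb) (use \<tau> \<beta> in auto)
      then show "\<bar>?c * apply_bcontfun (Z \<tau>) y powr \<beta>\<bar> \<le> ?c * norm (Z \<tau>) powr \<beta>" for y
        unfolding abs_mult by (intro mult_mono) auto
      show "(\<lambda>y. ?c * apply_bcontfun (Z \<tau>) y powr \<beta>) \<in> borel_measurable borel"
        by (intro borel_measurable_times borel_measurable_const Zm)
    qed (use \<tau> pt Zm in auto)
    also have "\<dots> = ?c * heat s (t - \<tau>) (\<lambda>y. apply_bcontfun (Z \<tau>) y powr \<beta>) x"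
      by (rule heat_semigroup_cmult[OF s])
    also have "\<dots> \<le> ?c * heat s (t - \<tau>) (apply_bcontfun (Z \<tau>)) x powr \<beta>"
    proof (intro mult_left_mono heat_semigroup_Jensen[OF s _ bcontfun_borel])
      show "apply_bcontfun (Z \<tau>) y \<le> norm (Z \<tau>)" for y using bcontfun_abs_le[of "Z \<tau>" y] by simp
    qed (use \<tau> \<beta> Z0 in auto)
    also have "heat s (t - \<tau>) (apply_bcontfun (Z \<tau>)) x = apply_bcontfun (Z t) x"
      using Zadd[of "t - \<tau>" \<tau>] \<tau> by simp
    finally show ?thesis by (simp add: mult_ac)
  qed
  have step': "\<bar>heat s (t - \<tau>) g x\<bar> \<le>
      (c * D powr (\<alpha> - \<beta>) * apply_bcontfun (Z t) x powr \<beta>) * \<tau> powr - (\<mu> * (\<alpha> - \<beta>))"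
    if \<tau>: "0 < \<tau>" "\<tau> \<le> t" and \<beta>: "0 < \<beta>" "\<beta> \<le> 1" "\<beta> \<le> \<alpha>" and c: "c \<ge> 0"
      and g: "g \<in> borel_measurable borel" "\<And>y. \<bar>g y\<bar> \<le> c * apply_bcontfun (Z \<tau>) y powr \<alpha>"
    for t \<tau> x \<alpha> \<beta> c g
  proof -
    have cm: "(\<lambda>y. c * apply_bcontfun (Z \<tau>) y powr \<alpha>) \<in> borel_measurable borel"
      by (intro borel_measurable_times borel_measurable_const Zm)
    have cb: "\<bar>c * apply_bcontfun (Z \<tau>) y powr \<alpha>\<bar> \<le> c * norm (Z \<tau>) powr \<alpha>" for y
      using Zb[of \<alpha> \<tau> y] \<tau> \<beta> c unfolding abs_mult by (intro mult_mono) auto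
    have gb: "\<bar>g y\<bar> \<le> c * norm (Z \<tau>) powr \<alpha>" for y
      using g(2)[of y] cb[of y] by linarith
    have nb: "\<bar>- g y\<bar> \<le> c * norm (Z \<tau>) powr \<alpha>" for y using gb by simp
    have gle: "g y \<le> c * apply_bcontfun (Z \<tau>) y powr \<alpha>" "- g y \<le> c * apply_bcontfun (Z \<tau>) y powr \<alpha>" for y
      using g(2)[of y] by (auto simp: abs_le_iff)
    have t\<tau>: "0 \<le> t - \<tau>" using \<tau> by simp
    have "heat s (t - \<tau>) g x \<le> heat s (t - \<tau>) (\<lambda>y. c * apply_bcontfun (Z \<tau>) y powr \<alpha>) x"
      by (rule heat_semigroup_mono[OF s t\<tau> g(1) cm gb cb gle(1)])
    moreover have "heat s (t - \<tau>) (\<lambda>y. - g y) x \<le> heat s (t - \<tau>) (\<lambda>y. c * apply_bcontfun (Z \<tau>) y powr \<alpha>) x"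
      by (rule heat_semigroup_mono[OF s t\<tau> _ cm nb cb gle(2)]) (use g(1) in auto)
    moreover have "heat s (t - \<tau>) (\<lambda>y. - g y) x = - heat s (t - \<tau>) g x"
      using heat_semigroup_cmult[OF s, of "t - \<tau>" "-1" g x] by simp
    ultimately have "\<bar>heat s (t - \<tau>) g x\<bar> \<le> c * heat s (t - \<tau>) (\<lambda>y. apply_bcontfun (Z \<tau>) y powr \<alpha>) x"
      by (simp add: heat_semigroup_cmult[OF s] abs_le_iff)
    also have "\<dots> \<le> c * (D powr (\<alpha> - \<beta>) * apply_bcontfun (Z t) x powr \<beta> * \<tau> powr - (\<mu> * (\<alpha> - \<beta>)))"
      using step[OF \<tau> \<beta>] c by (rule mult_left_mono)
    finally show ?thesis by (simp add: mult_ac)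
  qed
  \<comment> \<open>The fixed point is sought among bounded continuous functions on the whole real
    line; times are clipped at 0, so negative ones repeat the value at time 0.\<close>
  define T where "T t = max t 0" for t :: real
  have T: "T t \<ge> 0" "t \<ge> 0 \<Longrightarrow> T t = t" for t by (auto simp: T_def)
  \<comment> \<open>Of the factor 2, one half bounds the linear evolution and the other half the
    Duhamel term.\<close>
  define V where "V t x = 2 * apply_bcontfun (Z (T t)) x powr (1 / m)" for t x
  have V0: "V t x \<ge> 0" for t x by (simp add: V_def)
  have Vle: "V t x \<le> 2 * norm u0" for t x
  proof -
    have "apply_bcontfun (Z (T t)) x powr (1 / m) \<le> (norm u0 powr m) powr (1 / m)"
      using Zle[OF T(1)] Z0[OF T(1)] m by (intro powr_mono2) auto
    then show ?thesis using m by (simp add: V_def powr_powr)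
  qed
  \<comment> \<open>The bound is pointwise in t and x. It is closed in the sup norm, forces decay at
    infinity and carries the smallness, so the contraction can be run in the unweighted
    norm.\<close>
  define E where "E = {u :: real \<Rightarrow>\<^sub>C 'a \<Rightarrow>\<^sub>C real. \<forall>t x. \<bar>apply_bcontfun (apply_bcontfun u t) x\<bar> \<le> V t x}"
  have Enorm: "norm (apply_bcontfun u t) \<le> 2 * norm u0" if "u \<in> E" for u t
    by (rule norm_bound) (use that Vle[of t] in \<open>auto simp: E_def intro: order_trans\<close>)
  have EC0: "apply_bcontfun u t \<in> C0" if "u \<in> E" for u t
  proof -
    have "((\<lambda>x. V t x) \<longlongrightarrow> 2 * 0 powr (1 / m)) at_infinity"
      unfolding V_def using ZC0[OF T(1), of t] m Z0[OF T(1)]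
      by (intro tendsto_intros tendsto_powr2) (auto simp: C0_def)
    then have "((\<lambda>x. V t x) \<longlongrightarrow> 0) at_infinity" by simp
    then show ?thesis unfolding C0_def
      using that by (auto simp: E_def intro!: Lim_null_comparison[where g="V t"] always_eventually)
  qed
  define W where "W u \<tau> = abs_powr_bcf p (apply_bcontfun u \<tau>)" for u :: "real \<Rightarrow>\<^sub>C 'a \<Rightarrow>\<^sub>C real" and \<tau>
  have Wc: "continuous_on {0..} (W u)" if "u \<in> E" for u
    unfolding W_def by (rule continuous_on_abs_powr_bcf[where M="2 * norm u0"]) (use Enorm[OF that] p in auto)
  have WC0: "W u t \<in> C0" if "u \<in> E" for u t
    unfolding W_def using EC0[OF that] p by (intro abs_powr_bcf_C0) auto
  have Wx: "apply_bcontfun (W u \<tau>) y = \<bar>apply_bcontfun (apply_bcontfun u \<tau>) y\<bar> powr p" for u \<tau> y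
    using p by (simp add: W_def apply_abs_powr_bcf)
  define \<Psi> where "\<Psi> u t = heat_bcf (T t) u0 + duhamel (W u) (T t)" for u t
  have \<Psi>V: "\<bar>apply_bcontfun (\<Psi> u t) x\<bar> \<le> V t x" if u: "u \<in> E" for u t x
  proof -
    let ?z = "apply_bcontfun (Z (T t)) x"
    have lin: "\<bar>heat s (T t) (apply_bcontfun u0) x\<bar> \<le> ?z powr (1 / m)"
    proof -
      have Tt: "0 \<le> T t" by (rule T)
      have a: "\<bar>\<bar>apply_bcontfun u0 y\<bar>\<bar> \<le> norm u0" "\<bar>- apply_bcontfun u0 y\<bar> \<le> norm u0" for y using bcontfun_abs_le[of u0 y] by auto
      have am: "(\<lambda>y. \<bar>apply_bcontfun u0 y\<bar>) \<in> borel_measurable borel" using bcontfun_borel[of u0] by measurable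
      have "heat s (T t) (apply_bcontfun u0) x \<le> heat s (T t) (\<lambda>y. \<bar>apply_bcontfun u0 y\<bar>) x"
        by (rule heat_semigroup_mono[OF s Tt bcontfun_borel am bcontfun_abs_le a(1)]) simp
      moreover have "heat s (T t) (\<lambda>y. - apply_bcontfun u0 y) x \<le> heat s (T t) (\<lambda>y. \<bar>apply_bcontfun u0 y\<bar>) x"
        by (rule heat_semigroup_mono[OF s Tt _ am a(2) a(1)]) (use bcontfun_borel[of u0] in auto)
      moreover have "heat s (T t) (\<lambda>y. - apply_bcontfun u0 y) x = - heat s (T t) (apply_bcontfun u0) x"
        using heat_semigroup_cmult[OF s, of "T t" "-1" "apply_bcontfun u0" x] by simp
      moreover have "heat s (T t) (\<lambda>y. \<bar>apply_bcontfun u0 y\<bar>) x = heat s (T t) (\<lambda>y. apply_bcontfun (abs_powr_bcf m u0) y powr (1 / m)) x"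
        using m by (simp add: apply_abs_powr_bcf powr_powr)
      moreover have "\<dots> \<le> heat s (T t) (apply_bcontfun (abs_powr_bcf m u0)) x powr (1 / m)"
        by (rule heat_semigroup_Jensen[OF s Tt bcontfun_borel, where B="norm (abs_powr_bcf m u0)"])
           (use m bcontfun_abs_le[of "abs_powr_bcf m u0"] in \<open>auto simp: apply_abs_powr_bcf abs_le_iff\<close>)
      moreover have "heat s (T t) (apply_bcontfun (abs_powr_bcf m u0)) x = ?z" by (simp add: Z_def apply_heat_bcf T)
      ultimately show ?thesis by (simp add: abs_le_iff)
    qed
    have du: "\<bar>apply_bcontfun (duhamel (W u) (T t)) x\<bar> \<le> ?z powr (1 / m)"
    proof (cases "T t = 0")
      case True
      then show ?thesis by (simp add: apply_duhamel[OF Wc[OF u] WC0[OF u]])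
    next
      case False
      then have t: "T t > 0" using T(1)[of t] by simp
      \<comment> \<open>Here \<beta> = 1 and \<alpha> = p/m, which is at least 1 since m \<le> p.
        The resulting exponent \<open>e\<close> stays below 1 because m > 1.\<close>
      have \<beta>: "0 < (1::real)" "1 \<le> (1::real)" "1 \<le> p / m" using m by auto
      define e where "e = \<mu> * (p / m - 1)"
      have ee: "1 - e = (m - 1) / (p - 1)" using p m by (simp add: e_def \<mu>_def field_simps)
      then have e1: "e < 1" using p m by (smt (verit) divide_pos_pos)
      have "\<bar>apply_bcontfun (duhamel (W u) (T t)) x\<bar> \<le> (2 powr p * D powr (p / m - 1) * ?z powr 1) * (T t powr (1 - e) / (1 - e))"
        unfolding apply_duhamel[OF Wc[OF u] WC0[OF u]]
      proof (rule integral_abs_le_powr[OF continuous_on_duhamel_point[OF Wc[OF u] WC0[OF u]] t e1])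
        fix \<tau> assume \<tau>: "0 < \<tau>" "\<tau> \<le> T t"
        show "\<bar>heat s (T t - \<tau>) (apply_bcontfun (W u \<tau>)) x\<bar> \<le> (2 powr p * D powr (p / m - 1) * ?z powr 1) * \<tau> powr - e"
          unfolding e_def
        proof (rule step'[OF \<tau> \<beta> _ bcontfun_borel])
          fix y
          have "\<bar>apply_bcontfun (W u \<tau>) y\<bar> \<le> V \<tau> y powr p"
            using u p unfolding Wx E_def by (auto intro!: powr_mono2)
          also have "\<dots> = 2 powr p * apply_bcontfun (Z \<tau>) y powr (p / m)"
            using \<tau> m by (simp add: V_def T powr_mult powr_powr)
          finally show "\<bar>apply_bcontfun (W u \<tau>) y\<bar> \<le> 2 powr p * apply_bcontfun (Z \<tau>) y powr (p / m)" .
        qed simp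
      qed
      also have "\<dots> = (2 powr p * D powr (p / m - 1) / (1 - e)) * (?z powr 1 * T t powr (1 - e))" by simp
      \<comment> \<open>Only the power 1/m of z may survive. The excess 1 - 1/m is converted into
        decay, whose rate \<mu> (1 - 1/m) equals 1 - e, so all powers of time cancel: the estimate
        is scale invariant.\<close>
      also have "\<dots> \<le> (2 powr p * D powr (p / m - 1) / (1 - e)) * (?z powr (1 / m) * D powr (1 - 1 / m))"
      proof (rule mult_left_mono)
        have "?z powr 1 = ?z powr (1 / m) * ?z powr (1 - 1 / m)" by (simp flip: powr_add)
        also have "\<dots> \<le> ?z powr (1 / m) * (D * T t powr - \<mu>) powr (1 - 1 / m)"
          using Zdecay[OF t] Z0[OF T(1)] m by (intro mult_left_mono powr_mono2) auto
        also have "(D * T t powr - \<mu>) powr (1 - 1 / m) = D powr (1 - 1 / m) * T t powr - (1 - e)"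
        proof -
          have "\<mu> * (1 - 1 / m) = 1 - e" using m by (simp add: ee \<mu>_def field_simps)
          then have "- \<mu> * (1 - 1 / m) = - (1 - e)" by simp
          then show ?thesis using D by (simp only: powr_mult powr_powr)
        qed
        finally have "?z powr 1 * T t powr (1 - e) \<le> ?z powr (1 / m) * (D powr (1 - 1 / m) * T t powr - (1 - e)) * T t powr (1 - e)"
          by (rule mult_right_mono) simp
        also have "\<dots> = ?z powr (1 / m) * D powr (1 - 1 / m) * (T t powr - (1 - e) * T t powr (1 - e))" by (simp only: mult_ac)
        also have "T t powr - (1 - e) * T t powr (1 - e) = 1" using t by (simp flip: powr_add)
        finally show "?z powr 1 * T t powr (1 - e) \<le> ?z powr (1 / m) * D powr (1 - 1 / m)" by simp
      qed (use e1 in auto)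
      also have "\<dots> = (2 powr p * (D powr (p / m - 1) * D powr (1 - 1 / m)) * (1 / (1 - e))) * ?z powr (1 / m)" by simp
      also have "D powr (p / m - 1) * D powr (1 - 1 / m) = D powr ((p - 1) / m)"
        by (simp add: diff_divide_distrib flip: powr_add)
      also have "1 / (1 - e) = (p - 1) / (m - 1)" by (simp add: ee)
      also have "(2 powr p * D powr ((p - 1) / m) * ((p - 1) / (m - 1))) * ?z powr (1 / m) \<le> 1 * ?z powr (1 / m)"
        using K1 by (rule mult_right_mono) simp
      finally show ?thesis by simp
    qed
    have "apply_bcontfun (\<Psi> u t) x = heat s (T t) (apply_bcontfun u0) x + apply_bcontfun (duhamel (W u) (T t)) x"
      by (simp add: \<Psi>_def apply_heat_bcf T)
    then show ?thesis using lin du by (simp add: V_def)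
  qed
  have \<Psi>c: "continuous_on UNIV (\<Psi> u)" if u: "u \<in> E" for u
    unfolding \<Psi>_def
  proof (rule continuous_on_add)
    show "continuous_on UNIV (\<lambda>t. heat_bcf (T t) u0)"
      by (rule continuous_on_heat_bcf) (auto simp: T_def u0 intro!: continuous_intros)
    show "continuous_on UNIV (\<lambda>t. duhamel (W u) (T t))"
      by (rule continuous_on_compose2[OF continuous_on_duhamel[OF Wc[OF u] WC0[OF u]]]) (auto simp: T_def intro!: continuous_intros)
  qed
  define \<Phi> where "\<Phi> u = Bcontfun (\<Psi> u)" for u
  have \<Phi>x: "apply_bcontfun (\<Phi> u) = \<Psi> u" if u: "u \<in> E" for u
  proof -
    have "\<Psi> u \<in> bcontfun"
    proof (rule bcontfun_normI[OF \<Psi>c[OF u]])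
      show "norm (\<Psi> u t) \<le> 2 * norm u0" for t
        by (rule norm_bound) (use \<Psi>V[OF u, of t] Vle[of t] in \<open>auto intro: order_trans\<close>)
    qed
    then show ?thesis by (simp add: \<Phi>_def Bcontfun_inverse)
  qed
  have lip: "dist (\<Phi> u) (\<Phi> v) \<le> 1 / 2 * dist u v" if u: "u \<in> E" and v: "v \<in> E" for u v
  proof (rule dist_bound, rule dist_bound)
    fix t x
    let ?z = "apply_bcontfun (Z (T t)) x"
    let ?d = "dist u v"
    define h where "h \<tau> = heat s (T t - \<tau>) (apply_bcontfun (W u \<tau>)) x - heat s (T t - \<tau>) (apply_bcontfun (W v \<tau>)) x" for \<tau>
    have hc: "continuous_on {0..T t} h"
      unfolding h_def
      by (intro continuous_on_diff continuous_on_duhamel_point[OF Wc[OF u] WC0[OF u]] continuous_on_duhamel_point[OF Wc[OF v] WC0[OF v]])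
    have "dist (apply_bcontfun (apply_bcontfun (\<Phi> u) t) x) (apply_bcontfun (apply_bcontfun (\<Phi> v) t) x) = \<bar>integral {0..T t} h\<bar>"
      unfolding \<Phi>x[OF u] \<Phi>x[OF v] \<Psi>_def h_def
      using integrable_continuous_real[OF continuous_on_duhamel_point[OF Wc[OF u] WC0[OF u]]]
        integrable_continuous_real[OF continuous_on_duhamel_point[OF Wc[OF v] WC0[OF v]]]
      by (simp add: dist_real_def apply_duhamel[OF Wc[OF u] WC0[OF u]] apply_duhamel[OF Wc[OF v] WC0[OF v]]
          Henstock_Kurzweil_Integration.integral_diff)
    also have "\<dots> \<le> 1 / 2 * ?d"
    proof (cases "T t = 0")
      case True
      then show ?thesis by simp
    next
      case False
      then have t: "T t > 0" using T(1)[of t] by simp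
      \<comment> \<open>With \<kappa> = 0 this exponent would be exactly 1 and the time integral of
        the majorant would diverge. A positive \<kappa>, at most 1 for Jensen and at most (p - 1)/m
        as the available power, lowers it to 1 - \<mu> \<kappa>.\<close>
      define e where "e = \<mu> * ((p - 1) / m - \<kappa>)"
      have ee: "1 - e = m * \<kappa> / (p - 1)" using p m by (simp add: e_def \<mu>_def field_simps)
      then have e1: "e < 1" using p m \<kappa>01 by (smt (verit) divide_pos_pos mult_pos_pos)
      define c where "c = p * 2 powr (p - 1) * ?d"
      have c: "c \<ge> 0" using p by (simp add: c_def)
      have "\<bar>integral {0..T t} h\<bar> \<le> (c * D powr ((p - 1) / m - \<kappa>) * ?z powr \<kappa>) * (T t powr (1 - e) / (1 - e))"
      proof (rule integral_abs_le_powr[OF hc t e1])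
        fix \<tau> assume \<tau>: "0 < \<tau>" "\<tau> \<le> T t"
        have t\<tau>: "0 \<le> T t - \<tau>" using \<tau> by simp
        have "h \<tau> = heat s (T t - \<tau>) (\<lambda>y. apply_bcontfun (W u \<tau>) y - apply_bcontfun (W v \<tau>) y) x"
          unfolding h_def by (rule heat_semigroup_diff[OF s t\<tau> bcontfun_borel bcontfun_borel bcontfun_abs_le bcontfun_abs_le, symmetric])
        moreover have "\<bar>heat s (T t - \<tau>) (\<lambda>y. apply_bcontfun (W u \<tau>) y - apply_bcontfun (W v \<tau>) y) x\<bar>
            \<le> (c * D powr ((p - 1) / m - \<kappa>) * ?z powr \<kappa>) * \<tau> powr - e"
          unfolding e_def
        proof (rule step'[OF \<tau> \<kappa>01 c])
          show "(\<lambda>y. apply_bcontfun (W u \<tau>) y - apply_bcontfun (W v \<tau>) y) \<in> borel_measurable borel"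
            by (intro borel_measurable_diff bcontfun_borel)
          fix y
          let ?a = "apply_bcontfun (apply_bcontfun u \<tau>) y" and ?b = "apply_bcontfun (apply_bcontfun v \<tau>) y"
          have "\<bar>apply_bcontfun (W u \<tau>) y - apply_bcontfun (W v \<tau>) y\<bar> \<le> p * V \<tau> y powr (p - 1) * \<bar>?a - ?b\<bar>"
            unfolding Wx using u v p by (intro abs_powr_diff_le) (auto simp: E_def)
          also have "\<dots> \<le> p * V \<tau> y powr (p - 1) * ?d"
          proof (rule mult_left_mono)
            have "dist ?a ?b \<le> dist (apply_bcontfun u \<tau>) (apply_bcontfun v \<tau>)" by (rule dist_bounded)
            also have "\<dots> \<le> ?d" by (rule dist_bounded)
            finally show "\<bar>?a - ?b\<bar> \<le> ?d" by (simp add: dist_real_def)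
          qed (use p in auto)
          also have "V \<tau> y powr (p - 1) = 2 powr (p - 1) * apply_bcontfun (Z \<tau>) y powr ((p - 1) / m)"
            using \<tau> by (simp add: V_def T powr_mult powr_powr)
          finally show "\<bar>apply_bcontfun (W u \<tau>) y - apply_bcontfun (W v \<tau>) y\<bar> \<le> c * apply_bcontfun (Z \<tau>) y powr ((p - 1) / m)"
            by (simp add: c_def mult_ac)
        qed
        ultimately show "\<bar>h \<tau>\<bar> \<le> (c * D powr ((p - 1) / m - \<kappa>) * ?z powr \<kappa>) * \<tau> powr - e" by simp
      qed
      also have "\<dots> = (c * D powr ((p - 1) / m - \<kappa>) / (1 - e)) * (?z powr \<kappa> * T t powr (1 - e))" by simp
      \<comment> \<open>The Lipschitz bound must not depend on t and x, so here the whole power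
        \<kappa> of z is converted into decay; the powers of time cancel again.\<close>
      also have "\<dots> \<le> (c * D powr ((p - 1) / m - \<kappa>) / (1 - e)) * D powr \<kappa>"
      proof (rule mult_left_mono)
        have "?z powr \<kappa> \<le> (D * T t powr - \<mu>) powr \<kappa>"
          using Zdecay[OF t] Z0[OF T(1)] \<kappa>01 by (intro powr_mono2) auto
        also have "\<dots> = D powr \<kappa> * T t powr - (1 - e)"
        proof -
          have "- \<mu> * \<kappa> = - (1 - e)" by (simp add: ee \<mu>_def)
          then show ?thesis using D by (simp only: powr_mult powr_powr)
        qed
        finally have "?z powr \<kappa> * T t powr (1 - e) \<le> D powr \<kappa> * T t powr - (1 - e) * T t powr (1 - e)"
          by (rule mult_right_mono) simp
        also have "\<dots> = D powr \<kappa>" using t by (simp add: mult.assoc flip: powr_add)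
        finally show "?z powr \<kappa> * T t powr (1 - e) \<le> D powr \<kappa>" .
      qed (use c e1 in auto)
      also have "\<dots> = (p * 2 powr (p - 1) * (D powr ((p - 1) / m - \<kappa>) * D powr \<kappa>) * (1 / (1 - e))) * ?d"
        by (simp add: c_def)
      also have "D powr ((p - 1) / m - \<kappa>) * D powr \<kappa> = D powr ((p - 1) / m)" by (simp flip: powr_add)
      also have "1 / (1 - e) = (p - 1) / (m * \<kappa>)" by (simp add: ee)
      also have "(p * 2 powr (p - 1) * D powr ((p - 1) / m) * ((p - 1) / (m * \<kappa>))) * ?d \<le> 1 / 2 * ?d"
        using K2 by (rule mult_right_mono) simp
      finally show ?thesis .
    qed
    finally show "dist (apply_bcontfun (apply_bcontfun (\<Phi> u) t) x) (apply_bcontfun (apply_bcontfun (\<Phi> v) t) x) \<le> 1 / 2 * ?d" .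
  qed
  have "closed E"
  proof -
    have ev: "continuous_on UNIV (\<lambda>u::real \<Rightarrow>\<^sub>C 'a \<Rightarrow>\<^sub>C real. apply_bcontfun (apply_bcontfun u t) x)" for t x
    proof -
      have "bounded_linear (\<lambda>u::real \<Rightarrow>\<^sub>C 'a \<Rightarrow>\<^sub>C real. apply_bcontfun u t)"
        by (rule bounded_linear_intro[where K=1]) (auto simp: norm_bounded)
      from bounded_linear_compose[OF bounded_linear_apply_bcontfun this, of x]
      show ?thesis by (rule linear_continuous_on)
    qed
    have "E = (\<Inter>t. \<Inter>x. {u. \<bar>apply_bcontfun (apply_bcontfun u t) x\<bar> \<le> V t x})" by (auto simp: E_def)
    also have "closed \<dots>"
      by (intro closed_INT ballI closed_Collect_le continuous_on_const continuous_on_rabs ev)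
    finally show ?thesis .
  qed
  moreover have "0 \<in> E" by (simp add: E_def V0)
  moreover have "\<Phi> ` E \<subseteq> E" using \<Psi>V by (auto simp: E_def \<Phi>x[unfolded E_def])
  ultimately have "\<exists>!u\<in>E. \<Phi> u = u"
    by (intro Banach_fix[where c="1/2"] lip complete_eq_closed[THEN iffD2]) auto
  then obtain u where u: "u \<in> E" "\<Phi> u = u" by blast
  have ut: "apply_bcontfun u t = heat_bcf t u0 + duhamel (W u) t" if "t \<ge> 0" for t
    using \<Phi>x[OF u(1)] that unfolding u(2) by (simp add: \<Psi>_def T)
  have Wf: "apply_bcontfun (W u \<tau>) = (\<lambda>y. \<bar>apply_bcontfun (apply_bcontfun u \<tau>) y\<bar> powr p)" for \<tau>
    by (rule ext) (rule Wx)
  have "global_mild_solution 1 1 s p u0 (apply_bcontfun u)"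
    unfolding global_mild_solution_def
  proof (intro conjI allI impI)
    show "continuous_on {0..} (apply_bcontfun u)" by simp
    show "apply_bcontfun u t \<in> C0" for t by (rule EC0[OF u(1)])
    fix t x assume t: "(0::real) \<le> t"
    show "set_integrable lborel {0..t} (\<lambda>\<tau>. heat s (t - \<tau>) (\<lambda>y. \<bar>apply_bcontfun (apply_bcontfun u \<tau>) y\<bar> powr p) x)"
      using duhamel_lborel(1)[OF Wc[OF u(1)] WC0[OF u(1)], of t x] unfolding Wf .
    show "apply_bcontfun (apply_bcontfun u t) x = heat s t (apply_bcontfun u0) x +
       (LINT \<tau>:{0..t}|lborel. heat s (t - \<tau>) (\<lambda>y. \<bar>apply_bcontfun (apply_bcontfun u \<tau>) y\<bar> powr p) x)"
      using duhamel_lborel(2)[OF Wc[OF u(1)] WC0[OF u(1)], of t x] t unfolding Wf by (simp add: ut apply_heat_bcf)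
  qed
  then show ?thesis by blast
qed

text \<open>p > p_F says precisely that q > 1, which leaves room for 1 < m \<le> q. Jensen bounds
  the evolution of |u0|^m by the power m/q of that of |u0|^q, whose decay comes from its mass; m
  \<le> p is what the fixed point argument asks for.\<close>

lemma small_data_global_existence:
  fixes p :: real
  assumes p: "p > fujita_exponent DIM('a::euclidean_space) s"
  defines "q \<equiv> real DIM('a) * (p - 1) / (2 * s)"
  shows "\<exists>\<delta>>0. \<forall>u0 :: 'a \<Rightarrow>\<^sub>C real.
    u0 \<in> C0 \<and> in_Lp q (apply_bcontfun u0) \<and> Lp_norm q (apply_bcontfun u0) \<le> \<delta> \<longrightarrow>
    (\<exists>u. global_mild_solution 1 1 s p u0 u)"
proof -
  have d: "real DIM('a) > 0" by simp
  have p1: "1 < p"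
  proof -
    have "2 * s / real DIM('a) > 0" using s d by simp
    then show ?thesis using p unfolding fujita_exponent_def by linarith
  qed
  have "2 * s / real DIM('a) < p - 1" using p by (simp add: fujita_exponent_def)
  then have q: "1 < q" using s d by (simp add: q_def field_simps)
  define m where "m = min p q"
  have m: "1 < m" "m \<le> p" "m \<le> q" using p1 q by (auto simp: m_def)
  define \<kappa> where "\<kappa> = min 1 ((p - 1) / m)"
  have \<kappa>: "\<kappa> > 0" using p1 m by (simp add: \<kappa>_def)
  obtain C where C: "C > 0" "\<And>t f x::'a. t > 0 \<Longrightarrow> integrable lborel f \<Longrightarrow> (\<And>y. 0 \<le> f y) \<Longrightarrow>
      heat s t f x \<le> C * t powr - (real DIM('a) / (2 * s)) * (LINT y|lborel. f y)"
    using heat_semigroup_L1_bound[OF s, where 'a='a] by blast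
  define k1 where "k1 = 2 powr p * ((p - 1) / (m - 1))"
  define k2 where "k2 = p * 2 powr (p - 1) * ((p - 1) / (m * \<kappa>)) * 2"
  have k: "k1 > 0" "k2 > 0" unfolding k1_def k2_def using p1 m \<kappa> by (auto intro!: mult_pos_pos divide_pos_pos)
  \<comment> \<open>The largest value of D^((p - 1)/m) that both smallness conditions allow;
    \<open>D\<close> and then \<open>\<delta>\<close> are found by solving for them.\<close>
  define \<epsilon> where "\<epsilon> = min (1 / k1) (1 / k2)"
  have \<epsilon>: "\<epsilon> > 0" "\<epsilon> \<le> 1 / k1" "\<epsilon> \<le> 1 / k2" using k by (auto simp: \<epsilon>_def)
  define D where "D = \<epsilon> powr (m / (p - 1))"
  have D: "D > 0" using \<epsilon> by (simp add: D_def)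
  have D\<epsilon>: "D powr ((p - 1) / m) = \<epsilon>" using \<epsilon> p1 m by (simp add: D_def powr_powr)
  have K1: "2 powr p * D powr ((p - 1) / m) * ((p - 1) / (m - 1)) \<le> 1"
  proof -
    have "\<epsilon> * k1 \<le> 1" using \<epsilon> k by (simp add: pos_le_divide_eq)
    then show ?thesis unfolding D\<epsilon> k1_def by (simp add: mult_ac)
  qed
  have K2: "p * 2 powr (p - 1) * D powr ((p - 1) / m) * ((p - 1) / (m * \<kappa>)) \<le> 1 / 2"
  proof -
    have "\<epsilon> * k2 \<le> 1" using \<epsilon> k by (simp add: pos_le_divide_eq)
    then show ?thesis unfolding D\<epsilon> k2_def by (simp add: mult_ac)
  qed
  define \<delta> where "\<delta> = (D / C powr (m / q)) powr (1 / m)"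
  have \<delta>: "\<delta> > 0" using D C by (simp add: \<delta>_def)
  have \<delta>m: "C powr (m / q) * \<delta> powr m = D"
    using D C m by (simp add: \<delta>_def powr_powr)
  have "\<exists>u. global_mild_solution 1 1 s p u0 u"
    if u0: "u0 \<in> C0" "in_Lp q (apply_bcontfun u0)" "Lp_norm q (apply_bcontfun u0) \<le> \<delta>" for u0 :: "'a \<Rightarrow>\<^sub>C real"
  proof (rule global_mild_solution_exists[OF u0(1) p1 m(1,2) D \<kappa>_def _ K1 K2])
    fix t :: real and x :: 'a assume t: "t > 0"
    define N where "N = Lp_norm q (apply_bcontfun u0)"
    define f where "f y = \<bar>apply_bcontfun u0 y\<bar> powr q" for y
    have fm: "f \<in> borel_measurable borel"
      unfolding f_def[abs_def] using bcontfun_borel[of u0] by measurable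
    have fi: "integrable lborel f"
      using u0(2) fm unfolding in_Lp_def f_def[symmetric] by (simp add: integrable_completion)
    have f0: "0 \<le> f y" for y by (simp add: f_def)
    have "(LINT y|lborel. f y) = (LINT y|lebesgue. f y)"
      using fm by (simp add: integral_completion)
    then have "N = (LINT y|lborel. f y) powr (1 / q)" by (simp add: N_def Lp_norm_def f_def)
    then have I: "(LINT y|lborel. f y) = N powr q"
      using q f0 by (simp add: powr_powr)
    have N: "0 \<le> N" "N \<le> \<delta>" using u0(3) by (auto simp: N_def Lp_norm_def)
    have fb: "f y \<le> norm u0 powr q" for y
      unfolding f_def using q bcontfun_abs_le[of u0 y] by (intro powr_mono2) auto
    have "heat s t (\<lambda>y. \<bar>apply_bcontfun u0 y\<bar> powr m) x = heat s t (\<lambda>y. f y powr (m / q)) x"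
      using q by (simp add: f_def powr_powr)
    also have "\<dots> \<le> heat s t f x powr (m / q)"
      by (rule heat_semigroup_Jensen[OF s _ fm fb f0]) (use t m q in auto)
    also have "\<dots> \<le> (C * t powr - (real DIM('a) / (2 * s)) * N powr q) powr (m / q)"
    proof (rule powr_mono2)
      show "heat s t f x \<le> C * t powr - (real DIM('a) / (2 * s)) * N powr q"
        using C(2)[OF t fi f0] by (simp add: I)
      have nn: "\<bar>f y\<bar> \<le> norm u0 powr q" for y using fb f0 by simp
      have "heat s t (\<lambda>_. 0) x \<le> heat s t f x" by (rule heat_semigroup_mono[OF s _ _ fm _ nn f0, where B=0]) (use t in auto)
      then show "0 \<le> heat s t f x" using t by (simp add: heat_semigroup_const[OF s])
    qed (use m q in auto)
    also have "\<dots> = (C powr (m / q) * N powr m) * t powr - (real DIM('a) / (2 * s) * (m / q))"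
      using C q t by (simp add: powr_mult powr_powr)
    \<comment> \<open>This identity singles out q: it is the Lebesgue exponent for which smallness
      is invariant under the scaling of the fractional equation.\<close>
    also have "real DIM('a) / (2 * s) * (m / q) = m / (p - 1)"
      using s d p1 by (simp add: q_def field_simps)
    also have "(C powr (m / q) * N powr m) * t powr - (m / (p - 1)) \<le> D * t powr - (m / (p - 1))"
    proof (rule mult_right_mono)
      have "C powr (m / q) * N powr m \<le> C powr (m / q) * \<delta> powr m"
        using N m by (intro mult_left_mono powr_mono2) auto
      then show "C powr (m / q) * N powr m \<le> D" by (simp add: \<delta>m)
    qed simp
    finally show "heat s t (\<lambda>y. \<bar>apply_bcontfun u0 y\<bar> powr m) x \<le> D * t powr - (m / (p - 1))" .
  qed
  with \<delta> show ?thesis by blast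
qed

end

section \<open>Nonexistence of global weak solutions\<close>

lemma integrable_of_bounded_integrals:
  fixes f :: "nat \<Rightarrow> 'b \<Rightarrow> real"
  assumes f: "\<And>n. integrable M (f n)" "\<And>n x. 0 \<le> f n x" "\<And>n. integral\<^sup>L M (f n) \<le> B"
    and lim: "\<And>x. (\<lambda>n. f n x) \<longlonglongrightarrow> g x" and g: "g \<in> borel_measurable M"
  shows "integrable M g"
proof (rule integrableI_nonneg[OF g])
  show "AE x in M. 0 \<le> g x"
    by (intro AE_I2 tendsto_lowerbound[OF lim]) (auto simp: f(2))
  have "(\<integral>\<^sup>+x. ennreal (g x) \<partial>M) = (\<integral>\<^sup>+x. liminf (\<lambda>n. ennreal (f n x)) \<partial>M)"
  proof (intro nn_integral_cong)
    fix x
    have "(\<lambda>n. ennreal (f n x)) \<longlonglongrightarrow> ennreal (g x)" by (intro tendsto_ennrealI lim)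
    then show "ennreal (g x) = liminf (\<lambda>n. ennreal (f n x))"
      by (intro lim_imp_Liminf[symmetric]) auto
  qed
  also have "\<dots> \<le> liminf (\<lambda>n. \<integral>\<^sup>+x. ennreal (f n x) \<partial>M)"
    using f(1) by (intro nn_integral_liminf) auto
  also have "\<dots> \<le> ennreal B"
  proof -
    have "(\<integral>\<^sup>+x. ennreal (f n x) \<partial>M) \<le> ennreal B" for n
      using f by (subst nn_integral_eq_integral) (auto intro!: ennreal_leI)
    then have "liminf (\<lambda>n. \<integral>\<^sup>+x. ennreal (f n x) \<partial>M) \<le> liminf (\<lambda>n. ennreal B)"
      by (intro Liminf_mono always_eventually) auto
    then show ?thesis by (simp add: Liminf_const)
  qed
  finally show "(\<integral>\<^sup>+x. ennreal (g x) \<partial>M) < \<infinity>" by (simp add: le_less_trans)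
qed

text \<open>Young's inequality with a free weight; the factors 1/p and 1 - 1/p are discarded. The
  weight stays explicit because it is later sent to infinity for one term and to 0 for
  another.\<close>

lemma Young_parameter:
  fixes x y \<kappa> p :: real
  assumes p: "1 < p" and "0 < \<kappa>" "0 \<le> x" "0 \<le> y"
  shows "x * y \<le> \<kappa> * x powr p + \<kappa> powr - (1 / (p - 1)) * y powr (p / (p - 1))"
proof -
  let ?q = "p / (p - 1)"
  have q: "?q > 1" "1 / p + 1 / ?q = 1" using p by (auto simp: field_simps)
  have "x * y = (\<kappa> powr (1 / p) * x) * (\<kappa> powr - (1 / p) * y)"
    using assms by (simp add: powr_minus)
  also have "\<dots> \<le> (\<kappa> powr (1 / p) * x) powr p / p + (\<kappa> powr - (1 / p) * y) powr ?q / ?q"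
    by (rule Youngs_inequality) (use assms q in auto)
  also have "\<dots> \<le> (\<kappa> powr (1 / p) * x) powr p + (\<kappa> powr - (1 / p) * y) powr ?q"
  proof -
    have L: "X / r \<le> X" if "0 \<le> X" "1 < r" for X r :: real
      using that by (simp add: pos_divide_le_eq mult_le_cancel_left1)
    show ?thesis using p q(1) by (intro add_mono L) simp_all
  qed
  also have "(\<kappa> powr (1 / p) * x) powr p = \<kappa> * x powr p"
    using assms by (simp add: powr_mult powr_powr)
  also have "(\<kappa> powr - (1 / p) * y) powr ?q = \<kappa> powr - (1 / (p - 1)) * y powr ?q"
    using assms by (simp add: powr_mult powr_powr)
  finally show ?thesis .
qed

text \<open>Positive and negative part, taken as densities, define measures that agree on open
  boxes, an intersection-stable generator of the Borel sets. So the measures are equal, and the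
  densities agree almost everywhere.\<close>

lemma AE_zero_of_box_integrals:
  fixes f :: "'a::euclidean_space \<Rightarrow> real"
  assumes f: "integrable lebesgue f" and box: "\<And>c e. (LINT x|lebesgue. indicator (box c e) x * f x) = 0"
  shows "AE x in lebesgue. f x = 0"
proof -
  \<comment> \<open>A Borel representative is needed because \<open>lebesgue\<close> is a
    completion, whose sets are not generated by boxes.\<close>
  obtain g where g[measurable]: "g \<in> borel_measurable lborel" and fg: "AE x in lborel. f x = g x"
    using completion_ex_borel_measurable_real[of f lborel] f by auto
  have fg': "AE x in lebesgue. f x = g x" using fg by (rule AE_completion)
  have g': "g \<in> borel_measurable lebesgue" using g by (rule measurable_completion)
  have fm: "f \<in> borel_measurable lebesgue" using f by simp
  have "integrable lebesgue g" using f fg' g' fm by (subst (asm) integrable_cong_AE) auto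
  then have gi: "integrable lborel g" using g by (simp add: integrable_completion)
  have bx: "(LINT x|lborel. indicator (box c e) x * g x) = 0" for c e
  proof -
    have "(LINT x|lborel. indicator (box c e) x * g x) = (LINT x|lebesgue. indicator (box c e) x * g x)"
      by (rule integral_completion[symmetric]) measurable
    also have "\<dots> = (LINT x|lebesgue. indicator (box c e) x * f x)"
    proof (rule integral_cong_AE)
      show "AE x in lebesgue. indicator (box c e) x * g x = indicator (box c e) x * f x"
        using fg' by eventually_elim simp
      have "indicator (box c e) \<in> borel_measurable (lebesgue :: 'a measure)"
        by (intro borel_measurable_indicator sets_completionI_sets) simp
      then show "(\<lambda>x. indicator (box c e) x * g x) \<in> borel_measurable lebesgue"
          "(\<lambda>x. indicator (box c e) x * f x) \<in> borel_measurable lebesgue"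
        using g' fm by (auto intro!: borel_measurable_times)
    qed
    finally show ?thesis using box by simp
  qed
  have nn: "(\<integral>\<^sup>+x. ennreal (max 0 (g x)) * indicator (box c e) x \<partial>lborel) = (\<integral>\<^sup>+x. ennreal (max 0 (- g x)) * indicator (box c e) x \<partial>lborel)" for c e
  proof -
    have i: "integrable lborel (\<lambda>x. indicator (box c e) x * max 0 (g x))" "integrable lborel (\<lambda>x. indicator (box c e) x * max 0 (- g x))"
      by (rule Bochner_Integration.integrable_bound[OF gi], measurable, intro AE_I2, simp add: indicator_def max_def)+
    have "(LINT x|lborel. indicator (box c e) x * max 0 (g x)) - (LINT x|lborel. indicator (box c e) x * max 0 (- g x))
        = (LINT x|lborel. indicator (box c e) x * max 0 (g x) - indicator (box c e) x * max 0 (- g x))"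
      using i by simp
    also have "(\<lambda>x. indicator (box c e) x * max 0 (g x) - indicator (box c e) x * max 0 (- g x)) = (\<lambda>x. indicator (box c e) x * g x)"
      by (auto simp: fun_eq_iff indicator_def max_def)
    finally have e: "(LINT x|lborel. indicator (box c e) x * max 0 (g x)) = (LINT x|lborel. indicator (box c e) x * max 0 (- g x))"
      using bx by simp
    have "(\<integral>\<^sup>+x. ennreal (indicator (box c e) x * max 0 (g x)) \<partial>lborel) = (\<integral>\<^sup>+x. ennreal (indicator (box c e) x * max 0 (- g x)) \<partial>lborel)"
      using e nn_integral_eq_integral[OF i(1)] nn_integral_eq_integral[OF i(2)] by simp
    then show ?thesis by (simp add: ennreal_mult' ennreal_indicator mult.commute)
  qed
  have "density lborel (\<lambda>x. ennreal (max 0 (g x))) = density lborel (\<lambda>x. ennreal (max 0 (- g x)))"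
  proof (rule measure_eqI_generator_eq)
    let ?E = "range (\<lambda>(a, b). box a b :: 'a set)"
    show "Int_stable ?E" by (auto simp: Int_stable_def Int_interval box_Int_box)
    show "?E \<subseteq> Pow UNIV" by simp
    show "emeasure (density lborel (\<lambda>x. ennreal (max 0 (g x)))) X = emeasure (density lborel (\<lambda>x. ennreal (max 0 (- g x)))) X"
      if "X \<in> ?E" for X
      using that nn by (auto simp: emeasure_density)
    show "sets (density lborel (\<lambda>x. ennreal (max 0 (g x)))) = sigma_sets UNIV ?E"
      "sets (density lborel (\<lambda>x. ennreal (max 0 (- g x)))) = sigma_sets UNIV ?E"
      by (simp_all add: borel_eq_box)
    let ?A = "\<lambda>n::nat. box (- (real n *\<^sub>R One)) (real n *\<^sub>R One) :: 'a set"
    show "range ?A \<subseteq> ?E" by auto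
    show "(\<Union>i. ?A i) = UNIV" by (rule UN_box_eq_UNIV)
    show "emeasure (density lborel (\<lambda>x. ennreal (max 0 (g x)))) (?A i) \<noteq> \<infinity>" for i
    proof -
      have "emeasure (density lborel (\<lambda>x. ennreal (max 0 (g x)))) (?A i) \<le> (\<integral>\<^sup>+x. ennreal (norm (g x)) \<partial>lborel)"
        by (subst emeasure_density) (auto intro!: nn_integral_mono ennreal_leI split: split_indicator)
      also have "\<dots> < \<infinity>" using gi by (simp add: integrable_iff_bounded)
      finally show ?thesis by simp
    qed
  qed
  then have "AE x in lborel. ennreal (max 0 (g x)) = ennreal (max 0 (- g x))"
    by (intro sigma_finite_measure.density_unique[OF sigma_finite_lborel]) auto
  then have "AE x in lborel. g x = 0" by eventually_elim (auto simp: max_def split: if_splits)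
  then have "AE x in lebesgue. g x = 0" by (rule AE_completion)
  with fg' show ?thesis by eventually_elim simp
qed

lemma borel_measurable_space_time_weight:
  "(\<lambda>z::real \<times> 'a::euclidean_space. indicator {0..T} (fst z) * weight s (snd z /\<^sub>R \<rho>) :: real) \<in> borel_measurable borel"
proof (rule borel_measurable_times)
  have "fst \<in> borel_measurable (borel :: (real \<times> 'a) measure)"
    by (intro borel_measurable_continuous_onI continuous_intros)
  then show "(\<lambda>z::real \<times> 'a. indicator {0..T} (fst z) :: real) \<in> borel_measurable borel"
    by (rule measurable_compose) simp
  show "(\<lambda>z::real \<times> 'a. weight s (snd z /\<^sub>R \<rho>)) \<in> borel_measurable borel"
    by (intro borel_measurable_continuous_onI continuous_on_weight continuous_intros)
qed

lemma integrable_space_time_weight: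
  assumes s: "0 < s" "s < 1" and \<rho>: "\<rho> > 0" and T: "T \<ge> 0"
  shows "integrable lebesgue (\<lambda>z::real \<times> 'a::euclidean_space. indicator {0..T} (fst z) * weight s (snd z /\<^sub>R \<rho>))"
    and "(LINT z|lebesgue. indicator {0..T} (fst z) * weight s ((snd z :: 'a) /\<^sub>R \<rho>)) =
      T * (\<rho> powr real DIM('a) * (LINT x::'a|lborel. weight s x))"
proof -
  have wi: "integrable lborel (\<lambda>x::'a. weight s (x /\<^sub>R \<rho>))"
    using lborel_integrable_affine_iff[of "inverse \<rho>" "weight s" "0::'a"] integrable_weight[OF s] \<rho> by simp
  have "(LINT x::'a|lborel. weight s x) = inverse \<rho> ^ DIM('a) * (LINT x::'a|lborel. weight s (x /\<^sub>R \<rho>))"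
    using lborel_integral_affine[of "inverse \<rho>" "weight s" "0::'a"] \<rho> by simp
  then have we: "(LINT x::'a|lborel. weight s (x /\<^sub>R \<rho>)) = \<rho> powr real DIM('a) * (LINT x::'a|lborel. weight s x)"
    using \<rho> by (simp add: powr_realpow field_simps)
  have ii: "integrable lborel (indicator {0..T} :: real \<Rightarrow> real)"
    using T by (intro integrable_real_indicator) auto
  have eq: "(\<lambda>z::real \<times> 'a. indicator {0..T} (fst z) * weight s (snd z /\<^sub>R \<rho>)) = (\<lambda>(t, x). indicator {0..T} t * weight s (x /\<^sub>R \<rho>))"
    by (simp add: fun_eq_iff)
  have m: "(\<lambda>z::real \<times> 'a. indicator {0..T} (fst z) * weight s (snd z /\<^sub>R \<rho>) :: real) \<in> borel_measurable lborel"
    using borel_measurable_space_time_weight by simp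
  have P: "integrable (lborel \<Otimes>\<^sub>M lborel) (\<lambda>(t, x::'a). indicator {0..T} t * weight s (x /\<^sub>R \<rho>))"
  proof (rule lborel_pair.Fubini_integrable)
    show "(\<lambda>(t, x::'a). indicator {0..T} t * weight s (x /\<^sub>R \<rho>)) \<in> borel_measurable (lborel \<Otimes>\<^sub>M lborel)"
      by measurable
    show "integrable lborel (\<lambda>t. LINT x|lborel. norm (case (t, x) of (t, x::'a) \<Rightarrow> indicator {0..T} t * weight s (x /\<^sub>R \<rho>)))"
      using ii by (simp add: abs_mult)
    show "AE t in lborel. integrable lborel (\<lambda>x. case (t, x) of (t, x::'a) \<Rightarrow> indicator {0..T} t * weight s (x /\<^sub>R \<rho>))"
      using wi by simp
  qed
  then show "integrable lebesgue (\<lambda>z::real \<times> 'a. indicator {0..T} (fst z) * weight s (snd z /\<^sub>R \<rho>))"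
    using m by (simp add: integrable_completion eq lborel_prod)
  have "(LINT z|lebesgue. indicator {0..T} (fst z) * weight s ((snd z :: 'a) /\<^sub>R \<rho>)) =
      (LINT z|(lborel \<Otimes>\<^sub>M lborel). (case z of (t, x::'a) \<Rightarrow> indicator {0..T} t * weight s (x /\<^sub>R \<rho>)))"
    using m by (simp add: integral_completion eq lborel_prod)
  also have "\<dots> = (LINT t|lborel. (LINT x::'a|lborel. indicator {0..T} t * weight s (x /\<^sub>R \<rho>)))"
    using lborel_pair.integral_fst[OF P] by simp
  also have "\<dots> = T * (\<rho> powr real DIM('a) * (LINT x::'a|lborel. weight s x))"
    using T by (simp add: we)
  finally show "(LINT z|lebesgue. indicator {0..T} (fst z) * weight s ((snd z :: 'a) /\<^sub>R \<rho>)) =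
      T * (\<rho> powr real DIM('a) * (LINT x::'a|lborel. weight s x))" .
qed

section \<open>Weighted integrability of weak solutions\<close>

definition weak_density :: "real \<Rightarrow> real \<Rightarrow> real \<Rightarrow> (real \<times> 'a::euclidean_space \<Rightarrow> real) \<Rightarrow> real \<times> 'a \<Rightarrow> real" where
  "weak_density a b s \<phi> z = - deriv (\<lambda>\<tau>. \<phi> (\<tau>, snd z)) (fst z) + mixed_op a b s (\<lambda>y. \<phi> (fst z, y)) (snd z)"

text \<open>Extending a weak solution by \<open>0\<close> to negative times removes the restriction of the integrals
  to the half-space.\<close>

lemma global_weak_solutionD:
  fixes u0 :: "'a::euclidean_space \<Rightarrow> real"
  assumes sol: "global_weak_solution a b s p u0 u"
  defines "v \<equiv> \<lambda>z. indicator ({0..} \<times> UNIV) z * u z"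
  shows "v \<in> borel_measurable lebesgue"
    and "\<And>K. compact K \<Longrightarrow> K \<subseteq> {0..} \<times> UNIV \<Longrightarrow> integrable lebesgue (\<lambda>z. indicator K z * \<bar>v z\<bar> powr p)"
    and "\<And>\<phi> :: real \<times> 'a \<Rightarrow> real. test_function \<phi> \<Longrightarrow> integrable lebesgue (\<lambda>z. \<bar>v z\<bar> powr p * \<phi> z)"
    and "\<And>\<phi> :: real \<times> 'a \<Rightarrow> real. test_function \<phi> \<Longrightarrow> integrable lebesgue (\<lambda>x. u0 x * \<phi> (0, x))"
    and "\<And>\<phi> :: real \<times> 'a \<Rightarrow> real. test_function \<phi> \<Longrightarrow> integrable lebesgue (\<lambda>z. v z * weak_density a b s \<phi> z)"
    and "\<And>\<phi> :: real \<times> 'a \<Rightarrow> real. test_function \<phi> \<Longrightarrow> (LINT z|lebesgue. \<bar>v z\<bar> powr p * \<phi> z) + (LINT x|lebesgue. u0 x * \<phi> (0, x))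
      = (LINT z|lebesgue. v z * weak_density a b s \<phi> z)"
proof -
  have loc: "Lp_loc_on p ({0..} \<times> UNIV) u" using sol by (simp add: global_weak_solution_def)
  have "{0::real..} \<times> (UNIV::'a set) \<in> sets borel"
    by (intro borel_closed closed_Times closed_atLeast closed_UNIV)
  then have "{0::real..} \<times> (UNIV::'a set) \<in> sets lebesgue" by (intro sets_completionI_sets) simp
  then show "v \<in> borel_measurable lebesgue"
    using loc unfolding Lp_loc_on_def v_def
    by (simp add: borel_measurable_restrict_space_iff)
  have 1: "indicator ({0..} \<times> UNIV) z *\<^sub>R (case z of (t, x) \<Rightarrow> \<bar>u (t, x)\<bar> powr p * \<phi> (t, x)) = \<bar>v z\<bar> powr p * \<phi> z" for \<phi> z
    by (auto simp: v_def indicator_def split: prod.splits)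
  have 2: "indicator ({0..} \<times> UNIV) z *\<^sub>R (case z of (t, x) \<Rightarrow> u (t, x) * (- deriv (\<lambda>\<tau>. \<phi> (\<tau>, x)) t + mixed_op a b s (\<lambda>y. \<phi> (t, y)) x))
      = v z * weak_density a b s \<phi> z" for \<phi> z
    by (auto simp: v_def indicator_def weak_density_def split: prod.splits)
  show "integrable lebesgue (\<lambda>z. indicator K z * \<bar>v z\<bar> powr p)" if "compact K" "K \<subseteq> {0..} \<times> UNIV" for K
  proof -
    have "set_integrable lebesgue K (\<lambda>z. \<bar>u z\<bar> powr p)" using loc that by (simp add: Lp_loc_on_def)
    moreover have "indicator K z *\<^sub>R \<bar>u z\<bar> powr p = indicator K z * \<bar>v z\<bar> powr p" for z
      using that(2) by (auto simp: v_def indicator_def)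
    ultimately show ?thesis unfolding set_integrable_def by (simp only:)
  qed
  fix \<phi> :: "real \<times> 'a \<Rightarrow> real" assume \<phi>: "test_function \<phi>"
  note W = sol[unfolded global_weak_solution_def, THEN conjunct2, rule_format, OF \<phi>,
      unfolded set_integrable_def set_lebesgue_integral_def 1 2]
  from W show "integrable lebesgue (\<lambda>z. \<bar>v z\<bar> powr p * \<phi> z)" by blast
  from W show "integrable lebesgue (\<lambda>x. u0 x * \<phi> (0, x))" by blast
  from W show "integrable lebesgue (\<lambda>z. v z * weak_density a b s \<phi> z)" by blast
  from W show "(LINT z|lebesgue. \<bar>v z\<bar> powr p * \<phi> z) + (LINT x|lebesgue. u0 x * \<phi> (0, x))
      = (LINT z|lebesgue. v z * weak_density a b s \<phi> z)" by blast
qed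

lemma bump_le_weight:
  "M > 0 \<Longrightarrow> bump ((real DIM('a) + 2 * s) / 2) M (x::'a::euclidean_space) \<le> weight s x"
  unfolding bump_def profile_def weight_def
  using cutoff_le_1[of "(norm x)\<^sup>2 / M"] by (intro mult_right_le_one_le) (auto simp: cutoff_nonneg)

text \<open>Beyond the support of a bump, the nonlocal term alone contributes to the weak formulation, and
  it has the decay of the weight. Testing with a bump thus shows that every weak solution is
  integrable against the weight.\<close>

lemma weak_solution_weight_integrable:
  fixes v :: "real \<times> 'a::euclidean_space \<Rightarrow> real"
  assumes s: "0 < s" "s < 1" and ab: "0 < a" "0 < b" and p: "1 < p"
    and vm: "v \<in> borel_measurable lebesgue"
    and vK: "\<And>K. compact K \<Longrightarrow> K \<subseteq> {0..} \<times> UNIV \<Longrightarrow> integrable lebesgue (\<lambda>z. indicator K z * \<bar>v z\<bar> powr p)"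
    and vA: "\<And>\<phi>. test_function \<phi> \<Longrightarrow> integrable lebesgue (\<lambda>z. v z * weak_density a b s \<phi> z)"
    and T: "0 < T" and \<rho>: "1 \<le> \<rho>"
  shows "integrable lebesgue (\<lambda>z. indicator {0..T} (fst z) * (\<bar>v z\<bar> * weight s (snd z /\<^sub>R \<rho>)))"
proof -
  define \<sigma> where "\<sigma> = (real DIM('a) + 2 * s) / 2"
  \<comment> \<open>The time cutoff lives on |t| \<le> 2 T, so on \<open>{0..T}\<close> it is at
    least cutoff (1/4), which is positive and can be divided by.\<close>
  define \<phi> where "\<phi> z = cutoff ((fst z / (2 * T))\<^sup>2) * bump \<sigma> 1 (snd z /\<^sub>R 1)" for z :: "real \<times> 'a"
  have \<phi>: "test_function \<phi>" unfolding \<phi>_def using T by (intro test_function_bump) auto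
  obtain c0 where c0: "c0 > 0" "\<And>c x::'a. c \<ge> 0 \<Longrightarrow> 2 \<le> norm x \<Longrightarrow> mixed_op a b s (\<lambda>y. c * bump \<sigma> 1 y) x \<le> - (c0 * c * weight s x)"
    using mixed_op_bump_far[OF s, of a b, where 'a='a] ab unfolding \<sigma>_def by auto
  define \<eta> where "\<eta> = cutoff (1 / 4)"
  have \<eta>: "\<eta> > 0" unfolding \<eta>_def by (rule cutoff_pos) simp
  define K where "K = {0..T} \<times> cball (0::'a) 2"
  have K: "compact K" "K \<subseteq> {0..} \<times> UNIV" unfolding K_def by (auto intro!: compact_Times)
  have Km: "K \<in> sets lebesgue" using K(1) by (intro sets_completionI_sets) (simp add: borel_compact)
  have Ki: "integrable lebesgue (indicator K :: real \<times> 'a \<Rightarrow> real)"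
    using K(1) by (intro integrable_real_indicator Km) (use emeasure_bounded_finite[OF compact_imp_bounded[OF K(1)]] in \<open>simp add: emeasure_completion borel_compact K(1)\<close>)
  have far: "weight s x \<le> \<bar>weak_density a b s \<phi> (t, x)\<bar> / (c0 * \<eta>)" if t: "0 \<le> t" "t \<le> T" and x: "norm x > 2" for t x
  proof -
    have "bump \<sigma> 1 x = 0" using x by (intro bump_eq_0) auto
    then have d: "deriv (\<lambda>\<tau>. \<phi> (\<tau>, x)) t = 0" by (simp add: \<phi>_def)
    have "t / (2 * T) \<le> 1 / 2" using t T by (simp add: field_simps)
    then have "(t / (2 * T))\<^sup>2 \<le> (1 / 2)\<^sup>2" using t T by (intro power_mono) auto
    then have \<eta>t: "\<eta> \<le> cutoff ((t / (2 * T))\<^sup>2)" unfolding \<eta>_def by (intro cutoff_mono) (simp add: power2_eq_square)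
    have "mixed_op a b s (\<lambda>y. \<phi> (t, y)) x \<le> - (c0 * cutoff ((t / (2 * T))\<^sup>2) * weight s x)"
      using c0(2)[of "cutoff ((t / (2 * T))\<^sup>2)" x] x by (simp add: \<phi>_def cutoff_nonneg)
    also have "\<dots> \<le> - (c0 * \<eta> * weight s x)"
      using c0(1) \<eta>t weight_pos[of s x] by (simp add: mult_left_mono mult_right_mono)
    finally have "c0 * \<eta> * weight s x \<le> \<bar>weak_density a b s \<phi> (t, x)\<bar>"
      by (simp add: weak_density_def d)
    then show ?thesis using c0(1) \<eta> by (simp add: pos_le_divide_eq mult.commute)
  qed
  \<comment> \<open>On \<open>K\<close> the bound is |v| \<le> 1 + |v|^p, integrable on compact
    sets. Off \<open>K\<close> the weight is estimated by the weak density of \<open>\<phi>\<close>,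
    whose product with v is integrable because v solves the equation weakly.\<close>
  define g where "g z = indicator K z + indicator K z * \<bar>v z\<bar> powr p + \<bar>v z * weak_density a b s \<phi> z\<bar> / (c0 * \<eta>)" for z
  have gi: "integrable lebesgue g"
    unfolding g_def by (intro Bochner_Integration.integrable_add Ki vK K integrable_divide integrable_abs vA \<phi>)
  have pt: "indicator {0..T} (fst z) * (\<bar>v z\<bar> * weight s (snd z)) \<le> g z" for z
  proof (cases "fst z \<in> {0..T}")
    case True
    obtain t x where [simp]: "z = (t, x)" by (cases z)
    have g0: "0 \<le> indicator K z * \<bar>v z\<bar> powr p" "0 \<le> \<bar>v z * weak_density a b s \<phi> z\<bar> / (c0 * \<eta>)"
      using c0 \<eta> by auto
    show ?thesis
    proof (cases "norm x \<le> 2")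
      case x: True
      then have zK: "z \<in> K" using True by (simp add: K_def)
      have "\<bar>v z\<bar> * weight s x \<le> \<bar>v z\<bar>" using weight_le_1[OF s(1), of x] by (intro mult_left_le) auto
      also have "\<dots> \<le> 1 + \<bar>v z\<bar> powr p"
      proof (cases "\<bar>v z\<bar> \<le> 1")
        case False
        then have "\<bar>v z\<bar> powr 1 \<le> \<bar>v z\<bar> powr p" using p by (intro powr_mono) auto
        then show ?thesis using False by simp
      qed (simp add: add_increasing2)
      finally show ?thesis using True zK g0(2) by (simp add: g_def)
    next
      case False
      then have "\<bar>v z\<bar> * weight s x \<le> \<bar>v z\<bar> * (\<bar>weak_density a b s \<phi> z\<bar> / (c0 * \<eta>))"
        using far[of t x] True by (intro mult_left_mono) auto
      then show ?thesis using True g0(1) by (simp add: g_def abs_mult add_increasing indicator_def[of K])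
    qed
  next
    case False
    then have "indicator {0..T} (fst z) = (0::real)" by simp
    then show ?thesis using c0 \<eta> by (simp only: mult_zero_left) (simp add: g_def)
  qed
  have m: "(\<lambda>z. indicator {0..T} (fst z) * (\<bar>v z\<bar> * weight s (snd z /\<^sub>R r))) \<in> borel_measurable lebesgue" for r
  proof -
    have "(\<lambda>z::real \<times> 'a. indicator {0..T} (fst z) * weight s (snd z /\<^sub>R r) :: real) \<in> borel_measurable lborel"
      using borel_measurable_space_time_weight by simp
    then have "(\<lambda>z::real \<times> 'a. indicator {0..T} (fst z) * weight s (snd z /\<^sub>R r) :: real) \<in> borel_measurable lebesgue"
      by (rule measurable_completion)
    from borel_measurable_times[OF this borel_measurable_abs[OF vm]] show ?thesis by (simp add: mult_ac)
  qed
  have "integrable lebesgue (\<lambda>z. indicator {0..T} (fst z) * (\<bar>v z\<bar> * weight s (snd z)))"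
  proof (rule Bochner_Integration.integrable_bound[OF gi])
    have "norm (indicator {0..T} (fst z) * (\<bar>v z\<bar> * weight s (snd z))) \<le> norm (g z)" for z
    proof -
      have "norm (indicator {0..T} (fst z) * (\<bar>v z\<bar> * weight s (snd z))) = indicator {0..T} (fst z) * (\<bar>v z\<bar> * weight s (snd z))"
        by (simp add: abs_mult abs_of_pos[OF weight_pos])
      also have "\<dots> \<le> norm (g z)" using pt[of z] by simp
      finally show ?thesis .
    qed
    then show "AE z in lebesgue. norm (indicator {0..T} (fst z) * (\<bar>v z\<bar> * weight s (snd z))) \<le> norm (g z)" by blast
  qed (use m[of 1] in simp)
  then have wi: "integrable lebesgue (\<lambda>z. \<rho> powr (2 * \<sigma>) * (indicator {0..T} (fst z) * (\<bar>v z\<bar> * weight s (snd z))))"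
    by (rule integrable_mult_right)
  \<comment> \<open>Dilation by \<rho> \<ge> 1 raises the weight by a bounded factor only, so the
    case \<rho> = 1 carries over.\<close>
  have ws: "weight s (x /\<^sub>R \<rho>) \<le> \<rho> powr (2 * \<sigma>) * weight s x" for x :: 'a
  proof -
    have "1 / \<rho>\<^sup>2 \<le> 1" using \<rho> one_le_power[of \<rho> 2] by simp
    moreover have "(norm (x /\<^sub>R \<rho>))\<^sup>2 = (norm x)\<^sup>2 / \<rho>\<^sup>2"
      using \<rho> by (simp add: power_divide divide_inverse_commute[symmetric])
    ultimately have "1 + (norm (x /\<^sub>R \<rho>))\<^sup>2 \<ge> (1 + (norm x)\<^sup>2) / \<rho>\<^sup>2"
      by (simp add: add_divide_distrib)
    then have "weight s (x /\<^sub>R \<rho>) \<le> ((1 + (norm x)\<^sup>2) / \<rho>\<^sup>2) powr - \<sigma>"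
      unfolding weight_def \<sigma>_def[symmetric] using \<rho> one_plus_norm_sq_pos[of x] s
      by (intro powr_mono2') (auto simp: \<sigma>_def)
    also have "\<dots> = weight s x * (\<rho>\<^sup>2) powr \<sigma>"
    proof -
      have "((1 + (norm x)\<^sup>2) / \<rho>\<^sup>2) powr - \<sigma> = (1 + (norm x)\<^sup>2) powr - \<sigma> / (\<rho>\<^sup>2) powr - \<sigma>"
        by (rule powr_divide)
      then show ?thesis unfolding weight_def \<sigma>_def[symmetric] by (simp add: powr_minus divide_inverse)
    qed
    also have "(\<rho>\<^sup>2) powr \<sigma> = \<rho> powr (2 * \<sigma>)" using \<rho> by (simp add: powr_powr flip: powr_numeral)
    finally show ?thesis by (simp add: mult.commute)
  qed
  show ?thesis
  proof (rule Bochner_Integration.integrable_bound[OF wi m])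
    have "norm (indicator {0..T} (fst z) * (\<bar>v z\<bar> * weight s (snd z /\<^sub>R \<rho>))) \<le>
       norm (\<rho> powr (2 * \<sigma>) * (indicator {0..T} (fst z) * (\<bar>v z\<bar> * weight s (snd z))))" for z
      using ws[of "snd z"] mult_left_mono[OF ws[of "snd z"], of "\<bar>v z\<bar>"]
      by (auto simp: abs_mult abs_of_pos[OF weight_pos] indicator_def mult_ac)
    then show "AE z in lebesgue. norm (indicator {0..T} (fst z) * (\<bar>v z\<bar> * weight s (snd z /\<^sub>R \<rho>))) \<le>
       norm (\<rho> powr (2 * \<sigma>) * (indicator {0..T} (fst z) * (\<bar>v z\<bar> * weight s (snd z))))" by blast
  qed
qed

text \<open>The time derivative of the cutoff vanishes linearly at \<open>t = 0\<close>; this replaces the plateau that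
  localises it near \<open>t = T\<close> in the critical case.\<close>

lemma weak_density_bound:
  assumes s: "0 < s" "s < 1" and ab: "0 < a" "0 < b" and p: "1 < p"
  shows "\<exists>C\<ge>0. \<forall>M T \<rho> t. \<forall>x::'a::euclidean_space. M \<ge> 1 \<longrightarrow> T > 0 \<longrightarrow> \<rho> \<ge> 1 \<longrightarrow> t \<ge> 0 \<longrightarrow>
    \<bar>weak_density a b s (\<lambda>z. cutoff ((fst z / T)\<^sup>2) * bump ((real DIM('a) + 2 * s) / 2) M (snd z /\<^sub>R \<rho>)) (t, x)\<bar>
    \<le> indicator {0..T} t * (C * (t / T) / T + C * \<rho> powr (- 2 * s)) * cutoff ((t / T)\<^sup>2) powr (1 / p) * weight s (x /\<^sub>R \<rho>)"
proof -
  define \<sigma> where "\<sigma> = (real DIM('a) + 2 * s) / 2"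
  have \<sigma>: "\<sigma> > 0" using s by (simp add: \<sigma>_def add_nonneg_pos)
  obtain C1 where C1: "C1 \<ge> 0" "\<And>t. \<bar>expinvD 1 t\<bar> \<le> C1 * expinv t powr (1 / p)"
    using expinvD_powr_bound[of "1 / p" 1] p by auto
  obtain A where A: "A \<ge> 0" "\<And>M. M \<ge> 1 \<Longrightarrow> \<exists>F1 F2. radial_bound \<sigma> A (profile \<sigma> M) F1 F2"
    using radial_bound_profile[OF \<sigma>] by blast
  obtain C2 where C2: "C2 \<ge> 0" "\<And>A F F1 F2 c \<rho> x::'a. A \<ge> 0 \<Longrightarrow> \<rho> \<ge> 1 \<Longrightarrow> radial_bound \<sigma> A F F1 F2 \<Longrightarrow>
      \<bar>mixed_op a b s (\<lambda>y. c * F ((norm (y /\<^sub>R \<rho>))\<^sup>2)) x\<bar> \<le> C2 * A * \<bar>c\<bar> * \<rho> powr (- 2 * s) * weight s (x /\<^sub>R \<rho>)"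
    using mixed_op_radial_bound[OF s, of a b, where 'a='a] ab unfolding \<sigma>_def by (metis less_imp_le)
  define C where "C = max (2 * exp 1 * C1) (C2 * A)"
  have C: "C \<ge> 0" "2 * exp 1 * C1 \<le> C" "C2 * A \<le> C" unfolding C_def using C2 A by (auto simp: le_max_iff_disj)
  have "\<bar>weak_density a b s (\<lambda>z. cutoff ((fst z / T)\<^sup>2) * bump \<sigma> M (snd z /\<^sub>R \<rho>)) (t, x)\<bar>
    \<le> indicator {0..T} t * (C * (t / T) / T + C * \<rho> powr (- 2 * s)) * cutoff ((t / T)\<^sup>2) powr (1 / p) * weight s (x /\<^sub>R \<rho>)"
    if M: "M \<ge> 1" and T: "T > 0" and \<rho>: "\<rho> \<ge> 1" and t: "t \<ge> 0" for M T \<rho> t and x :: 'a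
  proof -
    let ?\<eta> = "cutoff ((t / T)\<^sup>2)" and ?w = "weight s (x /\<^sub>R \<rho>)"
    have \<eta>0: "0 \<le> ?\<eta>" "?\<eta> \<le> 1" by (auto simp: cutoff_nonneg cutoff_le_1)
    have w0: "?w > 0" by (rule weight_pos)
    have bw: "0 \<le> bump \<sigma> M (x /\<^sub>R \<rho>)" "bump \<sigma> M (x /\<^sub>R \<rho>) \<le> ?w"
      using M bump_le_weight[of M s "x /\<^sub>R \<rho>"] by (auto simp: bump_nonneg \<sigma>_def)
    have "((\<lambda>\<tau>. cutoff ((\<tau> / T)\<^sup>2)) has_real_derivative (- exp 1 * expinvD 1 (1 - (t / T)\<^sup>2)) * (2 * (t / T) / T)) (at t)"
      by (rule DERIV_chain2[OF cutoff_has_derivative]) (use T in \<open>auto intro!: derivative_eq_intros\<close>)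
    from DERIV_imp_deriv[OF DERIV_cmult_right[OF this, of "bump \<sigma> M (x /\<^sub>R \<rho>)"]]
    have d: "deriv (\<lambda>\<tau>. cutoff ((\<tau> / T)\<^sup>2) * bump \<sigma> M (x /\<^sub>R \<rho>)) t = 
        (- exp 1 * expinvD 1 (1 - (t / T)\<^sup>2)) * (2 * (t / T) / T) * bump \<sigma> M (x /\<^sub>R \<rho>)" .
    \<comment> \<open>\<open>cutoff\<close> is \<open>exp 1\<close> times \<open>expinv\<close>,
      hence at least as large; this turns the bound on the derivative into one by a power of the
      cutoff itself.\<close>
    have "expinv (1 - (t / T)\<^sup>2) \<le> ?\<eta>"
      unfolding cutoff_def using expinv_nonneg[of "1 - (t / T)\<^sup>2"] mult_right_mono[of 1 "exp 1" "expinv (1 - (t / T)\<^sup>2)"] by simp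
    then have "expinv (1 - (t / T)\<^sup>2) powr (1 / p) \<le> ?\<eta> powr (1 / p)"
      using p expinv_nonneg by (intro powr_mono2) auto
    then have e: "\<bar>expinvD 1 (1 - (t / T)\<^sup>2)\<bar> \<le> C1 * ?\<eta> powr (1 / p)"
      using C1(2)[of "1 - (t / T)\<^sup>2"] C1(1) by (meson mult_left_mono order_trans)
    have db: "\<bar>deriv (\<lambda>\<tau>. cutoff ((\<tau> / T)\<^sup>2) * bump \<sigma> M (x /\<^sub>R \<rho>)) t\<bar> \<le> C * (t / T) / T * ?\<eta> powr (1 / p) * ?w"
    proof -
      have "\<bar>deriv (\<lambda>\<tau>. cutoff ((\<tau> / T)\<^sup>2) * bump \<sigma> M (x /\<^sub>R \<rho>)) t\<bar>
          = exp 1 * \<bar>expinvD 1 (1 - (t / T)\<^sup>2)\<bar> * (2 * (t / T) / T) * bump \<sigma> M (x /\<^sub>R \<rho>)"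
        unfolding d using bw t T by (simp add: abs_mult)
      also have "\<dots> \<le> exp 1 * (C1 * ?\<eta> powr (1 / p)) * (2 * (t / T) / T) * ?w"
        using e bw t T C1(1) by (intro mult_mono mult_nonneg_nonneg) auto
      also have "\<dots> = (2 * exp 1 * C1) * ((t / T) / T * ?\<eta> powr (1 / p) * ?w)" by simp
      also have "\<dots> \<le> C * ((t / T) / T * ?\<eta> powr (1 / p) * ?w)"
        using C(2) t T w0 by (intro mult_right_mono) auto
      finally show ?thesis by (simp add: mult_ac)
    qed
    obtain F1 F2 where F: "radial_bound \<sigma> A (profile \<sigma> M) F1 F2" using A(2)[OF M] by blast
    have "\<bar>mixed_op a b s (\<lambda>y. ?\<eta> * bump \<sigma> M (y /\<^sub>R \<rho>)) x\<bar> \<le> C2 * A * \<bar>?\<eta>\<bar> * \<rho> powr (- 2 * s) * ?w"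
      unfolding bump_def by (rule C2(2)[OF A(1) \<rho> F])
    also have "\<dots> = (C2 * A) * (?\<eta> * (\<rho> powr (- 2 * s) * ?w))" using \<eta>0 by simp
    also have "\<dots> \<le> C * (?\<eta> powr (1 / p) * (\<rho> powr (- 2 * s) * ?w))"
    proof (intro mult_mono mult_right_mono C)
      have "?\<eta> powr 1 \<le> ?\<eta> powr (1 / p)" using p \<eta>0 by (intro powr_mono') auto
      then show "?\<eta> \<le> ?\<eta> powr (1 / p)" using \<eta>0 by simp
    qed (use C w0 \<eta>0 in auto)
    finally have mb: "\<bar>mixed_op a b s (\<lambda>y. ?\<eta> * bump \<sigma> M (y /\<^sub>R \<rho>)) x\<bar> \<le> C * \<rho> powr (- 2 * s) * ?\<eta> powr (1 / p) * ?w"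
      by (simp add: mult_ac)
    have "\<bar>weak_density a b s (\<lambda>z. cutoff ((fst z / T)\<^sup>2) * bump \<sigma> M (snd z /\<^sub>R \<rho>)) (t, x)\<bar>
       \<le> \<bar>deriv (\<lambda>\<tau>. cutoff ((\<tau> / T)\<^sup>2) * bump \<sigma> M (x /\<^sub>R \<rho>)) t\<bar> + \<bar>mixed_op a b s (\<lambda>y. ?\<eta> * bump \<sigma> M (y /\<^sub>R \<rho>)) x\<bar>"
      unfolding weak_density_def fst_conv snd_conv by linarith
    also have "\<dots> \<le> (C * (t / T) / T + C * \<rho> powr (- 2 * s)) * ?\<eta> powr (1 / p) * ?w"
      using db mb by (simp add: algebra_simps)
    finally have R: "\<bar>weak_density a b s (\<lambda>z. cutoff ((fst z / T)\<^sup>2) * bump \<sigma> M (snd z /\<^sub>R \<rho>)) (t, x)\<bar>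
       \<le> (C * (t / T) / T + C * \<rho> powr (- 2 * s)) * ?\<eta> powr (1 / p) * ?w" .
    \<comment> \<open>Beyond T the cutoff is 0, and \<open>0 powr (1 / p)\<close> is 0 as well, so
      inserting the indicator loses nothing.\<close>
    show ?thesis
    proof (cases "t \<le> T")
      case False
      then have "1 \<le> t / T" using T by simp
      then have "?\<eta> = 0" by (intro cutoff_eq_0 one_le_power)
      then show ?thesis using R by simp
    qed (use R t in simp)
  qed
  with C show ?thesis unfolding \<sigma>_def by blast
qed

section \<open>Convergence of the truncated test functions\<close>

lemma isCont_cutoff: "isCont cutoff r"
  by (rule DERIV_isCont[OF cutoff_has_derivative])

lemma isCont_weight_0: "isCont (weight s) (0::'a::euclidean_space)"
  using continuous_on_weight[OF continuous_on_id[of "UNIV :: 'a set"], of s]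
  by (simp add: continuous_on_eq_continuous_at)

lemma weight_0: "weight s (0::'a::euclidean_space) = 1"
  by (simp add: weight_def)

lemma bump_tendsto_weight:
  "(\<lambda>n. bump ((real DIM('a) + 2 * s) / 2) (real (Suc n)) (x::'a::euclidean_space)) \<longlonglongrightarrow> weight s x"
proof -
  have "(\<lambda>n. (norm x)\<^sup>2 * (1 / real (Suc n))) \<longlonglongrightarrow> (norm x)\<^sup>2 * 0"
    using LIMSEQ_inverse_real_of_nat by (intro tendsto_mult tendsto_const) (simp add: inverse_eq_divide)
  then have "(\<lambda>n. (norm x)\<^sup>2 / real (Suc n)) \<longlonglongrightarrow> 0" by simp
  then have "(\<lambda>n. cutoff ((norm x)\<^sup>2 / real (Suc n))) \<longlonglongrightarrow> cutoff 0"
    by (rule isCont_tendsto_compose[OF isCont_cutoff])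
  then have "(\<lambda>n. weight s x * cutoff ((norm x)\<^sup>2 / real (Suc n))) \<longlonglongrightarrow> weight s x * cutoff 0"
    by (intro tendsto_mult tendsto_const)
  then show ?thesis by (simp add: bump_def profile_def weight_def cutoff_0)
qed

lemma borel_measurable_lebesgue_continuous:
  fixes f :: "'b::euclidean_space \<Rightarrow> real"
  assumes "continuous_on UNIV f"
  shows "f \<in> borel_measurable lebesgue"
  using borel_measurable_continuous_onI[OF assms] by (intro measurable_completion) simp

section \<open>Energy inequality and its limit\<close>

context
  fixes a b s p :: real and u0 :: "'a::euclidean_space \<Rightarrow> real" and v :: "real \<times> 'a \<Rightarrow> real"
  assumes s: "0 < s" "s < 1" and ab: "0 < a" "0 < b" and p: "1 < p" "p \<le> fujita_exponent DIM('a) s"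
    and vm: "v \<in> borel_measurable lebesgue" and v0: "\<And>z. fst z < 0 \<Longrightarrow> v z = 0"
    and vK: "\<And>K. compact K \<Longrightarrow> K \<subseteq> {0..} \<times> UNIV \<Longrightarrow> integrable lebesgue (\<lambda>z. indicator K z * \<bar>v z\<bar> powr p)"
    and vP: "\<And>\<phi>. test_function \<phi> \<Longrightarrow> integrable lebesgue (\<lambda>z. \<bar>v z\<bar> powr p * \<phi> z)"
    and vU: "\<And>\<phi> :: real \<times> 'a \<Rightarrow> real. test_function \<phi> \<Longrightarrow> integrable lebesgue (\<lambda>x. u0 x * \<phi> (0, x))"
    and vA: "\<And>\<phi>. test_function \<phi> \<Longrightarrow> integrable lebesgue (\<lambda>z. v z * weak_density a b s \<phi> z)"
    and weq: "\<And>\<phi> :: real \<times> 'a \<Rightarrow> real. test_function \<phi> \<Longrightarrow> (LINT z|lebesgue. \<bar>v z\<bar> powr p * \<phi> z) + (LINT x|lebesgue. u0 x * \<phi> (0, x))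
      = (LINT z|lebesgue. v z * weak_density a b s \<phi> z)"
    and um: "u0 \<in> borel_measurable lebesgue" and un: "integrable lebesgue (\<lambda>x. max 0 (- u0 x))"
begin

definition \<eta> :: "real \<Rightarrow> real \<Rightarrow> real" where "\<eta> T t = cutoff ((t / T)\<^sup>2)"

lemma \<eta>_bounds: "0 \<le> \<eta> T t" "\<eta> T t \<le> 1"
  by (auto simp: \<eta>_def cutoff_nonneg cutoff_le_1)

lemma \<eta>_eq_0: "T > 0 \<Longrightarrow> t > T \<Longrightarrow> \<eta> T t = 0"
  unfolding \<eta>_def by (intro cutoff_eq_0 one_le_power) simp

lemma weight_scaled: "0 < weight s (x /\<^sub>R \<rho>)" "weight s (x /\<^sub>R \<rho>) \<le> 1" for x :: 'a
  by (rule weight_pos, rule weight_le_1[OF s(1)])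

lemma borel_measurable_v_powr: "(\<lambda>z. \<bar>v z\<bar> powr p) \<in> borel_measurable lebesgue"
  using vm by measurable

lemma \<eta>_weight_measurable:
  "(\<lambda>z::real \<times> 'a. \<eta> T (fst z) * weight s (snd z /\<^sub>R \<rho>)) \<in> borel_measurable lebesgue"
  unfolding \<eta>_def
proof (intro borel_measurable_lebesgue_continuous continuous_on_mult continuous_on_weight)
  show "continuous_on UNIV (\<lambda>z::real \<times> 'a. cutoff ((fst z / T)\<^sup>2))"
  proof -
    have "continuous_on UNIV cutoff" using isCont_cutoff by (simp add: continuous_on_eq_continuous_at)
    then show ?thesis
      by (rule continuous_on_compose2) (auto simp: divide_inverse intro!: continuous_intros)
  qed
qed (intro continuous_intros)

lemma weight_measurable: "(\<lambda>x::'a. weight s (x /\<^sub>R \<rho>)) \<in> borel_measurable lebesgue"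
  by (intro borel_measurable_lebesgue_continuous continuous_on_weight continuous_intros)

definition energy :: "real \<Rightarrow> real \<Rightarrow> real \<times> 'a \<Rightarrow> real" where
  "energy T \<rho> z = \<bar>v z\<bar> powr p * (\<eta> T (fst z) * weight s (snd z /\<^sub>R \<rho>))"

text \<open>The factor |t/T|^p comes from the linear vanishing of the time derivative of the cutoff
  at t = 0. It makes this part of the energy tend to 0 at each fixed point as T grows, whereas the
  full energy tends to |v|^p.\<close>

definition energy' :: "real \<Rightarrow> real \<Rightarrow> real \<times> 'a \<Rightarrow> real" where
  "energy' T \<rho> z = energy T \<rho> z * \<bar>fst z / T\<bar> powr p"

lemma energy_measurable: "energy T \<rho> \<in> borel_measurable lebesgue"
  unfolding energy_def[abs_def] by (intro borel_measurable_times borel_measurable_v_powr \<eta>_weight_measurable)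

lemma energy'_measurable: "energy' T \<rho> \<in> borel_measurable lebesgue"
proof -
  have "(\<lambda>z::real \<times> 'a. \<bar>fst z / T\<bar> powr p) \<in> borel_measurable lebesgue"
  proof (rule borel_measurable_lebesgue_continuous)
    have "continuous_on UNIV (\<lambda>z::real \<times> 'a. \<bar>fst z / T\<bar>)"
      unfolding divide_inverse by (intro continuous_intros)
    then show "continuous_on UNIV (\<lambda>z::real \<times> 'a. \<bar>fst z / T\<bar> powr p)"
      by (rule continuous_on_powr'[OF _ continuous_on_const]) (use p in auto)
  qed
  then show ?thesis unfolding energy'_def[abs_def] by (intro borel_measurable_times energy_measurable)
qed

lemma energy_nonneg: "0 \<le> energy T \<rho> z"
  unfolding energy_def using \<eta>_bounds weight_scaled by (intro mult_nonneg_nonneg) (auto simp: less_imp_le)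

lemma energy'_bounds: "0 \<le> energy' T \<rho> z" "T > 0 \<Longrightarrow> energy' T \<rho> z \<le> energy T \<rho> z"
proof -
  show "0 \<le> energy' T \<rho> z" unfolding energy'_def using energy_nonneg by simp
  assume T: "T > 0"
  show "energy' T \<rho> z \<le> energy T \<rho> z"
  proof (cases "0 \<le> fst z \<and> fst z \<le> T")
    case True
    then have "\<bar>fst z / T\<bar> powr p \<le> 1 powr p" using T p by (intro powr_mono2) auto
    then show ?thesis unfolding energy'_def using energy_nonneg by (simp add: mult_left_le)
  next
    case False
    then have "energy T \<rho> z = 0" using v0[of z] \<eta>_eq_0[OF T, of "fst z"] by (auto simp: energy_def)
    then show ?thesis by (simp add: energy'_def)
  qed
qed

text \<open>Only the negative part of u0 is known to be integrable, so the positive part is kept on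
  the left and obtained, together with the energy, by Fatou's lemma. Nothing is absorbed yet:
  \<kappa> weights the time derivative and \<epsilon> the operator term, and they are sent to
  different limits later.\<close>

lemma energy_inequality:
  "\<exists>C\<ge>0. \<forall>T>0. \<forall>\<rho>\<ge>1. \<forall>\<kappa>>0. \<forall>\<epsilon>>0.
    integrable lebesgue (energy T \<rho>) \<and> integrable lebesgue (\<lambda>x. max 0 (u0 x) * weight s (x /\<^sub>R \<rho>)) \<and>
    (LINT z|lebesgue. energy T \<rho> z) + (LINT x|lebesgue. max 0 (u0 x) * weight s (x /\<^sub>R \<rho>))
    \<le> (LINT x|lebesgue. max 0 (- u0 x) * weight s (x /\<^sub>R \<rho>)) + \<kappa> * (LINT z|lebesgue. energy' T \<rho> z)
      + \<epsilon> * (LINT z|lebesgue. energy T \<rho> z)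
      + C * (\<kappa> powr - (1 / (p - 1)) * T powr - (p / (p - 1)) + \<epsilon> powr - (1 / (p - 1)) * \<rho> powr - (2 * s * (p / (p - 1))))
        * (T * \<rho> powr real DIM('a))"
proof -
  define q where "q = p / (p - 1)"
  have q: "q > 0" using p by (simp add: q_def)
  obtain C where C: "C \<ge> 0" "\<And>M T \<rho> t x. M \<ge> 1 \<Longrightarrow> T > 0 \<Longrightarrow> \<rho> \<ge> 1 \<Longrightarrow> t \<ge> 0 \<Longrightarrow>
    \<bar>weak_density a b s (\<lambda>z. cutoff ((fst z / T)\<^sup>2) * bump ((real DIM('a) + 2 * s) / 2) M ((snd z :: 'a) /\<^sub>R \<rho>)) (t, x)\<bar>
    \<le> indicator {0..T} t * (C * (t / T) / T + C * \<rho> powr (- 2 * s)) * cutoff ((t / T)\<^sup>2) powr (1 / p) * weight s (x /\<^sub>R \<rho>)"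
    using weak_density_bound[OF s ab p(1), where 'a='a] by blast
  define Wt where "Wt = (LINT x::'a|lborel. weight s x)"
  have Wt: "Wt \<ge> 0" unfolding Wt_def by (simp add: less_imp_le[OF weight_pos])
  have main: "integrable lebesgue (energy T \<rho>) \<and> integrable lebesgue (\<lambda>x. max 0 (u0 x) * weight s (x /\<^sub>R \<rho>)) \<and>
    (LINT z|lebesgue. energy T \<rho> z) + (LINT x|lebesgue. max 0 (u0 x) * weight s (x /\<^sub>R \<rho>))
    \<le> (LINT x|lebesgue. max 0 (- u0 x) * weight s (x /\<^sub>R \<rho>)) + \<kappa> * (LINT z|lebesgue. energy' T \<rho> z)
      + \<epsilon> * (LINT z|lebesgue. energy T \<rho> z)
      + (C powr q * Wt) * (\<kappa> powr - (1 / (p - 1)) * T powr - q + \<epsilon> powr - (1 / (p - 1)) * \<rho> powr - (2 * s * q))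
        * (T * \<rho> powr real DIM('a))"
    if T: "T > 0" and \<rho>: "\<rho> \<ge> 1" and \<kappa>: "\<kappa> > 0" and \<epsilon>: "\<epsilon> > 0" for T \<rho> \<kappa> \<epsilon>
  proof -
    let ?w = "\<lambda>x::'a. weight s (x /\<^sub>R \<rho>)"
    define B where "B n x = bump ((real DIM('a) + 2 * s) / 2) (real (Suc n)) (x /\<^sub>R \<rho>)" for n and x :: 'a
    define \<phi> where "\<phi> n z = cutoff ((fst z / T)\<^sup>2) * B n (snd z)" for n and z :: "real \<times> 'a"
    have \<phi>: "test_function (\<phi> n)" for n
      unfolding \<phi>_def B_def using T \<rho> by (intro test_function_bump) auto
    have Bb: "0 \<le> B n x" "B n x \<le> ?w x" for n x
      unfolding B_def by (auto intro: bump_nonneg bump_le_weight)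
    have Blim: "(\<lambda>n. B n x) \<longlonglongrightarrow> ?w x" for x unfolding B_def by (rule bump_tendsto_weight)
    have \<phi>0: "\<phi> n (0, x) = B n x" for n x by (simp add: \<phi>_def cutoff_0)
    have \<phi>e: "\<bar>v z\<bar> powr p * \<phi> n z = \<bar>v z\<bar> powr p * (\<eta> T (fst z) * B n (snd z))" for n z
      by (simp add: \<phi>_def \<eta>_def)
    \<comment> \<open>A majorant of \<open>v z * weak_density a b s (\<phi> n) z\<close> that does
      not depend on the truncation n. Its integrability is where the weighted integrability of weak
      solutions enters.\<close>
    define E where "E z = indicator {0..T} (fst z) * ((C * (fst z / T) / T + C * \<rho> powr (- 2 * s)) * \<eta> T (fst z) powr (1 / p) * (\<bar>v z\<bar> * ?w (snd z)))" for z :: "real \<times> 'a"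
    have Em: "E \<in> borel_measurable lebesgue"
    proof -
      have c: "continuous_on UNIV (\<lambda>z::real \<times> 'a. (C * (fst z / T) / T + C * \<rho> powr (- 2 * s)) * \<eta> T (fst z) powr (1 / p))"
      proof (rule continuous_on_mult)
        have "continuous_on UNIV cutoff" using isCont_cutoff by (simp add: continuous_on_eq_continuous_at)
        then have "continuous_on UNIV (\<lambda>z::real \<times> 'a. \<eta> T (fst z))" unfolding \<eta>_def
          by (rule continuous_on_compose2) (auto simp: divide_inverse intro!: continuous_intros)
        then show "continuous_on UNIV (\<lambda>z::real \<times> 'a. \<eta> T (fst z) powr (1 / p))"
          by (rule continuous_on_powr'[OF _ continuous_on_const]) (use \<eta>_bounds p in auto)
        show "continuous_on UNIV (\<lambda>z::real \<times> 'a. C * (fst z / T) / T + C * \<rho> powr (- 2 * s))"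
          unfolding divide_inverse by (intro continuous_intros)
      qed
      have w: "(\<lambda>z::real \<times> 'a. indicator {0..T} (fst z) * ?w (snd z) :: real) \<in> borel_measurable lebesgue"
        using borel_measurable_space_time_weight by (intro measurable_completion) simp
      have "(\<lambda>z. ((C * (fst z / T) / T + C * \<rho> powr (- 2 * s)) * \<eta> T (fst z) powr (1 / p)) * (\<bar>v z\<bar> * (indicator {0..T} (fst z) * ?w (snd z)))) \<in> borel_measurable lebesgue"
        by (intro borel_measurable_times borel_measurable_lebesgue_continuous[OF c] w borel_measurable_abs vm)
      then show ?thesis by (simp add: E_def[abs_def] mult_ac)
    qed
    have Ei: "integrable lebesgue E"
    proof (rule Bochner_Integration.integrable_bound[OF _ Em])
      let ?c = "C / T + C * \<rho> powr (- 2 * s)"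
      show "integrable lebesgue (\<lambda>z. ?c * (indicator {0..T} (fst z) * (\<bar>v z\<bar> * ?w (snd z))))"
        by (intro integrable_mult_right weak_solution_weight_integrable[OF s ab p(1) vm vK vA T \<rho>])
      have "norm (E z) \<le> norm (?c * (indicator {0..T} (fst z) * (\<bar>v z\<bar> * ?w (snd z))))" for z
      proof (cases "fst z \<in> {0..T}")
        case True
        have f1: "0 \<le> fst z / T" "fst z / T \<le> 1" using True T by auto
        have f2: "C * (fst z / T) / T \<le> C * 1 / T" using f1 T C(1) by (intro divide_right_mono mult_left_mono) auto
        have f3: "0 \<le> \<eta> T (fst z) powr (1 / p)" "\<eta> T (fst z) powr (1 / p) \<le> 1"
          using \<eta>_bounds p powr_mono2[of "1 / p" "\<eta> T (fst z)" 1] by auto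
        have "(C * (fst z / T) / T + C * \<rho> powr (- 2 * s)) * \<eta> T (fst z) powr (1 / p) \<le> ?c * 1"
          using f1 f2 f3 T C(1) by (intro mult_mono add_mono) auto
        then have "(C * (fst z / T) / T + C * \<rho> powr (- 2 * s)) * \<eta> T (fst z) powr (1 / p) * (\<bar>v z\<bar> * ?w (snd z)) \<le> ?c * (\<bar>v z\<bar> * ?w (snd z))"
          using weight_scaled(1)[of \<rho> "snd z"] by (intro mult_right_mono) auto
        moreover have "0 \<le> (C * (fst z / T) / T + C * \<rho> powr (- 2 * s)) * \<eta> T (fst z) powr (1 / p) * (\<bar>v z\<bar> * ?w (snd z))"
          using True f1 T C(1) weight_scaled(1)[of \<rho> "snd z"] by (intro mult_nonneg_nonneg add_nonneg_nonneg divide_nonneg_pos) auto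
        ultimately have "\<bar>(C * (fst z / T) / T + C * \<rho> powr (- 2 * s)) * \<eta> T (fst z) powr (1 / p) * (\<bar>v z\<bar> * ?w (snd z))\<bar> \<le> \<bar>?c * (\<bar>v z\<bar> * ?w (snd z))\<bar>"
          by linarith
        then show ?thesis using True by (simp only: E_def indicator_simps mult_1 real_norm_def)
      qed (simp add: E_def)
      then show "AE z in lebesgue. norm (E z) \<le> norm (?c * (indicator {0..T} (fst z) * (\<bar>v z\<bar> * ?w (snd z))))" by blast
    qed
    have vE: "v z * weak_density a b s (\<phi> n) z \<le> E z" for n z
    proof (cases "fst z < 0")
      case True
      then show ?thesis using v0[of z] by (simp add: E_def)
    next
      case False
      obtain t x where [simp]: "z = (t, x)" by (cases z)
      have "\<bar>weak_density a b s (\<phi> n) (t, x)\<bar> \<le> indicator {0..T} t * (C * (t / T) / T + C * \<rho> powr (- 2 * s)) * \<eta> T t powr (1 / p) * ?w x"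
        using C(2)[of "real (Suc n)" T \<rho> t x] T \<rho> False unfolding \<phi>_def B_def \<eta>_def by simp
      then have "\<bar>v z\<bar> * \<bar>weak_density a b s (\<phi> n) (t, x)\<bar> \<le> \<bar>v z\<bar> * (indicator {0..T} t * (C * (t / T) / T + C * \<rho> powr (- 2 * s)) * \<eta> T t powr (1 / p) * ?w x)"
        by (rule mult_left_mono) simp
      also have "\<dots> = E z" by (simp add: E_def mult_ac)
      finally show ?thesis using abs_ge_self[of "v z * weak_density a b s (\<phi> n) z"] by (simp add: abs_mult)
    qed
    have iw: "integrable lebesgue (\<lambda>x. max 0 (- u0 x) * ?w x)"
    proof (rule Bochner_Integration.integrable_bound[OF un])
      show "(\<lambda>x. max 0 (- u0 x) * ?w x) \<in> borel_measurable lebesgue"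
        using un by (intro borel_measurable_times weight_measurable) simp
      show "AE x in lebesgue. norm (max 0 (- u0 x) * ?w x) \<le> norm (max 0 (- u0 x))"
        using weight_scaled by (intro AE_I2) (auto simp: abs_mult less_imp_le intro!: mult_right_le_one_le)
    qed
    define Nn where "Nn = (LINT x|lebesgue. max 0 (- u0 x) * ?w x)"
    have posi: "integrable lebesgue (\<lambda>x. max 0 (u0 x) * B n x)" and negi: "integrable lebesgue (\<lambda>x. max 0 (- u0 x) * B n x)" for n
    proof -
      have i: "integrable lebesgue (\<lambda>x. u0 x * B n x)" using vU[OF \<phi>, of n] by (simp add: \<phi>0)
      have "(\<lambda>x. max 0 (u0 x) * B n x) = (\<lambda>x. max 0 (u0 x * B n x))" "(\<lambda>x. max 0 (- u0 x) * B n x) = (\<lambda>x. max 0 (- (u0 x * B n x)))"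
        using Bb(1)[of n] by (auto simp: fun_eq_iff max_def mult_le_0_iff zero_le_mult_iff) (metis order_antisym)+
      then show "integrable lebesgue (\<lambda>x. max 0 (u0 x) * B n x)" "integrable lebesgue (\<lambda>x. max 0 (- u0 x) * B n x)"
        using i by auto
    qed
    have ineq: "(LINT z|lebesgue. \<bar>v z\<bar> powr p * (\<eta> T (fst z) * B n (snd z))) + (LINT x|lebesgue. max 0 (u0 x) * B n x) \<le> Nn + integral\<^sup>L lebesgue E" for n
    proof -
      have "(LINT x|lebesgue. u0 x * \<phi> n (0, x)) = (LINT x|lebesgue. max 0 (u0 x) * B n x - max 0 (- u0 x) * B n x)"
        by (intro Bochner_Integration.integral_cong refl) (auto simp: \<phi>0 max_def algebra_simps)
      also have "\<dots> = (LINT x|lebesgue. max 0 (u0 x) * B n x) - (LINT x|lebesgue. max 0 (- u0 x) * B n x)"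
        by (rule Bochner_Integration.integral_diff[OF posi negi])
      finally have 1: "(LINT x|lebesgue. u0 x * \<phi> n (0, x)) = (LINT x|lebesgue. max 0 (u0 x) * B n x) - (LINT x|lebesgue. max 0 (- u0 x) * B n x)" .
      have 2: "(LINT x|lebesgue. max 0 (- u0 x) * B n x) \<le> Nn"
        unfolding Nn_def using Bb by (intro integral_mono negi iw mult_left_mono) auto
      have 3: "(LINT z|lebesgue. v z * weak_density a b s (\<phi> n) z) \<le> integral\<^sup>L lebesgue E"
        by (rule integral_mono[OF vA[OF \<phi>] Ei vE])
      show ?thesis using weq[OF \<phi>, of n] 1 2 3 unfolding \<phi>e by linarith
    qed
    have fi: "integrable lebesgue (\<lambda>z. \<bar>v z\<bar> powr p * (\<eta> T (fst z) * B n (snd z)))" for n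
      using vP[OF \<phi>, of n] unfolding \<phi>e .
    have f0: "0 \<le> \<bar>v z\<bar> powr p * (\<eta> T (fst z) * B n (snd z))" "\<bar>v z\<bar> powr p * (\<eta> T (fst z) * B n (snd z)) \<le> energy T \<rho> z" for n z
      unfolding energy_def using \<eta>_bounds Bb by (auto intro!: mult_nonneg_nonneg mult_left_mono)
    have g0: "0 \<le> max 0 (u0 x) * B n x" "max 0 (u0 x) * B n x \<le> max 0 (u0 x) * ?w x" for n x
      using Bb by (auto intro!: mult_left_mono)
    have flim: "(\<lambda>n. \<bar>v z\<bar> powr p * (\<eta> T (fst z) * B n (snd z))) \<longlonglongrightarrow> energy T \<rho> z" for z
      unfolding energy_def by (intro tendsto_mult tendsto_const Blim)
    have glim: "(\<lambda>n. max 0 (u0 x) * B n x) \<longlonglongrightarrow> max 0 (u0 x) * ?w x" for x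
      by (intro tendsto_mult tendsto_const Blim)
    have If0: "0 \<le> (LINT z|lebesgue. \<bar>v z\<bar> powr p * (\<eta> T (fst z) * B n (snd z)))" "0 \<le> (LINT x|lebesgue. max 0 (u0 x) * B n x)" for n
      using f0(1) g0(1) by (intro Bochner_Integration.integral_nonneg; blast)+
    have gm: "(\<lambda>x. max 0 (u0 x) * ?w x) \<in> borel_measurable lebesgue"
      using um by (intro borel_measurable_times weight_measurable borel_measurable_max) auto
    \<comment> \<open>Both terms on the left of \<open>ineq\<close> are nonnegative, so each is
      bounded separately and passes to the limit by Fatou.\<close>
    have Ji: "integrable lebesgue (energy T \<rho>)"
      by (rule integrable_of_bounded_integrals[OF fi f0(1) _ flim energy_measurable, where B="Nn + integral\<^sup>L lebesgue E"])
         (use ineq If0(2) in \<open>smt (verit)\<close>)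
    have Pi: "integrable lebesgue (\<lambda>x. max 0 (u0 x) * ?w x)"
      by (rule integrable_of_bounded_integrals[OF posi g0(1) _ glim gm, where B="Nn + integral\<^sup>L lebesgue E"])
         (use ineq If0(1) in \<open>smt (verit)\<close>)
    have fm: "(\<lambda>z. \<bar>v z\<bar> powr p * (\<eta> T (fst z) * B n (snd z))) \<in> borel_measurable lebesgue" "(\<lambda>x. max 0 (u0 x) * B n x) \<in> borel_measurable lebesgue" for n
      using fi[of n] posi[of n] by auto
    have "(\<lambda>n. (LINT z|lebesgue. \<bar>v z\<bar> powr p * (\<eta> T (fst z) * B n (snd z))) + (LINT x|lebesgue. max 0 (u0 x) * B n x))
        \<longlonglongrightarrow> (LINT z|lebesgue. energy T \<rho> z) + (LINT x|lebesgue. max 0 (u0 x) * ?w x)"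
    proof (rule tendsto_add)
      show "(\<lambda>n. LINT z|lebesgue. \<bar>v z\<bar> powr p * (\<eta> T (fst z) * B n (snd z))) \<longlonglongrightarrow> (LINT z|lebesgue. energy T \<rho> z)"
        by (rule integral_dominated_convergence[OF energy_measurable fm(1) Ji])
           (use flim f0 in auto)
      show "(\<lambda>n. LINT x|lebesgue. max 0 (u0 x) * B n x) \<longlonglongrightarrow> (LINT x|lebesgue. max 0 (u0 x) * ?w x)"
        by (rule integral_dominated_convergence[OF gm fm(2) Pi])
           (use glim g0 in auto)
    qed
    then have JP: "(LINT z|lebesgue. energy T \<rho> z) + (LINT x|lebesgue. max 0 (u0 x) * ?w x) \<le> Nn + integral\<^sup>L lebesgue E"
      by (rule LIMSEQ_le_const2) (use ineq in auto)
    have J'i: "integrable lebesgue (energy' T \<rho>)"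
      by (rule Bochner_Integration.integrable_bound[OF Ji energy'_measurable])
         (use energy'_bounds(1) energy'_bounds(2)[OF T] energy_nonneg in auto)
    define c where "c = \<kappa> powr - (1 / (p - 1)) * (C / T) powr q + \<epsilon> powr - (1 / (p - 1)) * (C * \<rho> powr (- 2 * s)) powr q"
    have Ele: "E z \<le> \<kappa> * energy' T \<rho> z + \<epsilon> * energy T \<rho> z + c * (indicator {0..T} (fst z) * ?w (snd z))" for z
    proof (cases "fst z \<in> {0..T}")
      case True
      \<comment> \<open>With the power 1/p of the cutoff, X^p is the energy density up to the
        spatial weight; t/T stays with X in the time term and becomes the additional factor of
        \<open>energy'\<close>.\<close>
      define X where "X = \<bar>v z\<bar> * \<eta> T (fst z) powr (1 / p)"
      have X: "0 \<le> X" "X powr p = \<bar>v z\<bar> powr p * \<eta> T (fst z)"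
        using p \<eta>_bounds by (auto simp: X_def powr_mult powr_powr)
      have ft: "0 \<le> fst z / T" using True T by simp
      have "(X * (fst z / T)) * (C / T) + X * (C * \<rho> powr (- 2 * s))
          \<le> (\<kappa> * (X * (fst z / T)) powr p + \<kappa> powr - (1 / (p - 1)) * (C / T) powr q)
            + (\<epsilon> * X powr p + \<epsilon> powr - (1 / (p - 1)) * (C * \<rho> powr (- 2 * s)) powr q)"
        unfolding q_def using X ft C(1) T by (intro add_mono Young_parameter p \<kappa> \<epsilon> mult_nonneg_nonneg) auto
      also have "\<dots> = \<kappa> * (\<bar>v z\<bar> powr p * \<eta> T (fst z) * \<bar>fst z / T\<bar> powr p) + \<epsilon> * (\<bar>v z\<bar> powr p * \<eta> T (fst z)) + c"
      proof -
        have sep: "(X * (fst z / T)) powr p = X powr p * \<bar>fst z / T\<bar> powr p"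
          using ft by (simp only: powr_mult abs_of_nonneg)
        show ?thesis unfolding sep X(2) c_def by (simp only: add_ac)
      qed
      finally have "((X * (fst z / T)) * (C / T) + X * (C * \<rho> powr (- 2 * s))) * ?w (snd z)
        \<le> (\<kappa> * (\<bar>v z\<bar> powr p * \<eta> T (fst z) * \<bar>fst z / T\<bar> powr p) + \<epsilon> * (\<bar>v z\<bar> powr p * \<eta> T (fst z)) + c) * ?w (snd z)"
        using weight_scaled(1)[of \<rho> "snd z"] by (intro mult_right_mono) auto
      moreover have "E z = ((X * (fst z / T)) * (C / T) + X * (C * \<rho> powr (- 2 * s))) * ?w (snd z)"
        using True by (simp add: E_def X_def algebra_simps)
      ultimately show ?thesis using True by (simp add: energy'_def energy_def algebra_simps)
    next
      case False
      then have "indicator {0..T} (fst z) = (0::real)" by simp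
      then show ?thesis using energy'_bounds(1)[of T \<rho> z] energy_nonneg[of T \<rho> z] \<kappa> \<epsilon> by (simp only: E_def mult_zero_left) simp
    qed
    note sw = integrable_space_time_weight[OF s, of \<rho> T, where 'a='a]
    have swi: "integrable lebesgue (\<lambda>z::real \<times> 'a. indicator {0..T} (fst z) * ?w (snd z))"
      and swI: "(LINT z|lebesgue. indicator {0..T} (fst z) * ?w (snd z)) = T * (\<rho> powr real DIM('a) * Wt)"
      unfolding Wt_def using sw T \<rho> by auto
    have ri: "integrable lebesgue (\<lambda>z. \<kappa> * energy' T \<rho> z + \<epsilon> * energy T \<rho> z + c * (indicator {0..T} (fst z) * ?w (snd z)))"
      by (intro Bochner_Integration.integrable_add integrable_mult_right J'i Ji swi)
    have "integral\<^sup>L lebesgue E \<le> (LINT z|lebesgue. \<kappa> * energy' T \<rho> z + \<epsilon> * energy T \<rho> z + c * (indicator {0..T} (fst z) * ?w (snd z)))"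
      by (rule integral_mono[OF Ei ri Ele])
    also have "\<dots> = \<kappa> * (LINT z|lebesgue. energy' T \<rho> z) + \<epsilon> * (LINT z|lebesgue. energy T \<rho> z) + c * (T * (\<rho> powr real DIM('a) * Wt))"
      using J'i Ji swi swI by (simp add: integrable_mult_right)
    also have "c = C powr q * (\<kappa> powr - (1 / (p - 1)) * T powr - q + \<epsilon> powr - (1 / (p - 1)) * \<rho> powr - (2 * s * q))"
    proof -
      have "(C / T) powr q = C powr q * T powr - q"
        unfolding powr_divide by (simp add: powr_minus divide_inverse)
      moreover have "(C * \<rho> powr (- 2 * s)) powr q = C powr q * \<rho> powr - (2 * s * q)" by (simp add: powr_mult powr_powr)
      ultimately show ?thesis by (simp add: c_def algebra_simps)
    qed
    finally show ?thesis using JP Ji Pi unfolding Nn_def by (simp add: mult_ac)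
  qed
  have "C powr q * Wt \<ge> 0" using Wt by simp
  then show ?thesis using main unfolding q_def by blast
qed

text \<open>Both remainders scale like R^(d - 2 s r) with r = 1/(p - 1), which stays bounded exactly
  when p \<le> p_F and does not decay at p_F itself. There remain the time remainder, of order
  \<kappa>^(-r) B^d, and the spatial one, of order \<epsilon>^(-r) B^(-2s); the limits in \<kappa>,
  B and \<epsilon>, in this order, remove them.\<close>

lemma nonpositive_mass:
  "integrable lebesgue (\<lambda>z. \<bar>v z\<bar> powr p) \<and> integrable lebesgue u0 \<and>
    (LINT z|lebesgue. \<bar>v z\<bar> powr p) + (LINT x|lebesgue. u0 x) \<le> 0"
proof -
  let ?d = "real DIM('a)"
  define q where "q = p / (p - 1)"
  define r where "r = 1 / (p - 1)"
  have r: "r > 0" "q = 1 + r" using p by (auto simp: r_def q_def field_simps)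
  \<comment> \<open>The condition p \<le> p_F in the form in which it enters.\<close>
  have dr: "?d \<le> 2 * s * r"
  proof -
    have "p - 1 \<le> 2 * s / ?d" using p(2) by (simp add: fujita_exponent_def)
    then have "?d * (p - 1) \<le> 2 * s" by (simp add: field_simps)
    then show ?thesis using p by (simp add: r_def field_simps)
  qed
  obtain C where C: "C \<ge> 0" and EI: "\<And>T \<rho> \<kappa> \<epsilon>. T > 0 \<Longrightarrow> \<rho> \<ge> 1 \<Longrightarrow> \<kappa> > 0 \<Longrightarrow> \<epsilon> > 0 \<Longrightarrow>
    integrable lebesgue (energy T \<rho>) \<and> integrable lebesgue (\<lambda>x. max 0 (u0 x) * weight s (x /\<^sub>R \<rho>)) \<and>
    (LINT z|lebesgue. energy T \<rho> z) + (LINT x|lebesgue. max 0 (u0 x) * weight s (x /\<^sub>R \<rho>))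
    \<le> (LINT x|lebesgue. max 0 (- u0 x) * weight s (x /\<^sub>R \<rho>)) + \<kappa> * (LINT z|lebesgue. energy' T \<rho> z)
      + \<epsilon> * (LINT z|lebesgue. energy T \<rho> z)
      + C * (\<kappa> powr - r * T powr - q + \<epsilon> powr - r * \<rho> powr - (2 * s * q)) * (T * \<rho> powr ?d)"
    using energy_inequality unfolding q_def r_def by blast
  define R where "R n = real (Suc n)" for n
  define T where "T n = R n powr (2 * s)" for n
  have R: "R n \<ge> 1" "R n > 0" for n by (auto simp: R_def)
  have T: "T n \<ge> 1" "T n > 0" for n using R[of n] s by (auto simp: T_def ge_one_powr_ge_zero)
  have scale: "C * (\<kappa> powr - r * T n powr - q + \<epsilon> powr - r * (B * R n) powr - (2 * s * q)) * (T n * (B * R n) powr ?d)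
      \<le> C * (\<kappa> powr - r * B powr ?d + \<epsilon> powr - r * B powr - (2 * s))" if B: "B \<ge> 1" for \<kappa> \<epsilon> B n
  proof -
    have Rl: "R n powr x \<le> 1" if "x \<le> 0" for x using powr_mono[OF that R(1)[of n]] R(2)[of n] by simp
    have "T n powr - q * (T n * (B * R n) powr ?d) = B powr ?d * R n powr (?d - 2 * s * r)"
    proof -
      have "T n powr - q * T n = R n powr (- (2 * s * r))"
        using powr_add[of "R n" "2 * s * - q" "2 * s"] by (simp add: T_def powr_powr r algebra_simps)
      then have "T n powr - q * (T n * (B * R n) powr ?d) = B powr ?d * (R n powr (- (2 * s * r)) * R n powr ?d)"
        by (simp add: powr_mult mult_ac)
      then show ?thesis by (simp flip: powr_add)
    qed
    also have "\<dots> \<le> B powr ?d * 1" using Rl dr by (intro mult_left_mono) auto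
    finally have 1: "T n powr - q * (T n * (B * R n) powr ?d) \<le> B powr ?d" by simp
    have "(B * R n) powr - (2 * s * q) * (T n * (B * R n) powr ?d) = B powr (?d - 2 * s * q) * R n powr (?d - 2 * s * r)"
    proof -
      have "(B * R n) powr - (2 * s * q) * (B * R n) powr ?d = B powr (?d - 2 * s * q) * R n powr (?d - 2 * s * q)"
      proof -
        have "X powr (?d - 2 * s * q) = X powr - (2 * s * q) * X powr ?d" for X
          using powr_add[of X "- (2 * s * q)" ?d] by simp
        then show ?thesis by (simp only: powr_mult mult_ac)
      qed
      moreover have "R n powr (?d - 2 * s * q) * T n = R n powr (?d - 2 * s * r)"
        unfolding T_def by (simp add: r algebra_simps flip: powr_add)
      moreover have "X * (N * Y) = Z * W'" if "X * Y = Z * W" "W * N = W'" for X Y Z W W' N :: real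
        unfolding that(2)[symmetric] using arg_cong[OF that(1), of "\<lambda>r. r * N"] by (simp only: mult_ac)
      ultimately show ?thesis by blast
    qed
    also have "\<dots> \<le> B powr - (2 * s) * 1"
      using Rl[of "?d - 2 * s * r"] dr B by (intro mult_mono powr_mono) (auto simp: r algebra_simps)
    finally have 2: "(B * R n) powr - (2 * s * q) * (T n * (B * R n) powr ?d) \<le> B powr - (2 * s)" by simp
    have "C * (\<kappa> powr - r * T n powr - q + \<epsilon> powr - r * (B * R n) powr - (2 * s * q)) * (T n * (B * R n) powr ?d) =
      C * (\<kappa> powr - r * (T n powr - q * (T n * (B * R n) powr ?d)) + \<epsilon> powr - r * ((B * R n) powr - (2 * s * q) * (T n * (B * R n) powr ?d)))"
      by (simp add: algebra_simps)
    also have "\<dots> \<le> C * (\<kappa> powr - r * B powr ?d + \<epsilon> powr - r * B powr - (2 * s))"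
      using C 1 2 by (intro mult_left_mono add_mono) auto
    finally show ?thesis .
  qed
  have BR: "B * R n \<ge> 1" if "B \<ge> 1" for B n using that R(1)[of n] mult_mono[of 1 B 1 "R n"] by simp
  have neg_le: "max 0 (- u0 x) * weight s (x /\<^sub>R \<rho>) \<le> max 0 (- u0 x)" for x \<rho>
    using weight_scaled[of \<rho> x] by (intro mult_left_le) auto
  have negm: "(\<lambda>x. max 0 (- u0 x) * weight s (x /\<^sub>R \<rho>)) \<in> borel_measurable lebesgue" for \<rho>
    using un by (intro borel_measurable_times weight_measurable) simp
  have negi: "integrable lebesgue (\<lambda>x. max 0 (- u0 x) * weight s (x /\<^sub>R \<rho>))" for \<rho>
    by (rule Bochner_Integration.integrable_bound[OF un negm])
       (use weight_scaled in \<open>auto simp: abs_mult less_imp_le intro!: mult_right_le_one_le\<close>)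
  have Rinv: "(\<lambda>n. inverse (B * R n)) \<longlonglongrightarrow> 0" if "B \<ge> 1" for B
    using tendsto_mult[OF tendsto_const[of "inverse B"] LIMSEQ_inverse_real_of_nat] by (simp add: R_def)
  have wlim: "(\<lambda>n. weight s (x /\<^sub>R (B * R n))) \<longlonglongrightarrow> 1" if "B \<ge> 1" for B and x :: 'a
  proof -
    have "(\<lambda>n. inverse (B * R n) *\<^sub>R x) \<longlonglongrightarrow> 0 *\<^sub>R x" by (intro tendsto_scaleR Rinv that tendsto_const)
    then have "(\<lambda>n. weight s (x /\<^sub>R (B * R n))) \<longlonglongrightarrow> weight s (0::'a)"
      by (intro isCont_tendsto_compose[OF isCont_weight_0]) simp
    then show ?thesis by (simp add: weight_0)
  qed
  have Tlim: "(\<lambda>n. t / T n) \<longlonglongrightarrow> 0" for t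
  proof -
    have "filterlim R at_top sequentially"
      unfolding R_def by (rule filterlim_compose[OF filterlim_real_sequentially filterlim_Suc])
    then have "(\<lambda>n. R n powr - (2 * s)) \<longlonglongrightarrow> 0" by (intro tendsto_neg_powr) (use s in auto)
    then have "(\<lambda>n. t * R n powr - (2 * s)) \<longlonglongrightarrow> t * 0" by (intro tendsto_mult tendsto_const)
    then show ?thesis by (simp add: T_def powr_minus divide_inverse)
  qed
  have \<eta>lim: "(\<lambda>n. \<eta> (T n) t) \<longlonglongrightarrow> 1" for t
  proof -
    have "(\<lambda>n. (t / T n)\<^sup>2) \<longlonglongrightarrow> 0\<^sup>2" by (intro tendsto_power Tlim)
    then have "(\<lambda>n. cutoff ((t / T n)\<^sup>2)) \<longlonglongrightarrow> cutoff 0" by (intro isCont_tendsto_compose[OF isCont_cutoff]) simp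
    then show ?thesis by (simp add: \<eta>_def cutoff_0)
  qed
  have elim: "(\<lambda>n. energy (T n) (B * R n) z) \<longlonglongrightarrow> \<bar>v z\<bar> powr p" if "B \<ge> 1" for B z
    using tendsto_mult[OF tendsto_const[of "\<bar>v z\<bar> powr p"] tendsto_mult[OF \<eta>lim wlim[OF that]]]
    unfolding energy_def by simp
  have ele: "energy T' \<rho> z \<le> \<bar>v z\<bar> powr p" for T' \<rho> z
  proof -
    have "\<eta> T' (fst z) * weight s (snd z /\<^sub>R \<rho>) \<le> 1 * 1"
      using \<eta>_bounds weight_scaled[of \<rho> "snd z"] by (intro mult_mono) auto
    then show ?thesis unfolding energy_def by (simp add: mult_left_le)
  qed
  \<comment> \<open>Both parameters are 1/4 and B = 1: since \<open>energy'\<close> is at most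
    \<open>energy\<close>, half of the energy is absorbed. This preliminary bound provides the
    integrability of |v|^p and of the positive part of u0 that the dominated limits below
    need.\<close>
  define K where "K = (LINT x|lebesgue. max 0 (- u0 x)) + C * ((1/4) powr - r * 1 powr ?d + (1/4) powr - r * 1 powr - (2 * s))"
  have bnd: "(LINT z|lebesgue. energy (T n) (R n) z) / 2 + (LINT x|lebesgue. max 0 (u0 x) * weight s (x /\<^sub>R R n)) \<le> K" for n
  proof -
    note E = EI[OF T(2)[of n] R(1)[of n], of "1/4" "1/4", simplified]
    have J': "(LINT z|lebesgue. energy' (T n) (R n) z) \<le> (LINT z|lebesgue. energy (T n) (R n) z)"
    proof (rule integral_mono)
      show "integrable lebesgue (energy (T n) (R n))" using E by simp
      then show "integrable lebesgue (energy' (T n) (R n))"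
        by (rule Bochner_Integration.integrable_bound[OF _ energy'_measurable])
           (use energy'_bounds(1) energy'_bounds(2)[OF T(2)] energy_nonneg in auto)
    qed (rule energy'_bounds(2)[OF T(2)])
    have N: "(LINT x|lebesgue. max 0 (- u0 x) * weight s (x /\<^sub>R R n)) \<le> (LINT x|lebesgue. max 0 (- u0 x))"
      by (rule integral_mono[OF negi un neg_le])
    show ?thesis
      using EI[OF T(2)[of n] R(1)[of n], of "1/4" "1/4"] scale[of 1 "1/4" n "1/4"] J' N unfolding K_def by simp
  qed
  have J0: "0 \<le> (LINT z|lebesgue. energy (T n) (R n) z)" for n
    using energy_nonneg by (intro Bochner_Integration.integral_nonneg) auto
  have P0: "0 \<le> (LINT x|lebesgue. max 0 (u0 x) * weight s (x /\<^sub>R R n))" for n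
    using weight_scaled by (intro Bochner_Integration.integral_nonneg mult_nonneg_nonneg) (auto simp: less_imp_le)
  have vi: "integrable lebesgue (\<lambda>z. \<bar>v z\<bar> powr p)"
  proof (rule integrable_of_bounded_integrals[where f="\<lambda>n. energy (T n) (R n)" and B="2 * K"])
    show "integrable lebesgue (energy (T n) (R n))" for n using EI[OF T(2)[of n] R(1)[of n], of 1 1] by simp
    show "integral\<^sup>L lebesgue (energy (T n) (R n)) \<le> 2 * K" for n using bnd[of n] P0[of n] by simp
    show "(\<lambda>n. energy (T n) (R n) z) \<longlonglongrightarrow> \<bar>v z\<bar> powr p" for z using elim[of 1 z] by simp
  qed (rule energy_nonneg, rule borel_measurable_v_powr)
  have pm: "(\<lambda>x. max 0 (u0 x)) \<in> borel_measurable lebesgue" using um by measurable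
  have pi: "integrable lebesgue (\<lambda>x. max 0 (u0 x))"
  proof (rule integrable_of_bounded_integrals[where f="\<lambda>n x. max 0 (u0 x) * weight s (x /\<^sub>R R n)" and B=K])
    show "integrable lebesgue (\<lambda>x. max 0 (u0 x) * weight s (x /\<^sub>R R n))" for n
      using EI[OF T(2)[of n] R(1)[of n], of 1 1] by simp
    show "0 \<le> max 0 (u0 x) * weight s (x /\<^sub>R R n)" for n x
      using weight_scaled[of "R n" x] by (intro mult_nonneg_nonneg) auto
    show "(LINT x|lebesgue. max 0 (u0 x) * weight s (x /\<^sub>R R n)) \<le> K" for n using bnd[of n] J0[of n] by simp
    show "(\<lambda>n. max 0 (u0 x) * weight s (x /\<^sub>R R n)) \<longlonglongrightarrow> max 0 (u0 x)" for x
      using tendsto_mult[OF tendsto_const[of "max 0 (u0 x)"] wlim[of 1 x]] by simp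
  qed (rule pm)
  define I where "I = (LINT z|lebesgue. \<bar>v z\<bar> powr p)"
  define PP where "PP = (LINT x|lebesgue. max 0 (u0 x))"
  define NN where "NN = (LINT x|lebesgue. max 0 (- u0 x))"
  have wle: "norm (r * weight s (x /\<^sub>R \<rho>)) \<le> norm r" for r \<rho> and x :: 'a
  proof -
    have "\<bar>r\<bar> * weight s (x /\<^sub>R \<rho>) \<le> \<bar>r\<bar>" by (rule mult_left_le[OF weight_scaled(2)]) simp
    then show ?thesis by (simp only: real_norm_def abs_mult abs_of_pos[OF weight_scaled(1)])
  qed
  \<comment> \<open>In the limit R to infinity the energy term weighted by \<kappa> has disappeared,
    while its remainder still carries \<kappa>^(-r).\<close>
  have limit: "I + PP \<le> NN + \<epsilon> * I + C * (\<kappa> powr - r * B powr ?d + \<epsilon> powr - r * B powr - (2 * s))"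
    if B: "B \<ge> 1" and \<kappa>: "\<kappa> > 0" and \<epsilon>: "\<epsilon> > 0" for B \<kappa> \<epsilon>
  proof -
    have L1: "(\<lambda>n. LINT z|lebesgue. energy (T n) (B * R n) z) \<longlonglongrightarrow> I"
      unfolding I_def
      by (rule integral_dominated_convergence[OF borel_measurable_v_powr energy_measurable vi])
         (use elim[OF B] ele energy_nonneg in auto)
    have L2: "(\<lambda>n. LINT z|lebesgue. energy' (T n) (B * R n) z) \<longlonglongrightarrow> (LINT z::real \<times> 'a|lebesgue. 0)"
    proof (rule integral_dominated_convergence[OF _ energy'_measurable vi])
      show "AE z in lebesgue. (\<lambda>n. energy' (T n) (B * R n) z) \<longlonglongrightarrow> 0"
      proof (intro AE_I2)
        fix z :: "real \<times> 'a"
        have "(\<lambda>n. \<bar>fst z / T n\<bar> powr p) \<longlonglongrightarrow> \<bar>0\<bar> powr p"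
          using p by (intro tendsto_powr2 tendsto_rabs Tlim tendsto_const) auto
        from tendsto_mult[OF elim[OF B, of z] this] show "(\<lambda>n. energy' (T n) (B * R n) z) \<longlonglongrightarrow> 0"
          unfolding energy'_def by simp
      qed
      show "AE z in lebesgue. norm (energy' (T n) (B * R n) z) \<le> \<bar>v z\<bar> powr p" for n
        using energy'_bounds(1) order_trans[OF energy'_bounds(2)[OF T(2)] ele] by (intro AE_I2) auto
    qed simp
    have L3: "(\<lambda>n. LINT x|lebesgue. max 0 (u0 x) * weight s (x /\<^sub>R (B * R n))) \<longlonglongrightarrow> PP"
      unfolding PP_def
    proof (rule integral_dominated_convergence[OF pm _ pi])
      show "AE x in lebesgue. (\<lambda>n. max 0 (u0 x) * weight s (x /\<^sub>R (B * R n))) \<longlonglongrightarrow> max 0 (u0 x)"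
        using tendsto_mult[OF tendsto_const wlim[OF B], of "max 0 (u0 _)"] by (intro AE_I2) simp
      show "AE x in lebesgue. norm (max 0 (u0 x) * weight s (x /\<^sub>R (B * R n))) \<le> max 0 (u0 x)" for n
        by (intro AE_I2 order_trans[OF wle]) simp
    qed (intro borel_measurable_times pm weight_measurable)
    have L4: "(\<lambda>n. LINT x|lebesgue. max 0 (- u0 x) * weight s (x /\<^sub>R (B * R n))) \<longlonglongrightarrow> NN"
      unfolding NN_def
    proof (rule integral_dominated_convergence[OF _ negm un])
      show "AE x in lebesgue. (\<lambda>n. max 0 (- u0 x) * weight s (x /\<^sub>R (B * R n))) \<longlonglongrightarrow> max 0 (- u0 x)"
        using tendsto_mult[OF tendsto_const wlim[OF B], of "max 0 (- u0 _)"] by (intro AE_I2) simp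
      show "AE x in lebesgue. norm (max 0 (- u0 x) * weight s (x /\<^sub>R (B * R n))) \<le> max 0 (- u0 x)" for n
        by (intro AE_I2 order_trans[OF wle]) simp
    qed (use un in simp)
    let ?c = "C * (\<kappa> powr - r * B powr ?d + \<epsilon> powr - r * B powr - (2 * s))"
    have "I + PP \<le> NN + \<kappa> * (LINT z::real \<times> 'a|lebesgue. 0) + \<epsilon> * I + ?c"
    proof (rule LIMSEQ_le)
      show "(\<lambda>n. (LINT z|lebesgue. energy (T n) (B * R n) z) + (LINT x|lebesgue. max 0 (u0 x) * weight s (x /\<^sub>R (B * R n)))) \<longlonglongrightarrow> I + PP"
        by (rule tendsto_add[OF L1 L3])
      show "(\<lambda>n. (LINT x|lebesgue. max 0 (- u0 x) * weight s (x /\<^sub>R (B * R n))) + \<kappa> * (LINT z|lebesgue. energy' (T n) (B * R n) z)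
        + \<epsilon> * (LINT z|lebesgue. energy (T n) (B * R n) z) + ?c) \<longlonglongrightarrow> NN + \<kappa> * (LINT z::real \<times> 'a|lebesgue. 0) + \<epsilon> * I + ?c"
        by (intro tendsto_add tendsto_mult L1 L2 L4 tendsto_const)
      have "(LINT z|lebesgue. energy (T n) (B * R n) z) + (LINT x|lebesgue. max 0 (u0 x) * weight s (x /\<^sub>R (B * R n)))
        \<le> (LINT x|lebesgue. max 0 (- u0 x) * weight s (x /\<^sub>R (B * R n))) + \<kappa> * (LINT z|lebesgue. energy' (T n) (B * R n) z)
        + \<epsilon> * (LINT z|lebesgue. energy (T n) (B * R n) z) + ?c" for n
        using EI[OF T(2)[of n] BR[OF B, of n] \<kappa> \<epsilon>] scale[OF B, of \<kappa> n \<epsilon>] by linarith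
      then show "\<exists>N. \<forall>n\<ge>N. (LINT z|lebesgue. energy (T n) (B * R n) z) + (LINT x|lebesgue. max 0 (u0 x) * weight s (x /\<^sub>R (B * R n)))
        \<le> (LINT x|lebesgue. max 0 (- u0 x) * weight s (x /\<^sub>R (B * R n))) + \<kappa> * (LINT z|lebesgue. energy' (T n) (B * R n) z)
        + \<epsilon> * (LINT z|lebesgue. energy (T n) (B * R n) z) + ?c" by blast
    qed
    then show ?thesis by simp
  qed
  have 1: "I + PP \<le> NN + \<epsilon> * I + C * (0 * B powr ?d + \<epsilon> powr - r * B powr - (2 * s))" if "B \<ge> 1" "\<epsilon> > 0" for B \<epsilon>
  proof (rule tendsto_lowerbound)
    have "((\<lambda>\<kappa>. \<kappa> powr - r) \<longlongrightarrow> 0) at_top" by (rule tendsto_neg_powr) (use r filterlim_ident in auto)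
    then show "((\<lambda>\<kappa>. NN + \<epsilon> * I + C * (\<kappa> powr - r * B powr ?d + \<epsilon> powr - r * B powr - (2 * s))) \<longlongrightarrow>
       NN + \<epsilon> * I + C * (0 * B powr ?d + \<epsilon> powr - r * B powr - (2 * s))) at_top"
      by (intro tendsto_add tendsto_mult tendsto_const)
    show "\<forall>\<^sub>F \<kappa> in at_top. I + PP \<le> NN + \<epsilon> * I + C * (\<kappa> powr - r * B powr ?d + \<epsilon> powr - r * B powr - (2 * s))"
      using eventually_gt_at_top[of 0] by eventually_elim (use limit that in blast)
  qed simp
  have 2: "I + PP \<le> NN + \<epsilon> * I + C * (\<epsilon> powr - r * 0)" if "\<epsilon> > 0" for \<epsilon>
  proof (rule tendsto_lowerbound)
    have "((\<lambda>B. B powr - (2 * s)) \<longlongrightarrow> 0) at_top" by (rule tendsto_neg_powr) (use s filterlim_ident in auto)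
    then show "((\<lambda>B. NN + \<epsilon> * I + C * (\<epsilon> powr - r * B powr - (2 * s))) \<longlongrightarrow> NN + \<epsilon> * I + C * (\<epsilon> powr - r * 0)) at_top"
      by (intro tendsto_add tendsto_mult tendsto_const)
    show "\<forall>\<^sub>F B in at_top. I + PP \<le> NN + \<epsilon> * I + C * (\<epsilon> powr - r * B powr - (2 * s))"
      using eventually_ge_at_top[of 1] by eventually_elim (use 1 that in simp)
  qed simp
  \<comment> \<open>At this stage the remainder is 0 for every \<epsilon>, so the growth of
    \<epsilon>^(-r) does no harm as \<epsilon> tends to 0.\<close>
  have "I + PP \<le> NN + 0 * I"
  proof (rule tendsto_lowerbound)
    show "((\<lambda>\<epsilon>. NN + \<epsilon> * I) \<longlongrightarrow> NN + 0 * I) (at_right 0)" by (intro tendsto_intros)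
    show "\<forall>\<^sub>F \<epsilon> in at_right 0. I + PP \<le> NN + \<epsilon> * I" using 2 by (auto simp: eventually_at_filter)
  qed simp
  then have fin: "I + PP \<le> NN" by simp
  have u0e: "u0 = (\<lambda>x. max 0 (u0 x) - max 0 (- u0 x))" by (auto simp: fun_eq_iff max_def)
  have ui: "integrable lebesgue u0" by (subst u0e) (intro Bochner_Integration.integrable_diff pi un)
  have "(LINT x|lebesgue. u0 x) = (LINT x|lebesgue. max 0 (u0 x) - max 0 (- u0 x))"
    by (rule arg_cong[OF u0e])
  also have "\<dots> = PP - NN"
    unfolding PP_def NN_def by (rule Bochner_Integration.integral_diff[OF pi un])
  finally have "(LINT x|lebesgue. u0 x) = PP - NN" .
  with fin vi ui show ?thesis by (simp add: I_def)
qed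

text \<open>With v = 0 both space-time integrals vanish, and the weak formulation says that u0 is
  orthogonal to the initial trace of every test function. Smooth approximations of boxes are enough
  to conclude.\<close>

lemma initial_value_zero:
  assumes vz: "AE z in lebesgue. v z = 0" and ui: "integrable lebesgue u0"
  shows "AE x in lebesgue. u0 x = 0"
proof (rule AE_zero_of_box_integrals[OF ui])
  fix c e :: 'a
  define g where "g n x = (\<Prod>i\<in>Basis. expinv (real (Suc n) * (x \<bullet> i - c \<bullet> i)) * expinv (real (Suc n) * (e \<bullet> i - x \<bullet> i)))" for n and x :: 'a
  define \<phi> where "\<phi> n z = cutoff ((fst z)\<^sup>2) * g n (snd z)" for n and z :: "real \<times> 'a"
  have \<phi>: "test_function (\<phi> n)" for n
    unfolding \<phi>_def g_def by (rule test_function_box) simp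
  have zero: "(LINT x|lebesgue. u0 x * g n x) = 0" for n
  proof -
    have "(LINT z|lebesgue. \<bar>v z\<bar> powr p * \<phi> n z) = (LINT z::real \<times> 'a|lebesgue. 0)"
      by (rule integral_cong_AE) (use vz p vP[OF \<phi>, of n] in \<open>auto elim!: eventually_mono\<close>)
    moreover have "(LINT z|lebesgue. v z * weak_density a b s (\<phi> n) z) = (LINT z::real \<times> 'a|lebesgue. 0)"
      by (rule integral_cong_AE) (use vz vA[OF \<phi>, of n] in \<open>auto elim!: eventually_mono\<close>)
    ultimately show ?thesis using weq[OF \<phi>, of n] by (simp add: \<phi>_def cutoff_0)
  qed
  have g01: "0 \<le> g n x" "g n x \<le> 1" for n x
    unfolding g_def by (auto intro!: prod_nonneg prod_le_1 mult_nonneg_nonneg mult_le_one expinv_nonneg expinv_le_1)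
  \<comment> \<open>exp (- 1 / (n r)) tends to 1 for r > 0, and \<open>expinv\<close> is 0 for r
    \<le> 0, so the limit is the indicator of an open half-line; products of these give open
    boxes.\<close>
  have e1: "(\<lambda>n. expinv (real (Suc n) * r)) \<longlonglongrightarrow> (if r > 0 then 1 else 0)" for r :: real
  proof (cases "r > 0")
    case True
    have "(\<lambda>n. exp (- (inverse (real (Suc n)) * inverse r))) \<longlonglongrightarrow> exp (- (0 * inverse r))"
      by (intro tendsto_intros LIMSEQ_inverse_real_of_nat)
    moreover have "expinv (real (Suc n) * r) = exp (- (inverse (real (Suc n)) * inverse r))" for n
    proof -
      have "real (Suc n) * r > 0" using True by simp
      then show ?thesis by (simp add: expinv_eq divide_inverse del: of_nat_Suc)
    qed
    ultimately show ?thesis using True by simp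
  next
    case False
    then have "expinv (real (Suc n) * r) = 0" for n by (simp add: expinv_eq mult_le_0_iff)
    then show ?thesis using False by simp
  qed
  have glim: "(\<lambda>n. g n x) \<longlonglongrightarrow> indicator (box c e) x" for x
  proof -
    have "(\<lambda>n. g n x) \<longlonglongrightarrow> (\<Prod>i\<in>Basis. (if x \<bullet> i - c \<bullet> i > 0 then 1 else 0) * (if e \<bullet> i - x \<bullet> i > 0 then 1 else 0))"
      unfolding g_def by (intro tendsto_prod tendsto_mult e1)
    also have "(\<Prod>i\<in>Basis. (if x \<bullet> i - c \<bullet> i > 0 then 1 else 0) * (if e \<bullet> i - x \<bullet> i > 0 then 1 else 0)) = (indicator (box c e) x :: real)"
    proof (cases "x \<in> box c e")
      case True
      then show ?thesis by (simp add: mem_box)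
    next
      case False
      then obtain i where "i \<in> Basis" "\<not> (c \<bullet> i < x \<bullet> i \<and> x \<bullet> i < e \<bullet> i)" by (auto simp: mem_box)
      then show ?thesis using False by (auto intro!: prod_zero)
    qed
    finally show ?thesis .
  qed
  have um': "u0 \<in> borel_measurable lebesgue" using ui by simp
  have "indicator (box c e) \<in> borel_measurable (lebesgue :: 'a measure)"
    by (intro borel_measurable_indicator sets_completionI_sets) simp
  then have m: "(\<lambda>x. u0 x * indicator (box c e) x) \<in> borel_measurable lebesgue"
    using um' by (intro borel_measurable_times)
  have mg: "(\<lambda>x. u0 x * g n x) \<in> borel_measurable lebesgue" for n
    using vU[OF \<phi>, of n] by (simp add: \<phi>_def cutoff_0)
  have "(\<lambda>n. LINT x|lebesgue. u0 x * g n x) \<longlonglongrightarrow> (LINT x|lebesgue. u0 x * indicator (box c e) x)"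
  proof (rule integral_dominated_convergence[OF m mg integrable_abs[OF ui]])
    show "AE x in lebesgue. (\<lambda>n. u0 x * g n x) \<longlonglongrightarrow> u0 x * indicator (box c e) x"
      by (intro AE_I2 tendsto_mult tendsto_const glim)
    show "AE x in lebesgue. norm (u0 x * g n x) \<le> \<bar>u0 x\<bar>" for n
      using g01 by (intro AE_I2) (simp add: abs_mult mult_left_le)
  qed
  then have "(LINT x|lebesgue. u0 x * indicator (box c e) x) = 0"
    unfolding zero by (simp add: LIMSEQ_const_iff)
  then show "(LINT x|lebesgue. indicator (box c e) x * u0 x) = 0" by (simp add: mult.commute)
qed

end

section \<open>The extended integral and the conclusion\<close>

lemma ext_integral_nonneg_neg_part:
  assumes "has_ext_integral u0 I" "0 \<le> I"
  shows "u0 \<in> borel_measurable lebesgue" "integrable lebesgue (\<lambda>x. max 0 (- u0 x))"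
proof -
  show m: "u0 \<in> borel_measurable lebesgue" using assms by (simp add: has_ext_integral_def)
  \<comment> \<open>An infinite negative part would leave a finite positive part, by the definition
    of the extended integral, and make \<open>I\<close> equal to minus infinity.\<close>
  have "(\<integral>\<^sup>+x. ennreal (- u0 x) \<partial>lebesgue) \<noteq> \<infinity>"
  proof
    assume N: "(\<integral>\<^sup>+x. ennreal (- u0 x) \<partial>lebesgue) = \<infinity>"
    then have "(\<integral>\<^sup>+x. ennreal (u0 x) \<partial>lebesgue) \<noteq> \<infinity>" using assms(1) by (simp add: has_ext_integral_def)
    then obtain r where r: "(\<integral>\<^sup>+x. ennreal (u0 x) \<partial>lebesgue) = ennreal r" "0 \<le> r"
      by (cases "\<integral>\<^sup>+x. ennreal (u0 x) \<partial>lebesgue") auto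
    have "I = - \<infinity>" using assms(1) N r by (simp add: has_ext_integral_def)
    then show False using assms(2) by simp
  qed
  moreover have "ennreal (norm (max 0 (- u0 x))) = ennreal (- u0 x)" for x
    by (simp add: max_def ennreal_neg)
  moreover have "(\<lambda>x. max 0 (- u0 x)) \<in> borel_measurable lebesgue" using m by measurable
  ultimately show "integrable lebesgue (\<lambda>x. max 0 (- u0 x))"
    by (simp add: integrable_iff_bounded less_top)
qed

lemma ext_integral_integrable:
  fixes u0 :: "'a::euclidean_space \<Rightarrow> real"
  assumes "has_ext_integral u0 I" "integrable lebesgue u0"
  shows "I = ereal (LINT x|lebesgue. u0 x)"
proof -
  have "(\<integral>\<^sup>+x. ennreal (f x) \<partial>lebesgue) = ennreal (LINT x|lebesgue. max 0 (f x))" if "integrable lebesgue f" for f :: "'a \<Rightarrow> real"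
  proof -
    have "(\<integral>\<^sup>+x. ennreal (f x) \<partial>lebesgue) = (\<integral>\<^sup>+x. ennreal (max 0 (f x)) \<partial>lebesgue)"
      by (intro nn_integral_cong) (simp add: max_def ennreal_neg)
    also have "\<dots> = ennreal (LINT x|lebesgue. max 0 (f x))"
      using that by (intro nn_integral_eq_integral) auto
    finally show ?thesis .
  qed
  from this[OF assms(2)] this[of "\<lambda>x. - u0 x"] assms
  have "I = ereal (LINT x|lebesgue. max 0 (u0 x)) - ereal (LINT x|lebesgue. max 0 (- u0 x))"
    by (simp add: has_ext_integral_def)
  also have "\<dots> = ereal (LINT x|lebesgue. max 0 (u0 x) - max 0 (- u0 x))"
    using assms(2) by (subst Bochner_Integration.integral_diff) auto
  also have "(\<lambda>x. max 0 (u0 x) - max 0 (- u0 x)) = u0" by (auto simp: fun_eq_iff max_def)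
  finally show ?thesis .
qed

text \<open>Both nonexistence claims in one statement: a nonnegative mean forces the energy and the
  mean to be 0, so the solution and with it u0 vanish. Part (i) contradicts the first conclusion,
  part (ii) the second.\<close>

lemma no_global_weak_solution:
  fixes u0 :: "'a::euclidean_space \<Rightarrow> real"
  assumes s: "0 < s" "s < 1" and ab: "0 < a" "0 < b" and p: "1 < p" "p \<le> fujita_exponent DIM('a) s"
    and I: "has_ext_integral u0 I" "0 \<le> I" and sol: "global_weak_solution a b s p u0 u"
  shows "I = 0 \<and> (AE x in lebesgue. u0 x = 0)"
proof -
  define v where "v z = indicator ({0..} \<times> UNIV) z * u z" for z :: "real \<times> 'a"
  note D = global_weak_solutionD[OF sol, folded v_def]
  have v0: "v z = 0" if "fst z < 0" for z using that by (auto simp: v_def indicator_def)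
  note u0 = ext_integral_nonneg_neg_part[OF I]
  have N: "integrable lebesgue (\<lambda>z. \<bar>v z\<bar> powr p)" "integrable lebesgue u0"
    "(LINT z|lebesgue. \<bar>v z\<bar> powr p) + (LINT x|lebesgue. u0 x) \<le> 0"
    using nonpositive_mass[OF s ab p D(1) v0 D(2-6) u0] by auto
  have e: "I = ereal (LINT x|lebesgue. u0 x)" by (rule ext_integral_integrable[OF I(1) N(2)])
  have v: "0 \<le> (LINT z|lebesgue. \<bar>v z\<bar> powr p)" by simp
  have "0 \<le> (LINT x|lebesgue. u0 x)" using I(2) e by simp
  then have "(LINT x|lebesgue. u0 x) = 0" and "(LINT z|lebesgue. \<bar>v z\<bar> powr p) = 0"
    using N(3) v by linarith+
  then have I0: "I = 0" and "(LINT z|lebesgue. \<bar>v z\<bar> powr p) = 0"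
    using e by simp_all
  then have "AE z in lebesgue. \<bar>v z\<bar> powr p = 0"
    using integral_nonneg_eq_0_iff_AE[OF N(1)] by simp
  then have "AE z in lebesgue. v z = 0" by eventually_elim simp
  from initial_value_zero[OF s ab p D(1) v0 D(2-6) u0 this N(2)] I0 show ?thesis by blast
qed

theorem theorem1p2:
  fixes a b s p :: real
  assumes "a > 0" "b > 0" "0 < s" "s < 1" "1 < p"
  shows
    "(\<forall>u0 :: 'a::euclidean_space \<Rightarrow> real.
        Lp_loc_on 1 UNIV u0 \<and> p \<le> fujita_exponent DIM('a) s \<and>
        (\<exists>I>0. has_ext_integral u0 I) \<longrightarrow>
        \<not> (\<exists>u. global_weak_solution a b s p u0 u)) \<and>
     (\<forall>u0 :: 'a \<Rightarrow> real.
        Lp_loc_on 1 UNIV u0 \<and> p \<le> fujita_exponent DIM('a) s \<and>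
        has_ext_integral u0 0 \<and> \<not> (AE x in lebesgue. u0 x = 0) \<longrightarrow>
        \<not> (\<exists>u. global_weak_solution a b s p u0 u)) \<and>
     (a = 1 \<and> b = 1 \<and> p > fujita_exponent DIM('a) s \<longrightarrow>
        (\<exists>\<delta>>0. \<forall>u0 :: 'a \<Rightarrow>\<^sub>C real.
           u0 \<in> C0 \<and> in_Lp (real DIM('a) * (p - 1) / (2 * s)) (apply_bcontfun u0) \<and>
           Lp_norm (real DIM('a) * (p - 1) / (2 * s)) (apply_bcontfun u0) \<le> \<delta> \<longrightarrow>
           (\<exists>u. global_mild_solution a b s p u0 u)))"
proof (intro conjI allI impI notI)
  fix u0 :: "'a \<Rightarrow> real"
  assume u0: "Lp_loc_on 1 UNIV u0 \<and> p \<le> fujita_exponent DIM('a) s \<and> (\<exists>I>0. has_ext_integral u0 I)"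
    and "\<exists>u. global_weak_solution a b s p u0 u"
  then obtain I u where I: "0 < I" "has_ext_integral u0 I" and u: "global_weak_solution a b s p u0 u" by blast
  from no_global_weak_solution[OF assms(3,4,1,2,5) _ I(2) less_imp_le[OF I(1)] u] u0 I(1)
  show False by simp
next
  fix u0 :: "'a \<Rightarrow> real"
  assume u0: "Lp_loc_on 1 UNIV u0 \<and> p \<le> fujita_exponent DIM('a) s \<and> has_ext_integral u0 0 \<and>
      \<not> (AE x in lebesgue. u0 x = 0)"
    and "\<exists>u. global_weak_solution a b s p u0 u"
  then obtain u where u: "global_weak_solution a b s p u0 u" by blast
  from no_global_weak_solution[OF assms(3,4,1,2,5) _ _ order_refl u] u0 show False by blast
next
  assume "a = 1 \<and> b = 1 \<and> p > fujita_exponent DIM('a) s"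
  then show "\<exists>\<delta>>0. \<forall>u0 :: 'a \<Rightarrow>\<^sub>C real.
      u0 \<in> C0 \<and> in_Lp (real DIM('a) * (p - 1) / (2 * s)) (apply_bcontfun u0) \<and>
      Lp_norm (real DIM('a) * (p - 1) / (2 * s)) (apply_bcontfun u0) \<le> \<delta> \<longrightarrow>
      (\<exists>u. global_mild_solution a b s p u0 u)"
    using small_data_global_existence[OF assms(3,4), where 'a='a and p=p] by blast
qed

end
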